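(* Let $\hat\theta_{ML}$ and $\hat\gamma_{ML}$ be the MLEs of $\theta$ and $\gamma$ in a one-sided truncated family, based on i.i.d. observations $\mathbf X=(X_1,\dots,X_n)$ from $P_{\theta,\gamma}$, and let $\pi$ be a smooth prior density on $\Theta\times I$. With $u=\sqrt n(\theta-\hat\theta_{ML})\in\mathbb R^d$ and $t=n\hat c(\gamma-\hat\gamma_{ML})\le 0$, the posterior density $\pi(u,t;\mathbf X)$ of $(u,t)$ admits, as $n\to\infty$, the asymptotic expansion $$\pi(u,t;\mathbf X)=\frac{\sqrt{\det\hat g_\theta}}{(2\pi)^{d/2}}\,e^{\,t-u^\top\hat g_\theta u/2}\Big[1+\frac1{\sqrt n}B_1(u,t)+\frac1nB_2(u,t)+O_p(n^{-3/2})\Big],$$ where, with $\hat\pi=\pi(\hat\theta_{ML},\hat\gamma_{ML})$ (and $D_\theta\hat\pi$, $D_\theta^{\otimes2}\hat\pi$, $\partial_\gamma\hat\pi$ the derivatives of $\pi$ evaluated at $(\hat\theta_{ML},\hat\gamma_{ML})$), $$B_1=\frac1{\hat\pi}(D_\theta\hat\pi)^\top u+\hat A^{(1,1)\top}u\,\frac t{\hat c}+\frac1{3!}\hat A^{(3,0)\top}u^{\otimes3},$$ and $$\begin{aligned}B_2={}&\frac1{\hat c\hat\pi}\,\partial_\gamma\hat\pi\,(t+1)+\frac1{2\hat\pi}(D_\theta^{\otimes2}\hat\pi)^\top\big(u^{\otimes2}-\mathrm{vec}\,\hat g_\theta^{-1}\big)\\&+\frac1{\hat c\hat\pi}\big(D_\theta\hat\pi\otimes\hat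 A^{(1,1)}\big)^\top\big(u^{\otimes2}t+\mathrm{vec}\,\hat g_\theta^{-1}\big)+\frac1{3!\hat\pi}\big(D_\theta\hat\pi\otimes\hat A^{(3,0)}\big)^\top\big(u^{\otimes4}-3(\mathrm{vec}\,\hat g_\theta^{-1})^{\otimes2}\big)\\&+\frac1{2\hat c^2}\hat A^{(0,2)}(t^2-2)+\frac1{2\hat c}\hat A^{(2,1)\top}\big(u^{\otimes2}t+\mathrm{vec}\,\hat g_\theta^{-1}\big)+\frac1{4!}\hat A^{(4,0)\top}\big(u^{\otimes4}-3(\mathrm{vec}\,\hat g_\theta^{-1})^{\otimes2}\big)\\&+\frac1{2\hat c^2}\big(\hat A^{(1,1)\top}\big)^{\otimes2}\big(u^{\otimes2}t^2-2\,\mathrm{vec}\,\hat g_\theta^{-1}\big)+\frac1{2\cdot(3!)^2}\big(\hat A^{(3,0)\top}\big)^{\otimes2}S_6\big(u^{\otimes6}-15(\mathrm{vec}\,\hat g_\theta^{-1})^{\otimes3}\big)\\&+\frac1{3!\,\hat c}\big(\hat A^{(1,1)}\otimes\hat A^{(3,0)}\big)^\top\big(u^{\otimes4}t+3(\mathrm{vec}\,\hat g_\theta^{-1})^{\otimes2}\big).\end{aligned}$$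
   Context: One-sided truncated family (oTF): $\Theta\subset\mathbb R^d$ is open, $I=(I_1,I_2)$ is an open interval with $-\infty\le I_1<I_2\le\infty$, and $\{P_{\theta,\gamma}:\theta\in\Theta,\gamma\in I\}$ are probability distributions with Lebesgue densities $p(x;\theta,\gamma)=q(x;\theta)e^{-\psi(\theta,\gamma)}\mathbf 1_{[\gamma,I_2)}(x)$, $x\in I$, where $q>0$ (so $e^{\psi(\theta,\gamma)}$ is the normalizing constant). The family is identifiable in the sense that $P_{\theta_1,\gamma}=P_{\theta_2,\gamma}$ implies $\theta_1=\theta_2$, and $p(x;\theta,\gamma)$ is infinitely differentiable in $\theta$ and $\gamma$ for $x\in(\gamma,I_2)$. Derivatives of $\log p$ are taken on the support, ignoring the null set $\{x=\gamma\}$. Notation: $\partial_i=\partial/\partial\theta^i$, $\partial_\gamma=\partial/\partial\gamma$, $D_\theta=(\partial_1,\dots,\partial_d)^\top$; $\otimes$ is the Kronecker product and $M^{\otimes r}$ the Kronecker product of $r$ copies of $M$ (so $D_\theta^{\otimes r}f$ is the $d^r$-vector of all $r$-th order partial derivatives of $f$ in $\theta$). $\mathrm{vec}$ stacks the columns of a matrix into one column vector. MLEs: $\hat\gamma_{ML}=\min_iX_i$; it is assumed that for every $x\in(\gamma,I_2)^n$ the likelihood equation $\sum_{j=1}^n\partial_i\log p(x_j;\theta,x_{(1)})=0$, $i=1,\dots,d$ (with $x_{(1)}=\min_jx_j$) has a unique solution, and $\hat\theta_{ML}$ is the MLE solving $\sum_j\partial_i\log p(X_j;\theta,\hat\gamma_{ML})=0$.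 Empirical quantities: $\hat A^{(r,s)}=\frac1n\sum_{i=1}^nD_\theta^{\otimes r}(\partial_\gamma)^s\log p(X_i;\hat\theta_{ML},\hat\gamma_{ML})$ (a $d^r$-vector), $\hat c=\hat A^{(0,1)}=\frac1n\sum_i\partial_\gamma\log p(X_i;\hat\theta_{ML},\hat\gamma_{ML})$, and $\hat g_\theta$ is the $d\times d$ matrix $\big(-\hat A^{(2,0)}_{ij}\big)_{i,j}$, where $\hat A^{(2,0)}_{ij}=\frac1n\sum_k\partial_i\partial_j\log p(X_k;\hat\theta_{ML},\hat\gamma_{ML})$. Symmetrizer: with $e_1,\dots,e_d$ the standard basis of $\mathbb R^d$, $S_r\in\mathbb R^{d^r\times d^r}$ is the linear map with $S_r(e_{i_1}\otimes\cdots\otimes e_{i_r})=\frac1{r!}\sum_{\sigma\in\mathfrak S_r}e_{i_{\sigma(1)}}\otimes\cdots\otimes e_{i_{\sigma(r)}}$. $O_p$ is with respect to the sampling distribution $P_{\theta,\gamma}$. The prior density $\pi$ is positive where it is divided by.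
   Formalization: Regularity at the true parameter is added, as the claim fails without it: nonzero slope of ψ in γ, an integrable local envelope for θ-derivatives of log p of orders 2–5, positive definite Fisher information, and log-likelihood lower by order n away from the true θ. Expansion is for fixed u, t. *)

theory Defs
  imports "HOL-Probability.Probability"
begin

section \<open>Kronecker calculus\<close>

text \<open>
  A vector of dimension \<open>d\<^sup>r\<close> (for \<open>d = CARD('d)\<close>) is represented by its coordinates: the coordinate
  belonging to the basis vector \<open>e(i1) \<otimes> \<dots> \<otimes> e(ir)\<close> is the value at the list \<open>[i1, \<dots>, ir]\<close>. The
  order \<open>r\<close> is not part of the type, so the operations below take it as an argument; values at
  lists of another length are irrelevant.
\<close>

type_synonym 'd tensor = "'d list \<Rightarrow> real"

definition midx :: "nat \<Rightarrow> 'd list set" where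
  "midx r = {is. length is = r}"

definition tinner :: "nat \<Rightarrow> 'd::finite tensor \<Rightarrow> 'd tensor \<Rightarrow> real" where
  "tinner r x y = (\<Sum>is\<in>midx r. x is * y is)"

text \<open>The first argument of \<open>kron\<close> and \<open>kron_pow\<close> is the order of the (first) tensor.\<close>

definition kron :: "nat \<Rightarrow> 'd tensor \<Rightarrow> 'd tensor \<Rightarrow> 'd tensor" where
  "kron r x y = (\<lambda>is. x (take r is) * y (drop r is))"

fun kron_pow :: "nat \<Rightarrow> 'd tensor \<Rightarrow> nat \<Rightarrow> 'd tensor" where
  "kron_pow r x 0 = (\<lambda>is. 1)"
| "kron_pow r x (Suc m) = kron r x (kron_pow r x m)"

definition tensor_of_vec :: "real ^ 'd \<Rightarrow> 'd tensor" where
  "tensor_of_vec u = (\<lambda>is. u $ (is ! 0))"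

text \<open>
  Stacking the columns of \<open>M\<close> puts the entry in row \<open>i\<close> and column \<open>j\<close> at the position of
  \<open>e(j) \<otimes> e(i)\<close>.
\<close>

definition vec_mat :: "real ^ 'd ^ 'd \<Rightarrow> 'd tensor" where
  "vec_mat M = (\<lambda>is. M $ (is ! 1) $ (is ! 0))"

definition basis_tensor :: "'d list \<Rightarrow> 'd tensor" where
  "basis_tensor is = (\<lambda>js. if js = is then 1 else 0)"

text \<open>The linear map that averages each basis tensor over all permutations of its factors.\<close>

definition symmetrizer :: "nat \<Rightarrow> 'd::finite tensor \<Rightarrow> 'd tensor" where
  "symmetrizer r x = (\<lambda>js. \<Sum>is\<in>midx r. x is *
     (1 / fact r * (\<Sum>\<sigma> | \<sigma> permutes {..<r}. basis_tensor (map (\<lambda>k. is ! \<sigma> k) [0..<r]) js)))"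


section \<open>Partial derivatives and smoothness\<close>

definition pderiv_at :: "'d \<Rightarrow> (real ^ 'd \<Rightarrow> real) \<Rightarrow> real ^ 'd \<Rightarrow> real" where
  "pderiv_at i f \<theta> = deriv (\<lambda>h. f (\<theta> + h *\<^sub>R axis i 1)) 0"

text \<open>\<open>D_theta f \<theta>\<close> collects, for all \<open>r\<close> at once, the \<open>r\<close>-th order partial derivatives of \<open>f\<close>
  at \<open>\<theta>\<close>.\<close>

fun D_theta :: "(real ^ 'd \<Rightarrow> real) \<Rightarrow> real ^ 'd \<Rightarrow> 'd tensor" where
  "D_theta f \<theta> [] = f \<theta>"
| "D_theta f \<theta> (i # is) = pderiv_at i (\<lambda>\<eta>. D_theta f \<eta> is) \<theta>"

text \<open>\<open>C_k k f S\<close> is the usual notion for open \<open>S\<close>, the only case in which it is used.\<close>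

fun C_k :: "nat \<Rightarrow> ('a::euclidean_space \<Rightarrow> real) \<Rightarrow> 'a set \<Rightarrow> bool" where
  "C_k 0 f S = continuous_on S f"
| "C_k (Suc k) f S = (f differentiable_on S \<and>
     (\<forall>b\<in>Basis. C_k k (\<lambda>z. frechet_derivative f (at z) b) S))"

definition smooth_on :: "'a::euclidean_space set \<Rightarrow> ('a \<Rightarrow> real) \<Rightarrow> bool" where
  "smooth_on S f \<longleftrightarrow> (\<forall>k. C_k k f S)"


section \<open>Stochastic order symbols\<close>

text \<open>Inner approximations by events avoid measurability side conditions on estimators.\<close>

definition with_prob_tending_to_1 :: "'w measure \<Rightarrow> (nat \<Rightarrow> 'w \<Rightarrow> bool) \<Rightarrow> bool" where
  "with_prob_tending_to_1 M P \<longleftrightarrow> (\<forall>\<epsilon>>0. \<forall>\<^sub>F n in sequentially.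
     \<exists>A\<in>sets M. measure M A \<ge> 1 - \<epsilon> \<and> (\<forall>\<omega>\<in>A. P n \<omega>))"

definition bigO_p :: "'w measure \<Rightarrow> (nat \<Rightarrow> 'w \<Rightarrow> real) \<Rightarrow> (nat \<Rightarrow> real) \<Rightarrow> bool" where
  "bigO_p M R a \<longleftrightarrow> (\<forall>\<epsilon>>0. \<exists>C. \<forall>\<^sub>F n in sequentially.
     \<exists>A\<in>sets M. measure M A \<ge> 1 - \<epsilon> \<and> (\<forall>\<omega>\<in>A. \<bar>R n \<omega>\<bar> \<le> C * a n))"


section \<open>One-sided truncated families\<close>

text \<open>\<open>q x \<theta>\<close> is the untruncated, unnormalized density; \<open>exp (psi I2 q \<theta> \<gamma>)\<close> normalizes it.\<close>

definition tsupport :: "ereal \<Rightarrow> real \<Rightarrow> real set" where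
  "tsupport I2 \<gamma> = {x. \<gamma> \<le> x \<and> ereal x < I2}"

definition psi :: "ereal \<Rightarrow> (real \<Rightarrow> real ^ 'd \<Rightarrow> real) \<Rightarrow> real ^ 'd \<Rightarrow> real \<Rightarrow> real" where
  "psi I2 q \<theta> \<gamma> = ln (LINT x:tsupport I2 \<gamma>|lborel. q x \<theta>)"

definition pdens :: "ereal \<Rightarrow> (real \<Rightarrow> real ^ 'd \<Rightarrow> real) \<Rightarrow> real \<Rightarrow> real ^ 'd \<Rightarrow> real \<Rightarrow> real" where
  "pdens I2 q x \<theta> \<gamma> = q x \<theta> * exp (- psi I2 q \<theta> \<gamma>) * indicator (tsupport I2 \<gamma>) x"

definition Pdist :: "ereal \<Rightarrow> (real \<Rightarrow> real ^ 'd \<Rightarrow> real) \<Rightarrow> real ^ 'd \<Rightarrow> real \<Rightarrow> real measure" where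
  "Pdist I2 q \<theta> \<gamma> = density lborel (\<lambda>x. ennreal (pdens I2 q x \<theta> \<gamma>))"

definition oTF :: "(real ^ 'd::finite) set \<Rightarrow> ereal \<Rightarrow> ereal \<Rightarrow> (real \<Rightarrow> real ^ 'd \<Rightarrow> real) \<Rightarrow> bool" where
  "oTF \<Theta> I1 I2 q \<longleftrightarrow>
     open \<Theta> \<and> I1 < I2 \<and>
     (\<forall>\<theta>\<in>\<Theta>. \<forall>x\<in>einterval I1 I2. 0 < q x \<theta>) \<and>
     (\<forall>\<theta>\<in>\<Theta>. \<forall>\<gamma>\<in>einterval I1 I2. set_integrable lborel (tsupport I2 \<gamma>) (\<lambda>x. q x \<theta>)) \<and>
     (\<forall>\<theta>1\<in>\<Theta>. \<forall>\<theta>2\<in>\<Theta>. \<forall>\<gamma>\<in>einterval I1 I2.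
        Pdist I2 q \<theta>1 \<gamma> = Pdist I2 q \<theta>2 \<gamma> \<longrightarrow> \<theta>1 = \<theta>2) \<and>
     (\<forall>x\<in>einterval I1 I2.
        smooth_on (\<Theta> \<times> {\<gamma>\<in>einterval I1 I2. \<gamma> < x}) (\<lambda>(\<theta>, \<gamma>). pdens I2 q x \<theta> \<gamma>))"

text \<open>
  The log-density on the support, with the indicator dropped. It agrees with \<open>ln (pdens \<dots>)\<close> on
  \<open>\<gamma> \<le> x < I2\<close>, and its \<open>\<gamma>\<close>-derivatives also make sense at \<open>x = \<gamma>\<close>, which is needed
  because the smallest observation equals the MLE of \<open>\<gamma>\<close>.
\<close>

definition logp :: "ereal \<Rightarrow> (real \<Rightarrow> real ^ 'd \<Rightarrow> real) \<Rightarrow> real \<Rightarrow> real ^ 'd \<Rightarrow> real \<Rightarrow> real" where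
  "logp I2 q x \<theta> \<gamma> = ln (q x \<theta>) - psi I2 q \<theta> \<gamma>"

lemma ln_pdens_eq_logp:
  assumes "x \<in> tsupport I2 \<gamma>" "q x \<theta> > 0"
  shows "ln (pdens I2 q x \<theta> \<gamma>) = logp I2 q x \<theta> \<gamma>"
  using assms by (simp add: pdens_def logp_def ln_mult)


section \<open>Maximum likelihood\<close>

text \<open>A sample \<open>(x 0, \<dots>, x (n - 1))\<close> is given by a sequence of which only the first \<open>n\<close> terms are used.\<close>

definition likelihood ::
  "ereal \<Rightarrow> (real \<Rightarrow> real ^ 'd \<Rightarrow> real) \<Rightarrow> nat \<Rightarrow> (nat \<Rightarrow> real) \<Rightarrow> real ^ 'd \<Rightarrow> real \<Rightarrow> real" where
  "likelihood I2 q n x \<theta> \<gamma> = (\<Prod>j<n. pdens I2 q (x j) \<theta> \<gamma>)"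

definition is_MLE :: "(real ^ 'd) set \<Rightarrow> ereal \<Rightarrow> ereal \<Rightarrow> (real \<Rightarrow> real ^ 'd \<Rightarrow> real) \<Rightarrow>
    nat \<Rightarrow> (nat \<Rightarrow> real) \<Rightarrow> real ^ 'd \<Rightarrow> real \<Rightarrow> bool" where
  "is_MLE \<Theta> I1 I2 q n x \<theta> \<gamma> \<longleftrightarrow> \<theta> \<in> \<Theta> \<and> \<gamma> \<in> einterval I1 I2 \<and>
     (\<forall>\<theta>'\<in>\<Theta>. \<forall>\<gamma>'\<in>einterval I1 I2. likelihood I2 q n x \<theta>' \<gamma>' \<le> likelihood I2 q n x \<theta> \<gamma>)"

definition gamma_ML :: "nat \<Rightarrow> (nat \<Rightarrow> real) \<Rightarrow> real" where
  "gamma_ML n x = Min (x ` {..<n})"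

definition likelihood_eq ::
  "ereal \<Rightarrow> (real \<Rightarrow> real ^ 'd \<Rightarrow> real) \<Rightarrow> nat \<Rightarrow> (nat \<Rightarrow> real) \<Rightarrow> real ^ 'd \<Rightarrow> bool" where
  "likelihood_eq I2 q n x \<theta> \<longleftrightarrow>
     (\<forall>i. (\<Sum>j<n. pderiv_at i (\<lambda>\<eta>. logp I2 q (x j) \<eta> (gamma_ML n x)) \<theta>) = 0)"

definition theta_ML :: "(real ^ 'd) set \<Rightarrow> ereal \<Rightarrow> (real \<Rightarrow> real ^ 'd \<Rightarrow> real) \<Rightarrow>
    nat \<Rightarrow> (nat \<Rightarrow> real) \<Rightarrow> real ^ 'd" where
  "theta_ML \<Theta> I2 q n x = (THE \<theta>. \<theta> \<in> \<Theta> \<and> likelihood_eq I2 q n x \<theta>)"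

text \<open>
  The likelihood equation is uniquely solvable and its solution is an MLE, for samples from
  \<open>(\<gamma>, I2)\<close>. Ties (a null event) and small \<open>n\<close> are left out: for the truncated exponential family
  the equation has no solution if all observations coincide.
\<close>

definition MLE_condition :: "(real ^ 'd) set \<Rightarrow> ereal \<Rightarrow> ereal \<Rightarrow> (real \<Rightarrow> real ^ 'd \<Rightarrow> real) \<Rightarrow> real \<Rightarrow> bool" where
  "MLE_condition \<Theta> I1 I2 q \<gamma> \<longleftrightarrow> (\<forall>\<^sub>F n in sequentially. \<forall>x.
     (\<forall>j<n. \<gamma> < x j \<and> ereal (x j) < I2) \<and> inj_on x {..<n} \<longrightarrow>
       (\<exists>!\<theta>. \<theta> \<in> \<Theta> \<and> likelihood_eq I2 q n x \<theta>) \<and>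
       is_MLE \<Theta> I1 I2 q n x (theta_ML \<Theta> I2 q n x) (gamma_ML n x))"


section \<open>Empirical quantities\<close>

definition A_hat :: "(real ^ 'd) set \<Rightarrow> ereal \<Rightarrow> (real \<Rightarrow> real ^ 'd \<Rightarrow> real) \<Rightarrow>
    nat \<Rightarrow> (nat \<Rightarrow> real) \<Rightarrow> nat \<Rightarrow> nat \<Rightarrow> 'd tensor" where
  "A_hat \<Theta> I2 q n x r s = (\<lambda>is. if length is = r then
     1 / real n * (\<Sum>j<n. D_theta (\<lambda>\<theta>. (deriv ^^ s) (\<lambda>\<gamma>. logp I2 q (x j) \<theta> \<gamma>) (gamma_ML n x))
                            (theta_ML \<Theta> I2 q n x) is)
     else 0)"

definition c_hat :: "(real ^ 'd) set \<Rightarrow> ereal \<Rightarrow> (real \<Rightarrow> real ^ 'd \<Rightarrow> real) \<Rightarrow>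
    nat \<Rightarrow> (nat \<Rightarrow> real) \<Rightarrow> real" where
  "c_hat \<Theta> I2 q n x = A_hat \<Theta> I2 q n x 0 1 []"

definition g_hat :: "(real ^ 'd) set \<Rightarrow> ereal \<Rightarrow> (real \<Rightarrow> real ^ 'd \<Rightarrow> real) \<Rightarrow>
    nat \<Rightarrow> (nat \<Rightarrow> real) \<Rightarrow> real ^ 'd ^ 'd" where
  "g_hat \<Theta> I2 q n x = (\<chi> i j. - A_hat \<Theta> I2 q n x 2 0 [i, j])"


section \<open>Posterior\<close>

definition prior_density :: "(real ^ 'd::finite) set \<Rightarrow> ereal \<Rightarrow> ereal \<Rightarrow> (real ^ 'd \<Rightarrow> real \<Rightarrow> real) \<Rightarrow> bool" where
  "prior_density \<Theta> I1 I2 \<pi> \<longleftrightarrow>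
     (\<forall>\<theta>\<in>\<Theta>. \<forall>\<gamma>\<in>einterval I1 I2. 0 \<le> \<pi> \<theta> \<gamma>) \<and>
     smooth_on (\<Theta> \<times> einterval I1 I2) (\<lambda>(\<theta>, \<gamma>). \<pi> \<theta> \<gamma>) \<and>
     set_integrable lborel (\<Theta> \<times> einterval I1 I2) (\<lambda>(\<theta>, \<gamma>). \<pi> \<theta> \<gamma>) \<and>
     (LINT (\<theta>, \<gamma>):(\<Theta> \<times> einterval I1 I2)|lborel. \<pi> \<theta> \<gamma>) = 1"

definition posterior :: "(real ^ 'd::finite) set \<Rightarrow> ereal \<Rightarrow> ereal \<Rightarrow> (real \<Rightarrow> real ^ 'd \<Rightarrow> real) \<Rightarrow>
    (real ^ 'd \<Rightarrow> real \<Rightarrow> real) \<Rightarrow> nat \<Rightarrow> (nat \<Rightarrow> real) \<Rightarrow> real ^ 'd \<Rightarrow> real \<Rightarrow> real" where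
  "posterior \<Theta> I1 I2 q \<pi> n x \<theta> \<gamma> =
     indicator (\<Theta> \<times> einterval I1 I2) (\<theta>, \<gamma>) * (\<pi> \<theta> \<gamma> * likelihood I2 q n x \<theta> \<gamma>) /
     (LINT (\<eta>, g):(\<Theta> \<times> einterval I1 I2)|lborel. \<pi> \<eta> g * likelihood I2 q n x \<eta> g)"

text \<open>
  The density of \<open>u = sqrt n (\<theta> - theta_ML)\<close>, \<open>t = n c_hat (\<gamma> - gamma_ML)\<close> under the posterior,
  by change of variables.
\<close>

definition posterior_ut :: "(real ^ 'd::finite) set \<Rightarrow> ereal \<Rightarrow> ereal \<Rightarrow> (real \<Rightarrow> real ^ 'd \<Rightarrow> real) \<Rightarrow>
    (real ^ 'd \<Rightarrow> real \<Rightarrow> real) \<Rightarrow> nat \<Rightarrow> (nat \<Rightarrow> real) \<Rightarrow> real ^ 'd \<Rightarrow> real \<Rightarrow> real" where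
  "posterior_ut \<Theta> I1 I2 q \<pi> n x u t =
     posterior \<Theta> I1 I2 q \<pi> n x
       (theta_ML \<Theta> I2 q n x + (1 / sqrt (real n)) *\<^sub>R u)
       (gamma_ML n x + t / (real n * c_hat \<Theta> I2 q n x)) /
     (sqrt (real n) ^ CARD('d) * (real n * c_hat \<Theta> I2 q n x))"

lemma lborel_prod_affine:
  fixes m :: "real ^ 'd::finite" and k a b :: real
  assumes "a > 0" "b > 0"
  shows "(lborel :: ((real ^ 'd) \<times> real) measure) =
    density (distr lborel borel (\<lambda>w. (m + (1 / a) *\<^sub>R fst w, k + snd w / b)))
            (\<lambda>_. ennreal (1 / (a ^ CARD('d) * b)))"
proof -
  define c where "c j = (if snd j = 0 then 1 / a else 1 / b)" for j :: "(real ^ 'd) \<times> real"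
  have T: "(m, k) + (\<Sum>j\<in>Basis. (c j * (w \<bullet> j)) *\<^sub>R j) = (m + (1 / a) *\<^sub>R fst w, k + snd w / b)"
    for w :: "(real ^ 'd) \<times> real"
  proof -
    obtain x y where w: "w = (x, y)" by (cases w)
    have "(\<Sum>j\<in>Basis. (c j * (w \<bullet> j)) *\<^sub>R j) =
        (\<Sum>i\<in>Basis. (1 / a * (x \<bullet> i)) *\<^sub>R (i, 0)) + (1 / b * y) *\<^sub>R (0, 1)"
      unfolding w Basis_prod_def
      by (subst sum.union_disjoint) (auto simp: sum.reindex inj_on_def c_def inner_prod_def)
    also have "(\<Sum>i\<in>Basis. (1 / a * (x \<bullet> i)) *\<^sub>R (i, 0::real)) =
        ((1 / a) *\<^sub>R (\<Sum>i\<in>Basis. (x \<bullet> i) *\<^sub>R i), 0)"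
      by (rule prod_eqI)
        (simp_all add: fst_sum snd_sum scaleR_sum_right del: euclidean_representation)
    finally show ?thesis by (simp add: w euclidean_representation)
  qed
  have c0: "c j \<noteq> 0" for j using assms by (simp add: c_def)
  have "(\<Prod>j\<in>Basis. \<bar>c j\<bar>) = 1 / (a ^ CARD('d) * b)"
    unfolding Basis_prod_def
    using assms by (subst prod.union_disjoint)
      (auto simp: prod.reindex inj_on_def c_def power_divide)
  then show ?thesis
    using lborel_affine_euclidean[of c "(m, k)"] c0 by (simp add: T)
qed

lemma posterior_ut_density:
  fixes \<Theta> :: "(real ^ 'd::finite) set"
  assumes n: "n > 0" and c: "c_hat \<Theta> I2 q n x > 0"
    and meas: "(\<lambda>(\<theta>, \<gamma>). posterior \<Theta> I1 I2 q \<pi> n x \<theta> \<gamma>) \<in> borel_measurable borel"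
  shows "distr (density lborel (\<lambda>(\<theta>, \<gamma>). ennreal (posterior \<Theta> I1 I2 q \<pi> n x \<theta> \<gamma>))) borel
           (\<lambda>(\<theta>, \<gamma>). (sqrt (real n) *\<^sub>R (\<theta> - theta_ML \<Theta> I2 q n x),
                     real n * c_hat \<Theta> I2 q n x * (\<gamma> - gamma_ML n x)))
         = density lborel (\<lambda>(u, t). ennreal (posterior_ut \<Theta> I1 I2 q \<pi> n x u t))"
proof -
  define m where "m = theta_ML \<Theta> I2 q n x"
  define k where "k = gamma_ML n x"
  define a where "a = sqrt (real n)"
  define b where "b = real n * c_hat \<Theta> I2 q n x"
  define f where "f z = posterior \<Theta> I1 I2 q \<pi> n x (fst z) (snd z)" for z
  define S where "S z = (a *\<^sub>R (fst z - m), b * (snd z - k))" for z :: "(real ^ 'd) \<times> real"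
  define T where "T w = (m + (1 / a) *\<^sub>R fst w, k + snd w / b)" for w :: "(real ^ 'd) \<times> real"
  have ab: "a > 0" "b > 0" using n c by (auto simp: a_def b_def)
  have [measurable]: "f \<in> borel_measurable borel"
    using meas by (simp add: f_def[abs_def] case_prod_beta')
  have [measurable]: "S \<in> borel \<rightarrow>\<^sub>M borel" "T \<in> borel \<rightarrow>\<^sub>M borel"
    using ab by (auto simp: S_def[abs_def] T_def[abs_def]
        intro!: borel_measurable_continuous_onI continuous_intros)
  have ST: "S (T w) = w" for w
    using ab by (simp add: S_def T_def)
  let ?C = "1 / (a ^ CARD('d) * b)"
  have "distr (density lborel (\<lambda>z. ennreal (f z))) borel S =
      density lborel (\<lambda>w. ennreal (f (T w) * ?C))" (is "?L = ?R")
  proof (rule measure_eqI)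
    fix A assume "A \<in> sets ?L"
    then have [measurable]: "A \<in> sets borel" by simp
    have "emeasure ?L A = (\<integral>\<^sup>+z. ennreal (f z) * indicator A (S z) \<partial>lborel)"
      using measurable_sets_borel[of S borel A]
      by (auto simp: emeasure_distr emeasure_density indicator_def intro!: nn_integral_cong)
    also have "\<dots> = (\<integral>\<^sup>+z. ennreal (f z) * indicator A (S z)
        \<partial>density (distr lborel borel T) (\<lambda>_. ennreal ?C))"
      by (subst lborel_prod_affine[OF ab, of m k]) (simp add: T_def[abs_def])
    also have "\<dots> = (\<integral>\<^sup>+w. ennreal ?C * (ennreal (f (T w)) * indicator A w) \<partial>lborel)"
      by (simp add: nn_integral_density nn_integral_distr ST)
    also have "\<dots> = emeasure ?R A"
      using ab by (simp add: emeasure_density ennreal_mult''[of ?C] mult.assoc mult.left_commute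
          del: times_divide_eq_right mult_1_right)
    finally show "emeasure ?L A = emeasure ?R A" .
  qed simp
  moreover have "(\<lambda>z. ennreal (f z)) = (\<lambda>(\<theta>, \<gamma>). ennreal (posterior \<Theta> I1 I2 q \<pi> n x \<theta> \<gamma>))"
    by (auto simp: f_def)
  moreover have "S = (\<lambda>(\<theta>, \<gamma>). (sqrt (real n) *\<^sub>R (\<theta> - theta_ML \<Theta> I2 q n x),
                     real n * c_hat \<Theta> I2 q n x * (\<gamma> - gamma_ML n x)))"
    by (auto simp: S_def a_def b_def m_def k_def)
  moreover have "(\<lambda>w. ennreal (f (T w) * ?C)) =
      (\<lambda>(u, t). ennreal (posterior_ut \<Theta> I1 I2 q \<pi> n x u t))"
    by (auto simp: f_def T_def posterior_ut_def a_def b_def m_def k_def)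
  ultimately show ?thesis by simp
qed


section \<open>Coefficients of the expansion\<close>

definition B1 :: "(real ^ 'd::finite) set \<Rightarrow> ereal \<Rightarrow> (real \<Rightarrow> real ^ 'd \<Rightarrow> real) \<Rightarrow>
    (real ^ 'd \<Rightarrow> real \<Rightarrow> real) \<Rightarrow> nat \<Rightarrow> (nat \<Rightarrow> real) \<Rightarrow> real ^ 'd \<Rightarrow> real \<Rightarrow> real" where
  "B1 \<Theta> I2 q \<pi> n x u t =
    (let A = A_hat \<Theta> I2 q n x;
         c = c_hat \<Theta> I2 q n x;
         \<theta>' = theta_ML \<Theta> I2 q n x;
         \<gamma>' = gamma_ML n x;
         p = \<pi> \<theta>' \<gamma>';
         Dp = D_theta (\<lambda>\<theta>. \<pi> \<theta> \<gamma>') \<theta>';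
         U = kron_pow 1 (tensor_of_vec u)
     in 1 / p * tinner 1 Dp (U 1)
        + tinner 1 (A 1 1) (U 1) * (t / c)
        + 1 / fact 3 * tinner 3 (A 3 0) (U 3))"

definition B2 :: "(real ^ 'd::finite) set \<Rightarrow> ereal \<Rightarrow> (real \<Rightarrow> real ^ 'd \<Rightarrow> real) \<Rightarrow>
    (real ^ 'd \<Rightarrow> real \<Rightarrow> real) \<Rightarrow> nat \<Rightarrow> (nat \<Rightarrow> real) \<Rightarrow> real ^ 'd \<Rightarrow> real \<Rightarrow> real" where
  "B2 \<Theta> I2 q \<pi> n x u t =
    (let A = A_hat \<Theta> I2 q n x;
         c = c_hat \<Theta> I2 q n x;
         \<theta>' = theta_ML \<Theta> I2 q n x;
         \<gamma>' = gamma_ML n x;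
         p = \<pi> \<theta>' \<gamma>';
         Dp = D_theta (\<lambda>\<theta>. \<pi> \<theta> \<gamma>') \<theta>';
         dp = deriv (\<lambda>\<gamma>. \<pi> \<theta>' \<gamma>) \<gamma>';
         U = kron_pow 1 (tensor_of_vec u);
         V = kron_pow 2 (vec_mat (matrix_inv (g_hat \<Theta> I2 q n x)))
     in 1 / (c * p) * dp * (t + 1)
        + 1 / (2 * p) * tinner 2 Dp (\<lambda>is. U 2 is - V 1 is)
        + 1 / (c * p) * tinner 2 (kron 1 Dp (A 1 1)) (\<lambda>is. U 2 is * t + V 1 is)
        + 1 / (fact 3 * p) * tinner 4 (kron 1 Dp (A 3 0)) (\<lambda>is. U 4 is - 3 * V 2 is)
        + 1 / (2 * c\<^sup>2) * A 0 2 [] * (t\<^sup>2 - 2)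
        + 1 / (2 * c) * tinner 2 (A 2 1) (\<lambda>is. U 2 is * t + V 1 is)
        + 1 / fact 4 * tinner 4 (A 4 0) (\<lambda>is. U 4 is - 3 * V 2 is)
        + 1 / (2 * c\<^sup>2) * tinner 2 (kron_pow 1 (A 1 1) 2) (\<lambda>is. U 2 is * t\<^sup>2 - 2 * V 1 is)
        + 1 / (2 * (fact 3)\<^sup>2) *
            tinner 6 (kron_pow 3 (A 3 0) 2) (symmetrizer 6 (\<lambda>is. U 6 is - 15 * V 3 is))
        + 1 / (fact 3 * c) * tinner 4 (kron 1 (A 1 1) (A 3 0)) (\<lambda>is. U 4 is * t + 3 * V 2 is))"


section \<open>Regularity at the sampling parameter\<close>

text \<open>
  Classical conditions for the validity of Laplace expansions of posteriors (in the style of Walker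
  and Johnson), at the parameter \<open>(\<theta>, \<gamma>)\<close> that generates the observations \<open>X\<close>: the density is nonzero
  at the truncation point; the log-likelihood derivatives of orders 2 to 5 in \<open>\<theta>\<close> have a locally
  uniform integrable envelope; the Fisher information in \<open>\<theta>\<close> is positive definite; and outside each
  neighbourhood of \<open>\<theta>\<close> the log-likelihood is smaller by an amount of order \<open>n\<close>. None of them follows
  from \<open>oTF\<close> and \<open>MLE_condition\<close>. For instance, \<open>q x \<theta> = x\<^sup>2 exp (- \<theta> x)\<close> for \<open>x \<noteq> 0\<close>,
  \<open>q 0 \<theta> = 1\<close>, \<open>\<Theta> = {0<..}\<close>, \<open>I = UNIV\<close> satisfies both, but at \<open>\<gamma> = 0\<close> the first condition and
  the conclusion fail: there \<open>gamma_ML\<close> is of exact order \<open>n powr (- 1 / 3)\<close>.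
\<close>

definition fisher_info :: "ereal \<Rightarrow> (real \<Rightarrow> real ^ 'd \<Rightarrow> real) \<Rightarrow> real ^ 'd \<Rightarrow> real \<Rightarrow> real ^ 'd ^ 'd" where
  "fisher_info I2 q \<theta> \<gamma> =
     (\<chi> i j. - (LINT x:tsupport I2 \<gamma>|Pdist I2 q \<theta> \<gamma>. D_theta (\<lambda>\<eta>. logp I2 q x \<eta> \<gamma>) \<theta> [i, j]))"

definition regular_at :: "(real ^ 'd::finite) set \<Rightarrow> ereal \<Rightarrow> (real \<Rightarrow> real ^ 'd \<Rightarrow> real) \<Rightarrow>
    'w measure \<Rightarrow> (nat \<Rightarrow> 'w \<Rightarrow> real) \<Rightarrow> real ^ 'd \<Rightarrow> real \<Rightarrow> bool" where
  "regular_at \<Theta> I2 q M X \<theta> \<gamma> \<longleftrightarrow>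
     deriv (psi I2 q \<theta>) \<gamma> \<noteq> 0 \<and>
     (\<exists>\<delta>>0. ball \<theta> \<delta> \<subseteq> \<Theta> \<and> (\<exists>G. integrable (Pdist I2 q \<theta> \<gamma>) G \<and>
        (\<forall>x. \<gamma> < x \<and> ereal x < I2 \<longrightarrow> (\<forall>\<eta>\<in>ball \<theta> \<delta>. \<forall>is. 2 \<le> length is \<and> length is \<le> 5 \<longrightarrow>
           \<bar>D_theta (\<lambda>\<eta>. logp I2 q x \<eta> \<gamma>) \<eta> is\<bar> \<le> G x)))) \<and>
     (\<forall>v. v \<noteq> 0 \<longrightarrow> 0 < v \<bullet> (fisher_info I2 q \<theta> \<gamma> *v v)) \<and>
     (\<forall>\<delta>>0. \<exists>\<kappa>>0. with_prob_tending_to_1 M (\<lambda>n \<omega>. \<forall>\<eta>\<in>\<Theta>. dist \<eta> \<theta> \<ge> \<delta> \<longrightarrow>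
        (let g = gamma_ML n (\<lambda>j. X j \<omega>)
         in (\<Sum>j<n. logp I2 q (X j \<omega>) \<eta> g) \<le> (\<Sum>j<n. logp I2 q (X j \<omega>) \<theta> g) - \<kappa> * real n)))"

end

theory Submission
  imports Defs
begin

text \<open>
  The likelihood of a sample vanishes for \<open>\<gamma>\<close> beyond the smallest observation; below it, it is the
  exponential of \<open>n\<close> times the average log-density. At the MLE the average log-density has gradient
  \<open>0\<close> in \<open>\<theta>\<close> but a positive slope \<open>c_hat\<close> in \<open>\<gamma>\<close>, so its maximum lies at a corner. This dictates the
  two scales \<open>u = sqrt n (\<theta> - theta_ML)\<close> and \<open>t = n c_hat (\<gamma> - gamma_ML) \<le> 0\<close>, in which the
  log-likelihood ratio is
  \<open>t - u \<bullet> (g_hat *v u) / 2 + w3 / sqrt n + w4 / n\<close> up to order \<open>n powr (- 3 / 2)\<close>, with polynomials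
  \<open>w3\<close> and \<open>w4\<close> in \<open>u\<close> and \<open>t\<close>. Expanding the exponential and the prior gives, relative to the value at
  the MLE, a Gaussian density in \<open>u\<close> times an exponential density in \<open>t\<close> times
  \<open>1 + a1 / sqrt n + a2 / n\<close>.

  The posterior density is this function divided by its integral. Every term of \<open>a1\<close> has odd degree
  in \<open>u\<close> and integrates to \<open>0\<close>; the integral of \<open>a2\<close> against the limiting density is a number \<open>z2\<close>,
  which Wick's formula and the moments \<open>(- 1) ^ k * fact k\<close> of \<open>t\<close> evaluate. Therefore the coefficients
  of the quotient are \<open>B1 = a1\<close> and \<open>B2 = a2 - z2\<close>: the subtracted powers of
  \<open>vec_mat (matrix_inv g_hat)\<close> in \<open>B2\<close> are the Gaussian expectations of the monomials next to them.

  All error terms have to be of order \<open>n powr (- 3 / 2)\<close> with a constant that depends neither on \<open>n\<close>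
  nor on the sample. The analysis is therefore separated from the probability. The locale \<open>laplace\<close>
  carries out the expansion for one function, with remainders that depend only on a few numbers that
  bound its data (\<open>posterior_expansion\<close>). The locale \<open>good_sample\<close> collects conditions on a single sample
  under which the posterior is an instance with fixed numbers (\<open>posterior_ut_expansion\<close>). Finally, these
  conditions hold with probability tending to one (\<open>good_sample_with_prob_tending_to_1\<close>). There it helps
  that \<open>\<gamma>\<close> enters the log-density through the normalizing constant alone: all derivatives that involve
  \<open>\<gamma>\<close> are the same for every observation and are bounded by continuity, and the weak law of large
  numbers is needed only for the envelope of the \<open>\<theta>\<close>-derivatives and for the second derivatives at the
  true parameter.
\<close>


section \<open>Smooth functions and directional derivatives\<close>

definition ddir :: "'a::euclidean_space \<Rightarrow> ('a \<Rightarrow> real) \<Rightarrow> 'a \<Rightarrow> real" where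
  "ddir b f z = frechet_derivative f (at z) b"

lemma C_k_Suc_ddir:
  "C_k (Suc k) f S \<longleftrightarrow> f differentiable_on S \<and> (\<forall>b\<in>Basis. C_k k (ddir b f) S)"
  by (simp add: ddir_def[abs_def])

declare C_k.simps(2)[simp del]

lemma differentiable_has_ddir:
  "f differentiable (at z) \<Longrightarrow> (f has_derivative (\<lambda>b. ddir b f z)) (at z)"
  unfolding ddir_def by (simp add: frechet_derivative_works)

lemma ddir_eqI: "(f has_derivative D) (at z) \<Longrightarrow> ddir b f z = D b"
  unfolding ddir_def by (metis frechet_derivative_at)

lemma ddir_cong:
  assumes "open S" "z \<in> S" "\<And>w. w \<in> S \<Longrightarrow> f w = g w"
  shows "ddir b f z = ddir b g z"
proof -
  have "(f has_derivative D) (at z) \<longleftrightarrow> (g has_derivative D) (at z)" for D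
    using has_derivative_transform_within_open[OF _ assms(1,2), of f D UNIV g]
      has_derivative_transform_within_open[OF _ assms(1,2), of g D UNIV f] assms(3) by auto
  then show ?thesis
    unfolding ddir_def frechet_derivative_def by simp
qed

lemma differentiable_on_cong_open:
  assumes "open S" "\<And>w. w \<in> S \<Longrightarrow> f w = g w" "f differentiable_on S"
  shows "g differentiable_on S"
  unfolding differentiable_on_def
proof
  fix z assume z: "z \<in> S"
  then obtain D where "(f has_derivative D) (at z within S)"
    using assms(3) by (auto simp: differentiable_on_def differentiable_def)
  then have "(g has_derivative D) (at z within S)"
    by (rule has_derivative_transform[rotated 2]) (use assms(2) z in auto)
  then show "g differentiable at z within S" by (auto simp: differentiable_def)
qed

lemma C_k_cong:
  assumes S: "open S" and "\<And>w. w \<in> S \<Longrightarrow> f w = g w" "C_k k f S"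
  shows "C_k k g S"
  using assms(2,3)
proof (induction k arbitrary: f g)
  case 0
  then show ?case using continuous_on_cong[of S S f g] by simp
next
  case (Suc k)
  have "g differentiable_on S"
    using differentiable_on_cong_open[OF S, of f g] Suc.prems by (auto simp: C_k_Suc_ddir)
  moreover have "C_k k (ddir b g) S" if "b \<in> Basis" for b
  proof (rule Suc.IH)
    show "C_k k (ddir b f) S" using Suc.prems that by (auto simp: C_k_Suc_ddir)
    show "ddir b f w = ddir b g w" if "w \<in> S" for w
      using that Suc.prems(1) by (intro ddir_cong[OF S]) auto
  qed
  ultimately show ?case by (simp add: C_k_Suc_ddir)
qed

lemma C_k_SucD: "C_k (Suc k) f S \<Longrightarrow> C_k k f S"
proof (induction k arbitrary: f)
  case 0
  then show ?case by (simp add: C_k_Suc_ddir differentiable_imp_continuous_on)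
next
  case (Suc k)
  then show ?case unfolding C_k_Suc_ddir[of "Suc k"] C_k_Suc_ddir[of k f] by blast
qed

lemma C_k_differentiable:
  assumes "open S" "C_k (Suc k) f S" "z \<in> S"
  shows "f differentiable (at z)"
  using assms by (auto simp: C_k_Suc_ddir differentiable_on_eq_differentiable_at)

lemma C_k_SucI:
  assumes S: "open S"
    and "\<And>z. z \<in> S \<Longrightarrow> (f has_derivative D z) (at z)"
    and "\<And>b. b \<in> Basis \<Longrightarrow> C_k k (\<lambda>z. D z b) S"
  shows "C_k (Suc k) f S"
  unfolding C_k_Suc_ddir
proof (intro conjI ballI)
  show "f differentiable_on S"
    using assms(1,2) by (auto simp: differentiable_on_eq_differentiable_at differentiable_def)
  fix b :: 'a assume "b \<in> Basis"
  from assms(3)[OF this] show "C_k k (ddir b f) S"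
    by (rule C_k_cong[OF S, rotated]) (use assms(2) ddir_eqI in \<open>metis (no_types, lifting)\<close>)
qed

lemma C_k_const: "open S \<Longrightarrow> C_k k (\<lambda>z. c) S"
  by (induction k arbitrary: c) (auto intro!: C_k_SucI[where D = "\<lambda>_ _. 0"])

lemma C_k_add:
  assumes S: "open S" and "C_k k f S" "C_k k g S"
  shows "C_k k (\<lambda>z. f z + g z) S"
  using assms(2,3)
proof (induction k arbitrary: f g)
  case 0
  then show ?case by (auto intro: continuous_intros)
next
  case (Suc k)
  show ?case
  proof (rule C_k_SucI[OF S, where D = "\<lambda>z b. ddir b f z + ddir b g z"])
    fix z assume "z \<in> S"
    then show "((\<lambda>z. f z + g z) has_derivative (\<lambda>b. ddir b f z + ddir b g z)) (at z)"
      using Suc.prems C_k_differentiable[OF S]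
      by (intro has_derivative_add differentiable_has_ddir) auto
  next
    fix b :: 'a assume "b \<in> Basis"
    then show "C_k k (\<lambda>z. ddir b f z + ddir b g z) S"
      using Suc.prems by (intro Suc.IH) (auto simp: C_k_Suc_ddir)
  qed
qed

lemma C_k_mult:
  assumes S: "open S" and "C_k k f S" "C_k k g S"
  shows "C_k k (\<lambda>z. f z * g z) S"
  using assms(2,3)
proof (induction k arbitrary: f g)
  case 0
  then show ?case by (auto intro: continuous_intros)
next
  case (Suc k)
  show ?case
  proof (rule C_k_SucI[OF S, where D = "\<lambda>z b. f z * ddir b g z + ddir b f z * g z"])
    fix z assume "z \<in> S"
    then show "((\<lambda>z. f z * g z) has_derivative (\<lambda>b. f z * ddir b g z + ddir b f z * g z)) (at z)"
      using Suc.prems C_k_differentiable[OF S]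
      by (intro has_derivative_mult differentiable_has_ddir) auto
  next
    fix b :: 'a assume "b \<in> Basis"
    then show "C_k k (\<lambda>z. f z * ddir b g z + ddir b f z * g z) S"
      using Suc.prems C_k_SucD[OF Suc.prems(1)] C_k_SucD[OF Suc.prems(2)]
      by (intro C_k_add S Suc.IH) (simp_all add: C_k_Suc_ddir)
  qed
qed

lemma C_k_sum:
  assumes "open S" "finite I" "\<And>i. i \<in> I \<Longrightarrow> C_k k (f i) S"
  shows "C_k k (\<lambda>z. \<Sum>i\<in>I. f i z) S"
  using assms(2,3) by (induction I) (auto intro: C_k_const[OF assms(1)] C_k_add[OF assms(1)])

lemma C_k_inverse:
  assumes S: "open S" and "C_k k f S" "\<And>z. z \<in> S \<Longrightarrow> f z \<noteq> 0"
  shows "C_k k (\<lambda>z. inverse (f z)) S"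
  using assms(2,3)
proof (induction k arbitrary: f)
  case 0
  then show ?case by (auto intro: continuous_intros)
next
  case (Suc k)
  show ?case
  proof (rule C_k_SucI[OF S, where D = "\<lambda>z b. (-1) * (inverse (f z) * ddir b f z * inverse (f z))"])
    fix z assume "z \<in> S"
    then show "((\<lambda>z. inverse (f z)) has_derivative
        (\<lambda>b. (-1) * (inverse (f z) * ddir b f z * inverse (f z)))) (at z)"
      using Deriv.has_derivative_inverse[OF Suc.prems(2)
          differentiable_has_ddir[OF C_k_differentiable[OF S Suc.prems(1)]]] by simp
  next
    fix b :: 'a assume "b \<in> Basis"
    then show "C_k k (\<lambda>z. (-1) * (inverse (f z) * ddir b f z * inverse (f z))) S"
      using Suc.prems(1) C_k_SucD[OF Suc.prems(1)] Suc.prems(2)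
      by (intro C_k_mult C_k_const S Suc.IH) (simp_all add: C_k_Suc_ddir)
  qed
qed

lemma C_k_ln:
  assumes S: "open S" and "C_k k f S" "\<And>z. z \<in> S \<Longrightarrow> 0 < f z"
  shows "C_k k (\<lambda>z. ln (f z)) S"
proof (cases k)
  case 0
  then show ?thesis using assms by (auto intro!: continuous_intros)
      (metis less_irrefl)
next
  case (Suc l)
  have f: "C_k (Suc l) f S" using assms Suc by simp
  have "C_k (Suc l) (\<lambda>z. ln (f z)) S"
  proof (rule C_k_SucI[OF S, where D = "\<lambda>z b. inverse (f z) * ddir b f z"])
    fix z assume z: "z \<in> S"
    have "((\<lambda>z. ln (f z)) has_derivative (\<lambda>b. ddir b f z * inverse (f z))) (at z)"
      using C_k_differentiable[OF S f z] assms(3)[OF z]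
      by (intro has_derivative_ln differentiable_has_ddir) auto
    then show "((\<lambda>z. ln (f z)) has_derivative (\<lambda>b. inverse (f z) * ddir b f z)) (at z)"
      by (simp add: mult.commute)
  next
    fix b :: 'a assume "b \<in> Basis"
    then show "C_k l (\<lambda>z. inverse (f z) * ddir b f z) S"
      using f C_k_SucD[OF f] assms(3)
      by (intro C_k_mult C_k_inverse S) (force simp: C_k_Suc_ddir)+
  qed
  then show ?thesis by (simp add: Suc)
qed

lemma linear_ddir_expand:
  assumes "f differentiable (at z)"
  shows "ddir w f z = (\<Sum>b\<in>Basis. (w \<bullet> b) * ddir b f z)"
proof -
  have lin: "linear (\<lambda>b. ddir b f z)"
    using differentiable_has_ddir[OF assms] has_derivative_linear by blast
  have "ddir w f z = ddir (\<Sum>b\<in>Basis. (w \<bullet> b) *\<^sub>R b) f z"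
    by (simp add: euclidean_representation)
  also have "\<dots> = (\<Sum>b\<in>Basis. (w \<bullet> b) * ddir b f z)"
    using linear_sum[OF lin, of "\<lambda>b. (w \<bullet> b) *\<^sub>R b" Basis] linear_scale[OF lin] by simp
  finally show ?thesis .
qed

text \<open>
  Composition with an affine map is what freezes one of the two parameters of a smooth function.
\<close>

lemma C_k_affine:
  fixes L :: "'a::euclidean_space \<Rightarrow> 'b::euclidean_space"
  assumes S: "open S" and L: "bounded_linear L" and "C_k k f S"
  shows "C_k k (\<lambda>z. f (a + L z)) {z. a + L z \<in> S}"
  using assms(3)
proof (induction k arbitrary: f)
  case 0
  have "continuous_on {z. a + L z \<in> S} (\<lambda>z. a + L z)"
    by (intro continuous_intros linear_continuous_on L)
  then show ?case
    using 0 by (auto intro!: continuous_on_compose2[of S f])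
next
  case (Suc k)
  have cont: "continuous_on UNIV (\<lambda>z. a + L z)"
    by (intro continuous_intros linear_continuous_on L)
  have T: "open {z. a + L z \<in> S}"
    using open_vimage[OF S cont] by (simp add: vimage_def)
  show ?case
  proof (rule C_k_SucI[OF T, where D = "\<lambda>z b. \<Sum>b'\<in>Basis. (L b \<bullet> b') * ddir b' f (a + L z)"])
    fix z assume "z \<in> {z. a + L z \<in> S}"
    then have d: "f differentiable (at (a + L z))"
      using C_k_differentiable[OF S Suc.prems] by simp
    have "((\<lambda>z. a + L z) has_derivative L) (at z)"
      using bounded_linear_imp_has_derivative[OF L] by (auto intro!: derivative_eq_intros)
    from has_derivative_compose[OF this differentiable_has_ddir[OF d]]
    show "((\<lambda>z. f (a + L z)) has_derivative
       (\<lambda>b. \<Sum>b'\<in>Basis. (L b \<bullet> b') * ddir b' f (a + L z))) (at z)"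
      by (subst (asm) linear_ddir_expand[OF d])
  next
    fix b :: 'a assume "b \<in> Basis"
    show "C_k k (\<lambda>z. \<Sum>b'\<in>Basis. (L b \<bullet> b') * ddir b' f (a + L z)) {z. a + L z \<in> S}"
      using Suc.prems
      by (intro C_k_sum C_k_mult C_k_const T Suc.IH finite_Basis) (auto simp: C_k_Suc_ddir)
  qed
qed

lemma smooth_on_add:
  "open S \<Longrightarrow> smooth_on S f \<Longrightarrow> smooth_on S g \<Longrightarrow> smooth_on S (\<lambda>z. f z + g z)"
  by (simp add: smooth_on_def C_k_add)

lemma smooth_on_cmult: "open S \<Longrightarrow> smooth_on S f \<Longrightarrow> smooth_on S (\<lambda>z. c * f z)"
  by (simp add: smooth_on_def C_k_mult C_k_const)

lemma smooth_on_diff: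
  "open S \<Longrightarrow> smooth_on S f \<Longrightarrow> smooth_on S g \<Longrightarrow> smooth_on S (\<lambda>z. f z - g z)"
  using smooth_on_add[of S f "\<lambda>z. (-1) * g z"] smooth_on_cmult[of S g "-1"] by simp

lemma smooth_on_ln:
  "open S \<Longrightarrow> smooth_on S f \<Longrightarrow> (\<And>z. z \<in> S \<Longrightarrow> 0 < f z) \<Longrightarrow> smooth_on S (\<lambda>z. ln (f z))"
  by (simp add: smooth_on_def C_k_ln)

lemma smooth_on_affine:
  "open S \<Longrightarrow> bounded_linear L \<Longrightarrow> smooth_on S f \<Longrightarrow> smooth_on {z. a + L z \<in> S} (\<lambda>z. f (a + L z))"
  by (simp add: smooth_on_def C_k_affine)

lemma smooth_on_cong:
  "open S \<Longrightarrow> smooth_on S f \<Longrightarrow> (\<And>z. z \<in> S \<Longrightarrow> f z = g z) \<Longrightarrow> smooth_on S g"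
  using C_k_cong[of S f g] by (auto simp: smooth_on_def)

lemma smooth_on_differentiable:
  "open S \<Longrightarrow> smooth_on S f \<Longrightarrow> z \<in> S \<Longrightarrow> f differentiable (at z)"
  using C_k_differentiable[of S 0] by (auto simp: smooth_on_def)

lemma smooth_on_ddir: "smooth_on S f \<Longrightarrow> b \<in> Basis \<Longrightarrow> smooth_on S (ddir b f)"
  unfolding smooth_on_def by (metis C_k_Suc_ddir)

lemma smooth_on_continuous: "smooth_on S f \<Longrightarrow> continuous_on S f"
  unfolding smooth_on_def by (metis C_k.simps(1))

lemma C_k_subset:
  assumes "open S" "open T" "T \<subseteq> S" "C_k k f S" shows "C_k k f T"
  using assms(4)
proof (induction k arbitrary: f)
  case 0 then show ?case using assms(3) continuous_on_subset by auto
next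
  case (Suc k) then show ?case
    using assms(3) differentiable_on_subset by (auto simp: C_k_Suc_ddir)
qed

lemma smooth_on_subset:
  "open S \<Longrightarrow> open T \<Longrightarrow> T \<subseteq> S \<Longrightarrow> smooth_on S f \<Longrightarrow> smooth_on T f"
  unfolding smooth_on_def by (blast intro: C_k_subset)

lemma C_k_local:
  assumes "open S" and "\<And>z. z \<in> S \<Longrightarrow> \<exists>T. open T \<and> z \<in> T \<and> T \<subseteq> S \<and> C_k k f T"
  shows "C_k k f S"
  using assms(2)
proof (induction k arbitrary: f)
  case 0
  have "continuous (at z) f" if "z \<in> S" for z
    using 0[OF that] by (auto simp: continuous_on_eq_continuous_at)
  then show ?case by (simp add: continuous_at_imp_continuous_on)
next
  case (Suc k)
  have "f differentiable_on S"
    unfolding differentiable_on_eq_differentiable_at[OF assms(1)]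
    using Suc.prems C_k_differentiable by metis
  moreover have "C_k k (ddir b f) S" if "b \<in> Basis" for b
    by (rule Suc.IH) (use Suc.prems that in \<open>force simp: C_k_Suc_ddir\<close>)
  ultimately show ?case by (simp add: C_k_Suc_ddir)
qed

text \<open>
  Smoothness of a family is given on the sets \<open>\<gamma> < x\<close> only, one for each observation \<open>x\<close>; this lemma
  glues them together.
\<close>

lemma smooth_on_local:
  assumes "open S" and "\<And>z. z \<in> S \<Longrightarrow> \<exists>T. open T \<and> z \<in> T \<and> T \<subseteq> S \<and> smooth_on T f"
  shows "smooth_on S f"
  unfolding smooth_on_def
proof
  fix k show "C_k k f S"
    by (rule C_k_local[OF assms(1)]) (use assms(2) in \<open>force simp: smooth_on_def\<close>)
qed

lemma has_real_derivative_along_line: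
  assumes "f differentiable (at (z + s *\<^sub>R w))"
  shows "((\<lambda>s. f (z + s *\<^sub>R w)) has_real_derivative ddir w f (z + s *\<^sub>R w)) (at s)"
proof -
  have lin: "linear (\<lambda>b. ddir b f (z + s *\<^sub>R w))"
    using differentiable_has_ddir[OF assms] has_derivative_linear by blast
  have "((\<lambda>s. z + s *\<^sub>R w) has_derivative (\<lambda>h. h *\<^sub>R w)) (at s)"
    by (auto intro!: derivative_eq_intros)
  from has_derivative_compose[OF this differentiable_has_ddir[OF assms]]
  show ?thesis
    using linear_scale[OF lin]
    unfolding has_field_derivative_def by (auto elim!: has_derivative_eq_rhs)
qed

text \<open>
  Schwarz's theorem. By two applications of the mean value theorem, the second difference of \<open>f\<close> over
  a small parallelogram is the mixed derivative at a nearby point, in either order of differentiation.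
\<close>

lemma ddir_commute:
  assumes S: "open S" and f: "smooth_on S f" and ab: "a \<in> Basis" "b \<in> Basis" and z: "z \<in> S"
  shows "ddir a (ddir b f) z = ddir b (ddir a f) z"
proof -
  have diff: "g differentiable (at w)" if "smooth_on S g" "w \<in> S" for g w
    using smooth_on_differentiable[OF S] that by blast
  have key: "\<exists>w. dist w z \<le> 2 * s \<and> f (z + s *\<^sub>R a + s *\<^sub>R b) - f (z + s *\<^sub>R a) - f (z + s *\<^sub>R b) + f z
      = s * s * ddir b (ddir a f) w"
    if s: "0 < s" and sub: "cball z (2 * s) \<subseteq> S" and ab: "a \<in> Basis" "b \<in> Basis" for s a b
  proof -
    have in_S: "z + x *\<^sub>R a + y *\<^sub>R b \<in> S" if "0 \<le> x" "x \<le> s" "0 \<le> y" "y \<le> s" for x y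
    proof -
      have "norm (x *\<^sub>R a + y *\<^sub>R b) \<le> x + y"
        using norm_triangle_ineq[of "x *\<^sub>R a" "y *\<^sub>R b"] that ab by simp
      then have "z + x *\<^sub>R a + y *\<^sub>R b \<in> cball z (2 * s)"
        using that norm_minus_cancel[of "x *\<^sub>R a + y *\<^sub>R b"] by (simp add: dist_norm)
      then show ?thesis using sub by blast
    qed
    define \<phi> where "\<phi> x = f (z + s *\<^sub>R b + x *\<^sub>R a) - f (z + x *\<^sub>R a)" for x
    have "\<exists>x>0. x < s \<and> \<phi> s - \<phi> 0 = (s - 0) * (ddir a f (z + s *\<^sub>R b + x *\<^sub>R a) - ddir a f (z + x *\<^sub>R a))"
    proof (rule MVT2[OF s])
      fix x assume x: "0 \<le> x" "x \<le> s"
      show "(\<phi> has_real_derivative ddir a f (z + s *\<^sub>R b + x *\<^sub>R a) - ddir a f (z + x *\<^sub>R a)) (at x)"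
        unfolding \<phi>_def using in_S[of x s] in_S[of x 0] x s
        by (intro DERIV_diff has_real_derivative_along_line diff f) (auto simp: algebra_simps)
    qed
    then obtain x where x: "0 < x" "x < s"
      and eq1: "\<phi> s - \<phi> 0 = s * (ddir a f (z + s *\<^sub>R b + x *\<^sub>R a) - ddir a f (z + x *\<^sub>R a))" by auto
    define \<xi> where "\<xi> y = ddir a f (z + x *\<^sub>R a + y *\<^sub>R b)" for y
    have "\<exists>y>0. y < s \<and> \<xi> s - \<xi> 0 = (s - 0) * ddir b (ddir a f) (z + x *\<^sub>R a + y *\<^sub>R b)"
    proof (rule MVT2[OF s])
      fix y assume y: "0 \<le> y" "y \<le> s"
      show "(\<xi> has_real_derivative ddir b (ddir a f) (z + x *\<^sub>R a + y *\<^sub>R b)) (at y)"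
        unfolding \<xi>_def using in_S[of x y] x y
        by (intro has_real_derivative_along_line diff smooth_on_ddir f ab) auto
    qed
    then obtain y where y: "0 < y" "y < s"
      and eq2: "\<xi> s - \<xi> 0 = s * ddir b (ddir a f) (z + x *\<^sub>R a + y *\<^sub>R b)" by auto
    have "f (z + s *\<^sub>R a + s *\<^sub>R b) - f (z + s *\<^sub>R a) - f (z + s *\<^sub>R b) + f z = \<phi> s - \<phi> 0"
      by (simp add: \<phi>_def algebra_simps)
    also have "\<dots> = s * (\<xi> s - \<xi> 0)" by (simp add: eq1 \<xi>_def algebra_simps)
    finally have "f (z + s *\<^sub>R a + s *\<^sub>R b) - f (z + s *\<^sub>R a) - f (z + s *\<^sub>R b) + f z
      = s * s * ddir b (ddir a f) (z + x *\<^sub>R a + y *\<^sub>R b)" by (simp add: eq2)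
    moreover have "dist (z + x *\<^sub>R a + y *\<^sub>R b) z \<le> 2 * s"
      using norm_triangle_ineq[of "x *\<^sub>R a" "y *\<^sub>R b"] x y ab by (simp add: dist_norm add.assoc)
    ultimately show ?thesis by blast
  qed
  obtain r where r: "r > 0" "cball z r \<subseteq> S" using S z open_contains_cball by blast
  define s where "s n = r / 2 / real (Suc n)" for n
  have s: "s n > 0" "cball z (2 * s n) \<subseteq> S" for n
  proof -
    show "s n > 0" using r by (simp add: s_def)
    have "2 * s n \<le> r" using r by (simp add: s_def field_simps)
    then show "cball z (2 * s n) \<subseteq> S" using r by (meson order_trans subset_cball)
  qed
  have s0: "(\<lambda>n. 2 * s n) \<longlonglongrightarrow> 0"
    unfolding s_def by real_asymp
  obtain w1 where w1: "\<And>n. dist (w1 n) z \<le> 2 * s n" "\<And>n. f (z + s n *\<^sub>R a + s n *\<^sub>R b) - f (z + s n *\<^sub>R a) - f (z + s n *\<^sub>R b) + f z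
      = s n * s n * ddir b (ddir a f) (w1 n)"
    using key[OF s ab] by metis
  obtain w2 where w2: "\<And>n. dist (w2 n) z \<le> 2 * s n" "\<And>n. f (z + s n *\<^sub>R b + s n *\<^sub>R a) - f (z + s n *\<^sub>R b) - f (z + s n *\<^sub>R a) + f z
      = s n * s n * ddir a (ddir b f) (w2 n)"
    using key[OF s ab(2,1)] by metis
  have eq: "ddir b (ddir a f) (w1 n) = ddir a (ddir b f) (w2 n)" for n
  proof -
    have "s n * s n * ddir b (ddir a f) (w1 n) = s n * s n * ddir a (ddir b f) (w2 n)"
      unfolding w1(2)[symmetric] w2(2)[symmetric] by (simp add: algebra_simps)
    then show ?thesis using s(1)[of n] by simp
  qed
  have lim: "(\<lambda>n. g (w n)) \<longlonglongrightarrow> g z"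
    if "smooth_on S g" "\<And>n. dist (w n) z \<le> 2 * s n" for w g
  proof -
    have "w \<longlonglongrightarrow> z"
      by (rule tendsto_dist_iff[THEN iffD2], rule tendsto_sandwich[OF _ _ tendsto_const s0])
        (use that in auto)
    moreover have "isCont g z"
      using smooth_on_continuous[OF that(1)] S z by (simp add: continuous_on_eq_continuous_at)
    ultimately show ?thesis by (rule isCont_tendsto_compose[rotated])
  qed
  show ?thesis
    using lim[OF smooth_on_ddir[OF smooth_on_ddir[OF f ab(1)] ab(2)] w1(1)]
      lim[OF smooth_on_ddir[OF smooth_on_ddir[OF f ab(2)] ab(1)] w2(1)]
    unfolding eq by (rule LIMSEQ_unique[rotated])
qed


section \<open>Tensors as homogeneous polynomials\<close>

lemma midx_0: "midx 0 = {[]}"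
  by (auto simp: midx_def)

lemma midx_Suc: "midx (Suc r) = (\<lambda>(i, is). i # is) ` (UNIV \<times> midx r)"
  by (auto simp: midx_def length_Suc_conv)

lemma finite_midx [simp]: "finite (midx r :: 'd::finite list set)"
  by (induction r) (auto simp: midx_0 midx_Suc)

lemma sum_midx_Suc:
  fixes f :: "'d::finite list \<Rightarrow> real"
  shows "(\<Sum>is\<in>midx (Suc r). f is) = (\<Sum>i\<in>UNIV. \<Sum>is\<in>midx r. f (i # is))"
  unfolding midx_Suc
  by (subst sum.reindex) (auto simp: inj_on_def sum.cartesian_product case_prod_beta')

lemma sum_midx_0: "(\<Sum>is\<in>midx 0. f is) = f []"
  by (simp add: midx_0)

text \<open>The homogeneous polynomial with coefficient tensor \<open>T\<close>.\<close>

definition form :: "nat \<Rightarrow> 'd::finite tensor \<Rightarrow> real ^ 'd \<Rightarrow> real" where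
  "form r T v = tinner r T (kron_pow 1 (tensor_of_vec v) r)"

definition monom_at :: "real ^ 'd \<Rightarrow> 'd list \<Rightarrow> real" where
  "monom_at v is = prod_list (map (\<lambda>i. v $ i) is)"

lemma monom_at_simps [simp]:
  "monom_at v [] = 1" "monom_at v (i # is) = v $ i * monom_at v is"
  by (simp_all add: monom_at_def)

lemma monom_at_append: "monom_at v (is @ js) = monom_at v is * monom_at v js"
  by (simp add: monom_at_def)

lemma kron_pow_tensor_of_vec:
  "length is = r \<Longrightarrow> kron_pow 1 (tensor_of_vec v) r is = monom_at v is"
  by (induction r arbitrary: "is") (auto simp: kron_def tensor_of_vec_def length_Suc_conv)

lemma form_eq_sum: "form r T v = (\<Sum>is\<in>midx r. T is * monom_at v is)"
  unfolding form_def tinner_def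
  by (intro sum.cong refl) (simp add: kron_pow_tensor_of_vec[unfolded One_nat_def] midx_def)

lemma form_0 [simp]: "form 0 T v = T []"
  by (simp add: form_eq_sum sum_midx_0)

lemma form_Suc: "form (Suc r) T v = (\<Sum>i\<in>UNIV. v $ i * form r (\<lambda>is. T (i # is)) v)"
  by (simp add: form_eq_sum sum_midx_Suc sum_distrib_left mult_ac)

lemma form_cong: "(\<And>is. length is = r \<Longrightarrow> S is = T is) \<Longrightarrow> form r S v = form r T v"
  by (simp add: form_eq_sum midx_def)

lemma form_scaleR: "form r T (c *\<^sub>R v) = c ^ r * form r T v"
  by (induction r arbitrary: T) (simp_all add: form_Suc sum_distrib_left mult_ac)

lemma form_uminus: "form r (\<lambda>is. - T is) v = - form r T v"
  by (simp add: form_eq_sum sum_negf)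

lemma form_cmult: "form r (\<lambda>is. c * T is) v = c * form r T v"
  by (simp add: form_eq_sum sum_distrib_left mult_ac)

lemma form_sum: "form r (\<lambda>is. \<Sum>j\<in>J. T j is) v = (\<Sum>j\<in>J. form r (T j) v)"
  unfolding form_eq_sum by (subst sum.swap) (simp add: sum_distrib_right)

lemma form_mult: "form r S v * form s T v = form (r + s) (kron r S T) v"
proof -
  have bij: "bij_betw (\<lambda>(is, js). is @ js) (midx r \<times> midx s) (midx (r + s) :: 'd list set)"
    by (rule bij_betwI[where g = "\<lambda>is. (take r is, drop r is)"]) (auto simp: midx_def)
  have "form r S v * form s T v
      = (\<Sum>(is, js)\<in>midx r \<times> midx s. (S is * T js) * monom_at v (is @ js))"
    by (simp add: form_eq_sum sum_product sum.cartesian_product monom_at_append mult_ac)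
  also have "\<dots> = (\<Sum>(is, js)\<in>midx r \<times> midx s. kron r S T (is @ js) * monom_at v (is @ js))"
    by (intro sum.cong) (auto simp: kron_def midx_def)
  also have "\<dots> = form (r + s) (kron r S T) v"
    unfolding form_eq_sum
    by (subst sum.reindex_bij_betw[OF bij, symmetric]) (simp add: case_prod_beta')
  finally show ?thesis .
qed

lemma abs_monom_at_le: "\<bar>monom_at v is\<bar> \<le> norm v ^ length is"
  by (induction "is") (auto simp: abs_mult component_le_norm_cart intro!: mult_mono)

lemma card_midx: "card (midx r :: 'd::finite list set) = CARD('d) ^ r"
  using card_lists_length_eq[of "UNIV :: 'd set" r] by (simp add: midx_def)

lemma abs_form_le:
  fixes T :: "'d::finite tensor" and B :: real
  assumes "\<And>is. length is = r \<Longrightarrow> \<bar>T is\<bar> \<le> B"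
  shows "\<bar>form r T v\<bar> \<le> CARD('d) ^ r * B * norm v ^ r"
proof -
  have "\<bar>form r T v\<bar> \<le> (\<Sum>is\<in>(midx r :: 'd list set). B * norm v ^ r)"
    unfolding form_eq_sum
  proof (rule order_trans[OF sum_abs], rule sum_mono)
    fix "is" :: "'d list" assume "is \<in> midx r"
    then have "length is = r" by (simp add: midx_def)
    with assms[OF this] abs_monom_at_le[of v "is"]
    show "\<bar>T is * monom_at v is\<bar> \<le> B * norm v ^ r"
      by (auto simp: abs_mult intro!: mult_mono)
  qed
  then show ?thesis by (simp add: card_midx)
qed


section \<open>Taylor expansion in either parameter\<close>

text \<open>
  Iterated derivatives in the coordinates of \<open>\<theta>\<close>, of a function of \<open>(\<theta>, \<gamma>)\<close>. Unlike \<open>D_theta\<close>, which iterates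
  one-variable derivatives, they are values of total derivatives, to which the calculus of
  \<open>smooth_on\<close> applies.
\<close>

fun iter_d :: "((real ^ 'd::finite) \<times> real \<Rightarrow> real) \<Rightarrow> 'd list \<Rightarrow> (real ^ 'd) \<times> real \<Rightarrow> real" where
  "iter_d F [] = F"
| "iter_d F (i # is) = ddir (axis i 1, 0) (iter_d F is)"

lemma theta_axis_in_Basis: "(axis i 1, 0) \<in> (Basis :: ((real ^ 'd::finite) \<times> real) set)"
  by (auto simp: Basis_prod_def axis_in_Basis_iff)

lemma gamma_axis_in_Basis: "(0, 1) \<in> (Basis :: ((real ^ 'd::finite) \<times> real) set)"
  by (auto simp: Basis_prod_def)

lemma smooth_on_iter_d: "smooth_on S F \<Longrightarrow> smooth_on S (iter_d F is)"
  by (induction "is") (auto intro: smooth_on_ddir theta_axis_in_Basis)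

lemma open_line_vimage:
  fixes z w :: "'a::real_normed_vector"
  assumes "open S" shows "open {s. z + s *\<^sub>R w \<in> S}"
proof -
  have "continuous_on UNIV (\<lambda>s. z + s *\<^sub>R w)" by (intro continuous_intros)
  from open_vimage[OF assms this] show ?thesis by (simp add: vimage_def)
qed

lemma deriv_along_line:
  assumes S: "open S" and F: "smooth_on S F" and z: "z \<in> S"
    and eq: "\<And>h. z + h *\<^sub>R w \<in> S \<Longrightarrow> g h = F (z + h *\<^sub>R w)"
  shows "deriv g 0 = ddir w F z"
proof -
  have "((\<lambda>h. F (z + h *\<^sub>R w)) has_real_derivative ddir w F (z + 0 *\<^sub>R w)) (at 0)"
    using z by (intro has_real_derivative_along_line smooth_on_differentiable[OF S F]) simp
  then have "(g has_real_derivative ddir w F (z + 0 *\<^sub>R w)) (at 0)"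
    by (rule has_field_derivative_transform_within_open[OF _ open_line_vimage[OF S, of z w]])
      (use z eq in auto)
  then show ?thesis by (simp add: DERIV_imp_deriv)
qed

lemma deriv_gamma:
  assumes S: "open S" and F: "smooth_on S F" and z: "(\<theta>, \<gamma>) \<in> S"
    and eq: "\<And>g. (\<theta>, g) \<in> S \<Longrightarrow> f g = F (\<theta>, g)"
  shows "deriv f \<gamma> = ddir (0, 1) F (\<theta>, \<gamma>)"
proof -
  have "((\<lambda>g. F ((\<theta>, 0) + g *\<^sub>R (0, 1))) has_real_derivative ddir (0, 1) F ((\<theta>, 0) + \<gamma> *\<^sub>R (0, 1))) (at \<gamma>)"
    using z by (intro has_real_derivative_along_line smooth_on_differentiable[OF S F]) simp
  then have "(f has_real_derivative ddir (0, 1) F ((\<theta>, 0) + \<gamma> *\<^sub>R (0, 1))) (at \<gamma>)"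
    by (rule has_field_derivative_transform_within_open[OF _ open_line_vimage[OF S, of "(\<theta>, 0)" "(0, 1)"]])
      (use z eq in auto)
  then show ?thesis by (simp add: DERIV_imp_deriv)
qed

lemma ddir_theta_expand:
  fixes f :: "(real ^ 'd::finite) \<times> real \<Rightarrow> real"
  assumes "f differentiable (at z)"
  shows "ddir (v, 0) f z = (\<Sum>i\<in>UNIV. v $ i * ddir (axis i 1, 0) f z)"
proof -
  have lin: "linear (\<lambda>b. ddir b f z)"
    using differentiable_has_ddir[OF assms] has_derivative_linear by blast
  have "(\<Sum>i\<in>UNIV. v $ i *\<^sub>R axis i 1) = v"
    by (simp add: vec_eq_iff axis_def if_distrib cong: if_cong)
  then have eq: "(v, 0::real) = (\<Sum>i\<in>UNIV. v $ i *\<^sub>R (axis i 1, 0))"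
    by (simp add: sum_prod del: scaleR_zero_right) 
  have "ddir (v, 0) f z = ddir (\<Sum>i\<in>UNIV. v $ i *\<^sub>R (axis i 1, 0)) f z"
    by (rule arg_cong[OF eq])
  also have "\<dots> = (\<Sum>i\<in>UNIV. ddir (v $ i *\<^sub>R (axis i 1, 0)) f z)"
    by (rule linear_sum[OF lin])
  also have "\<dots> = (\<Sum>i\<in>UNIV. v $ i * ddir (axis i 1, 0) f z)"
    using linear_scale[OF lin] by (simp del: scaleR_Pair)
  finally show ?thesis .
qed

text \<open>
  Along a line in direction \<open>v\<close>, differentiation turns the form of the \<open>k\<close>-th derivatives, evaluated at
  \<open>v\<close>, into the form of the next derivatives. Hence the one-variable Taylor formula has forms as terms.
\<close>

lemma form_line_derivative:
  assumes S: "open S" and F: "smooth_on S F" and z: "(\<theta> + s *\<^sub>R v, \<gamma>) \<in> S"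
  shows "((\<lambda>s. form k (\<lambda>is. iter_d F is (\<theta> + s *\<^sub>R v, \<gamma>)) v) has_real_derivative
    form (Suc k) (\<lambda>is. iter_d F is (\<theta> + s *\<^sub>R v, \<gamma>)) v) (at s)"
proof -
  have d: "((\<lambda>s. iter_d F is (\<theta> + s *\<^sub>R v, \<gamma>)) has_real_derivative
      (\<Sum>i\<in>UNIV. v $ i * iter_d F (i # is) (\<theta> + s *\<^sub>R v, \<gamma>))) (at s)" for "is"
  proof -
    have diff: "iter_d F is differentiable (at ((\<theta>, \<gamma>) + s *\<^sub>R (v, 0)))"
      using z by (intro smooth_on_differentiable[OF S] smooth_on_iter_d F) simp
    from has_real_derivative_along_line[OF this]
    show ?thesis by (subst (asm) ddir_theta_expand[OF diff]) simp
  qed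
  have "((\<lambda>s. \<Sum>is\<in>midx k. iter_d F is (\<theta> + s *\<^sub>R v, \<gamma>) * monom_at v is) has_real_derivative
      (\<Sum>is\<in>midx k. (\<Sum>i\<in>UNIV. v $ i * iter_d F (i # is) (\<theta> + s *\<^sub>R v, \<gamma>)) * monom_at v is)) (at s)"
    by (intro DERIV_sum DERIV_cmult_right d)
  also have "(\<Sum>is\<in>midx k. (\<Sum>i\<in>UNIV. v $ i * iter_d F (i # is) (\<theta> + s *\<^sub>R v, \<gamma>)) * monom_at v is)
     = form (Suc k) (\<lambda>is. iter_d F is (\<theta> + s *\<^sub>R v, \<gamma>)) v"
    unfolding form_Suc unfolding form_eq_sum sum_distrib_left sum_distrib_right
    by (subst sum.swap) (simp add: mult_ac)
  finally show ?thesis by (simp add: form_eq_sum)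
qed

lemma theta_taylor:
  assumes S: "open S" and F: "smooth_on S F" and "k > 0"
    and line: "\<And>s. 0 \<le> s \<Longrightarrow> s \<le> 1 \<Longrightarrow> (\<theta> + s *\<^sub>R v, \<gamma>) \<in> S"
  shows "\<exists>s. 0 < s \<and> s < 1 \<and> F (\<theta> + v, \<gamma>) =
    (\<Sum>j<k. form j (\<lambda>is. iter_d F is (\<theta>, \<gamma>)) v / fact j)
    + form k (\<lambda>is. iter_d F is (\<theta> + s *\<^sub>R v, \<gamma>)) v / fact k"
proof -
  let ?d = "\<lambda>j s. form j (\<lambda>is. iter_d F is (\<theta> + s *\<^sub>R v, \<gamma>)) v"
  have "\<exists>t>0. t < 1 \<and> F (\<theta> + 1 *\<^sub>R v, \<gamma>) = (\<Sum>j<k. ?d j 0 / fact j * 1 ^ j) + ?d k t / fact k * 1 ^ k"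
    by (rule Maclaurin) (use assms line in \<open>auto intro!: form_line_derivative[OF S F]\<close>)
  then show ?thesis by simp
qed

fun iter_g :: "nat \<Rightarrow> ((real ^ 'd::finite) \<times> real \<Rightarrow> real) \<Rightarrow> (real ^ 'd) \<times> real \<Rightarrow> real" where
  "iter_g 0 F = F"
| "iter_g (Suc k) F = ddir (0, 1) (iter_g k F)"

lemma smooth_on_iter_g: "smooth_on S F \<Longrightarrow> smooth_on S (iter_g k F)"
  by (induction k) (auto intro: smooth_on_ddir gamma_axis_in_Basis)

lemma iter_deriv_gamma:
  assumes S: "open S" and F: "smooth_on S F" and "(\<theta>, \<gamma>) \<in> S"
  shows "(deriv ^^ k) (\<lambda>g. F (\<theta>, g)) \<gamma> = iter_g k F (\<theta>, \<gamma>)"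
  using assms(3)
  by (induction k arbitrary: \<gamma>) (auto intro: deriv_gamma[OF S smooth_on_iter_g[OF F]])

lemma gamma_taylor:
  assumes S: "open S" and F: "smooth_on S F" and "k > 0"
    and line: "\<And>s. 0 \<le> s \<Longrightarrow> s \<le> 1 \<Longrightarrow> (\<theta>, \<gamma> + s * h) \<in> S"
  shows "\<exists>s. 0 < s \<and> s < 1 \<and> F (\<theta>, \<gamma> + h) =
    (\<Sum>j<k. h ^ j * iter_g j F (\<theta>, \<gamma>) / fact j) + h ^ k * iter_g k F (\<theta>, \<gamma> + s * h) / fact k"
proof -
  let ?d = "\<lambda>j s. h ^ j * iter_g j F (\<theta>, \<gamma> + s * h)"
  have d: "DERIV (?d j) s :> ?d (Suc j) s" if "0 \<le> s" "s \<le> 1" for j s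
  proof -
    have diff: "iter_g j F differentiable (at ((\<theta>, \<gamma>) + s *\<^sub>R (0, h)))"
      using line[OF that] by (intro smooth_on_differentiable[OF S] smooth_on_iter_g F) simp
    have lin: "linear (\<lambda>b. ddir b (iter_g j F) (\<theta>, \<gamma> + s * h))"
      using differentiable_has_ddir[OF diff] has_derivative_linear by fastforce
    have "ddir (0, h) (iter_g j F) (\<theta>, \<gamma> + s * h) = h * ddir (0, 1) (iter_g j F) (\<theta>, \<gamma> + s * h)"
      using linear_scale[OF lin, of h "(0, 1)"] by simp
    with has_real_derivative_along_line[OF diff]
    have "((\<lambda>s. iter_g j F (\<theta>, \<gamma> + s * h)) has_real_derivative h * iter_g (Suc j) F (\<theta>, \<gamma> + s * h)) (at s)"
      by simp
    from DERIV_cmult[OF this, of "h ^ j"] show ?thesis by (simp add: mult_ac)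
  qed
  have "\<exists>t>0. t < 1 \<and> F (\<theta>, \<gamma> + 1 * h) = (\<Sum>j<k. ?d j 0 / fact j * 1 ^ j) + ?d k t / fact k * 1 ^ k"
    by (rule Maclaurin) (use assms d in auto)
  then show ?thesis by simp
qed

lemma iter_d_swap:
  assumes "open S" "smooth_on S F" "z \<in> S"
  shows "iter_d F (i # j # is) z = iter_d F (j # i # is) z"
  using assms by (auto intro: ddir_commute smooth_on_iter_d theta_axis_in_Basis)

lemma iter_d_cong_Cons:
  assumes "open S" "z \<in> S" "\<And>w. w \<in> S \<Longrightarrow> iter_d F is w = iter_d F js w"
  shows "iter_d F (i # is) z = iter_d F (i # js) z"
  using ddir_cong[OF assms] by simp


section \<open>Linear substitution in Lebesgue integrals\<close>

text \<open>
  Once coordinate \<open>m\<close> is integrated first, the shear is a translation of that coordinate.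
\<close>

lemma nn_integral_shear:
  fixes h :: "real ^ 'd::finite \<Rightarrow> ennreal"
  assumes mn: "m \<noteq> n" and [measurable]: "h \<in> borel_measurable borel"
  shows "(\<integral>\<^sup>+x. h (\<chi> i. if i = m then x $ m + x $ n else x $ i) \<partial>lborel) = (\<integral>\<^sup>+x. h x \<partial>lborel)"
proof -
  let ?B = "Basis :: (real ^ 'd) set"
  define b0 where "b0 = (axis m 1 :: real ^ 'd)"
  define b1 where "b1 = (axis n 1 :: real ^ 'd)"
  define V where "V = (\<lambda>x. \<Sum>b\<in>?B. x b *\<^sub>R b)"
  define f where "f = (\<lambda>x :: real ^ 'd. \<chi> i. if i = m then x $ m + x $ n else x $ i)"
  define I where "I = ?B - {b0}"
  have b: "b0 \<in> ?B" "b1 \<in> ?B" "b0 \<noteq> b1"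
    using mn by (auto simp: b0_def b1_def axis_in_Basis_iff axis_eq_axis)
  have I: "finite I" "b0 \<notin> I" "insert b0 I = ?B" using b by (auto simp: I_def)
  interpret P: product_sigma_finite "\<lambda>_. lborel :: real measure" ..
  have f_add: "f x = x + (x \<bullet> b1) *\<^sub>R b0" for x
    by (auto simp: f_def b0_def b1_def vec_eq_iff axis_def inner_axis' inner_axis[unfolded axis_def])
  have f_meas [measurable]: "f \<in> borel \<rightarrow>\<^sub>M borel"
    unfolding f_add[abs_def] by measurable
  have V_meas: "V \<in> (\<Pi>\<^sub>M b\<in>?B. lborel) \<rightarrow>\<^sub>M borel"
    unfolding V_def by measurable
  have V_upd: "V (x(b0 := y)) = y *\<^sub>R b0 + (\<Sum>b\<in>I. x b *\<^sub>R b)" for x y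
  proof -
    have "V (x(b0 := y)) = (x(b0 := y)) b0 *\<^sub>R b0 + (\<Sum>b\<in>I. (x(b0 := y)) b *\<^sub>R b)"
      unfolding V_def I(3)[symmetric] using I(1,2) by simp
    also have "(\<Sum>b\<in>I. (x(b0 := y)) b *\<^sub>R b) = (\<Sum>b\<in>I. x b *\<^sub>R b)"
      using I(2) by (intro sum.cong) auto
    finally show ?thesis by (simp only: fun_upd_same)
  qed
  have V_b1: "V (x(b0 := y)) \<bullet> b1 = x b1" for x y
  proof -
    have "V (x(b0 := y)) \<bullet> b1 = (x(b0 := y)) b1"
      unfolding V_def using b(2) by (rule inner_sum_left_Basis)
    then show ?thesis using b(3) by auto
  qed
  have step: "(\<integral>\<^sup>+x. k x \<partial>lborel)
      = (\<integral>\<^sup>+x. (\<integral>\<^sup>+y. k (V (x(b0 := y))) \<partial>lborel) \<partial>(\<Pi>\<^sub>M b\<in>I. lborel))"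
    if [measurable]: "k \<in> borel_measurable borel" for k :: "real ^ 'd \<Rightarrow> ennreal"
  proof -
    have "(\<integral>\<^sup>+x. k x \<partial>lborel) = (\<integral>\<^sup>+x. k (V x) \<partial>(\<Pi>\<^sub>M b\<in>insert b0 I. lborel))"
      unfolding I(3) by (subst lborel_eq) (use V_meas in \<open>simp add: nn_integral_distr V_def\<close>)
    also have "\<dots> = (\<integral>\<^sup>+x. (\<integral>\<^sup>+y. k (V (x(b0 := y))) \<partial>lborel) \<partial>(\<Pi>\<^sub>M b\<in>I. lborel))"
      by (rule P.product_nn_integral_insert[OF I(1,2)])
        (use measurable_compose[OF V_meas that] in \<open>simp add: I(3)\<close>)
    finally show ?thesis .
  qed
  have "(\<integral>\<^sup>+x. h (f x) \<partial>lborel)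
      = (\<integral>\<^sup>+x. (\<integral>\<^sup>+y. h (f (V (x(b0 := y)))) \<partial>lborel) \<partial>(\<Pi>\<^sub>M b\<in>I. lborel))"
    by (rule step) measurable
  also have "\<dots> = (\<integral>\<^sup>+x. (\<integral>\<^sup>+y. h (V (x(b0 := y))) \<partial>lborel) \<partial>(\<Pi>\<^sub>M b\<in>I. lborel))"
  proof (rule nn_integral_cong)
    fix x
    have "f (V (x(b0 := y))) = V (x(b0 := x b1 + 1 * y))" for y
      unfolding f_add V_b1 unfolding V_upd by (simp add: algebra_simps)
    moreover have "(\<integral>\<^sup>+y. h (V (x(b0 := y))) \<partial>lborel) = (\<integral>\<^sup>+y. h (V (x(b0 := x b1 + 1 * y))) \<partial>lborel)"
      by (subst nn_integral_real_affine[of _ 1 "x b1"]) (auto simp: V_upd)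
    ultimately show "(\<integral>\<^sup>+y. h (f (V (x(b0 := y)))) \<partial>lborel) = (\<integral>\<^sup>+y. h (V (x(b0 := y))) \<partial>lborel)"
      by simp
  qed
  also have "\<dots> = (\<integral>\<^sup>+x. h x \<partial>lborel)"
    by (rule step[symmetric]) measurable
  finally show ?thesis by (simp add: f_def)
qed

lemma prod_Basis_vec:
  fixes p :: "real ^ 'd::finite \<Rightarrow> 'a::comm_monoid_mult"
  shows "(\<Prod>b\<in>Basis. p b) = (\<Prod>i\<in>UNIV. p (axis i 1))"
proof -
  have eq: "(Basis :: (real ^ 'd) set) = range (\<lambda>i. axis i 1)" by (auto simp: Basis_vec_def)
  show ?thesis
    unfolding eq by (subst prod.reindex) (auto simp: inj_on_def axis_eq_axis)
qed

lemma nn_integral_diagonal: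
  fixes h :: "real ^ 'd::finite \<Rightarrow> ennreal"
  assumes c: "\<And>i. c i \<noteq> 0" and [measurable]: "h \<in> borel_measurable borel"
  shows "ennreal (\<Prod>i\<in>UNIV. \<bar>c i\<bar>) * (\<integral>\<^sup>+x. h (\<chi> i. c i * x $ i) \<partial>lborel) = (\<integral>\<^sup>+x. h x \<partial>lborel)"
proof -
  define c' where "c' b = (\<Sum>i\<in>UNIV. c i * b $ i)" for b :: "real ^ 'd"
  have c': "c' (axis i 1) = c i" for i
    by (simp add: c'_def axis_def if_distrib cong: if_cong)
  have nz: "c' b \<noteq> 0" if "b \<in> Basis" for b
    using that c c' by (auto simp: Basis_vec_def)
  have T: "(0 + (\<Sum>j\<in>Basis. (c' j * (x \<bullet> j)) *\<^sub>R j)) = (\<chi> i. c i * x $ i)" for x :: "real ^ 'd"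
  proof (rule vec_eq_iff[THEN iffD2], rule allI)
    fix i
    have "(\<Sum>j\<in>Basis. (c' j * (x \<bullet> j)) *\<^sub>R j) \<bullet> axis i 1 = c' (axis i 1) * (x \<bullet> axis i 1)"
      by (simp add: inner_sum_left inner_Basis axis_in_Basis_iff if_distrib cong: if_cong)
    then show "(0 + (\<Sum>j\<in>Basis. (c' j * (x \<bullet> j)) *\<^sub>R j)) $ i = (\<chi> i. c i * x $ i) $ i"
      by (simp add: c' inner_axis)
  qed
  have [measurable]: "(\<lambda>x :: real ^ 'd. \<chi> i. c i * x $ i) \<in> borel \<rightarrow>\<^sub>M borel"
    unfolding T[symmetric] by measurable
  have eq: "lborel = density (distr lborel borel (\<lambda>x :: real ^ 'd. \<chi> i. c i * x $ i)) (\<lambda>_. ennreal (\<Prod>i\<in>UNIV. \<bar>c i\<bar>))"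
    using lborel_affine_euclidean[of c' 0, OF nz] unfolding T
    by (simp add: prod_Basis_vec c')
  show ?thesis
    by (subst (2) eq) (simp add: nn_integral_density nn_integral_distr nn_integral_cmult)
qed

lemma nn_integral_swap_coords:
  fixes h :: "real ^ 'd::finite \<Rightarrow> ennreal"
  assumes [measurable]: "h \<in> borel_measurable borel"
  shows "(\<integral>\<^sup>+x. h (\<chi> i. x $ Transposition.transpose m n i) \<partial>lborel) = (\<integral>\<^sup>+x. h x \<partial>lborel)"
proof -
  let ?t = "Transposition.transpose m n"
  define f where "f = (\<lambda>x :: real ^ 'd. \<chi> i. x $ ?t i)"
  have "linear f" by (rule linearI) (auto simp: f_def vec_eq_iff)
  then have [measurable]: "f \<in> borel \<rightarrow>\<^sub>M borel"
    by (intro borel_measurable_continuous_onI linear_continuous_on linear_conv_bounded_linear[THEN iffD1])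
  have ff: "f (f x) = x" for x by (simp add: f_def)
  have "lborel = distr lborel borel f"
  proof (rule lborel_eqI)
    fix l u :: "real ^ 'd" assume le: "\<And>b. b \<in> Basis \<Longrightarrow> l \<bullet> b \<le> u \<bullet> b"
    have le': "l $ i \<le> u $ i" for i using le[of "axis i 1"] by (simp add: inner_axis axis_in_Basis_iff)
    have "f -` box l u = box (f l) (f u)"
    proof -
      have "(\<forall>i. l $ i < x $ ?t i \<and> x $ ?t i < u $ i) \<longleftrightarrow> (\<forall>i. l $ ?t i < x $ i \<and> x $ i < u $ ?t i)" for x :: "real ^ 'd"
        by (metis transpose_involutory)
      then show ?thesis by (auto simp: mem_box_cart f_def)
    qed
    then have "emeasure (distr lborel borel f) (box l u) = emeasure lborel (box (f l) (f u))"
      by (simp add: emeasure_distr)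
    also have "\<dots> = (\<Prod>b\<in>Basis. (f u - f l) \<bullet> b)"
    proof (rule emeasure_lborel_box)
      fix b :: "real ^ 'd" assume "b \<in> Basis"
      then show "f l \<bullet> b \<le> f u \<bullet> b" using le' by (auto simp: Basis_vec_def inner_axis f_def)
    qed
    also have "\<dots> = (\<Prod>i\<in>UNIV. u $ ?t i - l $ ?t i)"
      by (simp add: prod_Basis_vec inner_axis f_def)
    also have "(\<Prod>i\<in>UNIV. u $ ?t i - l $ ?t i) = (\<Prod>i\<in>UNIV. u $ i - l $ i)"
      using prod.permute[of ?t UNIV "\<lambda>i. u $ i - l $ i"] by (simp add: permutes_swap_id o_def)
    also have "\<dots> = (\<Prod>b\<in>Basis. (u - l) \<bullet> b)"
      by (simp add: prod_Basis_vec inner_axis)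
    finally show "emeasure (distr lborel borel f) (box l u) = (\<Prod>b\<in>Basis. (u - l) \<bullet> b)" .
  qed simp
  then have "(\<integral>\<^sup>+x. h x \<partial>lborel) = (\<integral>\<^sup>+x. h x \<partial>distr lborel borel f)" by simp
  also have "\<dots> = (\<integral>\<^sup>+x. h (f x) \<partial>lborel)" by (rule nn_integral_distr) measurable
  finally show ?thesis by (simp add: f_def)
qed

text \<open>
  Linear maps are compositions of scalings, exchanges and shears of coordinates and of maps that lose
  a coordinate; for the last kind the hypothesis on the determinant fails.
\<close>

lemma nn_integral_linear_change:
  fixes f :: "real ^ 'd::finite \<Rightarrow> real ^ 'd"
  assumes "linear f" "det (matrix f) \<noteq> 0" "h \<in> borel_measurable borel"
  shows "ennreal \<bar>det (matrix f)\<bar> * (\<integral>\<^sup>+x. h (f x) \<partial>lborel) = (\<integral>\<^sup>+x. h x \<partial>lborel)"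
proof -
  define P where "P f \<longleftrightarrow> linear f \<and> (det (matrix f) \<noteq> 0 \<longrightarrow> (\<forall>h\<in>borel_measurable borel.
    ennreal \<bar>det (matrix f)\<bar> * (\<integral>\<^sup>+x. h (f x) \<partial>lborel) = (\<integral>\<^sup>+x. h x \<partial>lborel)))"
    for f :: "real ^ 'd::finite \<Rightarrow> real ^ 'd"
  have PI: "P f" if "linear f" "\<bar>det (matrix f)\<bar> = 1"
    "\<And>h. h \<in> borel_measurable borel \<Longrightarrow> (\<integral>\<^sup>+x. h (f x) \<partial>lborel) = (\<integral>\<^sup>+x. h x \<partial>lborel)" for f
    using that by (simp add: P_def)
  have "P f"
  proof (rule induct_linear_elementary[OF assms(1)])
    fix f g :: "real ^ 'd::finite \<Rightarrow> real ^ 'd"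
    assume lin: "linear f" "linear g" and P: "P f" "P g"
    have d: "det (matrix (f \<circ> g)) = det (matrix f) * det (matrix g)"
      using matrix_compose[OF lin(2,1)] by (simp add: det_mul)
    have "ennreal \<bar>det (matrix (f \<circ> g))\<bar> * (\<integral>\<^sup>+x. h ((f \<circ> g) x) \<partial>lborel) = (\<integral>\<^sup>+x. h x \<partial>lborel)"
      if nz: "det (matrix (f \<circ> g)) \<noteq> 0" and h [measurable]: "h \<in> borel_measurable borel" for h
    proof -
      have fm [measurable]: "f \<in> borel \<rightarrow>\<^sub>M borel"
        using lin by (intro borel_measurable_continuous_onI linear_continuous_on linear_conv_bounded_linear[THEN iffD1])
      have "(\<lambda>x. h (f x)) \<in> borel_measurable borel" by measurable
      then have "ennreal \<bar>det (matrix g)\<bar> * (\<integral>\<^sup>+x. h (f (g x)) \<partial>lborel) = (\<integral>\<^sup>+x. h (f x) \<partial>lborel)"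
        using P(2) nz d by (auto simp: P_def)
      moreover have "ennreal \<bar>det (matrix f)\<bar> * (\<integral>\<^sup>+x. h (f x) \<partial>lborel) = (\<integral>\<^sup>+x. h x \<partial>lborel)"
        using P(1) nz d h by (auto simp: P_def)
      ultimately show ?thesis by (simp add: d abs_mult ennreal_mult mult.assoc)
    qed
    then show "P (f \<circ> g)" using lin by (auto simp: P_def intro: linear_compose)
  next
    fix f :: "real ^ 'd::finite \<Rightarrow> real ^ 'd" and i
    assume "linear f" "\<And>x. f x $ i = 0"
    then have "row i (matrix f) = 0" by (simp add: row_def matrix_def vec_eq_iff)
    then have "det (matrix f) = 0" by (rule det_zero_row)
    then show "P f" using \<open>linear f\<close> by (simp add: P_def)
  next
    fix c :: "'d \<Rightarrow> real"
    have lin: "linear (\<lambda>x :: real ^ 'd. \<chi> i. c i * x $ i)"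
      by (rule linearI) (auto simp: vec_eq_iff algebra_simps)
    have d: "det (matrix (\<lambda>x :: real ^ 'd. \<chi> i. c i * x $ i)) = (\<Prod>i\<in>UNIV. c i)"
      by (subst det_diagonal) (auto simp: matrix_def axis_def)
    show "P (\<lambda>x. \<chi> i. c i * x $ i)"
      unfolding P_def d using lin nn_integral_diagonal[of c] by (auto simp: abs_prod)
  next
    fix m n :: 'd
    let ?f = "\<lambda>x :: real ^ 'd. \<chi> i. x $ Transposition.transpose m n i"
    have lin: "linear ?f" by (rule linearI) (auto simp: vec_eq_iff)
    have "?f \<circ> ?f = id" by (auto simp: vec_eq_iff)
    then have "det (matrix ?f) * det (matrix ?f) = 1"
      by (metis lin matrix_compose det_mul matrix_id_mat_1 det_I)
    then have "\<bar>det (matrix ?f)\<bar> = 1"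
      by (metis abs_square_eq_1 power2_eq_square)
    then show "P ?f" by (intro PI lin nn_integral_swap_coords)
  next
    fix m n :: 'd assume mn: "m \<noteq> n"
    let ?f = "\<lambda>x :: real ^ 'd. \<chi> i. if i = m then x $ m + x $ n else x $ i"
    have lin: "linear ?f" by (rule linearI) (auto simp: vec_eq_iff algebra_simps)
    have "matrix ?f = (\<chi> k. if k = m then row m (mat 1) + 1 *s row n (mat 1) else row k (mat 1))"
      by (auto simp: matrix_def vec_eq_iff row_def mat_def axis_def)
    then have "det (matrix ?f) = 1" using det_row_operation[OF mn, of "mat 1 :: real ^ 'd ^ 'd" 1] by simp
    then show "P ?f" by (intro PI lin nn_integral_shear[OF mn]) auto
  qed
  then show ?thesis using assms by (simp add: P_def)
qed


section \<open>Gaussian integrals and moments\<close>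

text \<open>
  Gram--Schmidt for the inner product \<open>x \<bullet> (g *v y)\<close>: a maximal orthonormal set spans, since otherwise
  the normalized residual of a vector outside of the span could be added.
\<close>

lemma orthonormal_wrt_exists:
  fixes g :: "real ^ 'd::finite ^ 'd"
  assumes sym: "transpose g = g" and pd: "\<And>v. v \<noteq> 0 \<Longrightarrow> 0 < v \<bullet> (g *v v)"
  shows "\<exists>B :: real ^ 'd ^ 'd. transpose B ** g ** B = mat 1"
proof -
  define ip where "ip x y = x \<bullet> (g *v y)" for x y
  have ip_sym: "ip x y = ip y x" for x y
    unfolding ip_def by (metis dot_lmul_matrix inner_commute sym transpose_matrix_vector)
  have ip_add: "ip x (y + z) = ip x y + ip x z" "ip x (y - z) = ip x y - ip x z"
    "ip x (c *\<^sub>R y) = c * ip x y" for x y z c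
    by (simp_all add: ip_def matrix_vector_right_distrib inner_add_right
        matrix_vector_mult_diff_distrib inner_diff_right matrix_vector_mult_scaleR)
  have ip_lin: "linear (ip x)" for x by (rule linearI) (auto simp: ip_add)
  have ip_sum: "ip x (\<Sum>s\<in>S. f s) = (\<Sum>s\<in>S. ip x (f s))" for x S and f :: "real ^ 'd \<Rightarrow> real ^ 'd"
    by (rule linear_sum[OF ip_lin])
  define ON where "ON S \<longleftrightarrow> finite S \<and> (\<forall>x\<in>S. \<forall>y\<in>S. ip x y = of_bool (x = y))" for S
  have coeff: "ip s (\<Sum>x\<in>S. c x *\<^sub>R x) = c s" if "ON S" "s \<in> S" for S s c
  proof -
    have "ip s (\<Sum>x\<in>S. c x *\<^sub>R x) = (\<Sum>x\<in>S. c x * ip s x)" by (simp add: ip_sum ip_add)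
    also have "\<dots> = (\<Sum>x\<in>S. if x = s then c x else 0)"
      using that by (intro sum.cong) (auto simp: ON_def)
    finally show ?thesis using that by (simp add: ON_def)
  qed
  have indep: "independent S" if S: "ON S" for S
  proof
    assume "dependent S"
    then obtain c v where c: "v \<in> S" "c v \<noteq> 0" "(\<Sum>v\<in>S. c v *\<^sub>R v) = 0"
      using S by (auto simp: ON_def dependent_finite)
    have "c v = ip v 0" using coeff[OF S c(1), of c] c(3) by simp
    then show False using c(2) by (simp add: ip_def)
  qed
  have ON0: "ON {}" by (simp add: ON_def)
  have bound: "\<forall>S. ON S \<longrightarrow> card S < Suc CARD('d)"
    using independent_bound[OF indep] by (auto simp: less_Suc_eq_le)
  obtain S where S: "ON S" and max: "\<And>T. ON T \<Longrightarrow> card T \<le> card S"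
    using ex_has_greatest_nat[of ON "{}" card "Suc CARD('d)"] ON0 bound by auto
  have "span S = UNIV"
  proof (rule ccontr)
    assume "span S \<noteq> UNIV"
    then obtain x where x: "x \<notin> span S" by auto
    define w where "w = x - (\<Sum>s\<in>S. ip s x *\<^sub>R s)"
    have "w \<noteq> 0"
    proof
      assume "w = 0"
      then have "x = (\<Sum>s\<in>S. ip s x *\<^sub>R s)" by (simp add: w_def)
      also have "\<dots> \<in> span S" by (intro span_sum span_scale span_base)
      finally show False using x by simp
    qed
    then have pos: "ip w w > 0" using pd by (simp add: ip_def)
    have orth: "ip s w = 0" if "s \<in> S" for s
      unfolding w_def using coeff[OF S that, of "\<lambda>s. ip s x"] by (simp add: ip_add)
    define e where "e = (1 / sqrt (ip w w)) *\<^sub>R w"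
    have e1: "ip e e = 1"
    proof -
      have "ip e e = (1 / sqrt (ip w w)) * ((1 / sqrt (ip w w)) * ip w w)"
        unfolding e_def by (simp only: ip_add ip_sym[of "_ *\<^sub>R w" w])
      then show ?thesis using pos by (simp add: field_simps real_sqrt_mult_self)
    qed
    have e0: "ip s e = 0" "ip e s = 0" if "s \<in> S" for s
      using orth[OF that] ip_sym[of e s] by (auto simp: e_def ip_add)
    have "e \<notin> S" using e0 e1 by force
    moreover have "ON (insert e S)"
      using S e0 e1 \<open>e \<notin> S\<close> by (auto simp: ON_def)
    ultimately show False using max[of "insert e S"] S by (simp add: ON_def)
  qed
  then have "card S = CARD('d)"
    using basis_card_eq_dim[of S UNIV] indep[OF S] by (simp add: dim_UNIV)
  then obtain b where b: "bij_betw b (UNIV :: 'd set) S"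
    using S finite_same_card_bij[of "UNIV :: 'd set" S] by (auto simp: ON_def)
  define B :: "real ^ 'd ^ 'd" where "B = (\<chi> i j. b j $ i)"
  have "(transpose B ** g ** B) $ i $ j = ip (b i) (b j)" for i j
    by (simp add: ip_def B_def matrix_matrix_mult_def matrix_vector_mult_def transpose_def inner_vec_def
        sum_distrib_left sum_distrib_right mult.assoc) (rule sum.swap)
  moreover have "ip (b i) (b j) = of_bool (i = j)" for i j
    using S b unfolding ON_def bij_betw_def by (auto simp: inj_on_def)
  ultimately have "transpose B ** g ** B = mat 1"
    by (simp add: vec_eq_iff mat_def)
  then show ?thesis by blast
qed

text \<open>
  The bound \<open>lam\<close> is a parameter of its own because \<open>g\<close> will be the observed information matrix:
  a constant may depend on \<open>lam\<close>, which is fixed, but not on \<open>g\<close>, which varies with the sample.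
\<close>

locale gaussian =
  fixes g :: "real ^ 'd::finite ^ 'd" and lam :: real
  assumes g_sym: "transpose g = g" and lam_pos: "0 < lam"
    and g_coercive: "\<And>v. lam * (norm v)\<^sup>2 \<le> v \<bullet> (g *v v)"
begin

definition gauss :: "real ^ 'd \<Rightarrow> real" where
  "gauss v = exp (- (v \<bullet> (g *v v)) / 2)"

definition mass :: real where
  "mass = (2 * pi) powr (real CARD('d) / 2) / sqrt (det g)"

lemma gauss_pos: "0 < gauss v" by (simp add: gauss_def)

lemma gauss_le: "gauss v \<le> exp (- (lam / 2) * (norm v)\<^sup>2)"
  using g_coercive[of v] by (simp add: gauss_def)

lemma gauss_measurable [measurable]: "gauss \<in> borel_measurable borel"
  unfolding gauss_def[abs_def]
  by (intro borel_measurable_continuous_onI continuous_intros matrix_vector_mult_linear_continuous_on) auto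

text \<open>
  A basis \<open>B\<close> that is orthonormal with respect to \<open>g\<close> reduces the integral to the standard normal one, and
  \<open>(det B)\<^sup>2 * det g = 1\<close>.
\<close>

lemma nn_integral_gauss: "det g > 0" "(\<integral>\<^sup>+v. ennreal (gauss v) \<partial>lborel) = ennreal mass"
proof -
  have pd: "0 < v \<bullet> (g *v v)" if "v \<noteq> 0" for v
    using g_coercive[of v] lam_pos that by (smt (verit) mult_pos_pos zero_less_norm_iff zero_less_power)
  obtain B :: "real ^ 'd ^ 'd" where B: "transpose B ** g ** B = mat 1" using orthonormal_wrt_exists[OF g_sym pd] by blast
  have "det (transpose B ** g ** B) = (det B)\<^sup>2 * det g"
    by (simp add: det_mul power2_eq_square)
  then have d: "(det B)\<^sup>2 * det g = 1" using B by simp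
  have dB: "det B \<noteq> 0" using d by auto
  then have "0 < (det B)\<^sup>2" by simp
  then show pos: "det g > 0" using zero_less_mult_pos[of "(det B)\<^sup>2" "det g"] d by simp
  have absB: "\<bar>det B\<bar> = 1 / sqrt (det g)"
  proof -
    have "(det B)\<^sup>2 = 1 / det g" using d pos by (simp add: field_simps)
    then show ?thesis by (metis real_sqrt_abs real_sqrt_divide real_sqrt_one)
  qed
  have quad: "(B *v z) \<bullet> (g *v (B *v z)) = z \<bullet> z" for z
  proof -
    have "(B *v z) \<bullet> (g *v (B *v z)) = z \<bullet> (transpose B *v (g *v (B *v z)))"
      by (metis dot_lmul_matrix inner_commute transpose_matrix_vector transpose_transpose)
    also have "transpose B *v (g *v (B *v z)) = (transpose B ** g ** B) *v z"
      by (simp add: matrix_vector_mul_assoc matrix_mul_assoc)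
    finally show ?thesis by (simp add: B)
  qed
  have one: "(\<integral>\<^sup>+x. ennreal (exp (- x\<^sup>2 / 2)) \<partial>lborel) = ennreal (sqrt (2 * pi))"
  proof -
    have "ennreal (exp (- x\<^sup>2 / 2)) = ennreal (sqrt (2 * pi)) * ennreal (std_normal_density x)" for x
      by (simp add: std_normal_density_def ennreal_mult[symmetric])
    moreover have "(\<integral>\<^sup>+x. ennreal (std_normal_density x) \<partial>lborel) = 1"
      by (subst nn_integral_eq_integral) (auto simp: integral_normal_density)
    ultimately show ?thesis by (simp add: nn_integral_cmult)
  qed
  have std: "(\<integral>\<^sup>+z. ennreal (exp (- (z \<bullet> z) / 2)) \<partial>(lborel :: (real ^ 'd) measure)) = ennreal (sqrt (2 * pi) ^ CARD('d))"
  proof -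
    have eq: "ennreal (exp (- (z \<bullet> z) / 2)) = (\<Prod>b\<in>Basis. ennreal (exp (- (z \<bullet> b)\<^sup>2 / 2)))" for z :: "real ^ 'd"
      by (subst euclidean_inner)
        (simp add: prod_ennreal exp_sum[symmetric] sum_divide_distrib sum_negf power2_eq_square)
    have "(\<integral>\<^sup>+z. ennreal (exp (- (z \<bullet> z) / 2)) \<partial>(lborel :: (real ^ 'd) measure))
        = (\<Prod>b\<in>(Basis :: (real ^ 'd) set). \<integral>\<^sup>+x. ennreal (exp (- x\<^sup>2 / 2)) \<partial>lborel)"
      unfolding eq by (rule nn_integral_lborel_prod) auto
    then show ?thesis unfolding one by (simp add: ennreal_power)
  qed
  have "ennreal \<bar>det (matrix ((*v) B))\<bar> * (\<integral>\<^sup>+z. ennreal (gauss (B *v z)) \<partial>lborel) = (\<integral>\<^sup>+v. ennreal (gauss v) \<partial>lborel)"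
    by (rule nn_integral_linear_change) (use dB in auto)
  moreover have "(\<integral>\<^sup>+z. ennreal (gauss (B *v z)) \<partial>lborel) = ennreal (sqrt (2 * pi) ^ CARD('d))"
    unfolding gauss_def quad by (rule std)
  moreover have "sqrt (2 * pi) ^ CARD('d) = (2 * pi) powr (real CARD('d) / 2)"
    by (simp add: powr_half_sqrt[symmetric] powr_powr powr_realpow[symmetric])
  ultimately show "(\<integral>\<^sup>+v. ennreal (gauss v) \<partial>lborel) = ennreal mass"
    using absB pos by (simp add: mass_def ennreal_mult[symmetric])
qed

lemma mass_pos: "mass > 0"
  using nn_integral_gauss(1) by (simp add: mass_def)

lemma has_bochner_integral_gauss: "has_bochner_integral lborel gauss mass"
  using nn_integral_gauss(2) mass_pos
  by (intro has_bochner_integral_nn_integral) (auto intro: less_imp_le gauss_pos)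

end

lemma integrable_exp_norm:
  assumes "a > 0" shows "integrable lborel (\<lambda>v :: real ^ 'd::finite. exp (- a * (norm v)\<^sup>2))"
proof -
  interpret gaussian "mat (2 * a) :: real ^ 'd ^ 'd" "2 * a"
  proof
    have m: "mat (2 * a) *v v = (2 * a) *\<^sub>R v" for v :: "real ^ 'd"
      by (simp add: vec_eq_iff matrix_vector_mult_def mat_def if_distrib if_distribR cong: if_cong)
    show "2 * a * (norm v)\<^sup>2 \<le> v \<bullet> (mat (2 * a) *v v)" for v :: "real ^ 'd"
      by (simp add: m power2_norm_eq_inner)
  qed (use assms in auto)
  have m: "mat (2 * a) *v v = (2 * a) *\<^sub>R v" for v :: "real ^ 'd"
    by (simp add: vec_eq_iff matrix_vector_mult_def mat_def if_distrib if_distribR cong: if_cong)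
  have "gauss = (\<lambda>v. exp (- a * (norm v)\<^sup>2))"
    by (auto simp: gauss_def m power2_norm_eq_inner)
  then show ?thesis using has_bochner_integral_gauss by (simp add: has_bochner_integral_iff)
qed

text \<open>
  From \<open>1 + x \<le> exp x\<close> and \<open>m * x \<le> m\<^sup>2 / (4 * a) + a * x\<^sup>2\<close>.
\<close>

lemma poly_le_exp_square:
  fixes x a :: real
  assumes "0 \<le> x" "0 < a"
  shows "(1 + x) ^ m \<le> exp ((real m)\<^sup>2 / (4 * a)) * exp (a * x\<^sup>2)"
proof -
  have "(1 + x) ^ m \<le> exp x ^ m" using assms by (intro power_mono) (auto simp: exp_ge_add_one_self)
  also have "\<dots> = exp (real m * x)" by (simp add: exp_of_nat_mult)
  also have "real m * x \<le> (real m)\<^sup>2 / (4 * a) + a * x\<^sup>2"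
  proof -
    have "0 \<le> (real m - 2 * a * x)\<^sup>2" by simp
    then have "4 * a * (real m * x) \<le> (real m)\<^sup>2 + 4 * a * (a * x\<^sup>2)"
      by (simp add: power2_eq_square algebra_simps)
    then show ?thesis using assms by (simp add: field_simps)
  qed
  finally show ?thesis by (simp add: exp_add)
qed

lemma integrable_poly_exp_norm:
  assumes "a > 0" shows "integrable lborel (\<lambda>v :: real ^ 'd::finite. (1 + norm v) ^ m * exp (- a * (norm v)\<^sup>2))"
proof (rule Bochner_Integration.integrable_bound)
  let ?C = "exp ((real m)\<^sup>2 / (4 * (a / 2)))"
  show "integrable lborel (\<lambda>v :: real ^ 'd. ?C * exp (- (a / 2) * (norm v)\<^sup>2))"
    using assms by (intro integrable_mult_right integrable_exp_norm) auto
  show "AE v :: real ^ 'd in lborel. norm ((1 + norm v) ^ m * exp (- a * (norm v)\<^sup>2)) \<le> norm (?C * exp (- (a / 2) * (norm v)\<^sup>2))"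
  proof (rule AE_I2)
    fix v :: "real ^ 'd"
    have "(1 + norm v) ^ m * exp (- a * (norm v)\<^sup>2) \<le> (?C * exp ((a / 2) * (norm v)\<^sup>2)) * exp (- a * (norm v)\<^sup>2)"
      using assms by (intro mult_right_mono poly_le_exp_square) auto
    also have "\<dots> = ?C * (exp ((a / 2) * (norm v)\<^sup>2) * exp (- a * (norm v)\<^sup>2))" by simp
    also have "exp ((a / 2) * (norm v)\<^sup>2) * exp (- a * (norm v)\<^sup>2) = exp (- (a / 2) * (norm v)\<^sup>2)"
      unfolding exp_add[symmetric] by (simp add: field_simps)
    finally show "norm ((1 + norm v) ^ m * exp (- a * (norm v)\<^sup>2)) \<le> norm (?C * exp (- (a / 2) * (norm v)\<^sup>2))"
      by (simp add: abs_mult)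
  qed
qed simp

text \<open>
  By translation invariance the difference quotients integrate to \<open>0\<close>; dominated convergence passes to
  the limit.
\<close>

lemma integral_derivative_eq_0:
  fixes F F' D :: "real ^ 'd::finite \<Rightarrow> real"
  assumes F: "integrable lborel F" and D: "integrable lborel D"
    and [measurable]: "F' \<in> borel_measurable borel"
    and deriv: "\<And>v h. ((\<lambda>h. F (v + h *\<^sub>R e)) has_real_derivative F' (v + h *\<^sub>R e)) (at h)"
    and bound: "\<And>v h. 0 \<le> h \<Longrightarrow> h \<le> 1 \<Longrightarrow> \<bar>F' (v + h *\<^sub>R e)\<bar> \<le> D v"
  shows "(\<integral>v. F' v \<partial>lborel) = 0"
proof -
  have [measurable]: "F \<in> borel_measurable borel" "D \<in> borel_measurable borel"
    using F D by auto
  define h where "h k = 1 / real (Suc k)" for k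
  define s where "s k v = (F (v + h k *\<^sub>R e) - F v) / h k" for k v
  have h: "0 < h k" "h k \<le> 1" for k by (auto simp: h_def)
  have h0: "h \<longlonglongrightarrow> 0" unfolding h_def[abs_def] by (rule LIMSEQ_Suc[OF lim_1_over_n])
  have shift: "integrable lborel (\<lambda>v. F (v + c))" "(\<integral>v. F (v + c) \<partial>lborel) = (\<integral>v. F v \<partial>lborel)" for c
  proof -
    have L: "distr lborel borel ((+) c) = lborel" by (rule lborel_distr_plus)
    have "integrable (distr lborel borel ((+) c)) F" using F by (simp add: L)
    then show "integrable lborel (\<lambda>v. F (v + c))"
      by (subst (asm) integrable_distr_eq) (auto simp: add.commute)
    have "(\<integral>v. F v \<partial>lborel) = (\<integral>v. F v \<partial>distr lborel borel ((+) c))" by (simp add: L)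
    then show "(\<integral>v. F (v + c) \<partial>lborel) = (\<integral>v. F v \<partial>lborel)"
      by (subst (asm) integral_distr) (auto simp: add.commute)
  qed
  have "(\<lambda>k. \<integral>v. s k v \<partial>lborel) \<longlonglongrightarrow> (\<integral>v. F' v \<partial>lborel)"
  proof (rule integral_dominated_convergence[where w = D])
    show "s k \<in> borel_measurable lborel" for k unfolding s_def[abs_def] by measurable
    show "AE v in lborel. (\<lambda>k. s k v) \<longlonglongrightarrow> F' v"
    proof (rule AE_I2)
      fix v
      have "((\<lambda>x. (F (v + x *\<^sub>R e) - F v) / x) \<longlongrightarrow> F' v) (at 0)"
        using deriv[of v 0] by (simp add: has_field_derivative_iff)
      moreover have "filterlim h (at 0) sequentially"
        unfolding filterlim_at using h h0 by (auto simp: less_imp_neq[symmetric])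
      ultimately show "(\<lambda>k. s k v) \<longlonglongrightarrow> F' v"
        unfolding s_def by (rule filterlim_compose)
    qed
    show "AE v in lborel. norm (s k v) \<le> D v" for k
    proof (rule AE_I2)
      fix v
      have "\<exists>x>0. x < h k \<and> F (v + h k *\<^sub>R e) - F (v + 0 *\<^sub>R e) = (h k - 0) * F' (v + x *\<^sub>R e)"
        by (rule MVT2) (use h deriv in auto)
      then obtain x where x: "0 < x" "x < h k" "F (v + h k *\<^sub>R e) - F v = h k * F' (v + x *\<^sub>R e)"
        by auto
      then have "s k v = F' (v + x *\<^sub>R e)" using h[of k] by (simp add: s_def)
      then show "norm (s k v) \<le> D v" using bound[of x v] x h[of k] by simp
    qed
  qed (use D in auto)
  moreover have "(\<integral>v. s k v \<partial>lborel) = 0" for k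
    unfolding s_def using shift F by (simp add: Bochner_Integration.integral_diff)
  ultimately show ?thesis by (simp add: LIMSEQ_const_iff)
qed

lemma measurable_monom_at [measurable]: "(\<lambda>v. monom_at v is) \<in> borel_measurable borel"
  by (induction "is") auto

fun pderiv_monom :: "'d \<Rightarrow> 'd list \<Rightarrow> real ^ 'd \<Rightarrow> real" where
  "pderiv_monom i [] v = 0"
| "pderiv_monom i (j # js) v = of_bool (i = j) * monom_at v js + v $ j * pderiv_monom i js v"

lemma measurable_pderiv_monom [measurable]: "pderiv_monom i is \<in> borel_measurable borel"
proof -
  have "(\<lambda>v. pderiv_monom i is v) \<in> borel_measurable borel" by (induction "is") auto
  then show ?thesis by simp
qed

lemma DERIV_monom_at:
  "((\<lambda>h. monom_at (v + h *\<^sub>R axis i 1) is) has_real_derivative pderiv_monom i is (v + h *\<^sub>R axis i 1)) (at h)"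
proof (induction "is")
  case (Cons j js)
  have "((\<lambda>h. (v + h *\<^sub>R axis i 1) $ j) has_real_derivative of_bool (i = j)) (at h)"
    by (auto simp: axis_def intro!: derivative_eq_intros)
  from DERIV_mult[OF this Cons.IH] show ?case by (simp add: algebra_simps)
qed simp

abbreviation del_nth :: "nat \<Rightarrow> 'a list \<Rightarrow> 'a list" where
  "del_nth p is \<equiv> take p is @ drop (Suc p) is"

lemma pderiv_monom_eq_sum:
  "pderiv_monom i is v = (\<Sum>p<length is. of_bool (i = is ! p) * monom_at v (del_nth p is))"
proof (induction "is")
  case (Cons j js)
  have "pderiv_monom i (j # js) v = of_bool (i = j) * monom_at v js
      + v $ j * (\<Sum>p<length js. of_bool (i = js ! p) * monom_at v (del_nth p js))"
    by (simp add: Cons.IH)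
  also have "v $ j * (\<Sum>p<length js. of_bool (i = js ! p) * monom_at v (del_nth p js))
      = (\<Sum>p<length js. of_bool (i = (j # js) ! Suc p) * monom_at v (del_nth (Suc p) (j # js)))"
      by (simp add: sum_distrib_left mult_ac del: sum_of_bool_mult_eq sum_mult_of_bool_eq)
  also have "of_bool (i = j) * monom_at v js + \<dots>
      = (\<Sum>p<length (j # js). of_bool (i = (j # js) ! p) * monom_at v (del_nth p (j # js)))"
    by (simp del: sum_of_bool_mult_eq sum_mult_of_bool_eq sum.lessThan_Suc add: sum.lessThan_Suc_shift)
  finally show ?case .
qed simp

lemma abs_monom_at_le': "\<bar>monom_at v is\<bar> \<le> (1 + norm v) ^ length is"
  by (rule order_trans[OF abs_monom_at_le power_mono]) auto

lemma abs_pderiv_monom_le: "\<bar>pderiv_monom i is v\<bar> \<le> real (length is) * (1 + norm v) ^ length is"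
proof (induction "is")
  case (Cons j js)
  let ?n = "length js"
  have "\<bar>pderiv_monom i (j # js) v\<bar> \<le> \<bar>monom_at v js\<bar> + \<bar>v $ j\<bar> * \<bar>pderiv_monom i js v\<bar>"
    by (auto simp: abs_mult intro: order_trans[OF abs_triangle_ineq])
  also have "\<dots> \<le> (1 + norm v) ^ ?n + (1 + norm v) * (real ?n * (1 + norm v) ^ ?n)"
    using component_le_norm_cart[of v j]
    by (intro add_mono mult_mono abs_monom_at_le' Cons.IH) auto
  also have "\<dots> \<le> (1 + norm v) * (1 + norm v) ^ ?n + (1 + norm v) * (real ?n * (1 + norm v) ^ ?n)"
    using mult_right_mono[of 1 "1 + norm v" "(1 + norm v) ^ ?n"] by simp
  also have "\<dots> = real (length (j # js)) * (1 + norm v) ^ length (j # js)"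
    by (simp add: algebra_simps)
  finally show ?case .
qed simp

context gaussian
begin

lemma g_inner_commute: "x \<bullet> (g *v y) = y \<bullet> (g *v x)"
  by (metis dot_lmul_matrix inner_commute g_sym transpose_matrix_vector)

lemma DERIV_gauss:
  "((\<lambda>h. gauss (v + h *\<^sub>R axis i 1)) has_real_derivative
     - (g *v (v + h *\<^sub>R axis i 1)) $ i * gauss (v + h *\<^sub>R axis i 1)) (at h)"
proof -
  define e where "e = (axis i 1 :: real ^ 'd)"
  have expand: "(v + h *\<^sub>R e) \<bullet> (g *v (v + h *\<^sub>R e))
      = v \<bullet> (g *v v) + 2 * h * (e \<bullet> (g *v v)) + h\<^sup>2 * (e \<bullet> (g *v e))" for h
    using g_inner_commute[of v e]
    by (simp add: matrix_vector_right_distrib matrix_vector_mult_scaleR inner_add_left inner_add_right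
        power2_eq_square algebra_simps)
  have lin: "(g *v (v + h *\<^sub>R e)) $ i = e \<bullet> (g *v v) + h * (e \<bullet> (g *v e))"
    by (simp add: e_def inner_axis' matrix_vector_right_distrib matrix_vector_mult_scaleR)
  have "((\<lambda>h. exp (- (v \<bullet> (g *v v) + 2 * h * (e \<bullet> (g *v v)) + h\<^sup>2 * (e \<bullet> (g *v e))) / 2)) has_real_derivative
      - (e \<bullet> (g *v v) + h * (e \<bullet> (g *v e))) * exp (- (v \<bullet> (g *v v) + 2 * h * (e \<bullet> (g *v v)) + h\<^sup>2 * (e \<bullet> (g *v e))) / 2)) (at h)"
    by (auto intro!: derivative_eq_intros simp: field_simps)
  then show ?thesis unfolding gauss_def e_def[symmetric] expand lin .
qed

lemma integrable_poly_gauss: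
  assumes [measurable]: "p \<in> borel_measurable borel" and le: "\<And>v. \<bar>p v\<bar> \<le> C * (1 + norm v) ^ m"
  shows "integrable lborel (\<lambda>v. p v * gauss v)"
proof (rule Bochner_Integration.integrable_bound)
  show "integrable lborel (\<lambda>v :: real ^ 'd. C * ((1 + norm v) ^ m * exp (- (lam / 2) * (norm v)\<^sup>2)))"
    using lam_pos by (intro integrable_mult_right integrable_poly_exp_norm) auto
  show "AE v in lborel. norm (p v * gauss v) \<le> norm (C * ((1 + norm v) ^ m * exp (- (lam / 2) * (norm v)\<^sup>2)))"
  proof (rule AE_I2)
    fix v
    have "\<bar>p v\<bar> * gauss v \<le> (C * (1 + norm v) ^ m) * exp (- (lam / 2) * (norm v)\<^sup>2)"
      using le[of v] gauss_pos[of v] gauss_le[of v] by (intro mult_mono) auto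
    moreover have "C \<ge> 0" using le[of 0] by simp
    ultimately show "norm (p v * gauss v) \<le> norm (C * ((1 + norm v) ^ m * exp (- (lam / 2) * (norm v)\<^sup>2)))"
      using gauss_pos[of v] by (simp add: abs_mult mult.assoc)
  qed
qed simp

lemma integrable_monom_gauss: "integrable lborel (\<lambda>v. monom_at v is * gauss v)"
  by (rule integrable_poly_gauss[of _ 1 "length is"]) (auto simp: abs_monom_at_le')

text \<open>
  Integration by parts (Stein's identity): the two integrands differ by the derivative of
  \<open>monom_at v is * gauss v\<close> in coordinate \<open>i\<close>, which integrates to \<open>0\<close>.
\<close>

lemma stein:
  "(\<integral>v. pderiv_monom i is v * gauss v \<partial>lborel) = (\<integral>v. (g *v v) $ i * monom_at v is * gauss v \<partial>lborel)"
  "integrable lborel (\<lambda>v. pderiv_monom i is v * gauss v)"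
  "integrable lborel (\<lambda>v. (g *v v) $ i * monom_at v is * gauss v)"
proof -
  define L where "L = length is"
  define C where "C = onorm ((*v) g)"
  have C: "\<bar>(g *v v) $ i\<bar> \<le> C * norm v" for v
    using component_le_norm_cart[of "g *v v" i] onorm[OF matrix_vector_mul_bounded_linear, of g v]
    by (simp add: C_def)
  have C0: "C \<ge> 0" unfolding C_def by (rule onorm_pos_le) (rule matrix_vector_mul_bounded_linear)
  have [measurable]: "(\<lambda>v. (g *v v) $ i) \<in> borel_measurable borel"
    by (intro borel_measurable_continuous_onI continuous_intros matrix_vector_mult_linear_continuous_on)
  \<comment> \<open>\<open>p * gauss\<close> is the derivative of \<open>monom_at v is * gauss v\<close> in coordinate \<open>i\<close>.\<close>
  define p where "p v = pderiv_monom i is v - (g *v v) $ i * monom_at v is" for v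
  have [measurable]: "p \<in> borel_measurable borel" unfolding p_def[abs_def] by measurable
  have le1: "\<bar>pderiv_monom i is v\<bar> \<le> real L * (1 + norm v) ^ Suc L" for v
  proof -
    have "(1 + norm v) ^ L \<le> (1 + norm v) ^ Suc L" by (rule power_increasing) auto
    then show ?thesis using abs_pderiv_monom_le[of i "is" v] by (simp add: L_def) (meson mult_left_mono of_nat_0_le_iff order_trans)
  qed
  have le2: "\<bar>(g *v v) $ i * monom_at v is\<bar> \<le> C * (1 + norm v) ^ Suc L" for v
  proof -
    have "\<bar>(g *v v) $ i * monom_at v is\<bar> \<le> (C * (1 + norm v)) * (1 + norm v) ^ L"
      unfolding abs_mult L_def using C[of v] C0
      by (intro mult_mono abs_monom_at_le') (auto simp: algebra_simps)
    then show ?thesis by (simp add: mult.assoc)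
  qed
  have le: "\<bar>p v\<bar> \<le> (real L + C) * (1 + norm v) ^ Suc L" for v
    using le1[of v] le2[of v] unfolding p_def ring_distribs by linarith
  show int1: "integrable lborel (\<lambda>v. pderiv_monom i is v * gauss v)"
    by (rule integrable_poly_gauss[OF _ le1]) measurable
  show int2: "integrable lborel (\<lambda>v. (g *v v) $ i * monom_at v is * gauss v)"
    by (rule integrable_poly_gauss[OF _ le2]) measurable
  let ?D = "\<lambda>v :: real ^ 'd. (real L + C) * 2 ^ Suc L * exp (lam / 2) * ((1 + norm v) ^ Suc L * exp (- (lam / 4) * (norm v)\<^sup>2))"
  have "(\<integral>v. p v * gauss v \<partial>lborel) = 0"
  proof (rule integral_derivative_eq_0[where F = "\<lambda>v. monom_at v is * gauss v" and e = "axis i 1" and D = ?D])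
    have "integrable lborel (\<lambda>v :: real ^ 'd. (1 + norm v) ^ Suc L * exp (- (lam / 4) * (norm v)\<^sup>2))"
      by (rule integrable_poly_exp_norm) (use lam_pos in simp)
    then show "integrable lborel ?D" by (intro integrable_mult_right)
    fix v :: "real ^ 'd" and h :: real
    show "((\<lambda>h. monom_at (v + h *\<^sub>R axis i 1) is * gauss (v + h *\<^sub>R axis i 1)) has_real_derivative
        p (v + h *\<^sub>R axis i 1) * gauss (v + h *\<^sub>R axis i 1)) (at h)"
      using DERIV_mult[OF DERIV_monom_at[of v i "is" h] DERIV_gauss[of v i h]]
      by (simp add: p_def algebra_simps)
    assume h: "0 \<le> h" "h \<le> 1"
    define w where "w = v + h *\<^sub>R axis i 1"
    have nh: "norm (h *\<^sub>R (axis i 1 :: real ^ 'd)) \<le> 1" using h by simp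
    have w1: "norm w \<le> norm v + 1" "norm v \<le> norm w + 1"
      using norm_triangle_ineq[of v "h *\<^sub>R axis i 1"] norm_triangle_ineq4[of w "h *\<^sub>R axis i 1"] nh
      by (auto simp: w_def)
    have "(norm v)\<^sup>2 \<le> (norm w + 1)\<^sup>2" using w1 by (intro power_mono) auto
    also have "\<dots> \<le> 2 * (norm w)\<^sup>2 + 2"
      using sum_squares_bound[of "norm w" 1] by (simp add: power2_sum)
    finally have "- (lam / 2) * (norm w)\<^sup>2 \<le> lam / 2 + - (lam / 4) * (norm v)\<^sup>2"
      using mult_left_mono[of "(norm v)\<^sup>2" "2 * (norm w)\<^sup>2 + 2" "lam / 4"] lam_pos by (simp add: field_simps)
    then have e: "gauss w \<le> exp (lam / 2) * exp (- (lam / 4) * (norm v)\<^sup>2)"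
      using gauss_le[of w] unfolding exp_add[symmetric] by (meson exp_le_cancel_iff order_trans)
    have "(1 + norm w) ^ Suc L \<le> (2 * (1 + norm v)) ^ Suc L"
    proof (rule power_mono)
      have "1 + norm w \<le> 2 + norm v" using w1(1) by simp
      also have "\<dots> \<le> 2 * (1 + norm v)" by simp
      finally show "1 + norm w \<le> 2 * (1 + norm v)" .
    qed simp
    then have q: "(1 + norm w) ^ Suc L \<le> 2 ^ Suc L * (1 + norm v) ^ Suc L" by (simp only: power_mult_distrib)
    have "\<bar>p w * gauss w\<bar> = \<bar>p w\<bar> * gauss w" using gauss_pos[of w] by (simp add: abs_mult)
    also have "\<dots> \<le> ((real L + C) * (2 ^ Suc L * (1 + norm v) ^ Suc L)) * (exp (lam / 2) * exp (- (lam / 4) * (norm v)\<^sup>2))"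
      using le[of w] mult_left_mono[OF q, of "real L + C"] C0 e gauss_pos[of w]
      by (intro mult_mono) auto
    finally show "\<bar>p (v + h *\<^sub>R axis i 1) * gauss (v + h *\<^sub>R axis i 1)\<bar> \<le> ?D v"
      by (simp add: w_def mult_ac)
  qed (use integrable_monom_gauss in auto)
  then show "(\<integral>v. pderiv_monom i is v * gauss v \<partial>lborel) = (\<integral>v. (g *v v) $ i * monom_at v is * gauss v \<partial>lborel)"
    using int1 int2 by (simp add: p_def left_diff_distrib)
qed

definition moment :: "'d list \<Rightarrow> real" where
  "moment is = (\<integral>v. monom_at v is * gauss v \<partial>lborel) / mass"

definition cov :: "real ^ 'd ^ 'd" where "cov = matrix_inv g"

lemma cov_g: "cov ** g = mat 1" "g ** cov = mat 1"
proof -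
  have "invertible g" using nn_integral_gauss(1) by (simp add: invertible_det_nz)
  then have "g ** cov = mat 1 \<and> cov ** g = mat 1"
    unfolding cov_def matrix_inv_def invertible_def by (rule someI_ex)
  then show "cov ** g = mat 1" "g ** cov = mat 1" by auto
qed

lemma cov_commute: "cov $ i $ j = cov $ j $ i"
proof -
  have "transpose cov ** g = mat 1"
    using arg_cong[OF cov_g(2), of transpose] by (simp add: matrix_transpose_mul g_sym transpose_mat)
  then have "transpose cov = cov"
    by (metis cov_g(2) matrix_mul_assoc matrix_mul_lid matrix_mul_rid)
  then show ?thesis by (metis transpose_def vec_lambda_beta)
qed

lemma moment_Nil: "moment [] = 1"
  using has_bochner_integral_gauss mass_pos
  by (simp add: moment_def has_bochner_integral_iff)

lemma moment_mset: "mset is = mset js \<Longrightarrow> moment is = moment js"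
proof -
  assume "mset is = mset js"
  then have "monom_at v is = monom_at v js" for v
    unfolding monom_at_def by (metis mset_map prod_mset_prod_list)
  then show ?thesis by (simp add: moment_def)
qed

text \<open>
  Wick's recursion. Stein's identity gives it with \<open>g\<close> applied to the first factor; multiplication by the
  inverse \<open>cov\<close> isolates that factor.
\<close>

lemma moment_Cons:
  "moment (k # is) = (\<Sum>p<length is. cov $ k $ (is ! p) * moment (del_nth p is))"
proof -
  have g_mom: "(\<Sum>j\<in>UNIV. g $ i $ j * moment (j # is))
      = (\<Sum>p<length is. of_bool (i = is ! p) * moment (del_nth p is))" for i
  proof -
    have "(\<integral>v. (g *v v) $ i * monom_at v is * gauss v \<partial>lborel)
        = (\<integral>v. (\<Sum>j\<in>UNIV. g $ i $ j * (monom_at v (j # is) * gauss v)) \<partial>lborel)"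
      by (simp add: matrix_vector_mult_def sum_distrib_right sum_distrib_left mult_ac)
    also have "\<dots> = (\<Sum>j\<in>UNIV. g $ i $ j * (\<integral>v. monom_at v (j # is) * gauss v \<partial>lborel))"
      using integrable_monom_gauss[of "_ # is"]
      by (subst Bochner_Integration.integral_sum) (auto simp del: monom_at_simps)
    finally have L: "(\<integral>v. (g *v v) $ i * monom_at v is * gauss v \<partial>lborel)
        = (\<Sum>j\<in>UNIV. g $ i $ j * (\<integral>v. monom_at v (j # is) * gauss v \<partial>lborel))" .
    have "(\<integral>v. pderiv_monom i is v * gauss v \<partial>lborel)
        = (\<integral>v. (\<Sum>p<length is. of_bool (i = is ! p) * (monom_at v (del_nth p is) * gauss v)) \<partial>lborel)"
      by (simp add: pderiv_monom_eq_sum sum_distrib_left sum_distrib_right mult_ac del: sum_of_bool_mult_eq sum_mult_of_bool_eq)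
    also have "\<dots> = (\<Sum>p<length is. of_bool (i = is ! p) * (\<integral>v. monom_at v (del_nth p is) * gauss v \<partial>lborel))"
      using integrable_monom_gauss by (subst Bochner_Integration.integral_sum) auto
    finally show ?thesis
      using L stein(1)[of i "is"] by (simp add: moment_def sum_divide_distrib[symmetric] del: monom_at_simps)
  qed
  have "moment (k # is) = (\<Sum>j\<in>UNIV. (cov ** g) $ k $ j * moment (j # is))"
    by (simp add: cov_g mat_def if_distrib if_distribR cong: if_cong)
  also have "\<dots> = (\<Sum>i\<in>UNIV. cov $ k $ i * (\<Sum>j\<in>UNIV. g $ i $ j * moment (j # is)))"
    unfolding matrix_matrix_mult_def
    by (simp add: sum_distrib_right sum_distrib_left mult.assoc) (rule sum.swap)
  also have "\<dots> = (\<Sum>i\<in>UNIV. \<Sum>p<length is. (if i = is ! p then cov $ k $ i * moment (del_nth p is) else 0))"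
    unfolding g_mom sum_distrib_left by (intro sum.cong) auto
  also have "\<dots> = (\<Sum>p<length is. \<Sum>i\<in>UNIV. (if i = is ! p then cov $ k $ i * moment (del_nth p is) else 0))"
    by (rule sum.swap)
  also have "\<dots> = (\<Sum>p<length is. cov $ k $ (is ! p) * moment (del_nth p is))"
    by simp
  finally show ?thesis .
qed

lemma moment_1: "moment [a] = 0"
  by (simp add: moment_Cons)

lemma moment_2: "moment [a, b] = cov $ a $ b"
  by (simp add: moment_Cons moment_Nil)

lemma moment_3: "moment [a, b, c] = 0"
  by (simp add: moment_Cons[of a] moment_1 numeral_2_eq_2)

lemma moment_4: "moment [a, b, c, d] = cov $ a $ b * cov $ c $ d + cov $ a $ c * cov $ b $ d + cov $ a $ d * cov $ b $ c"
  by (simp add: moment_Cons[of a] moment_2 numeral_3_eq_3)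

lemma moment_6:
  "moment [a, b, c, d, e, f] = cov $ a $ b * moment [c, d, e, f] + cov $ a $ c * moment [b, d, e, f]
    + cov $ a $ d * moment [b, c, e, f] + cov $ a $ e * moment [b, c, d, f] + cov $ a $ f * moment [b, c, d, e]"
  by (simp add: moment_Cons[of a] eval_nat_numeral)

end


section \<open>Expectations of forms under the limiting law\<close>

text \<open>
  On the negative half-line, \<open>exp\<close> is the density of minus a standard exponential variable.
\<close>

lemma has_bochner_integral_power_exp:
  "has_bochner_integral lborel (\<lambda>t :: real. indicator {..0} t * (t ^ k * exp t)) ((- 1) ^ k * fact k)"
proof -
  have "has_bochner_integral lborel (\<lambda>x :: real. x ^ k * exp (- x) * indicator {0..} x) (fact k)"
    using nn_intergal_power_times_exp_Ici[of k]
    by (intro has_bochner_integral_nn_integral)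
      (auto simp: indicator_def ennreal_mult'' if_distrib intro!: AE_I2 cong: if_cong elim!: trans[rotated] intro!: nn_integral_cong)
  then have "has_bochner_integral lborel (\<lambda>t :: real. (0 + (-1) * t) ^ k * exp (- (0 + (-1) * t)) * indicator {0..} (0 + (-1) * t)) (fact k /\<^sub>R \<bar>-1\<bar>)"
    by (subst (asm) lborel_has_bochner_integral_real_affine_iff[of "-1" _ _ 0]) auto
  then have "has_bochner_integral lborel (\<lambda>t :: real. (-1) ^ k * ((- t) ^ k * exp t * indicator {0..} (- t))) ((-1) ^ k * fact k)"
    by (intro has_bochner_integral_mult_right) simp
  moreover have "(-1) ^ k * ((- t) ^ k * exp t * indicator {0..} (- t)) = indicator {..0} t * (t ^ k * exp t)" for t :: real
  proof -
    have "(-1) ^ k * (- t) ^ k = t ^ k" by (simp flip: power_mult_distrib)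
    then show ?thesis by (auto simp: indicator_def)
  qed
  ultimately show ?thesis by simp
qed

lemma has_bochner_integral_prod:
  fixes F :: "'a::euclidean_space \<Rightarrow> real" and G :: "'b::euclidean_space \<Rightarrow> real"
  assumes F: "has_bochner_integral lborel F a" and G: "has_bochner_integral lborel G b"
  shows "has_bochner_integral lborel (\<lambda>z. F (fst z) * G (snd z)) (a * b)"
proof -
  have Fi: "integrable lborel F" "integral\<^sup>L lborel F = a" and Gi: "integrable lborel G" "integral\<^sup>L lborel G = b"
    using assms by (auto simp: has_bochner_integral_iff)
  have [measurable]: "F \<in> borel_measurable borel" "G \<in> borel_measurable borel" using Fi Gi by auto
  have int: "integrable (lborel \<Otimes>\<^sub>M lborel) (\<lambda>(x, y). F x * G y)"
  proof (rule lborel_pair.Fubini_integrable)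
    show "(\<lambda>(x, y). F x * G y) \<in> borel_measurable (lborel \<Otimes>\<^sub>M lborel)" by measurable
    have "(\<integral>y. norm (case (x, y) of (x, y) \<Rightarrow> F x * G y) \<partial>lborel) = norm (F x) * (\<integral>y. norm (G y) \<partial>lborel)" for x
      by (simp add: abs_mult)
    then show "integrable lborel (\<lambda>x. \<integral>y. norm (case (x, y) of (x, y) \<Rightarrow> F x * G y) \<partial>lborel)"
      using Fi(1) by (simp add: integrable_abs)
    show "AE x in lborel. integrable lborel (\<lambda>y. case (x, y) of (x, y) \<Rightarrow> F x * G y)"
      using Gi(1) by simp
  qed
  have "(\<integral>z. (case z of (x, y) \<Rightarrow> F x * G y) \<partial>(lborel \<Otimes>\<^sub>M lborel)) = (\<integral>x. (\<integral>y. F x * G y \<partial>lborel) \<partial>lborel)"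
    using lborel_pair.integral_fst'[OF int] by simp
  also have "\<dots> = a * b" using Fi Gi by simp
  finally show ?thesis using int by (simp add: has_bochner_integral_iff lborel_prod case_prod_beta')
qed

lemma integrable_poly_exp_half:
  "integrable lborel (\<lambda>t :: real. indicator {..0} t * ((1 + \<bar>t\<bar>) ^ m * exp (t / 2)))"
proof (rule Bochner_Integration.integrable_bound)
  let ?C = "(4 * real (Suc m)) ^ m"
  have "has_bochner_integral lborel (\<lambda>t :: real. indicator {..0} (0 + (1/4) * t) * ((0 + (1/4) * t) ^ 0 * exp (0 + (1/4) * t))) (((- 1) ^ 0 * fact 0) /\<^sub>R \<bar>1/4\<bar>)"
    using has_bochner_integral_power_exp[of 0]
    by (subst (asm) lborel_has_bochner_integral_real_affine_iff[of "1/4" _ _ 0]) simp_all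
  moreover have "(\<lambda>t :: real. indicator {..0} (0 + (1/4) * t) * ((0 + (1/4) * t) ^ 0 * exp (0 + (1/4) * t)))
      = (\<lambda>t. indicator {..0} t * exp (t / 4))"
    by (auto simp: indicator_def)
  ultimately have "integrable lborel (\<lambda>t :: real. indicator {..0} t * exp (t / 4))"
    by (simp add: has_bochner_integral_iff)
  then show "integrable lborel (\<lambda>t :: real. ?C * (indicator {..0} t * exp (t / 4)))"
    by (rule integrable_mult_right)
  show "AE t :: real in lborel. norm (indicator {..0} t * ((1 + \<bar>t\<bar>) ^ m * exp (t / 2))) \<le> norm (?C * (indicator {..0} t * exp (t / 4)))"
  proof (rule AE_I2)
    fix t :: real
    show "norm (indicator {..0} t * ((1 + \<bar>t\<bar>) ^ m * exp (t / 2))) \<le> norm (?C * (indicator {..0} t * exp (t / 4)))"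
    proof (cases "t \<le> 0")
      case True
      let ?y = "\<bar>t\<bar>" and ?M = "4 * real (Suc m)"
      have "1 + ?y \<le> ?M * (1 + ?y / ?M)" by (simp add: field_simps)
      also have "\<dots> \<le> ?M * exp (?y / ?M)" by (intro mult_left_mono exp_ge_add_one_self) auto
      finally have "(1 + ?y) ^ m \<le> (?M * exp (?y / ?M)) ^ m" by (intro power_mono) auto
      also have "\<dots> = ?C * exp (real m * (?y / ?M))" by (simp only: power_mult_distrib exp_of_nat_mult)
      also have "\<dots> \<le> ?C * exp (?y / 4)"
        by (intro mult_left_mono) (auto simp: field_simps)
      finally have "(1 + ?y) ^ m * exp (t / 2) \<le> ?C * exp (?y / 4) * exp (t / 2)"
        by (intro mult_right_mono) auto
      also have "\<dots> = ?C * exp (t / 4)" using True by (simp add: mult.assoc exp_add[symmetric])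
      finally show ?thesis using True by (simp add: abs_mult)
    qed simp
  qed
qed simp

text \<open>
  Averaging basis tensors over permutations amounts to averaging coordinates over permutations of the
  multi-index; the inverse permutations that appear run through the same set.
\<close>

lemma symmetrizer_eq:
  assumes "length js = r"
  shows "symmetrizer r x js = 1 / fact r * (\<Sum>\<sigma> | \<sigma> permutes {..<r}. x (map (\<lambda>k. js ! \<sigma> k) [0..<r]))"
proof -
  let ?P = "{\<sigma>. \<sigma> permutes {..<r}}"
  have fin: "finite ?P" by (rule finite_permutations) simp
  have inv_eq: "(js = map (\<lambda>k. is ! \<sigma> k) [0..<r]) \<longleftrightarrow> (is = map (\<lambda>k. js ! inv \<sigma> k) [0..<r])"
    if s: "\<sigma> permutes {..<r}" and l: "length is = r" for \<sigma> "is"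
  proof -
    have lt: "k < r \<Longrightarrow> \<sigma> k < r" "k < r \<Longrightarrow> inv \<sigma> k < r" for k
      using permutes_in_image[OF s] permutes_in_image[OF permutes_inv[OF s]] by auto
    show ?thesis
      using permutes_inverses[OF s] lt assms l by (auto simp: list_eq_iff_nth_eq)
  qed
  have "symmetrizer r x js = (\<Sum>is\<in>midx r. \<Sum>\<sigma>\<in>?P. 1 / fact r * (if is = map (\<lambda>k. js ! inv \<sigma> k) [0..<r] then x is else 0))"
    unfolding symmetrizer_def sum_distrib_left basis_tensor_def
    by (intro sum.cong refl) (auto simp: midx_def inv_eq)
  also have "\<dots> = (\<Sum>\<sigma>\<in>?P. \<Sum>is\<in>midx r. 1 / fact r * (if is = map (\<lambda>k. js ! inv \<sigma> k) [0..<r] then x is else 0))"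
    by (rule sum.swap)
  also have "\<dots> = (\<Sum>\<sigma>\<in>?P. 1 / fact r * x (map (\<lambda>k. js ! inv \<sigma> k) [0..<r]))"
    unfolding sum_distrib_left[symmetric] by (intro sum.cong refl arg_cong2[of _ _ _ _ "(*)"])
      (subst sum.delta[OF finite_midx], simp add: midx_def)
  also have "\<dots> = 1 / fact r * (\<Sum>\<sigma>\<in>?P. x (map (\<lambda>k. js ! inv \<sigma> k) [0..<r]))"
    by (simp add: sum_distrib_left)
  also have "(\<Sum>\<sigma>\<in>?P. x (map (\<lambda>k. js ! inv \<sigma> k) [0..<r])) = (\<Sum>\<sigma>\<in>?P. x (map (\<lambda>k. js ! \<sigma> k) [0..<r]))"
    by (rule sum_permutations_inverse[symmetric, where f = "\<lambda>\<sigma>. x (map (\<lambda>k. js ! \<sigma> k) [0..<r])"])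
  finally show ?thesis .
qed

lemma sum_midx_2:
  fixes f :: "'d::finite list \<Rightarrow> real"
  shows "(\<Sum>is\<in>midx 2. f is) = (\<Sum>a\<in>UNIV. \<Sum>b\<in>UNIV. f [a, b])"
  by (simp add: numeral_2_eq_2 sum_midx_Suc sum_midx_0)

lemma sum_midx_4:
  fixes f :: "'d::finite list \<Rightarrow> real"
  shows "(\<Sum>is\<in>midx 4. f is) = (\<Sum>a\<in>UNIV. \<Sum>b\<in>UNIV. \<Sum>c\<in>UNIV. \<Sum>d\<in>UNIV. f [a, b, c, d])"
proof -
  have "4 = Suc (Suc (Suc (Suc 0)))" by simp
  then show ?thesis by (simp only: sum_midx_Suc sum_midx_0)
qed

context gaussian
begin

abbreviation cov_pow :: "nat \<Rightarrow> 'd tensor" where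
  "cov_pow \<equiv> kron_pow 2 (vec_mat cov)"

lemma cov_pow_1: "cov_pow (Suc 0) [a, b] = cov $ a $ b"
  by (simp add: kron_def vec_mat_def cov_commute)

lemma cov_pow_2: "cov_pow 2 [a, b, c, d] = cov $ a $ b * cov $ c $ d"
  by (simp add: numeral_2_eq_2 kron_def vec_mat_def cov_commute)

lemma cov_pow_3: "cov_pow 3 [a, b, c, d, e, f] = cov $ a $ b * (cov $ c $ d * cov $ e $ f)"
  by (simp add: numeral_3_eq_3 numeral_2_eq_2 kron_def vec_mat_def cov_commute)

text \<open>
  The expectation of \<open>form r T\<close> under the probability density \<open>gauss v / mass\<close>.
\<close>

definition expect :: "nat \<Rightarrow> 'd tensor \<Rightarrow> real" where
  "expect r T = (\<Sum>is\<in>midx r. T is * moment is)"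

lemma has_bochner_integral_form_power:
  "has_bochner_integral lborel
    (\<lambda>z. form r T (fst z) * snd z ^ k * (gauss (fst z) * (indicator {..0} (snd z) * exp (snd z))))
    (mass * (expect r T * ((- 1) ^ k * fact k)))"
proof -
  have "has_bochner_integral lborel (\<lambda>v. \<Sum>is\<in>midx r. T is * (monom_at v is * gauss v))
      (\<Sum>is\<in>midx r. T is * (mass * moment is))"
  proof (intro has_bochner_integral_sum has_bochner_integral_mult_right)
    fix "is" :: "'d list"
    show "has_bochner_integral lborel (\<lambda>v. monom_at v is * gauss v) (mass * moment is)"
      using integrable_monom_gauss[of "is"] mass_pos by (simp add: has_bochner_integral_iff moment_def)
  qed
  moreover have "(\<Sum>is\<in>midx r. T is * (monom_at v is * gauss v)) = form r T v * gauss v" for v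
    by (simp add: form_eq_sum sum_distrib_left mult_ac)
  moreover have "(\<Sum>is\<in>midx r. T is * (mass * moment is)) = mass * expect r T"
    by (simp add: expect_def sum_distrib_left mult_ac)
  ultimately have "has_bochner_integral lborel (\<lambda>v. form r T v * gauss v) (mass * expect r T)" by simp
  from has_bochner_integral_prod[OF this has_bochner_integral_power_exp[of k]]
  show ?thesis by (simp add: mult_ac)
qed

lemma expect_0: "expect 0 T = T []"
  by (simp add: expect_def sum_midx_0 moment_Nil)

lemma expect_1: "expect 1 T = 0"
  unfolding One_nat_def by (simp add: expect_def sum_midx_Suc sum_midx_0 moment_1)

lemma expect_3: "expect 3 T = 0"
  by (simp add: expect_def numeral_3_eq_3 sum_midx_Suc sum_midx_0 moment_3)

lemma expect_2: "expect 2 T = tinner 2 T (cov_pow 1)"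
  unfolding expect_def tinner_def sum_midx_2 One_nat_def cov_pow_1 by (simp add: moment_2)

text \<open>
  Symmetry of \<open>T\<close> in its last three indices, which is all that a product \<open>kron 1 S T\<close> with symmetric \<open>T\<close>
  has, suffices: the three pairings of Wick's formula differ only in the partner of the first index.
\<close>

lemma expect_4:
  assumes "\<And>a b c d. T [a, b, c, d] = T [a, c, b, d]" "\<And>a b c d. T [a, b, c, d] = T [a, b, d, c]"
  shows "expect 4 T = 3 * tinner 4 T (cov_pow 2)"
proof -
  let ?S = "\<Sum>a\<in>UNIV. \<Sum>b\<in>UNIV. \<Sum>c\<in>UNIV. \<Sum>d\<in>UNIV. T [a, b, c, d] * (cov $ a $ b * cov $ c $ d)"
  have 2: "(\<Sum>a\<in>UNIV. \<Sum>b\<in>UNIV. \<Sum>c\<in>UNIV. \<Sum>d\<in>UNIV. T [a, b, c, d] * (cov $ a $ c * cov $ b $ d)) = ?S"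
    (is "(\<Sum>a\<in>UNIV. ?l a) = _")
  proof (rule sum.cong[OF refl])
    fix a
    have "?l a = (\<Sum>c\<in>UNIV. \<Sum>b\<in>UNIV. \<Sum>d\<in>UNIV. T [a, b, c, d] * (cov $ a $ c * cov $ b $ d))"
      by (rule sum.swap)
    also have "\<dots> = (\<Sum>b\<in>UNIV. \<Sum>c\<in>UNIV. \<Sum>d\<in>UNIV. T [a, b, c, d] * (cov $ a $ b * cov $ c $ d))"
      by (intro sum.cong refl) (metis assms(1))
    finally show "?l a = \<dots>" .
  qed
  have 3: "(\<Sum>a\<in>UNIV. \<Sum>b\<in>UNIV. \<Sum>c\<in>UNIV. \<Sum>d\<in>UNIV. T [a, b, c, d] * (cov $ a $ d * cov $ b $ c)) = ?S"
  proof -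
    have "(\<Sum>a\<in>UNIV. \<Sum>b\<in>UNIV. \<Sum>c\<in>UNIV. \<Sum>d\<in>UNIV. T [a, b, c, d] * (cov $ a $ d * cov $ b $ c))
        = (\<Sum>a\<in>UNIV. \<Sum>b\<in>UNIV. \<Sum>d\<in>UNIV. \<Sum>c\<in>UNIV. T [a, b, c, d] * (cov $ a $ d * cov $ b $ c))"
      by (intro sum.cong refl sum.swap)
    also have "\<dots> = (\<Sum>a\<in>UNIV. \<Sum>b\<in>UNIV. \<Sum>c\<in>UNIV. \<Sum>d\<in>UNIV. T [a, b, c, d] * (cov $ a $ c * cov $ b $ d))"
      by (intro sum.cong refl) (metis assms(2))
    finally show ?thesis using 2 by simp
  qed
  have "expect 4 T = ?S + ?S + ?S"
    unfolding expect_def sum_midx_4 moment_4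
    by (subst 2[symmetric], subst 3[symmetric]) (simp add: ring_distribs sum.distrib)
  then show ?thesis unfolding tinner_def sum_midx_4 cov_pow_2 by simp
qed

text \<open>
  A moment is invariant under permutations of its indices, so it equals its average over them. Under the
  average all pairings in Wick's formula coincide: there are 5 partners for the first index, and then 3
  pairings of the other four.
\<close>

lemma moment_6_symmetrizer:
  assumes "length js = 6"
  shows "moment js = 15 * symmetrizer 6 (cov_pow 3) js"
proof -
  let ?P = "{\<sigma>. \<sigma> permutes {..<6 :: nat}}"
  have upt6: "[0..<6] = [0, 1, 2, 3, 4, 5 :: nat]" by (simp add: upt_rec)
  \<comment> \<open>The sum over all permutations of one of the 5 terms of the recursion, and of one of the 15 pairings.\<close>
  define A where "A = (\<Sum>\<sigma>\<in>?P. cov $ (js ! \<sigma> 0) $ (js ! \<sigma> 1) * moment [js ! \<sigma> 2, js ! \<sigma> 3, js ! \<sigma> 4, js ! \<sigma> 5])"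
  define B where "B = (\<Sum>\<sigma>\<in>?P. cov $ (js ! \<sigma> 0) $ (js ! \<sigma> 1) * (cov $ (js ! \<sigma> 2) $ (js ! \<sigma> 3) * cov $ (js ! \<sigma> 4) $ (js ! \<sigma> 5)))"
  have swap: "(\<Sum>\<sigma>\<in>?P. f \<sigma>) = (\<Sum>\<sigma>\<in>?P. f (\<sigma> \<circ> Transposition.transpose i j))"
    if "i < 6" "j < 6" for f :: "(nat \<Rightarrow> nat) \<Rightarrow> real" and i j
    by (rule sum_permutations_compose_right, rule permutes_swap_id) (use that in auto)
  have mset4: "moment [b, d, e, f] = moment [d, b, e, f]" "moment [b, d, e, f] = moment [d, e, b, f]"
    "moment [b, d, e, f] = moment [d, e, f, b]" for b d e f
    by (intro moment_mset; simp)+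
  have "A = (\<Sum>\<sigma>\<in>?P. cov $ (js ! \<sigma> 0) $ (js ! \<sigma> 2) * moment [js ! \<sigma> 1, js ! \<sigma> 3, js ! \<sigma> 4, js ! \<sigma> 5])"
    unfolding A_def by (subst swap[of 1 2]) (simp_all add: Transposition.transpose_def)
  moreover have "A = (\<Sum>\<sigma>\<in>?P. cov $ (js ! \<sigma> 0) $ (js ! \<sigma> 3) * moment [js ! \<sigma> 1, js ! \<sigma> 2, js ! \<sigma> 4, js ! \<sigma> 5])"
    unfolding A_def by (subst swap[of 1 3]) (simp_all add: Transposition.transpose_def, subst mset4(1), simp)
  moreover have "A = (\<Sum>\<sigma>\<in>?P. cov $ (js ! \<sigma> 0) $ (js ! \<sigma> 4) * moment [js ! \<sigma> 1, js ! \<sigma> 2, js ! \<sigma> 3, js ! \<sigma> 5])"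
    unfolding A_def by (subst swap[of 1 4]) (simp_all add: Transposition.transpose_def, subst (2) mset4(2), simp)
  moreover have "A = (\<Sum>\<sigma>\<in>?P. cov $ (js ! \<sigma> 0) $ (js ! \<sigma> 5) * moment [js ! \<sigma> 1, js ! \<sigma> 2, js ! \<sigma> 3, js ! \<sigma> 4])"
    unfolding A_def by (subst swap[of 1 5]) (simp_all add: Transposition.transpose_def, subst (2) mset4(3), simp)
  moreover have "(\<Sum>\<sigma>\<in>?P. moment [js ! \<sigma> 0, js ! \<sigma> 1, js ! \<sigma> 2, js ! \<sigma> 3, js ! \<sigma> 4, js ! \<sigma> 5]) =
      A + (\<Sum>\<sigma>\<in>?P. cov $ (js ! \<sigma> 0) $ (js ! \<sigma> 2) * moment [js ! \<sigma> 1, js ! \<sigma> 3, js ! \<sigma> 4, js ! \<sigma> 5])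
      + (\<Sum>\<sigma>\<in>?P. cov $ (js ! \<sigma> 0) $ (js ! \<sigma> 3) * moment [js ! \<sigma> 1, js ! \<sigma> 2, js ! \<sigma> 4, js ! \<sigma> 5])
      + (\<Sum>\<sigma>\<in>?P. cov $ (js ! \<sigma> 0) $ (js ! \<sigma> 4) * moment [js ! \<sigma> 1, js ! \<sigma> 2, js ! \<sigma> 3, js ! \<sigma> 5])
      + (\<Sum>\<sigma>\<in>?P. cov $ (js ! \<sigma> 0) $ (js ! \<sigma> 5) * moment [js ! \<sigma> 1, js ! \<sigma> 2, js ! \<sigma> 3, js ! \<sigma> 4])"
    unfolding A_def moment_6 by (simp only: sum.distrib)
  ultimately have sum6: "(\<Sum>\<sigma>\<in>?P. moment [js ! \<sigma> 0, js ! \<sigma> 1, js ! \<sigma> 2, js ! \<sigma> 3, js ! \<sigma> 4, js ! \<sigma> 5]) = 5 * A"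
    by simp
  have "B = (\<Sum>\<sigma>\<in>?P. cov $ (js ! \<sigma> 0) $ (js ! \<sigma> 1) * (cov $ (js ! \<sigma> 2) $ (js ! \<sigma> 4) * cov $ (js ! \<sigma> 3) $ (js ! \<sigma> 5)))"
    unfolding B_def by (subst swap[of 3 4]) (simp_all add: Transposition.transpose_def)
  moreover have "B = (\<Sum>\<sigma>\<in>?P. cov $ (js ! \<sigma> 0) $ (js ! \<sigma> 1) * (cov $ (js ! \<sigma> 2) $ (js ! \<sigma> 5) * cov $ (js ! \<sigma> 3) $ (js ! \<sigma> 4)))"
    unfolding B_def by (subst swap[of 3 5]) (simp_all add: Transposition.transpose_def cov_commute)
  moreover have "A = B + (\<Sum>\<sigma>\<in>?P. cov $ (js ! \<sigma> 0) $ (js ! \<sigma> 1) * (cov $ (js ! \<sigma> 2) $ (js ! \<sigma> 4) * cov $ (js ! \<sigma> 3) $ (js ! \<sigma> 5)))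
      + (\<Sum>\<sigma>\<in>?P. cov $ (js ! \<sigma> 0) $ (js ! \<sigma> 1) * (cov $ (js ! \<sigma> 2) $ (js ! \<sigma> 5) * cov $ (js ! \<sigma> 3) $ (js ! \<sigma> 4)))"
    unfolding A_def B_def moment_4 by (simp only: sum.distrib ring_distribs)
  ultimately have A: "A = 3 * B" by simp
  have inv: "moment (map (\<lambda>k. js ! \<sigma> k) [0..<6]) = moment js" if "\<sigma> \<in> ?P" for \<sigma>
  proof (rule moment_mset)
    have "map (\<lambda>k. js ! \<sigma> k) [0..<6] = permute_list \<sigma> js" using assms by (simp add: permute_list_def)
    then show "mset (map (\<lambda>k. js ! \<sigma> k) [0..<6]) = mset js" using that assms by simp
  qed
  have "fact 6 * moment js = (\<Sum>\<sigma>\<in>?P. moment (map (\<lambda>k. js ! \<sigma> k) [0..<6]))"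
    by (simp add: inv card_permutations[of "{..<6}" 6])
  also have "\<dots> = 5 * A" unfolding upt6 using sum6 by simp
  also have "\<dots> = 15 * B" using A by simp
  also have "B = (\<Sum>\<sigma>\<in>?P. cov_pow 3 (map (\<lambda>k. js ! \<sigma> k) [0..<6]))"
    unfolding B_def upt6 list.map cov_pow_3 ..
  finally show ?thesis unfolding symmetrizer_eq[OF assms] by (simp add: field_simps)
qed

lemma expect_6: "expect 6 T = 15 * tinner 6 T (symmetrizer 6 (cov_pow 3))"
  unfolding expect_def tinner_def sum_distrib_left
  by (intro sum.cong refl) (simp add: midx_def moment_6_symmetrizer)

end

lemma symmetrizer_monom:
  assumes "length js = r" shows "symmetrizer r (kron_pow 1 (tensor_of_vec u) r) js = monom_at u js"
proof -
  have "kron_pow 1 (tensor_of_vec u) r (map (\<lambda>k. js ! \<sigma> k) [0..<r]) = monom_at u js"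
    if "\<sigma> permutes {..<r}" for \<sigma>
  proof -
    have "map (\<lambda>k. js ! \<sigma> k) [0..<r] = permute_list \<sigma> js" using assms by (simp add: permute_list_def)
    moreover have "monom_at u (permute_list \<sigma> js) = monom_at u js"
      unfolding monom_at_def prod_mset_prod_list[symmetric] mset_map using that assms by simp
    ultimately show ?thesis using kron_pow_tensor_of_vec[of "map (\<lambda>k. js ! \<sigma> k) [0..<r]" r u]
      by (simp only: length_permute_list assms)
  qed
  then show ?thesis by (simp add: symmetrizer_eq[OF assms] card_permutations[of "{..<r}" r])
qed


section \<open>Expanding the exponential of a perturbed exponent\<close>

text \<open>
  The maximum bounds the third derivative between \<open>0\<close> and \<open>z\<close>, whatever the sign of \<open>z\<close>.
\<close>

lemma exp_cubic_remainder:
  fixes z :: real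
  shows "\<bar>exp z - (1 + z + z\<^sup>2 / 2)\<bar> \<le> \<bar>z\<bar> ^ 3 * max 1 (exp z)"
proof -
  have "\<exists>t>0. t < 1 \<and> exp (1 * z) = (\<Sum>j<3. (z ^ j * exp (0 * z)) / fact j * 1 ^ j) + (z ^ 3 * exp (t * z)) / fact 3 * 1 ^ 3"
    by (rule Maclaurin[where diff = "\<lambda>j t. z ^ j * exp (t * z)"])
      (auto intro!: derivative_eq_intros simp: mult_ac)
  then obtain t where t: "0 < t" "t < 1" "exp z = 1 + z + z\<^sup>2 / 2 + z ^ 3 * exp (t * z) / 6"
    by (auto simp: numeral_3_eq_3 lessThan_Suc fact_numeral algebra_simps power2_eq_square)
  have le: "exp (t * z) \<le> max 1 (exp z)"
  proof (cases "z \<ge> 0")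
    case True
    then have "t * z \<le> z" using t by (simp add: mult_left_le_one_le)
    then show ?thesis by (simp add: le_max_iff_disj)
  next
    case False
    then have "t * z \<le> 0" using t by (simp add: mult_nonneg_nonpos)
    then show ?thesis by (simp add: le_max_iff_disj)
  qed
  have "\<bar>exp z - (1 + z + z\<^sup>2 / 2)\<bar> = \<bar>z\<bar> ^ 3 * exp (t * z) / 6"
    unfolding t(3) by (simp add: abs_mult power_abs)
  also have "\<dots> \<le> \<bar>z\<bar> ^ 3 * exp (t * z)" by simp
  also have "\<dots> \<le> \<bar>z\<bar> ^ 3 * max 1 (exp z)" using le by (intro mult_left_mono) auto
  finally show ?thesis .
qed

lemma abs_mult_le:
  fixes a b A B :: real
  shows "\<bar>a\<bar> \<le> A \<Longrightarrow> \<bar>b\<bar> \<le> B \<Longrightarrow> \<bar>a * b\<bar> \<le> A * B"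
  unfolding abs_mult by (intro mult_mono) auto

lemma abs_sum4_le:
  fixes x y z w :: real
  shows "0 \<le> w \<Longrightarrow> \<bar>x + y + z + w / 2\<bar> \<le> \<bar>x\<bar> + \<bar>y\<bar> + \<bar>z\<bar> + \<bar>w\<bar>"
  by linarith

lemma powers_le:
  fixes \<rho> M e :: real
  assumes "1 \<le> \<rho>" "1 \<le> M" "0 < e" "e \<le> 1" "a \<le> a'" "b \<le> b'" "c' \<le> c"
  shows "M ^ a * e ^ c * \<rho> ^ b \<le> M ^ a' * e ^ c' * \<rho> ^ b'"
  using assms by (intro mult_mono power_increasing power_decreasing) auto

text \<open>
  The expansion at one point of the rescaled parameter space. Here \<open>e\<close> is \<open>n powr (- 1 / 2)\<close>, \<open>Q\<close> is the
  exponent of the limiting density, \<open>z\<close> is the perturbation of the exponent, and \<open>\<rho>\<close> dominates all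
  monomials. It is essential that \<open>Dm\<close> bounds the perturbed exponential too: Taylor's formula for
  \<open>exp (Q + z)\<close> around \<open>Q\<close> has its remainder at a point between the two, whereas the cruder factor \<open>exp \<bar>z\<bar>\<close>
  need not be integrable against the limiting density.
\<close>

lemma expansion_bound:
  fixes e M \<rho> w3 w4 r b1 b2 rp Q Dm :: real
  defines "z \<equiv> e * w3 + e\<^sup>2 * w4 + r"
  assumes e: "0 < e" "e \<le> 1" and M: "1 \<le> M" and \<rho>: "1 \<le> \<rho>"
    and w3: "\<bar>w3\<bar> \<le> M * \<rho> ^ 3" and w4: "\<bar>w4\<bar> \<le> M * \<rho> ^ 4" and r: "\<bar>r\<bar> \<le> M * e ^ 3 * \<rho> ^ 5"
    and b1: "\<bar>b1\<bar> \<le> M * \<rho>" and b2: "\<bar>b2\<bar> \<le> M * \<rho>\<^sup>2" and rp: "\<bar>rp\<bar> \<le> M * e ^ 3 * \<rho> ^ 3"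
    and Dm: "exp Q \<le> Dm" "exp (Q + z) \<le> Dm"
  shows "\<bar>(1 + e * b1 + e\<^sup>2 * b2 + rp) * exp (Q + z)
      - exp Q * (1 + e * (b1 + w3) + e\<^sup>2 * (b2 + b1 * w3 + w4 + w3\<^sup>2 / 2))\<bar>
    \<le> 200 * M ^ 4 * e ^ 3 * \<rho> ^ 18 * Dm"
proof -
  note pl = powers_le[OF \<rho> M e]
  have Dpos: "0 < Dm" using Dm(1) exp_gt_zero less_le_trans by blast
  have EQ: "\<bar>exp Q\<bar> \<le> Dm" using Dm by simp
  have x1: "\<bar>e * w3\<bar> \<le> M * e * \<rho> ^ 5"
  proof -
    have "\<bar>e * w3\<bar> \<le> e * (M * \<rho> ^ 3)" using abs_mult_le[of e e w3] w3 e by simp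
    also have "\<dots> \<le> M * e * \<rho> ^ 5" using pl[of 1 1 3 5 1 1] by (simp add: mult_ac)
    finally show ?thesis .
  qed
  have x2: "\<bar>e\<^sup>2 * w4\<bar> \<le> M * e\<^sup>2 * \<rho> ^ 5"
  proof -
    have "\<bar>e\<^sup>2 * w4\<bar> \<le> e\<^sup>2 * (M * \<rho> ^ 4)" using abs_mult_le[of "e\<^sup>2" "e\<^sup>2" w4] w4 e by simp
    also have "\<dots> \<le> M * e\<^sup>2 * \<rho> ^ 5" using pl[of 1 1 4 5 2 2] by (simp add: mult_ac)
    finally show ?thesis .
  qed
  have r2: "\<bar>r\<bar> \<le> M * e\<^sup>2 * \<rho> ^ 5" using r pl[of 1 1 5 5 2 3] by simp
  have e21: "M * e\<^sup>2 * \<rho> ^ 5 \<le> M * e * \<rho> ^ 5" using pl[of 1 1 5 5 1 2] by simp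
  have zb: "\<bar>z\<bar> \<le> 3 * M * e * \<rho> ^ 5"
    unfolding z_def using x1 x2 r2 e21 by linarith
  have zm: "\<bar>z - e * w3\<bar> \<le> 2 * M * e\<^sup>2 * \<rho> ^ 5" unfolding z_def using x2 r2 by linarith
  have zp: "\<bar>z + e * w3\<bar> \<le> 4 * M * e * \<rho> ^ 5" using zb x1 by linarith
  define S where "S = exp z - (1 + z + z\<^sup>2 / 2)"
  have zcube: "\<bar>z\<bar> ^ 3 \<le> 27 * M ^ 3 * e ^ 3 * \<rho> ^ 15"
  proof -
    have "\<bar>z\<bar> ^ 3 \<le> (3 * M * e * \<rho> ^ 5) ^ 3" by (rule power_mono[OF zb]) simp
    then show ?thesis by (simp add: power_mult_distrib power_mult[symmetric])
  qed
  have S: "\<bar>exp Q * S\<bar> \<le> 27 * M ^ 3 * e ^ 3 * \<rho> ^ 15 * Dm"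
  proof -
    have "\<bar>exp Q * S\<bar> = exp Q * \<bar>S\<bar>" by (simp add: abs_mult)
    also have "\<dots> \<le> exp Q * (\<bar>z\<bar> ^ 3 * max 1 (exp z))"
      unfolding S_def by (intro mult_left_mono exp_cubic_remainder) auto
    also have "\<dots> = \<bar>z\<bar> ^ 3 * max (exp Q) (exp (Q + z))"
      by (simp add: max_def exp_add)
    also have "\<dots> \<le> (27 * M ^ 3 * e ^ 3 * \<rho> ^ 15) * Dm"
      using Dm zcube M e \<rho> by (intro mult_mono) (auto simp: max_def)
    finally show ?thesis .
  qed
  define w4' where "w4' = w4 + w3\<^sup>2 / 2"
  have w4': "\<bar>w4'\<bar> \<le> 2 * M ^ 2 * \<rho> ^ 6"
  proof -
    have "\<bar>w3 * w3\<bar> \<le> (M * \<rho> ^ 3) * (M * \<rho> ^ 3)" by (rule abs_mult_le[OF w3 w3])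
    then have "\<bar>w3\<^sup>2\<bar> \<le> M ^ 2 * \<rho> ^ 6" by (simp add: power2_eq_square algebra_simps flip: power_add)
    moreover have "M * \<rho> ^ 4 \<le> M ^ 2 * \<rho> ^ 6" using pl[of 1 2 4 6 0 0] by simp
    ultimately show ?thesis unfolding w4'_def using w4 by linarith
  qed
  define S' where "S' = exp Q * (r + (z - e * w3) * (z + e * w3) / 2) + exp Q * S"
  have S': "\<bar>S'\<bar> \<le> 32 * M ^ 3 * e ^ 3 * \<rho> ^ 15 * Dm"
  proof -
    have "\<bar>(z - e * w3) * (z + e * w3)\<bar> \<le> (2 * M * e\<^sup>2 * \<rho> ^ 5) * (4 * M * e * \<rho> ^ 5)"
      by (rule abs_mult_le[OF zm zp])
    also have "\<dots> = 8 * (M ^ 2 * e ^ 3 * \<rho> ^ 10)"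
      by (simp add: power2_eq_square power3_eq_cube algebra_simps flip: power_add)
    also have "\<dots> \<le> 8 * (M ^ 3 * e ^ 3 * \<rho> ^ 15)" using pl[of 2 3 10 15 3 3] by simp
    finally have 1: "\<bar>(z - e * w3) * (z + e * w3)\<bar> \<le> 8 * (M ^ 3 * e ^ 3 * \<rho> ^ 15)" .
    have 2: "\<bar>r\<bar> \<le> M ^ 3 * e ^ 3 * \<rho> ^ 15" using r pl[of 1 3 5 15 3 3] by simp
    have "\<bar>r + (z - e * w3) * (z + e * w3) / 2\<bar> \<le> 5 * (M ^ 3 * e ^ 3 * \<rho> ^ 15)" using 1 2 by linarith
    from abs_mult_le[OF EQ this]
    have "\<bar>exp Q * (r + (z - e * w3) * (z + e * w3) / 2)\<bar> \<le> 5 * (M ^ 3 * e ^ 3 * \<rho> ^ 15 * Dm)"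
      by (simp add: mult_ac)
    moreover have "\<bar>exp Q * S\<bar> \<le> 27 * (M ^ 3 * e ^ 3 * \<rho> ^ 15 * Dm)"
      using S by (simp add: mult.assoc)
    moreover have "\<bar>S'\<bar> \<le> \<bar>exp Q * (r + (z - e * w3) * (z + e * w3) / 2)\<bar> + \<bar>exp Q * S\<bar>"
      unfolding S'_def by (rule abs_triangle_ineq)
    ultimately have "\<bar>S'\<bar> \<le> 32 * (M ^ 3 * e ^ 3 * \<rho> ^ 15 * Dm)" by linarith
    then show ?thesis by (simp add: mult.assoc)
  qed
  have eq: "exp (Q + z) = exp Q * (1 + e * w3 + e\<^sup>2 * w4') + S'"
    unfolding exp_add S'_def S_def w4'_def z_def by (simp add: power2_eq_square field_simps)
  define a where "a = 1 + e * b1 + e\<^sup>2 * b2 + rp"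
  have a: "\<bar>a\<bar> \<le> 4 * M * \<rho> ^ 3"
  proof -
    have "\<bar>e * b1\<bar> \<le> 1 * (M * \<rho>)" by (rule abs_mult_le[OF _ b1]) (use e in auto)
    moreover have "\<bar>e\<^sup>2 * b2\<bar> \<le> 1 * (M * \<rho>\<^sup>2)" by (rule abs_mult_le[OF _ b2]) (use e in \<open>auto simp: power_le_one\<close>)
    ultimately show ?thesis
      using rp pl[of 0 1 0 3 0 0] pl[of 1 1 1 3 0 0] pl[of 1 1 2 3 0 0] pl[of 1 1 3 3 0 3] unfolding a_def by simp
  qed
  have 1: "\<bar>a * S'\<bar> \<le> 128 * (M ^ 4 * e ^ 3 * \<rho> ^ 18 * Dm)"
    using abs_mult_le[OF a S'] by (simp add: mult_ac eval_nat_numeral)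
  \<comment> \<open>The product of the two truncated expansions has its own terms of order \<open>e ^ 3\<close> and more, collected in \<open>T\<close>.\<close>
  define W where "W = 1 + e * w3 + e\<^sup>2 * w4'"
  have W: "\<bar>W\<bar> \<le> 4 * M ^ 2 * \<rho> ^ 6"
  proof -
    have "\<bar>e * w3\<bar> \<le> 1 * (M * \<rho> ^ 3)" by (rule abs_mult_le[OF _ w3]) (use e in auto)
    moreover have "\<bar>e\<^sup>2 * w4'\<bar> \<le> 1 * (2 * M ^ 2 * \<rho> ^ 6)" by (rule abs_mult_le[OF _ w4']) (use e in \<open>auto simp: power_le_one\<close>)
    ultimately show ?thesis
      using pl[of 0 2 0 6 0 0] pl[of 1 2 3 6 0 0] unfolding W_def by simp
  qed
  define T where "T = rp * W + e ^ 3 * (b1 * w4' + b2 * w3) + e ^ 4 * (b2 * w4')"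
  have T: "\<bar>T\<bar> \<le> 9 * (M ^ 3 * e ^ 3 * \<rho> ^ 9)"
  proof -
    have t1: "\<bar>rp * W\<bar> \<le> 4 * (M ^ 3 * e ^ 3 * \<rho> ^ 9)"
      using abs_mult_le[OF rp W] by (simp add: eval_nat_numeral mult_ac)
    have "\<bar>b1 * w4'\<bar> \<le> 2 * (M ^ 3 * \<rho> ^ 7)" using abs_mult_le[OF b1 w4'] by (simp add: eval_nat_numeral mult_ac)
    then have b1w: "\<bar>b1 * w4'\<bar> \<le> 2 * (M ^ 3 * \<rho> ^ 9)" using pl[of 3 3 7 9 0 0] by simp
    have "\<bar>b2 * w3\<bar> \<le> M ^ 2 * \<rho> ^ 5" using abs_mult_le[OF b2 w3] by (simp add: eval_nat_numeral mult_ac)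
    then have b2w: "\<bar>b2 * w3\<bar> \<le> M ^ 3 * \<rho> ^ 9" using pl[of 2 3 5 9 0 0] by simp
    have "\<bar>b1 * w4' + b2 * w3\<bar> \<le> 3 * (M ^ 3 * \<rho> ^ 9)" using b1w b2w by linarith
    from abs_mult_le[of "e ^ 3" "e ^ 3", OF _ this]
    have t2: "\<bar>e ^ 3 * (b1 * w4' + b2 * w3)\<bar> \<le> 3 * (M ^ 3 * e ^ 3 * \<rho> ^ 9)" using e by (simp add: mult_ac)
    have "\<bar>b2 * w4'\<bar> \<le> 2 * (M ^ 3 * \<rho> ^ 8)" using abs_mult_le[OF b2 w4'] by (simp add: eval_nat_numeral mult_ac)
    from abs_mult_le[of "e ^ 4" "e ^ 4", OF _ this]
    have "\<bar>e ^ 4 * (b2 * w4')\<bar> \<le> 2 * (M ^ 3 * e ^ 4 * \<rho> ^ 8)" using e by (simp add: mult_ac)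
    then have t3: "\<bar>e ^ 4 * (b2 * w4')\<bar> \<le> 2 * (M ^ 3 * e ^ 3 * \<rho> ^ 9)" using pl[of 3 3 8 9 3 4] by simp
    show ?thesis unfolding T_def using t1 t2 t3 by linarith
  qed
  define B where "B = 1 + e * (b1 + w3) + e\<^sup>2 * (b2 + b1 * w3 + w4 + w3\<^sup>2 / 2)"
  have "a * W - B = T"
    unfolding a_def W_def T_def B_def w4'_def by (simp add: eval_nat_numeral algebra_simps)
  moreover have "a * exp (Q + z) - exp Q * B = exp Q * (a * W - B) + a * S'"
    unfolding eq W_def[symmetric] by (simp add: algebra_simps)
  ultimately have "a * exp (Q + z) - exp Q * B = exp Q * T + a * S'" by simp
  moreover have "\<bar>exp Q * T\<bar> \<le> 9 * (M ^ 4 * e ^ 3 * \<rho> ^ 18 * Dm)"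
  proof -
    have "\<bar>exp Q * T\<bar> \<le> Dm * (9 * (M ^ 3 * e ^ 3 * \<rho> ^ 9))" by (rule abs_mult_le[OF EQ T])
    also have "\<dots> \<le> Dm * (9 * (M ^ 4 * e ^ 3 * \<rho> ^ 18))"
      using pl[of 3 4 9 18 3 3] Dpos by (intro mult_left_mono) auto
    finally show ?thesis by (simp add: mult_ac)
  qed
  moreover have "0 \<le> M ^ 4 * e ^ 3 * \<rho> ^ 18 * Dm" using M e \<rho> Dpos by simp
  ultimately show ?thesis using 1 unfolding a_def B_def by linarith
qed


section \<open>Laplace expansion at a corner\<close>

text \<open>
  The data of a Laplace expansion at the point \<open>(m, k)\<close> for the function \<open>p \<theta> \<gamma> * exp (n * L \<theta> \<gamma>)\<close> on \<open>D\<close>, cut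
  off at \<open>\<gamma> \<le> k\<close>: \<open>c\<close> is the slope of \<open>L\<close> in \<open>\<gamma>\<close>, \<open>- g\<close> is the Hessian of \<open>L\<close> in \<open>\<theta>\<close>, \<open>A11\<close>, \<open>A21\<close>, \<open>A30\<close>, \<open>A40\<close>, \<open>A02\<close> are
  the derivatives of \<open>L\<close> of these orders in \<open>\<theta>\<close> and in \<open>\<gamma>\<close>, and \<open>P1\<close>, \<open>P2\<close>, \<open>dp\<close> are those of \<open>p\<close>. Only the
  numbers \<open>lam\<close>, \<open>K\<close>, \<open>eta\<close> and \<open>kap\<close> (and the dimension) may enter the remainders. The expansions hold in a
  box of size \<open>eta\<close>, which is so small that the terms of higher order are dominated by the quadratic term
  in \<open>\<theta>\<close> and the linear term in \<open>\<gamma>\<close>; outside of the box, \<open>L\<close> is smaller by \<open>kap\<close>.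
\<close>

locale laplace = gaussian g lam for g :: "real ^ 'd::finite ^ 'd" and lam :: real +
  fixes D :: "((real ^ 'd) \<times> real) set" and n :: nat
    and L p :: "real ^ 'd \<Rightarrow> real \<Rightarrow> real" and m :: "real ^ 'd" and k c :: real
    and A11 A21 A30 A40 P1 P2 :: "'d tensor" and A02 dp :: real
    and K eta kap :: real
  assumes n: "0 < n"
    and K1: "1 \<le> K" and eta: "0 < eta" "eta \<le> 1" "12 * K * eta \<le> lam" "12 * K * eta \<le> c"
    and c: "0 < c" "1 \<le> K * c" "c \<le> K" and p0: "1 \<le> K * p m k" and kap: "0 < kap"
    and g_bound: "\<And>v. v \<bullet> (g *v v) \<le> K * (norm v)\<^sup>2"
    and A11: "\<And>v. \<bar>form 1 A11 v\<bar> \<le> K * norm v"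
    and A21: "\<And>v. \<bar>form 2 A21 v\<bar> \<le> K * (norm v)\<^sup>2"
    and A30: "\<And>v. \<bar>form 3 A30 v\<bar> \<le> K * norm v ^ 3"
    and A40: "\<And>v. \<bar>form 4 A40 v\<bar> \<le> K * norm v ^ 4"
    and P1: "\<And>v. \<bar>form 1 P1 v\<bar> \<le> K * norm v"
    and P2: "\<And>v. \<bar>form 2 P2 v\<bar> \<le> K * (norm v)\<^sup>2"
    and A02: "\<bar>A02\<bar> \<le> K" and dp: "\<bar>dp\<bar> \<le> K"
    and box: "\<And>v s. norm v < eta \<Longrightarrow> - eta < s \<Longrightarrow> s \<le> 0 \<Longrightarrow> (m + v, k + s) \<in> D"
    and expand_L: "\<And>v s. norm v < eta \<Longrightarrow> - eta < s \<Longrightarrow> s \<le> 0 \<Longrightarrow>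
      \<bar>L (m + v) (k + s) - L m k - (- (v \<bullet> (g *v v)) / 2 + form 3 A30 v / 6 + form 4 A40 v / 24
         + s * (c + form 1 A11 v + form 2 A21 v / 2) + A02 * s\<^sup>2 / 2)\<bar>
      \<le> K * (norm v ^ 5 + \<bar>s\<bar> * norm v ^ 3 + s\<^sup>2 * norm v + \<bar>s\<bar> ^ 3)"
    and expand_p: "\<And>v s. norm v < eta \<Longrightarrow> - eta < s \<Longrightarrow> s \<le> 0 \<Longrightarrow>
      \<bar>p (m + v) (k + s) - (p m k + form 1 P1 v + form 2 P2 v / 2 + dp * s)\<bar>
      \<le> K * (norm v ^ 3 + norm v * \<bar>s\<bar> + s\<^sup>2)"
    and far: "\<And>\<theta> \<gamma>. (\<theta>, \<gamma>) \<in> D \<Longrightarrow> \<gamma> \<le> k \<Longrightarrow> \<not> (norm (\<theta> - m) < eta \<and> k - eta < \<gamma>) \<Longrightarrow>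
      L \<theta> \<gamma> \<le> L m k - kap"
    and p_nonneg: "\<And>\<theta> \<gamma>. (\<theta>, \<gamma>) \<in> D \<Longrightarrow> 0 \<le> p \<theta> \<gamma>"
    and p_int: "integrable lborel (\<lambda>z. indicator D z * p (fst z) (snd z))"
    and p_mass: "(\<integral>z. indicator D z * p (fst z) (snd z) \<partial>lborel) = 1"
    and D_meas [measurable]: "D \<in> sets borel"
    and L_meas [measurable]: "(\<lambda>z. indicator D z * L (fst z) (snd z)) \<in> borel_measurable borel"
begin

definition e :: real where "e = 1 / sqrt (real n)"

text \<open>
  With \<open>\<theta> = m + e *\<^sub>R u\<close> and \<open>\<gamma> = k + e\<^sup>2 * (t / c)\<close>, the index \<open>r\<close> of \<open>w3\<close>, \<open>w4\<close>, \<open>b1\<close>, \<open>b2\<close> is the degree in \<open>u\<close> and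
  \<open>t\<close>, where \<open>t\<close> counts twice. As \<open>n * e\<^sup>2 = 1\<close>, the terms of degree 3 and 4 in \<open>n * L\<close> have the factors \<open>e\<close>
  and \<open>e\<^sup>2\<close>.
\<close>

definition w3 :: "real ^ 'd \<Rightarrow> real \<Rightarrow> real" where
  "w3 u t = form 1 A11 u * (t / c) + form 3 A30 u / 6"

definition w4 :: "real ^ 'd \<Rightarrow> real \<Rightarrow> real" where
  "w4 u t = form 4 A40 u / 24 + form 2 A21 u * (t / c) / 2 + A02 * (t / c)\<^sup>2 / 2"

definition b1 :: "real ^ 'd \<Rightarrow> real" where
  "b1 u = form 1 P1 u / p m k"

definition b2 :: "real ^ 'd \<Rightarrow> real \<Rightarrow> real" where
  "b2 u t = (form 2 P2 u / 2 + dp * (t / c)) / p m k"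

definition a1 :: "real ^ 'd \<Rightarrow> real \<Rightarrow> real" where
  "a1 u t = b1 u + w3 u t"

definition a2 :: "real ^ 'd \<Rightarrow> real \<Rightarrow> real" where
  "a2 u t = b2 u t + b1 u * w3 u t + w4 u t + (w3 u t)\<^sup>2 / 2"

definition rho :: "real ^ 'd \<Rightarrow> real \<Rightarrow> real" where
  "rho u t = (1 + norm u) * (1 + \<bar>t\<bar>)"

definition dom :: "real ^ 'd \<Rightarrow> real \<Rightarrow> real" where
  "dom u t = exp (- (lam / 4) * (norm u)\<^sup>2) * exp (t / 2)"

text \<open>The unnormalized posterior density, relative to its value at \<open>(m, k)\<close>.\<close>

definition kernel :: "real ^ 'd \<Rightarrow> real \<Rightarrow> real" where
  "kernel \<theta> \<gamma> = indicator D (\<theta>, \<gamma>) * indicator {..k} \<gamma> * (p \<theta> \<gamma> / p m k * exp (real n * (L \<theta> \<gamma> - L m k)))"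

definition in_box :: "real ^ 'd \<Rightarrow> real \<Rightarrow> bool" where
  "in_box \<theta> \<gamma> \<longleftrightarrow> norm (\<theta> - m) < eta \<and> k - eta < \<gamma> \<and> \<gamma> \<le> k"

definition M :: real where "M = 4 * K ^ 4"

definition C1 :: real where "C1 = 200 * M ^ 4 + 7 * M\<^sup>2 * (K / eta) ^ 3"

lemma e_pos: "0 < e" and e_le_1: "e \<le> 1" and n_e: "real n * e\<^sup>2 = 1"
  using n by (auto simp: e_def field_simps power_divide)

lemma p0_pos: "0 < p m k"
  using p0 K1 by (smt (verit) mult_nonneg_nonpos)

lemma inverse_p0_le: "1 / p m k \<le> K"
  using p0 p0_pos by (simp add: field_simps)

lemma inverse_c_le: "1 / c \<le> K"
  using c by (simp add: field_simps)

lemma rho_ge_1: "1 \<le> rho u t"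
  using mult_mono[of 1 "1 + norm u" 1 "1 + \<bar>t\<bar>"] by (simp add: rho_def)

lemma rho_ge: "norm u \<le> rho u t" "\<bar>t\<bar> \<le> rho u t" "norm u * \<bar>t\<bar> \<le> rho u t"
  by (simp_all add: rho_def algebra_simps)

lemma monomial_le_rho: "norm u ^ i * \<bar>t\<bar> ^ j \<le> rho u t ^ max i j"
proof -
  have "norm u ^ i * \<bar>t\<bar> ^ j \<le> (1 + norm u) ^ i * (1 + \<bar>t\<bar>) ^ j"
    by (intro mult_mono power_mono) auto
  also have "\<dots> \<le> (1 + norm u) ^ max i j * (1 + \<bar>t\<bar>) ^ max i j"
    by (intro mult_mono power_increasing) auto
  finally show ?thesis by (simp add: rho_def power_mult_distrib)
qed

lemma monomial_le_rho': "i \<le> r \<Longrightarrow> j \<le> r \<Longrightarrow> norm u ^ i * \<bar>t\<bar> ^ j \<le> rho u t ^ r"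
  using monomial_le_rho[of u i t j] power_increasing[of "max i j" r "rho u t"] rho_ge_1[of u t]
  by simp

lemma abs_t_c: "\<bar>t / c\<bar> \<le> K * \<bar>t\<bar>"
  using mult_right_mono[OF inverse_c_le, of "\<bar>t\<bar>"] c by simp

lemma M_ge: "i \<le> 4 \<Longrightarrow> 4 * K ^ i \<le> M" "1 \<le> M"
proof -
  show "i \<le> 4 \<Longrightarrow> 4 * K ^ i \<le> M"
    using K1 power_increasing[of i 4 K] by (simp add: M_def)
  show "1 \<le> M" using one_le_power[OF K1, of 4] unfolding M_def by linarith
qed

lemma w3_bound: "\<bar>w3 u t\<bar> \<le> M * rho u t ^ 3"
proof -
  have "\<bar>form 1 A11 u * (t / c)\<bar> \<le> (K * norm u) * (K * \<bar>t\<bar>)"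
    by (rule abs_mult_le[OF A11 abs_t_c])
  also have "\<dots> = K\<^sup>2 * (norm u ^ 1 * \<bar>t\<bar> ^ 1)" by (simp add: power2_eq_square)
  also have "\<dots> \<le> K\<^sup>2 * rho u t ^ 3" by (intro mult_left_mono monomial_le_rho') auto
  finally have 1: "\<bar>form 1 A11 u * (t / c)\<bar> \<le> K\<^sup>2 * rho u t ^ 3" .
  have "\<bar>form 3 A30 u\<bar> \<le> K * (norm u ^ 3 * \<bar>t\<bar> ^ 0)" using A30 by simp
  also have "\<dots> \<le> K * rho u t ^ 3" using K1 by (intro mult_left_mono monomial_le_rho') auto
  finally have 2: "\<bar>form 3 A30 u\<bar> \<le> K ^ 1 * rho u t ^ 3" by simp
  have "0 \<le> rho u t ^ 3" using rho_ge_1[of u t] by simp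
  then have "4 * K\<^sup>2 * rho u t ^ 3 \<le> M * rho u t ^ 3" "4 * K ^ 1 * rho u t ^ 3 \<le> M * rho u t ^ 3"
    by (intro mult_right_mono M_ge; simp)+
  then show ?thesis unfolding w3_def using 1 2 by linarith
qed

lemma w4_bound: "\<bar>w4 u t\<bar> \<le> M * rho u t ^ 4"
proof -
  have "\<bar>form 2 A21 u * (t / c)\<bar> \<le> (K * (norm u)\<^sup>2) * (K * \<bar>t\<bar>)"
    by (rule abs_mult_le[OF A21 abs_t_c])
  also have "\<dots> = K\<^sup>2 * (norm u ^ 2 * \<bar>t\<bar> ^ 1)" by (simp add: power2_eq_square)
  also have "\<dots> \<le> K\<^sup>2 * rho u t ^ 4" by (intro mult_left_mono monomial_le_rho') auto
  finally have 1: "\<bar>form 2 A21 u * (t / c)\<bar> \<le> K\<^sup>2 * rho u t ^ 4" .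
  have "\<bar>form 4 A40 u\<bar> \<le> K * (norm u ^ 4 * \<bar>t\<bar> ^ 0)" using A40 by simp
  also have "\<dots> \<le> K * rho u t ^ 4" using K1 by (intro mult_left_mono monomial_le_rho') auto
  finally have 2: "\<bar>form 4 A40 u\<bar> \<le> K ^ 1 * rho u t ^ 4" by simp
  have "\<bar>A02 * (t / c * (t / c))\<bar> \<le> K * ((K * \<bar>t\<bar>) * (K * \<bar>t\<bar>))"
    by (intro abs_mult_le A02 abs_t_c)
  also have "\<dots> = K ^ 3 * (norm u ^ 0 * \<bar>t\<bar> ^ 2)" by (simp add: power2_eq_square power3_eq_cube)
  also have "\<dots> \<le> K ^ 3 * rho u t ^ 4" using K1 by (intro mult_left_mono monomial_le_rho') auto
  finally have 3: "\<bar>A02 * (t / c)\<^sup>2\<bar> \<le> K ^ 3 * rho u t ^ 4" by (simp add: power2_eq_square)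
  have "0 \<le> rho u t ^ 4" using rho_ge_1[of u t] by simp
  then have "4 * K\<^sup>2 * rho u t ^ 4 \<le> M * rho u t ^ 4" "4 * K ^ 1 * rho u t ^ 4 \<le> M * rho u t ^ 4"
    "4 * K ^ 3 * rho u t ^ 4 \<le> M * rho u t ^ 4"
    by (intro mult_right_mono M_ge; simp)+
  moreover define x where "x = form 2 A21 u * (t / c)"
  moreover define y where "y = A02 * (t / c)\<^sup>2"
  ultimately have "\<bar>form 4 A40 u / 24 + x / 2 + y / 2\<bar> \<le> M * rho u t ^ 4"
    using 1 2 3 by linarith
  then show ?thesis by (simp add: w4_def x_def y_def)
qed

lemma abs_div_p0: "\<bar>x / p m k\<bar> \<le> K * \<bar>x\<bar>"
  using mult_right_mono[OF inverse_p0_le, of "\<bar>x\<bar>"] p0_pos by simp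

lemma b1_bound: "\<bar>b1 u\<bar> \<le> M * rho u t"
proof -
  have "\<bar>b1 u\<bar> \<le> K * \<bar>form 1 P1 u\<bar>" unfolding b1_def by (rule abs_div_p0)
  also have "\<dots> \<le> K * (K * norm u)" using K1 by (intro mult_left_mono P1) auto
  also have "\<dots> = K\<^sup>2 * norm u" by (simp add: power2_eq_square)
  also have "\<dots> \<le> M * rho u t"
  proof (rule mult_mono)
    have "4 * K\<^sup>2 \<le> M" by (rule M_ge) simp
    then show "K\<^sup>2 \<le> M" using zero_le_power2[of K] by linarith
  qed (use M_ge(2) rho_ge in auto)
  finally show ?thesis .
qed

lemma b2_bound: "\<bar>b2 u t\<bar> \<le> M * (rho u t)\<^sup>2"
proof -
  have 1: "\<bar>form 2 P2 u\<bar> \<le> K * rho u t ^ 2"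
  proof -
    have "norm u ^ 2 * \<bar>t\<bar> ^ 0 \<le> rho u t ^ 2" by (intro monomial_le_rho') auto
    then have "K * (norm u)\<^sup>2 \<le> K * rho u t ^ 2" using K1 by (intro mult_left_mono) auto
    then show ?thesis using P2[of u] by linarith
  qed
  have "\<bar>dp * (t / c)\<bar> \<le> K * (K * \<bar>t\<bar>)" by (rule abs_mult_le[OF dp abs_t_c])
  also have "\<dots> = K\<^sup>2 * (norm u ^ 0 * \<bar>t\<bar> ^ 1)" by (simp add: power2_eq_square)
  also have "\<dots> \<le> K\<^sup>2 * rho u t ^ 2" by (intro mult_left_mono monomial_le_rho') auto
  finally have 2: "\<bar>dp * (t / c)\<bar> \<le> K\<^sup>2 * rho u t ^ 2" .
  have le: "K * (rho u t)\<^sup>2 \<le> K\<^sup>2 * (rho u t)\<^sup>2"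
    using K1 by (intro mult_right_mono) (auto simp: power2_eq_square)
  have "\<bar>b2 u t\<bar> \<le> K * \<bar>form 2 P2 u / 2 + dp * (t / c)\<bar>" unfolding b2_def by (rule abs_div_p0)
  also have "\<dots> \<le> K * (2 * (K\<^sup>2 * (rho u t)\<^sup>2))"
    using K1 1 2 le by (intro mult_left_mono) linarith+
  also have "\<dots> = (2 * K ^ 3) * (rho u t)\<^sup>2" by (simp add: eval_nat_numeral)
  also have "\<dots> \<le> M * (rho u t)\<^sup>2"
  proof (rule mult_right_mono)
    have "4 * K ^ 3 \<le> M" by (rule M_ge) simp
    moreover have "0 \<le> K ^ 3" using K1 by simp
    ultimately show "2 * K ^ 3 \<le> M" by linarith
  qed simp
  finally show ?thesis .
qed

lemma gauss_dom:
  assumes "t \<le> 0" shows "gauss u * exp t \<le> dom u t"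
proof -
  have "gauss u \<le> exp (- (lam / 2) * (norm u)\<^sup>2)" by (rule gauss_le)
  also have "\<dots> \<le> exp (- (lam / 4) * (norm u)\<^sup>2)" using lam_pos by (simp add: mult_right_mono)
  finally show ?thesis unfolding dom_def using assms by (intro mult_mono) auto
qed

text \<open>
  In the box the terms of higher order use up at most half of the quadratic and half of the linear
  decay. After rescaling, what is left is the integrable majorant \<open>dom\<close>.
\<close>

lemma box_decay:
  assumes v: "norm v < eta" and s: "- eta < s" "s \<le> 0"
  shows "L (m + v) (k + s) - L m k \<le> - (lam / 4) * (norm v)\<^sup>2 + c * s / 2"
proof -
  define N where "N = norm v"
  define S where "S = \<bar>s\<bar>"
  have N: "0 \<le> N" "N \<le> eta" "N \<le> 1" and S: "0 \<le> S" "S \<le> eta" "S \<le> 1" and sS: "s = - S"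
    using v s eta by (auto simp: N_def S_def)
  have K0: "0 \<le> K" using K1 by simp
  \<comment> \<open>Each monomial of higher order is at most \<open>eta\<close> times \<open>N\<^sup>2\<close> or \<open>eta\<close> times \<open>S\<close>.\<close>
  have N3: "N ^ 3 \<le> eta * N\<^sup>2" using mult_right_mono[OF N(2), of "N\<^sup>2"] by (simp add: eval_nat_numeral)
  have "N ^ 4 \<le> N ^ 3" "N ^ 5 \<le> N ^ 3" using N by (intro power_decreasing; simp)+
  then have N45: "N ^ 4 \<le> eta * N\<^sup>2" "N ^ 5 \<le> eta * N\<^sup>2" using N3 by auto
  have "N\<^sup>2 \<le> N" "N ^ 3 \<le> N" using N power_decreasing[of 1 2 N] power_decreasing[of 1 3 N] by auto
  then have N23: "N\<^sup>2 \<le> eta" "N ^ 3 \<le> eta" using N by auto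
  have S2: "S\<^sup>2 \<le> eta * S" using mult_right_mono[OF S(2,1)] by (simp add: power2_eq_square)
  have "S ^ 3 \<le> S\<^sup>2" using S by (intro power_decreasing) auto
  then have S3: "S ^ 3 \<le> eta * S" using S2 by simp
  have SN: "S * N \<le> eta * S" "S * N\<^sup>2 \<le> eta * S" "S * N ^ 3 \<le> eta * S"
    using N S N23 by (auto simp: mult.commute[of eta] intro!: mult_left_mono)
  have S2N: "S\<^sup>2 * N \<le> eta * S"
  proof -
    have "S\<^sup>2 * N \<le> S\<^sup>2" using N S by (simp add: mult_left_le)
    then show ?thesis using S2 by simp
  qed
  have q: "lam * N\<^sup>2 \<le> v \<bullet> (g *v v)" unfolding N_def by (rule g_coercive)
  have f3: "\<bar>form 3 A30 v\<bar> \<le> K * (eta * N\<^sup>2)"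
    using A30[of v] mult_left_mono[OF N3 K0] unfolding N_def by linarith
  have f4: "\<bar>form 4 A40 v\<bar> \<le> K * (eta * N\<^sup>2)"
    using A40[of v] mult_left_mono[OF N45(1) K0] unfolding N_def by linarith
  have f1: "\<bar>s * form 1 A11 v\<bar> \<le> K * (eta * S)"
  proof -
    have "\<bar>s * form 1 A11 v\<bar> \<le> S * (K * N)" by (rule abs_mult_le) (use A11 in \<open>auto simp: S_def N_def\<close>)
    then show ?thesis using mult_left_mono[OF SN(1) K0] by (simp add: mult_ac)
  qed
  have f2: "\<bar>s * form 2 A21 v\<bar> \<le> K * (eta * S)"
  proof -
    have "\<bar>s * form 2 A21 v\<bar> \<le> S * (K * N\<^sup>2)" by (rule abs_mult_le) (use A21 in \<open>auto simp: S_def N_def\<close>)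
    then show ?thesis using mult_left_mono[OF SN(2) K0] by (simp add: mult_ac)
  qed
  have fs: "\<bar>A02 * s\<^sup>2\<bar> \<le> K * (eta * S)"
  proof -
    have "\<bar>A02 * s\<^sup>2\<bar> \<le> K * S\<^sup>2" by (rule abs_mult_le) (use A02 in \<open>auto simp: S_def\<close>)
    then show ?thesis using mult_left_mono[OF S2 K0] by simp
  qed
  have "K * (N ^ 5 + S * N ^ 3 + S\<^sup>2 * N + S ^ 3) \<le> K * (eta * N\<^sup>2 + 3 * (eta * S))"
    using N45 SN S2N S3 by (intro mult_left_mono K0) linarith
  then have R: "K * (norm v ^ 5 + \<bar>s\<bar> * norm v ^ 3 + s\<^sup>2 * norm v + \<bar>s\<bar> ^ 3) \<le> K * (eta * N\<^sup>2) + 3 * (K * (eta * S))"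
    unfolding N_def S_def by (simp add: algebra_simps)
  have le1: "12 * (K * (eta * N\<^sup>2)) \<le> lam * N\<^sup>2"
    using mult_right_mono[OF eta(3), of "N\<^sup>2"] by (simp add: mult_ac)
  have le2: "12 * (K * (eta * S)) \<le> c * S"
    using mult_right_mono[OF eta(4) S(1)] by (simp add: mult_ac)
  have nn: "0 \<le> K * (eta * N\<^sup>2)" "0 \<le> K * (eta * S)" using K0 eta S by auto
  have expand: "s * (c + form 1 A11 v + form 2 A21 v / 2) = - (c * S) + s * form 1 A11 v + (s * form 2 A21 v) / 2"
    by (simp add: sS algebra_simps)
  have "L (m + v) (k + s) - L m k \<le> - (lam / 4) * N\<^sup>2 - c * S / 2"
    using expand_L[OF v s, THEN abs_le_D1] R q f1[THEN abs_le_D1] f2[THEN abs_le_D1]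
      f3[THEN abs_le_D1] f4[THEN abs_le_D1] fs[THEN abs_le_D1] le1 le2 nn
    unfolding expand by linarith
  then show ?thesis by (simp add: N_def sS)
qed

lemma inverse_n: "1 / real n = e\<^sup>2"
  using n by (simp add: e_def power_divide)

lemma scaled_gamma: "k + t / (real n * c) = k + e\<^sup>2 * (t / c)"
  by (simp add: inverse_n[symmetric])

lemma in_box_scaled:
  assumes "in_box (m + e *\<^sub>R u) (k + t / (real n * c))"
  shows "norm (e *\<^sub>R u) < eta" "- eta < e\<^sup>2 * (t / c)" "e\<^sup>2 * (t / c) \<le> 0"
  using assms unfolding in_box_def scaled_gamma by auto

text \<open>
  Every error monomial of the two expansions has degree at least 5 (for \<open>L\<close>, which is multiplied by
  \<open>n\<close>) or 3 (for \<open>p\<close>) if \<open>s\<close> counts twice, hence a factor \<open>e ^ 3\<close> after rescaling.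
\<close>

lemma kernel_expand:
  assumes t: "t \<le> 0" and box': "in_box (m + e *\<^sub>R u) (k + t / (real n * c))"
  shows "\<bar>kernel (m + e *\<^sub>R u) (k + t / (real n * c)) - gauss u * exp t * (1 + e * a1 u t + e\<^sup>2 * a2 u t)\<bar>
    \<le> 200 * M ^ 4 * e ^ 3 * rho u t ^ 18 * dom u t"
proof -
  define v where "v = e *\<^sub>R u"
  define \<tau> where "\<tau> = t / c"
  define s where "s = e\<^sup>2 * \<tau>"
  define \<rho> where "\<rho> = rho u t"
  define U where "U = norm u"
  define T where "T = \<bar>t\<bar>"
  have vs: "norm v < eta" "- eta < s" "s \<le> 0"
    using in_box_scaled[OF box'] by (auto simp: v_def s_def \<tau>_def)
  have \<rho>1: "1 \<le> \<rho>" unfolding \<rho>_def by (rule rho_ge_1)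
  have U0: "0 \<le> U" "0 \<le> T" by (auto simp: U_def T_def)
  have K0: "0 \<le> K" using K1 by simp
  have mono: "U ^ i * T ^ j \<le> \<rho> ^ r" if "i \<le> r" "j \<le> r" for i j r
    unfolding U_def T_def \<rho>_def using that by (rule monomial_le_rho')
  have nv: "norm v = e * U" using e_pos by (simp add: v_def U_def)
  have \<tau>: "\<bar>\<tau>\<bar> \<le> K * T" unfolding \<tau>_def T_def by (rule abs_t_c)
  have abs_s: "\<bar>s\<bar> = e\<^sup>2 * \<bar>\<tau>\<bar>" by (simp add: s_def abs_mult)
  define dL where "dL = L (m + v) (k + s) - L m k"
  define Q where "Q = t - (u \<bullet> (g *v u)) / 2"
  define r where "r = real n * dL - (Q + e * w3 u t + e\<^sup>2 * w4 u t)"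
  define X where "X = - (v \<bullet> (g *v v)) / 2 + form 3 A30 v / 6 + form 4 A40 v / 24
         + s * (c + form 1 A11 v + form 2 A21 v / 2) + A02 * s\<^sup>2 / 2"
  have nX: "real n * X = Q + e * w3 u t + e\<^sup>2 * w4 u t"
  proof -
    have q: "v \<bullet> (g *v v) = e\<^sup>2 * (u \<bullet> (g *v u))"
      by (simp add: v_def matrix_vector_mult_scaleR power2_eq_square)
    have sc: "s * c = e\<^sup>2 * t" using c by (simp add: s_def \<tau>_def)
    have "X = e\<^sup>2 * (Q + e * w3 u t + e\<^sup>2 * w4 u t)"
      unfolding X_def q distrib_left sc
      unfolding v_def form_scaleR Q_def w3_def w4_def s_def \<tau>_def[symmetric]
      by (simp add: eval_nat_numeral field_simps)
    then show ?thesis using n_e by (simp add: mult.assoc[symmetric])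
  qed
  have r: "\<bar>r\<bar> \<le> M * e ^ 3 * \<rho> ^ 5"
  proof -
    have "r = real n * (dL - X)" unfolding r_def nX[symmetric] by (simp add: algebra_simps)
    then have "\<bar>r\<bar> = real n * \<bar>dL - X\<bar>" by (simp add: abs_mult)
    also have "\<dots> \<le> real n * (K * (norm v ^ 5 + \<bar>s\<bar> * norm v ^ 3 + s\<^sup>2 * norm v + \<bar>s\<bar> ^ 3))"
      unfolding dL_def X_def by (intro mult_left_mono expand_L vs) auto
    also have "s\<^sup>2 = \<bar>s\<bar>\<^sup>2" by simp
    also have "real n * (K * (norm v ^ 5 + \<bar>s\<bar> * norm v ^ 3 + \<bar>s\<bar>\<^sup>2 * norm v + \<bar>s\<bar> ^ 3))
        = (real n * e\<^sup>2) * (K * e ^ 3 * (U ^ 5 + \<bar>\<tau>\<bar> * U ^ 3 + \<bar>\<tau>\<bar>\<^sup>2 * U + e * \<bar>\<tau>\<bar> ^ 3))"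
      unfolding nv abs_s by (simp add: eval_nat_numeral algebra_simps)
    also have "\<dots> = K * e ^ 3 * (U ^ 5 + \<bar>\<tau>\<bar> * U ^ 3 + \<bar>\<tau>\<bar>\<^sup>2 * U + e * \<bar>\<tau>\<bar> ^ 3)" by (simp add: n_e)
    also have "\<dots> \<le> K * e ^ 3 * (4 * K ^ 3 * \<rho> ^ 5)"
    proof (rule mult_left_mono)
      have K3: "x \<le> K ^ 3 * \<rho> ^ 5" if "x \<le> K ^ i * \<rho> ^ 5" "i \<le> 3" for x i
        by (rule order_trans[OF that(1)], intro mult_right_mono power_increasing that(2) K1) (use \<rho>1 in auto)
      have "U ^ 5 \<le> K ^ 3 * \<rho> ^ 5" by (rule K3[of _ 0]) (use mono[of 5 5 0] in auto)
      moreover have "\<bar>\<tau>\<bar> * U ^ 3 \<le> K ^ 3 * \<rho> ^ 5"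
      proof (rule K3[of _ 1])
        have "\<bar>\<tau>\<bar> * U ^ 3 \<le> (K * T) * U ^ 3" using \<tau> U0 by (intro mult_right_mono) auto
        also have "\<dots> = K * (U ^ 3 * T ^ 1)" by simp
        also have "\<dots> \<le> K * \<rho> ^ 5" by (intro mult_left_mono mono K0) auto
        finally show "\<bar>\<tau>\<bar> * U ^ 3 \<le> K ^ 1 * \<rho> ^ 5" by simp
      qed simp
      moreover have "\<bar>\<tau>\<bar>\<^sup>2 * U \<le> K ^ 3 * \<rho> ^ 5"
      proof (rule K3[of _ 2])
        have "\<bar>\<tau>\<bar>\<^sup>2 * U \<le> (K * T)\<^sup>2 * U" using \<tau> U0 by (intro mult_right_mono power_mono) auto
        also have "\<dots> = K\<^sup>2 * (U ^ 1 * T ^ 2)" by (simp add: power_mult_distrib)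
        also have "\<dots> \<le> K\<^sup>2 * \<rho> ^ 5" by (intro mult_left_mono mono) auto
        finally show "\<bar>\<tau>\<bar>\<^sup>2 * U \<le> K ^ 2 * \<rho> ^ 5" .
      qed simp
      moreover have "e * \<bar>\<tau>\<bar> ^ 3 \<le> K ^ 3 * \<rho> ^ 5"
      proof -
        have "e * \<bar>\<tau>\<bar> ^ 3 \<le> 1 * (K * T) ^ 3"
          using \<tau> e_pos e_le_1 by (intro mult_mono power_mono) auto
        also have "\<dots> = K ^ 3 * (U ^ 0 * T ^ 3)" by (simp add: power_mult_distrib)
        also have "\<dots> \<le> K ^ 3 * \<rho> ^ 5" using K0 by (intro mult_left_mono mono) auto
        finally show ?thesis .
      qed
      ultimately show "U ^ 5 + \<bar>\<tau>\<bar> * U ^ 3 + \<bar>\<tau>\<bar>\<^sup>2 * U + e * \<bar>\<tau>\<bar> ^ 3 \<le> 4 * K ^ 3 * \<rho> ^ 5" by linarith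
    qed (use K0 e_pos in auto)
    also have "\<dots> = M * e ^ 3 * \<rho> ^ 5" by (simp add: M_def eval_nat_numeral)
    finally show ?thesis .
  qed
  define rp where "rp = p (m + v) (k + s) / p m k - (1 + e * b1 u + e\<^sup>2 * b2 u t)"
  have rp: "\<bar>rp\<bar> \<le> M * e ^ 3 * \<rho> ^ 3"
  proof -
    have "rp = (p (m + v) (k + s) - (p m k + form 1 P1 v + form 2 P2 v / 2 + dp * s)) / p m k"
      unfolding rp_def b1_def b2_def v_def form_scaleR s_def \<tau>_def using p0_pos by (simp add: field_simps)
    then have "\<bar>rp\<bar> \<le> K * \<bar>p (m + v) (k + s) - (p m k + form 1 P1 v + form 2 P2 v / 2 + dp * s)\<bar>"
      using abs_div_p0 by metis
    also have "\<dots> \<le> K * (K * (norm v ^ 3 + norm v * \<bar>s\<bar> + s\<^sup>2))"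
      by (intro mult_left_mono expand_p vs K0)
    also have "s\<^sup>2 = \<bar>s\<bar>\<^sup>2" by simp
    also have "K * (K * (norm v ^ 3 + norm v * \<bar>s\<bar> + \<bar>s\<bar>\<^sup>2)) = K\<^sup>2 * e ^ 3 * (U ^ 3 + U * \<bar>\<tau>\<bar> + e * \<bar>\<tau>\<bar>\<^sup>2)"
      unfolding nv abs_s by (simp add: eval_nat_numeral algebra_simps)
    also have "\<dots> \<le> K\<^sup>2 * e ^ 3 * (4 * K\<^sup>2 * \<rho> ^ 3)"
    proof (rule mult_left_mono)
      have K3: "x \<le> K\<^sup>2 * \<rho> ^ 3" if "x \<le> K ^ i * \<rho> ^ 3" "i \<le> 2" for x i
        by (rule order_trans[OF that(1)], intro mult_right_mono power_increasing that(2) K1) (use \<rho>1 in auto)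
      have "U ^ 3 \<le> K\<^sup>2 * \<rho> ^ 3" by (rule K3[of _ 0]) (use mono[of 3 3 0] in auto)
      moreover have "U * \<bar>\<tau>\<bar> \<le> K\<^sup>2 * \<rho> ^ 3"
      proof (rule K3[of _ 1])
        have "U * \<bar>\<tau>\<bar> \<le> U * (K * T)" using \<tau> U0 by (intro mult_left_mono) auto
        also have "\<dots> = K * (U ^ 1 * T ^ 1)" by simp
        also have "\<dots> \<le> K * \<rho> ^ 3" by (intro mult_left_mono mono K0) auto
        finally show "U * \<bar>\<tau>\<bar> \<le> K ^ 1 * \<rho> ^ 3" by simp
      qed simp
      moreover have "e * \<bar>\<tau>\<bar>\<^sup>2 \<le> K\<^sup>2 * \<rho> ^ 3"
      proof -
        have "e * \<bar>\<tau>\<bar>\<^sup>2 \<le> 1 * (K * T)\<^sup>2"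
          using \<tau> e_pos e_le_1 by (intro mult_mono power_mono) auto
        also have "\<dots> = K\<^sup>2 * (U ^ 0 * T ^ 2)" by (simp add: power_mult_distrib)
        also have "\<dots> \<le> K\<^sup>2 * \<rho> ^ 3" using K0 by (intro mult_left_mono mono) auto
        finally show ?thesis .
      qed
      moreover have "0 \<le> K\<^sup>2 * \<rho> ^ 3" using \<rho>1 by simp
      ultimately show "U ^ 3 + U * \<bar>\<tau>\<bar> + e * \<bar>\<tau>\<bar>\<^sup>2 \<le> 4 * K\<^sup>2 * \<rho> ^ 3" by linarith
    qed (use K0 e_pos in auto)
    also have "\<dots> = M * e ^ 3 * \<rho> ^ 3" by (simp add: M_def eval_nat_numeral)
    finally show ?thesis .
  qed
  have in_D: "(m + v, k + s) \<in> D" by (rule box[OF vs])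
  have z: "real n * dL = Q + (e * w3 u t + e\<^sup>2 * w4 u t + r)" by (simp add: r_def)
  have ker: "kernel (m + e *\<^sub>R u) (k + t / (real n * c)) = (1 + e * b1 u + e\<^sup>2 * b2 u t + rp) * exp (Q + (e * w3 u t + e\<^sup>2 * w4 u t + r))"
    unfolding scaled_gamma v_def[symmetric] \<tau>_def[symmetric] s_def[symmetric] z[symmetric]
    using in_D vs by (simp add: kernel_def dL_def rp_def)
  have EQ: "exp Q = gauss u * exp t" unfolding Q_def gauss_def by (simp add: exp_add[symmetric])
  have D1: "exp Q \<le> dom u t" unfolding EQ by (rule gauss_dom[OF t])
  have D2: "exp (Q + (e * w3 u t + e\<^sup>2 * w4 u t + r)) \<le> dom u t"
  proof -
    have "real n * dL \<le> real n * (- (lam / 4) * (norm v)\<^sup>2 + c * s / 2)"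
      unfolding dL_def by (intro mult_left_mono box_decay vs) auto
    also have "\<dots> = (real n * e\<^sup>2) * (- (lam / 4) * U\<^sup>2 + t / 2)"
      using c by (simp add: nv s_def \<tau>_def power_mult_distrib algebra_simps)
    also have "\<dots> = - (lam / 4) * U\<^sup>2 + t / 2" by (simp add: n_e)
    finally show ?thesis unfolding z[symmetric] dom_def exp_add[symmetric] U_def by simp
  qed
  show ?thesis
    unfolding ker a1_def a2_def EQ[symmetric] \<rho>_def[symmetric]
    using expansion_bound[OF e_pos e_le_1 M_ge(2) \<rho>1 _ _ r _ _ rp D1 D2]
      w3_bound[of u t] w4_bound[of u t] b1_bound[of u t] b2_bound[of u t]
    unfolding \<rho>_def by blast
qed

lemma a1_bound: "\<bar>a1 u t\<bar> \<le> 7 * M\<^sup>2 * rho u t ^ 6"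
  and a2_bound: "\<bar>a2 u t\<bar> \<le> 4 * M\<^sup>2 * rho u t ^ 6"
  and main_bound: "\<bar>1 + e * a1 u t + e\<^sup>2 * a2 u t\<bar> \<le> 7 * M\<^sup>2 * rho u t ^ 6"
proof -
  define \<rho> where "\<rho> = rho u t"
  have \<rho>: "1 \<le> \<rho>" unfolding \<rho>_def by (rule rho_ge_1)
  note pl = powers_le[OF \<rho> M_ge(2) zero_less_one order_refl, of _ _ _ _ 0 0, simplified]
  note b = w3_bound[of u t] w4_bound[of u t] b1_bound[of u t] b2_bound[of u t]
  have a1': "\<bar>a1 u t\<bar> \<le> 2 * (M\<^sup>2 * \<rho> ^ 6)"
    using b pl[of 1 2 3 6] pl[of 1 2 1 6] unfolding a1_def \<rho>_def[symmetric] by simp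
  have bw: "\<bar>b1 u * w3 u t\<bar> \<le> M\<^sup>2 * \<rho> ^ 4"
    using abs_mult_le[OF b(3,1)] unfolding \<rho>_def by (simp add: eval_nat_numeral mult_ac)
  have "\<bar>w3 u t * w3 u t\<bar> \<le> M\<^sup>2 * \<rho> ^ 6"
    using abs_mult_le[OF b(1,1)] unfolding \<rho>_def by (simp add: eval_nat_numeral mult_ac)
  then have w33: "\<bar>(w3 u t)\<^sup>2\<bar> \<le> M\<^sup>2 * \<rho> ^ 6" by (simp add: power2_eq_square)
  have a2': "\<bar>a2 u t\<bar> \<le> 4 * (M\<^sup>2 * \<rho> ^ 6)"
  proof -
    have "\<bar>a2 u t\<bar> \<le> \<bar>b2 u t\<bar> + \<bar>b1 u * w3 u t\<bar> + \<bar>w4 u t\<bar> + \<bar>(w3 u t)\<^sup>2\<bar>"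
      unfolding a2_def using abs_sum4_le[OF zero_le_power2] .
    moreover have "\<bar>b2 u t\<bar> \<le> M\<^sup>2 * \<rho> ^ 6" using b(4) pl[of 1 2 2 6] by (simp add: \<rho>_def)
    moreover have "\<bar>b1 u * w3 u t\<bar> \<le> M\<^sup>2 * \<rho> ^ 6" using bw pl[of 2 2 4 6] by simp
    moreover have "\<bar>w4 u t\<bar> \<le> M\<^sup>2 * \<rho> ^ 6" using b(2) pl[of 1 2 4 6] by (simp add: \<rho>_def)
    ultimately show ?thesis using w33 by simp
  qed
  then show "\<bar>a2 u t\<bar> \<le> 4 * M\<^sup>2 * rho u t ^ 6" by (simp add: \<rho>_def)
  have pos: "0 \<le> M\<^sup>2 * \<rho> ^ 6" using \<rho> by simp
  then show "\<bar>a1 u t\<bar> \<le> 7 * M\<^sup>2 * rho u t ^ 6" using a1' unfolding \<rho>_def by linarith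
  have "\<bar>e * a1 u t\<bar> \<le> 1 * (2 * (M\<^sup>2 * \<rho> ^ 6))" by (rule abs_mult_le[OF _ a1']) (use e_pos e_le_1 in auto)
  moreover have "\<bar>e\<^sup>2 * a2 u t\<bar> \<le> 1 * (4 * (M\<^sup>2 * \<rho> ^ 6))"
    by (rule abs_mult_le[OF _ a2']) (use e_pos e_le_1 in \<open>auto simp: power_le_one\<close>)
  moreover have "1 \<le> M\<^sup>2 * \<rho> ^ 6" using pl[of 0 2 0 6] by simp
  ultimately show "\<bar>1 + e * a1 u t + e\<^sup>2 * a2 u t\<bar> \<le> 7 * M\<^sup>2 * rho u t ^ 6"
    unfolding \<rho>_def by linarith
qed

text \<open>
  Outside of the box \<open>K * e * rho u t\<close> is at least \<open>eta\<close>, so a factor \<open>(K / eta * e * rho u t) ^ 3\<close> can be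
  inserted for free.
\<close>

lemma main_outside:
  assumes t: "t \<le> 0" and out: "\<not> in_box (m + e *\<^sub>R u) (k + t / (real n * c))"
  shows "\<bar>gauss u * exp t * (1 + e * a1 u t + e\<^sup>2 * a2 u t)\<bar>
    \<le> 7 * M\<^sup>2 * (K / eta) ^ 3 * e ^ 3 * rho u t ^ 18 * dom u t"
proof -
  define \<rho> where "\<rho> = rho u t"
  have \<rho>: "1 \<le> \<rho>" unfolding \<rho>_def by (rule rho_ge_1)
  have "eta \<le> K * e * \<rho>"
  proof -
    have "k + e\<^sup>2 * (t / c) \<le> k" using t c by (simp add: divide_nonpos_pos mult_nonneg_nonpos)
    then consider "eta \<le> norm (e *\<^sub>R u)" | "e\<^sup>2 * (t / c) \<le> - eta"
      using out unfolding in_box_def scaled_gamma by force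
    then show ?thesis
    proof cases
      case 1
      then have "eta \<le> e * norm u" using e_pos by simp
      also have "\<dots> \<le> e * \<rho>" unfolding \<rho>_def using e_pos rho_ge(1) by simp
      also have "\<dots> \<le> K * (e * \<rho>)" using mult_right_mono[OF K1, of "e * \<rho>"] e_pos \<rho> by simp
      finally show ?thesis by (simp add: mult_ac)
    next
      case 2
      moreover have "\<bar>t / c\<bar> = - (t / c)" using t c by (intro abs_of_nonpos divide_nonpos_pos)
      ultimately have "eta \<le> e\<^sup>2 * \<bar>t / c\<bar>" by simp
      also have "\<dots> \<le> e * \<bar>t / c\<bar>"
        using e_pos e_le_1 by (intro mult_right_mono) (auto simp: power2_eq_square)
      also have "\<dots> \<le> e * (K * \<bar>t\<bar>)" using e_pos by (intro mult_left_mono abs_t_c) auto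
      also have "\<dots> \<le> e * (K * \<rho>)" unfolding \<rho>_def using e_pos K1 rho_ge(2) by (intro mult_left_mono) auto
      finally show ?thesis by (simp add: mult_ac)
    qed
  qed
  then have "1 \<le> (K / eta) * e * \<rho>" using eta by (simp add: field_simps)
  then have one: "1 \<le> (K / eta) ^ 3 * e ^ 3 * \<rho> ^ 3"
    using one_le_power[of "(K / eta) * e * \<rho>" 3] by (simp only: power_mult_distrib)
  have "\<bar>gauss u * exp t * (1 + e * a1 u t + e\<^sup>2 * a2 u t)\<bar> \<le> dom u t * (7 * M\<^sup>2 * \<rho> ^ 6)"
    using gauss_dom[OF t, of u] gauss_pos[of u] main_bound[of u t] unfolding \<rho>_def
    by (intro abs_mult_le) auto
  also have "\<dots> \<le> (dom u t * (7 * M\<^sup>2 * \<rho> ^ 6)) * ((K / eta) ^ 3 * e ^ 3 * \<rho> ^ 3)"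
  proof -
    have "0 \<le> dom u t * (7 * M\<^sup>2 * \<rho> ^ 6)" using \<rho> by (simp add: dom_def)
    from mult_left_mono[OF one this] show ?thesis by (simp only: mult_1_right)
  qed
  also have "\<dots> = 7 * M\<^sup>2 * (K / eta) ^ 3 * e ^ 3 * \<rho> ^ 9 * dom u t"
    by (simp add: eval_nat_numeral mult_ac)
  also have "\<dots> \<le> 7 * M\<^sup>2 * (K / eta) ^ 3 * e ^ 3 * \<rho> ^ 18 * dom u t"
    using \<rho> e_pos K1 eta by (intro mult_right_mono mult_left_mono power_increasing) (auto simp: dom_def)
  finally show ?thesis by (simp add: \<rho>_def)
qed

definition boxed_kernel :: "real ^ 'd \<Rightarrow> real \<Rightarrow> real" where
  "boxed_kernel \<theta> \<gamma> = of_bool (in_box \<theta> \<gamma>) * kernel \<theta> \<gamma>"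

lemma boxed_kernel_expand:
  "\<bar>boxed_kernel (m + e *\<^sub>R u) (k + t / (real n * c))
      - gauss u * (indicator {..0} t * exp t) * (1 + e * a1 u t + e\<^sup>2 * a2 u t)\<bar>
    \<le> C1 * e ^ 3 * (rho u t ^ 18 * (indicator {..0} t * dom u t))"
proof (cases "t \<le> 0")
  case False
  then have "\<not> in_box (m + e *\<^sub>R u) (k + t / (real n * c))"
    using n c by (simp add: in_box_def field_simps zero_less_divide_iff not_le)
  then show ?thesis using False by (simp add: boxed_kernel_def)
next
  case t: True
  have nn: "0 \<le> M ^ 4 * e ^ 3 * rho u t ^ 18 * dom u t" "0 \<le> M\<^sup>2 * (K / eta) ^ 3 * e ^ 3 * rho u t ^ 18 * dom u t"
    using M_ge(2) e_pos rho_ge_1[of u t] K1 eta by (auto simp: dom_def)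
  have C1: "C1 * e ^ 3 * (rho u t ^ 18 * dom u t)
      = 200 * (M ^ 4 * e ^ 3 * rho u t ^ 18 * dom u t) + 7 * (M\<^sup>2 * (K / eta) ^ 3 * e ^ 3 * rho u t ^ 18 * dom u t)"
    by (simp add: C1_def algebra_simps)
  show ?thesis
  proof (cases "in_box (m + e *\<^sub>R u) (k + t / (real n * c))")
    case True
    then show ?thesis
      using kernel_expand[OF t True] nn t C1 by (simp add: boxed_kernel_def mult.assoc)
  next
    case False
    then show ?thesis
      using main_outside[OF t False] nn t C1 by (simp add: boxed_kernel_def mult.assoc)
  qed
qed

end


section \<open>The normalizing constant and the quotient\<close>

lemma power_div_fact_le_exp:
  fixes x :: real
  assumes "0 \<le> x" shows "x ^ N / fact N \<le> exp x"
proof -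
  obtain t where t: "exp x = (\<Sum>m<Suc N. x ^ m / fact m) + exp t / fact (Suc N) * x ^ Suc N"
    using Maclaurin_exp_le[of x "Suc N"] by blast
  have "x ^ N / fact N \<le> (\<Sum>m<Suc N. x ^ m / fact m)"
    using assms by (intro member_le_sum) auto
  moreover have "0 \<le> exp t / fact (Suc N) * x ^ Suc N" using assms by (intro mult_nonneg_nonneg) auto
  ultimately show ?thesis unfolding t by linarith
qed

lemma integral_exp_norm_pos:
  assumes "a > 0" shows "0 < (\<integral>v. exp (- a * (norm (v :: real ^ 'd::finite))\<^sup>2) \<partial>lborel)"
proof -
  have m: "mat (2 * a) *v v = (2 * a) *\<^sub>R v" for v :: "real ^ 'd"
    by (simp add: vec_eq_iff matrix_vector_mult_def mat_def if_distrib if_distribR cong: if_cong)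
  interpret gaussian "mat (2 * a) :: real ^ 'd ^ 'd" "2 * a"
    by unfold_locales (use assms in \<open>auto simp: m power2_norm_eq_inner\<close>)
  have "gauss = (\<lambda>v. exp (- a * (norm v)\<^sup>2))"
    by (auto simp: gauss_def m power2_norm_eq_inner)
  then show ?thesis using has_bochner_integral_gauss mass_pos by (simp add: has_bochner_integral_iff)
qed

context laplace
begin

definition unscale :: "(real ^ 'd) \<times> real \<Rightarrow> (real ^ 'd) \<times> real" where
  "unscale w = (m + e *\<^sub>R fst w, k + snd w / (real n * c))"

text \<open>The Jacobian of the inverse of \<open>unscale\<close>.\<close>

definition jac :: real where "jac = sqrt (real n) ^ CARD('d) * (real n * c)"

lemma jac_pos: "0 < jac"
  using n c by (simp add: jac_def)

lemma measurable_unscale [measurable]: "unscale \<in> borel \<rightarrow>\<^sub>M borel"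
  unfolding unscale_def[abs_def] using n c
  by (intro borel_measurable_continuous_onI continuous_intros) auto

lemma change_variables:
  assumes [measurable]: "f \<in> borel_measurable borel"
  shows "integrable lborel (\<lambda>w. f (unscale w)) \<longleftrightarrow> integrable lborel f"
    and "(\<integral>w. f (unscale w) \<partial>lborel) = jac * (\<integral>z. f z \<partial>lborel :: real)"
proof -
  have eq: "lborel = density (distr lborel borel unscale) (\<lambda>_. ennreal (1 / jac))"
    using lborel_prod_affine[of "sqrt (real n)" "real n * c" m k] n c
    by (simp add: unscale_def[abs_def] e_def jac_def)
  have "integrable lborel f \<longleftrightarrow> integrable (density (distr lborel borel unscale) (\<lambda>_. ennreal (1 / jac))) f"
    by (subst eq) simp
  also have "\<dots> \<longleftrightarrow> integrable lborel (\<lambda>w. (1 / jac) * f (unscale w))"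
    using jac_pos by (simp add: integrable_density integrable_distr_eq)
  also have "\<dots> \<longleftrightarrow> integrable lborel (\<lambda>w. f (unscale w))"
    using jac_pos by (subst integrable_mult_left_iff) auto
  finally show "integrable lborel (\<lambda>w. f (unscale w)) \<longleftrightarrow> integrable lborel f" by simp
  have "(\<integral>z. f z \<partial>lborel) = (\<integral>z. f z \<partial>density (distr lborel borel unscale) (\<lambda>_. ennreal (1 / jac)))"
    by (subst eq) simp
  also have "\<dots> = (\<integral>w. (1 / jac) * f (unscale w) \<partial>lborel)"
    using jac_pos by (simp add: integral_density integral_distr)
  finally show "(\<integral>w. f (unscale w) \<partial>lborel) = jac * (\<integral>z. f z \<partial>lborel)" using jac_pos by simp
qed

definition kernel_pair :: "(real ^ 'd) \<times> real \<Rightarrow> real" where "kernel_pair z = kernel (fst z) (snd z)"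
definition boxed_kernel_pair :: "(real ^ 'd) \<times> real \<Rightarrow> real" where "boxed_kernel_pair z = boxed_kernel (fst z) (snd z)"

lemma kernel_measurable [measurable]: "kernel_pair \<in> borel_measurable borel"
proof -
  define q1 where "q1 z = indicator D z * p (fst z) (snd z)" for z
  define q2 where "q2 z = indicator D z * L (fst z) (snd z)" for z
  have [measurable]: "q1 \<in> borel_measurable borel" "q2 \<in> borel_measurable borel"
    using borel_measurable_integrable[OF p_int] L_meas by (simp_all add: q1_def[abs_def] q2_def[abs_def])
  define A where "A = {z :: (real ^ 'd) \<times> real. snd z \<le> k}"
  have [measurable]: "A \<in> sets borel"
    unfolding A_def by (intro borel_closed closed_Collect_le continuous_intros)
  have "kernel_pair z = indicator A z * (q1 z / p m k * exp (real n * (q2 z - L m k)))" for z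
    by (cases z) (simp add: kernel_pair_def kernel_def indicator_def q1_def q2_def A_def)
  then have "kernel_pair = (\<lambda>z. indicator A z * (q1 z / p m k * exp (real n * (q2 z - L m k))))"
    by (rule ext)
  then show ?thesis by simp
qed

lemma boxed_kernel_measurable [measurable]: "boxed_kernel_pair \<in> borel_measurable borel"
proof -
  define A where "A = {z :: (real ^ 'd) \<times> real. norm (fst z - m) < eta} \<inter> {z. k - eta < snd z} \<inter> {z. snd z \<le> k}"
  have [measurable]: "A \<in> sets borel"
    unfolding A_def
    by (intro sets.Int borel_open borel_closed open_Collect_less closed_Collect_le continuous_intros)
  have "boxed_kernel_pair = (\<lambda>z. indicator A z * kernel_pair z)"
    by (auto simp: boxed_kernel_pair_def kernel_pair_def boxed_kernel_def in_box_def indicator_def A_def)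
  then show ?thesis by simp
qed

lemma kernel_nonneg: "0 \<le> kernel \<theta> \<gamma>"
  using p_nonneg p0_pos by (auto simp: kernel_def indicator_def intro!: mult_nonneg_nonneg)

lemma kernel_le:
  "kernel \<theta> \<gamma> \<le> (if in_box \<theta> \<gamma> then 1 else exp (- kap * real n)) * (indicator D (\<theta>, \<gamma>) * p \<theta> \<gamma> / p m k)"
proof (cases "(\<theta>, \<gamma>) \<in> D \<and> \<gamma> \<le> k")
  case True
  have "exp (real n * (L \<theta> \<gamma> - L m k)) \<le> (if in_box \<theta> \<gamma> then 1 else exp (- kap * real n))"
  proof (cases "in_box \<theta> \<gamma>")
    case box': True
    have "L (m + (\<theta> - m)) (k + (\<gamma> - k)) - L m k \<le> - (lam / 4) * (norm (\<theta> - m))\<^sup>2 + c * (\<gamma> - k) / 2"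
      using box' by (intro box_decay) (auto simp: in_box_def)
    also have "\<dots> \<le> 0"
      using lam_pos c box' by (intro add_nonpos_nonpos) (auto simp: in_box_def mult_nonneg_nonpos)
    finally show ?thesis using box' by (simp add: mult_nonneg_nonpos)
  next
    case False
    then have "L \<theta> \<gamma> - L m k \<le> - kap" using far[of \<theta> \<gamma>] True by (auto simp: in_box_def)
    from mult_left_mono[OF this, of "real n"] show ?thesis using False by (simp add: mult.commute)
  qed
  then show ?thesis
    using True p_nonneg[of \<theta> \<gamma>] p0_pos
      mult_left_mono[of "exp (real n * (L \<theta> \<gamma> - L m k))" "if in_box \<theta> \<gamma> then 1 else exp (- kap * real n)" "p \<theta> \<gamma> / p m k"]
    by (simp add: kernel_def mult.commute)
next
  case False
  then show ?thesis using p_nonneg[of \<theta> \<gamma>] p0_pos by (auto simp: kernel_def indicator_def)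
qed

lemma integrable_kernel: "integrable lborel kernel_pair"
proof (rule Bochner_Integration.integrable_bound)
  show "integrable lborel (\<lambda>z. (indicator D z * p (fst z) (snd z)) / p m k)" using p_int by simp
  show "AE z in lborel. norm (kernel_pair z) \<le> norm ((indicator D z * p (fst z) (snd z)) / p m k)"
  proof (rule AE_I2)
    fix z :: "(real ^ 'd) \<times> real"
    have nn: "0 \<le> indicator D z * p (fst z) (snd z) / p m k"
      using p_nonneg[of "fst z" "snd z"] p0_pos by (simp add: indicator_def)
    have "(if in_box (fst z) (snd z) then 1 else exp (- kap * real n)) \<le> 1" using kap by simp
    from mult_right_mono[OF this nn] kernel_le[of "fst z" "snd z"]
    show "norm (kernel_pair z) \<le> norm ((indicator D z * p (fst z) (snd z)) / p m k)"
      unfolding kernel_pair_def real_norm_def abs_of_nonneg[OF nn] abs_of_nonneg[OF kernel_nonneg] by simp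
  qed
qed simp

lemma integrable_boxed_kernel: "integrable lborel boxed_kernel_pair"
proof (rule Bochner_Integration.integrable_bound[OF integrable_kernel])
  show "AE z in lborel. norm (boxed_kernel_pair z) \<le> norm (kernel_pair z)"
    by (auto simp: boxed_kernel_pair_def kernel_pair_def boxed_kernel_def)
qed simp

text \<open>
  The Jacobian is of order \<open>sqrt n ^ (CARD('d) + 2)\<close>, and a factor \<open>e ^ 3\<close> has to be gained: the exponent
  is the power of \<open>sqrt n\<close> that \<open>exp (- kap * n)\<close> must absorb.
\<close>

definition far_const :: real where
  "far_const = K\<^sup>2 * (fact (CARD('d) + 5) / kap ^ (CARD('d) + 5))"

lemma far_mass: "\<bar>(\<integral>w. kernel_pair (unscale w) \<partial>lborel) - (\<integral>w. boxed_kernel_pair (unscale w) \<partial>lborel)\<bar> \<le> far_const * e ^ 3"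
proof -
  let ?N = "CARD('d) + 5"
  have "(\<integral>z. kernel_pair z - boxed_kernel_pair z \<partial>lborel) \<le> (\<integral>z. exp (- kap * real n) / p m k * (indicator D z * p (fst z) (snd z)) \<partial>lborel)"
  proof (rule integral_mono)
    show "integrable lborel (\<lambda>z. kernel_pair z - boxed_kernel_pair z)"
      using integrable_kernel integrable_boxed_kernel by simp
    show "integrable lborel (\<lambda>z. exp (- kap * real n) / p m k * (indicator D z * p (fst z) (snd z)))"
      using p_int by (rule integrable_mult_right)
    fix z :: "(real ^ 'd) \<times> real"
    have "0 \<le> exp (- kap * real n) / p m k * (indicator D z * p (fst z) (snd z))"
      using p_nonneg[of "fst z" "snd z"] p0_pos by (simp add: indicator_def)
    then show "kernel_pair z - boxed_kernel_pair z \<le> exp (- kap * real n) / p m k * (indicator D z * p (fst z) (snd z))"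
      using kernel_le[of "fst z" "snd z"]
      by (cases "in_box (fst z) (snd z)") (simp_all add: kernel_pair_def boxed_kernel_pair_def boxed_kernel_def)
  qed
  also have "\<dots> = exp (- kap * real n) / p m k" using p_mass by simp
  also have "\<dots> \<le> exp (- kap * real n) * K"
    using mult_left_mono[OF inverse_p0_le, of "exp (- kap * real n)"] by simp
  finally have 1: "(\<integral>z. kernel_pair z - boxed_kernel_pair z \<partial>lborel) \<le> exp (- kap * real n) * K" .
  have 0: "0 \<le> (\<integral>z. kernel_pair z - boxed_kernel_pair z \<partial>lborel)"
    by (rule integral_nonneg_AE) (auto simp: kernel_pair_def boxed_kernel_pair_def boxed_kernel_def kernel_nonneg)
  have sq: "1 \<le> sqrt (real n)" using n by simp
  have n_sq: "real n = sqrt (real n) ^ 2" by simp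
  have expn: "sqrt (real n) ^ ?N * exp (- kap * real n) \<le> fact ?N / kap ^ ?N"
  proof -
    have "sqrt (real n) \<le> real n"
      using mult_right_mono[OF sq, of "sqrt (real n)"] by simp
    then have "sqrt (real n) ^ ?N \<le> real n ^ ?N" by (intro power_mono) auto
    moreover have "(kap * real n) ^ ?N / fact ?N \<le> exp (kap * real n)"
      using kap power_div_fact_le_exp[of "kap * real n" ?N] by simp
    then have "real n ^ ?N \<le> fact ?N / kap ^ ?N * exp (kap * real n)"
      using kap by (simp add: power_mult_distrib field_simps)
    ultimately have "sqrt (real n) ^ ?N \<le> fact ?N / kap ^ ?N * exp (kap * real n)" by linarith
    from mult_right_mono[OF this, of "exp (- kap * real n)"]
    show ?thesis by (simp add: mult.assoc exp_add[symmetric])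
  qed
  have e3: "e ^ 3 * sqrt (real n) ^ 3 = 1" using n by (simp add: e_def power_divide)
  have "(\<integral>w. kernel_pair (unscale w) \<partial>lborel) - (\<integral>w. boxed_kernel_pair (unscale w) \<partial>lborel) = jac * (\<integral>z. kernel_pair z - boxed_kernel_pair z \<partial>lborel)"
    using integrable_kernel integrable_boxed_kernel
    by (simp add: change_variables right_diff_distrib)
  then have "\<bar>(\<integral>w. kernel_pair (unscale w) \<partial>lborel) - (\<integral>w. boxed_kernel_pair (unscale w) \<partial>lborel)\<bar> = jac * (\<integral>z. kernel_pair z - boxed_kernel_pair z \<partial>lborel)"
    using 0 jac_pos by (simp add: abs_mult)
  also have "\<dots> \<le> jac * (exp (- kap * real n) * K)" using 1 jac_pos by simp
  also have "\<dots> = (e ^ 3 * sqrt (real n) ^ 3) * (jac * (exp (- kap * real n) * K))" by (simp add: e3)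
  also have "\<dots> = (K * c) * e ^ 3 * (sqrt (real n) ^ ?N * exp (- kap * real n))"
    unfolding jac_def by (subst (2) n_sq) (simp add: eval_nat_numeral power_add mult_ac)
  also have "\<dots> \<le> (K * c) * e ^ 3 * (fact ?N / kap ^ ?N)"
    using expn K1 c e_pos by (intro mult_left_mono) auto
  also have "\<dots> \<le> (K * K) * e ^ 3 * (fact ?N / kap ^ ?N)"
    using K1 c e_pos kap by (intro mult_right_mono mult_left_mono) auto
  finally show ?thesis by (simp add: far_const_def power2_eq_square mult_ac)
qed

definition dom_mass :: real where
  "dom_mass = (\<integral>v. (1 + norm (v :: real ^ 'd)) ^ 18 * exp (- (lam / 4) * (norm v)\<^sup>2) \<partial>lborel)
    * (\<integral>t. indicator {..0} t * ((1 + \<bar>t\<bar>) ^ 18 * exp (t / 2)) \<partial>lborel)"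

lemma has_bochner_integral_dom:
  "has_bochner_integral lborel (\<lambda>w. rho (fst w) (snd w) ^ 18 * (indicator {..0} (snd w) * dom (fst w) (snd w))) dom_mass"
proof -
  have "has_bochner_integral lborel (\<lambda>w. ((1 + norm (fst w :: real ^ 'd)) ^ 18 * exp (- (lam / 4) * (norm (fst w))\<^sup>2))
      * (indicator {..0} (snd w) * ((1 + \<bar>snd w\<bar>) ^ 18 * exp (snd w / 2)))) dom_mass"
    unfolding dom_mass_def
    by (rule has_bochner_integral_prod; rule has_bochner_integral_integrable)
      (use lam_pos integrable_poly_exp_norm[of "lam / 4" 18] integrable_poly_exp_half[of 18] in simp_all)
  then show ?thesis by (simp add: rho_def dom_def power_mult_distrib mult_ac)
qed

text \<open>The unnormalized limiting density.\<close>

definition limit_weight :: "(real ^ 'd) \<times> real \<Rightarrow> real" where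
  "limit_weight w = gauss (fst w) * (indicator {..0} (snd w) * exp (snd w))"

text \<open>
  The expectation of \<open>a2\<close> under the limiting law, in the monomials of \<open>a2_eq\<close>: \<open>t\<close> and \<open>t\<^sup>2\<close> have become
  \<open>- 1\<close> and \<open>2\<close>.
\<close>

definition z2 :: real where
  "z2 = 1 / (2 * p m k) * expect 2 P2 - dp / (c * p m k)
    - 1 / (c * p m k) * expect 2 (kron 1 P1 A11) + 1 / (6 * p m k) * expect 4 (kron 1 P1 A30)
    + 1 / 24 * expect 4 A40 - 1 / (2 * c) * expect 2 A21 + A02 / c\<^sup>2
    + 1 / c\<^sup>2 * expect 2 (kron 1 A11 A11) + 1 / 72 * expect 6 (kron 3 A30 A30)
    - 1 / (6 * c) * expect 4 (kron 1 A11 A30)"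

lemma a2_eq:
  "a2 u t = 1 / (2 * p m k) * form 2 P2 u + dp / (c * p m k) * t
    + 1 / (c * p m k) * (form 2 (kron 1 P1 A11) u * t) + 1 / (6 * p m k) * form 4 (kron 1 P1 A30) u
    + 1 / 24 * form 4 A40 u + 1 / (2 * c) * (form 2 A21 u * t) + A02 / (2 * c\<^sup>2) * t\<^sup>2
    + 1 / (2 * c\<^sup>2) * (form 2 (kron 1 A11 A11) u * t\<^sup>2) + 1 / 72 * form 6 (kron 3 A30 A30) u
    + 1 / (6 * c) * (form 4 (kron 1 A11 A30) u * t)"
proof -
  have f: "form 2 (kron 1 P1 A11) u = form 1 P1 u * form 1 A11 u"
    "form 4 (kron 1 P1 A30) u = form 1 P1 u * form 3 A30 u"
    "form 2 (kron 1 A11 A11) u = form 1 A11 u * form 1 A11 u"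
    "form 6 (kron 3 A30 A30) u = form 3 A30 u * form 3 A30 u"
    "form 4 (kron 1 A11 A30) u = form 1 A11 u * form 3 A30 u"
  proof -
    have d: "(2::nat) = 1 + 1" "(4::nat) = 1 + 3" "(6::nat) = 3 + 3" by simp_all
    show "form 2 (kron 1 P1 A11) u = form 1 P1 u * form 1 A11 u"
      "form 2 (kron 1 A11 A11) u = form 1 A11 u * form 1 A11 u" unfolding d(1) form_mult by rule+
    show "form 4 (kron 1 P1 A30) u = form 1 P1 u * form 3 A30 u"
      "form 4 (kron 1 A11 A30) u = form 1 A11 u * form 3 A30 u" unfolding d(2) form_mult by rule+
    show "form 6 (kron 3 A30 A30) u = form 3 A30 u * form 3 A30 u" unfolding d(3) form_mult by rule
  qed
  show ?thesis
    unfolding a2_def b2_def b1_def w3_def w4_def f using c p0_pos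
    by (simp add: power2_eq_square field_simps)
qed

lemma has_bochner_integral_a2: "has_bochner_integral lborel (\<lambda>w. limit_weight w * a2 (fst w) (snd w)) (mass * z2)"
proof -
  let ?X = "\<lambda>r T j w. form r T (fst w) * snd w ^ j * (gauss (fst w) * (indicator {..0} (snd w) * exp (snd w)))"
  let ?V = "\<lambda>r T j. mass * (expect r T * ((- 1) ^ j * fact j))"
  let ?one = "\<lambda>_. 1 :: real"
  have "has_bochner_integral lborel
    (\<lambda>w. 1 / (2 * p m k) * ?X 2 P2 0 w + dp / (c * p m k) * ?X 0 ?one 1 w
      + 1 / (c * p m k) * ?X 2 (kron 1 P1 A11) 1 w + 1 / (6 * p m k) * ?X 4 (kron 1 P1 A30) 0 w
      + 1 / 24 * ?X 4 A40 0 w + 1 / (2 * c) * ?X 2 A21 1 w + A02 / (2 * c\<^sup>2) * ?X 0 ?one 2 w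
      + 1 / (2 * c\<^sup>2) * ?X 2 (kron 1 A11 A11) 2 w + 1 / 72 * ?X 6 (kron 3 A30 A30) 0 w
      + 1 / (6 * c) * ?X 4 (kron 1 A11 A30) 1 w)
    (1 / (2 * p m k) * ?V 2 P2 0 + dp / (c * p m k) * ?V 0 ?one 1
      + 1 / (c * p m k) * ?V 2 (kron 1 P1 A11) 1 + 1 / (6 * p m k) * ?V 4 (kron 1 P1 A30) 0
      + 1 / 24 * ?V 4 A40 0 + 1 / (2 * c) * ?V 2 A21 1 + A02 / (2 * c\<^sup>2) * ?V 0 ?one 2
      + 1 / (2 * c\<^sup>2) * ?V 2 (kron 1 A11 A11) 2 + 1 / 72 * ?V 6 (kron 3 A30 A30) 0
      + 1 / (6 * c) * ?V 4 (kron 1 A11 A30) 1)"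
    by (intro has_bochner_integral_add has_bochner_integral_mult_right has_bochner_integral_form_power)
  moreover have "1 / (2 * p m k) * ?X 2 P2 0 w + dp / (c * p m k) * ?X 0 ?one 1 w
      + 1 / (c * p m k) * ?X 2 (kron 1 P1 A11) 1 w + 1 / (6 * p m k) * ?X 4 (kron 1 P1 A30) 0 w
      + 1 / 24 * ?X 4 A40 0 w + 1 / (2 * c) * ?X 2 A21 1 w + A02 / (2 * c\<^sup>2) * ?X 0 ?one 2 w
      + 1 / (2 * c\<^sup>2) * ?X 2 (kron 1 A11 A11) 2 w + 1 / 72 * ?X 6 (kron 3 A30 A30) 0 w
      + 1 / (6 * c) * ?X 4 (kron 1 A11 A30) 1 w = limit_weight w * a2 (fst w) (snd w)" for w
    unfolding a2_eq limit_weight_def[symmetric] by (simp add: distrib_left mult_ac)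
  moreover have "(1 / (2 * p m k) * ?V 2 P2 0 + dp / (c * p m k) * ?V 0 ?one 1
      + 1 / (c * p m k) * ?V 2 (kron 1 P1 A11) 1 + 1 / (6 * p m k) * ?V 4 (kron 1 P1 A30) 0
      + 1 / 24 * ?V 4 A40 0 + 1 / (2 * c) * ?V 2 A21 1 + A02 / (2 * c\<^sup>2) * ?V 0 ?one 2
      + 1 / (2 * c\<^sup>2) * ?V 2 (kron 1 A11 A11) 2 + 1 / 72 * ?V 6 (kron 3 A30 A30) 0
      + 1 / (6 * c) * ?V 4 (kron 1 A11 A30) 1) = mass * z2"
    unfolding z2_def expect_0 by (simp add: algebra_simps)
  ultimately show ?thesis by simp
qed

text \<open>Every term of \<open>a1\<close> has odd degree in \<open>u\<close>.\<close>

lemma has_bochner_integral_a1: "has_bochner_integral lborel (\<lambda>w. limit_weight w * (1 + e * a1 (fst w) (snd w))) mass"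
proof -
  let ?X = "\<lambda>r T j w. form r T (fst w) * snd w ^ j * (gauss (fst w) * (indicator {..0} (snd w) * exp (snd w)))"
  let ?V = "\<lambda>r T j. mass * (expect r T * ((- 1) ^ j * fact j))"
  let ?one = "\<lambda>_. 1 :: real"
  have "has_bochner_integral lborel
    (\<lambda>w. ?X 0 ?one 0 w + e / p m k * ?X 1 P1 0 w + e / c * ?X 1 A11 1 w + e / 6 * ?X 3 A30 0 w)
    (?V 0 ?one 0 + e / p m k * ?V 1 P1 0 + e / c * ?V 1 A11 1 + e / 6 * ?V 3 A30 0)"
    by (intro has_bochner_integral_add has_bochner_integral_mult_right has_bochner_integral_form_power)
  moreover have "?X 0 ?one 0 w + e / p m k * ?X 1 P1 0 w + e / c * ?X 1 A11 1 w + e / 6 * ?X 3 A30 0 w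
      = limit_weight w * (1 + e * a1 (fst w) (snd w))" for w
    unfolding a1_def b1_def w3_def limit_weight_def[symmetric] by (simp add: algebra_simps)
  moreover have "?V 0 ?one 0 + e / p m k * ?V 1 P1 0 + e / c * ?V 1 A11 1 + e / 6 * ?V 3 A30 0 = mass"
    unfolding expect_0 expect_1 expect_3 by simp
  ultimately show ?thesis by simp
qed

text \<open>
  A lower bound of \<open>mass\<close> that does not depend on \<open>g\<close>, and so may enter the constants.
\<close>

definition mass_lb :: real where
  "mass_lb = (\<integral>v. exp (- (K / 2) * (norm (v :: real ^ 'd))\<^sup>2) \<partial>lborel)"

lemma mass_lb: "0 < mass_lb" "mass_lb \<le> mass"
proof -
  have K0: "0 < K / 2" using K1 by simp
  have int: "integrable lborel (\<lambda>v :: real ^ 'd. exp (- (K / 2) * (norm v)\<^sup>2))"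
    by (rule integrable_exp_norm[OF K0])
  show "0 < mass_lb" unfolding mass_lb_def by (rule integral_exp_norm_pos[OF K0])
  have "mass_lb \<le> (\<integral>v. gauss v \<partial>lborel)"
    unfolding mass_lb_def
  proof (rule integral_mono[OF int])
    show "integrable lborel gauss" using has_bochner_integral_gauss by (simp add: has_bochner_integral_iff)
    show "exp (- (K / 2) * (norm v)\<^sup>2) \<le> gauss v" for v
      using g_bound[of v] by (simp add: gauss_def)
  qed
  then show "mass_lb \<le> mass" using has_bochner_integral_gauss by (simp add: has_bochner_integral_iff)
qed

definition C2 :: real where "C2 = C1 * dom_mass + far_const"

lemma C1_nonneg: "0 \<le> C1"
  using K1 eta by (simp add: C1_def M_def)

lemma limit_weight_dom:
  "\<bar>limit_weight w\<bar> \<le> indicator {..0} (snd w) * dom (fst w) (snd w)"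
  using gauss_dom[of "snd w" "fst w"] gauss_pos[of "fst w"]
  by (cases "snd w \<le> 0") (auto simp: limit_weight_def abs_mult)

lemma normalizer: "\<bar>(\<integral>w. kernel_pair (unscale w) \<partial>lborel) - mass * (1 + e\<^sup>2 * z2)\<bar> \<le> C2 * e ^ 3"
proof -
  let ?main = "\<lambda>w. limit_weight w * (1 + e * a1 (fst w) (snd w) + e\<^sup>2 * a2 (fst w) (snd w))"
  let ?D = "\<lambda>w. C1 * e ^ 3 * (rho (fst w) (snd w) ^ 18 * (indicator {..0} (snd w) * dom (fst w) (snd w)))"
  have "has_bochner_integral lborel (\<lambda>w. limit_weight w * (1 + e * a1 (fst w) (snd w)) + e\<^sup>2 * (limit_weight w * a2 (fst w) (snd w)))
      (mass + e\<^sup>2 * (mass * z2))"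
    by (intro has_bochner_integral_add has_bochner_integral_mult_right has_bochner_integral_a1 has_bochner_integral_a2)
  moreover have "(\<lambda>w. limit_weight w * (1 + e * a1 (fst w) (snd w)) + e\<^sup>2 * (limit_weight w * a2 (fst w) (snd w))) = ?main"
    by (auto simp: algebra_simps)
  moreover have "mass + e\<^sup>2 * (mass * z2) = mass * (1 + e\<^sup>2 * z2)" by (simp add: algebra_simps)
  ultimately have main: "has_bochner_integral lborel ?main (mass * (1 + e\<^sup>2 * z2))" by simp
  have intB: "integrable lborel (\<lambda>w. boxed_kernel_pair (unscale w))"
    using change_variables(1)[of boxed_kernel_pair] integrable_boxed_kernel by simp
  have D: "has_bochner_integral lborel ?D (C1 * e ^ 3 * dom_mass)"
    by (intro has_bochner_integral_mult_right has_bochner_integral_dom)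
  have "\<bar>(\<integral>w. boxed_kernel_pair (unscale w) \<partial>lborel) - mass * (1 + e\<^sup>2 * z2)\<bar> = \<bar>\<integral>w. boxed_kernel_pair (unscale w) - ?main w \<partial>lborel\<bar>"
    using main intB by (simp add: has_bochner_integral_iff)
  also have "\<dots> \<le> (\<integral>w. ?D w \<partial>lborel)"
  proof (rule integral_abs_bound[THEN order_trans], rule integral_mono)
    show "integrable lborel (\<lambda>w. \<bar>boxed_kernel_pair (unscale w) - ?main w\<bar>)"
      using main intB by (simp add: has_bochner_integral_iff)
    show "integrable lborel ?D" using D by (simp add: has_bochner_integral_iff)
    show "\<bar>boxed_kernel_pair (unscale w) - ?main w\<bar> \<le> ?D w" for w
      using boxed_kernel_expand[of "fst w" "snd w"] by (simp add: boxed_kernel_pair_def unscale_def limit_weight_def)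
  qed
  also have "\<dots> = C1 * dom_mass * e ^ 3" using D by (simp add: has_bochner_integral_iff mult_ac)
  finally show ?thesis using far_mass unfolding C2_def by (simp add: algebra_simps)
qed

definition z2_bound :: real where "z2_bound = 4 * M\<^sup>2 * dom_mass / mass_lb"

lemma z2_le: "\<bar>z2\<bar> \<le> z2_bound"
proof -
  let ?D = "\<lambda>w. 4 * M\<^sup>2 * (rho (fst w) (snd w) ^ 18 * (indicator {..0} (snd w) * dom (fst w) (snd w)))"
  have D: "has_bochner_integral lborel ?D (4 * M\<^sup>2 * dom_mass)"
    by (intro has_bochner_integral_mult_right has_bochner_integral_dom)
  have "\<bar>mass * z2\<bar> = \<bar>\<integral>w. limit_weight w * a2 (fst w) (snd w) \<partial>lborel\<bar>"
    using has_bochner_integral_a2 by (simp add: has_bochner_integral_iff)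
  also have "\<dots> \<le> (\<integral>w. ?D w \<partial>lborel)"
  proof (rule integral_abs_bound[THEN order_trans], rule integral_mono)
    show "integrable lborel (\<lambda>w. \<bar>limit_weight w * a2 (fst w) (snd w)\<bar>)"
      using has_bochner_integral_a2 by (simp add: has_bochner_integral_iff)
    show "integrable lborel ?D" using D by (simp add: has_bochner_integral_iff)
    fix w :: "(real ^ 'd) \<times> real"
    have "\<bar>a2 (fst w) (snd w)\<bar> \<le> 4 * M\<^sup>2 * rho (fst w) (snd w) ^ 18"
      by (rule order_trans[OF a2_bound], intro mult_left_mono power_increasing) (use rho_ge_1 in auto)
    from abs_mult_le[OF limit_weight_dom this]
    show "\<bar>limit_weight w * a2 (fst w) (snd w)\<bar> \<le> ?D w" by (simp add: mult_ac)
  qed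
  also have "\<dots> = 4 * M\<^sup>2 * dom_mass" using D by (simp add: has_bochner_integral_iff)
  finally have "mass * \<bar>z2\<bar> \<le> 4 * M\<^sup>2 * dom_mass" using mass_pos by (simp add: abs_mult)
  moreover have "mass_lb * \<bar>z2\<bar> \<le> mass * \<bar>z2\<bar>" using mass_lb by (intro mult_right_mono) auto
  ultimately show ?thesis using mass_lb by (simp add: z2_bound_def field_simps)
qed

definition remainder_const :: "real ^ 'd \<Rightarrow> real \<Rightarrow> real" where
  "remainder_const u t = 2 * (C1 * rho u t ^ 18 * exp (K / 2 * (norm u)\<^sup>2 + \<bar>t\<bar>)
     + z2_bound * (2 * (7 * M\<^sup>2 * rho u t ^ 6) + z2_bound) + C2 / mass_lb * (7 * M\<^sup>2 * rho u t ^ 6 + z2_bound))"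

text \<open>
  Write \<open>X = A + e1\<close> for the kernel and \<open>Y = 1 + e\<^sup>2 * z2 + e2\<close> for the normalizing constant, both relative
  to the limiting law, and \<open>F = A - e\<^sup>2 * z2\<close>. Then \<open>X - Y * F = e1 + e\<^sup>2 * z2 * (1 - F) - e2 * F\<close> is of order
  \<open>e ^ 3\<close>, because \<open>1 - F\<close> is of order \<open>e\<close>; and \<open>Y\<close> is at least \<open>1 / 2\<close> for large \<open>n\<close>.
\<close>

lemma posterior_expansion:
  assumes t: "t \<le> 0" and box': "in_box (m + e *\<^sub>R u) (k + t / (real n * c))"
    and small: "e\<^sup>2 * (z2_bound + C2 / mass_lb) \<le> 1 / 2"
  shows "\<bar>kernel (m + e *\<^sub>R u) (k + t / (real n * c)) / (\<integral>w. kernel_pair (unscale w) \<partial>lborel)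
      * (mass / (gauss u * exp t)) - (1 + e * a1 u t + e\<^sup>2 * (a2 u t - z2))\<bar> \<le> remainder_const u t * e ^ 3"
proof -
  define G where "G = gauss u * exp t"
  define X where "X = kernel (m + e *\<^sub>R u) (k + t / (real n * c)) / G"
  define Y where "Y = (\<integral>w. kernel_pair (unscale w) \<partial>lborel) / mass"
  define A where "A = 1 + e * a1 u t + e\<^sup>2 * a2 u t"
  define B where "B = 7 * M\<^sup>2 * rho u t ^ 6"
  define E0 where "E0 = exp (K / 2 * (norm u)\<^sup>2 + \<bar>t\<bar>)"
  have G: "0 < G" using gauss_pos by (simp add: G_def)
  have B0: "0 \<le> B" using rho_ge_1[of u t] by (simp add: B_def)
  have Abound: "\<bar>A\<bar> \<le> B" unfolding A_def B_def by (rule main_bound)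
  have a1b: "\<bar>a1 u t\<bar> \<le> B" unfolding B_def by (rule a1_bound)
  have a2b: "\<bar>a2 u t\<bar> \<le> B" using a2_bound[of u t] rho_ge_1[of u t] unfolding B_def
    by (elim order_trans) (simp add: mult_right_mono)
  have z2_bound_nonneg: "0 \<le> z2_bound" using z2_le by (meson abs_ge_zero order_trans)
  have C2nn: "0 \<le> C2"
  proof -
    have "0 \<le> C2 * e ^ 3" using normalizer by (meson abs_ge_zero order_trans)
    then show ?thesis using e_pos by (simp add: zero_le_mult_iff)
  qed
  define q where "q = C2 / mass_lb"
  have q0: "0 \<le> q" using C2nn mass_lb by (simp add: q_def)
  define e1 where "e1 = X - A"
  have e1: "\<bar>e1\<bar> \<le> C1 * rho u t ^ 18 * E0 * e ^ 3"
  proof -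
    have "\<bar>kernel (m + e *\<^sub>R u) (k + t / (real n * c)) - G * A\<bar> \<le> C1 * e ^ 3 * (rho u t ^ 18 * dom u t)"
      using boxed_kernel_expand[of u t] t box' by (simp add: boxed_kernel_def G_def A_def)
    also have "\<dots> \<le> C1 * e ^ 3 * (rho u t ^ 18 * (G * E0))"
    proof -
      have "dom u t \<le> 1" unfolding dom_def using t lam_pos by (intro mult_le_one) auto
      also have "1 \<le> G * E0"
        unfolding G_def E0_def gauss_def exp_add[symmetric] using g_bound[of u] t by simp
      finally show ?thesis
        using C1_nonneg e_pos rho_ge_1[of u t] by (intro mult_left_mono) auto
    qed
    finally have "\<bar>G * e1\<bar> \<le> G * (C1 * rho u t ^ 18 * E0 * e ^ 3)"
      using G by (simp add: e1_def X_def right_diff_distrib mult_ac)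
    then show ?thesis using G by (simp add: abs_mult)
  qed
  define e2 where "e2 = Y - 1 - e\<^sup>2 * z2"
  have e2: "\<bar>e2\<bar> \<le> q * e ^ 3"
  proof -
    have "\<bar>mass * e2\<bar> \<le> C2 * e ^ 3"
      using normalizer mass_pos by (simp add: e2_def Y_def right_diff_distrib distrib_left)
    then have "mass * \<bar>e2\<bar> \<le> C2 * e ^ 3" using mass_pos by (simp add: abs_mult)
    moreover have "mass_lb * \<bar>e2\<bar> \<le> mass * \<bar>e2\<bar>" using mass_lb by (intro mult_right_mono) auto
    ultimately show ?thesis using mass_lb by (simp add: q_def field_simps)
  qed
  have e32: "e ^ 3 \<le> e\<^sup>2" using e_pos e_le_1 by (intro power_decreasing) auto
  have Y: "1 / 2 \<le> Y"
  proof -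
    have "\<bar>e\<^sup>2 * z2\<bar> \<le> e\<^sup>2 * z2_bound" by (rule abs_mult_le[OF _ z2_le]) simp
    moreover have "q * e ^ 3 \<le> q * e\<^sup>2" using e32 q0 by (rule mult_left_mono)
    ultimately show ?thesis using e2 small unfolding e2_def q_def[symmetric] by (simp add: algebra_simps)
  qed
  define F where "F = A - e\<^sup>2 * z2"
  have F: "\<bar>F\<bar> \<le> B + z2_bound"
  proof -
    have "\<bar>e\<^sup>2 * z2\<bar> \<le> 1 * z2_bound" by (rule abs_mult_le[OF _ z2_le]) (use e_pos e_le_1 in \<open>auto simp: power_le_one\<close>)
    then show ?thesis using Abound by (simp add: F_def)
  qed
  have F1: "\<bar>1 - F\<bar> \<le> e * (2 * B + z2_bound)"
  proof -
    have "\<bar>e * z2\<bar> \<le> 1 * z2_bound" by (rule abs_mult_le[OF _ z2_le]) (use e_pos e_le_1 in auto)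
    moreover have "\<bar>e * a2 u t\<bar> \<le> 1 * B" by (rule abs_mult_le[OF _ a2b]) (use e_pos e_le_1 in auto)
    ultimately have "\<bar>- a1 u t - e * a2 u t + e * z2\<bar> \<le> 2 * B + z2_bound" using a1b by simp
    from abs_mult_le[of e e, OF _ this]
    have "\<bar>e * (- a1 u t - e * a2 u t + e * z2)\<bar> \<le> e * (2 * B + z2_bound)" using e_pos by simp
    moreover have "1 - F = e * (- a1 u t - e * a2 u t + e * z2)"
      by (simp add: F_def A_def power2_eq_square algebra_simps)
    ultimately show ?thesis by simp
  qed
  have XY: "X - Y * F = e1 + e\<^sup>2 * z2 * (1 - F) - e2 * F"
    by (simp add: e1_def e2_def F_def algebra_simps)
  have t2: "\<bar>e\<^sup>2 * z2 * (1 - F)\<bar> \<le> z2_bound * (2 * B + z2_bound) * e ^ 3"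
  proof -
    have "\<bar>(e\<^sup>2 * z2) * (1 - F)\<bar> \<le> (e\<^sup>2 * z2_bound) * (e * (2 * B + z2_bound))"
      by (rule abs_mult_le[OF abs_mult_le[OF _ z2_le] F1]) simp
    then show ?thesis by (simp add: eval_nat_numeral mult_ac)
  qed
  have t3: "\<bar>e2 * F\<bar> \<le> q * (B + z2_bound) * e ^ 3"
    using abs_mult_le[OF e2 F] by (simp add: mult_ac)
  define S where "S = C1 * rho u t ^ 18 * E0 + z2_bound * (2 * B + z2_bound) + q * (B + z2_bound)"
  have "\<bar>X - Y * F\<bar> \<le> S * e ^ 3"
    unfolding XY S_def distrib_right using e1 t2 t3 by linarith
  moreover have "X / Y - F = (X - Y * F) / Y" using Y by (simp add: field_simps)
  ultimately have "\<bar>X / Y - F\<bar> \<le> (S * e ^ 3) / Y" using Y by (simp add: divide_right_mono)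
  also have "\<dots> \<le> (S * e ^ 3) / (1 / 2)"
  proof (rule divide_left_mono[OF Y])
    have "0 \<le> \<bar>X - Y * F\<bar>" by simp
    then show "0 \<le> S * e ^ 3" using \<open>\<bar>X - Y * F\<bar> \<le> S * e ^ 3\<close> by linarith
  qed (use Y in simp)
  finally have "\<bar>X / Y - F\<bar> \<le> 2 * S * e ^ 3" by simp
  moreover have "2 * S = remainder_const u t"
    by (simp only: remainder_const_def S_def B_def E0_def q_def)
  ultimately have "\<bar>X / Y - F\<bar> \<le> remainder_const u t * e ^ 3" by simp
  moreover have "X / Y = kernel (m + e *\<^sub>R u) (k + t / (real n * c)) / (\<integral>w. kernel_pair (unscale w) \<partial>lborel)
      * (mass / (gauss u * exp t))"
    by (simp add: X_def Y_def G_def)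
  moreover have "F = 1 + e * a1 u t + e\<^sup>2 * (a2 u t - z2)"
    by (simp add: F_def A_def algebra_simps)
  ultimately show "\<bar>kernel (m + e *\<^sub>R u) (k + t / (real n * c)) / (\<integral>w. kernel_pair (unscale w) \<partial>lborel)
      * (mass / (gauss u * exp t)) - (1 + e * a1 u t + e\<^sup>2 * (a2 u t - z2))\<bar> \<le> remainder_const u t * e ^ 3"
    by simp
qed

end


section \<open>Events of probability tending to one and the weak law\<close>

lemma with_prob_mono:
  assumes "with_prob_tending_to_1 M P"
    and "\<forall>\<^sub>F n in sequentially. \<forall>\<omega>\<in>space M. P n \<omega> \<longrightarrow> Q n \<omega>"
  shows "with_prob_tending_to_1 M Q"
  unfolding with_prob_tending_to_1_def
proof (intro allI impI)
  fix \<epsilon> :: real assume "\<epsilon> > 0"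
  then have "\<forall>\<^sub>F n in sequentially. \<exists>A\<in>sets M. measure M A \<ge> 1 - \<epsilon> \<and> (\<forall>\<omega>\<in>A. P n \<omega>)"
    using assms(1) by (simp add: with_prob_tending_to_1_def)
  with assms(2) show "\<forall>\<^sub>F n in sequentially. \<exists>A\<in>sets M. measure M A \<ge> 1 - \<epsilon> \<and> (\<forall>\<omega>\<in>A. Q n \<omega>)"
    by eventually_elim (meson sets.sets_into_space subsetD)
qed

context prob_space
begin

lemma with_prob_conj:
  assumes "with_prob_tending_to_1 M P" "with_prob_tending_to_1 M Q"
  shows "with_prob_tending_to_1 M (\<lambda>n \<omega>. P n \<omega> \<and> Q n \<omega>)"
  unfolding with_prob_tending_to_1_def
proof (intro allI impI)
  fix \<epsilon> :: real assume "\<epsilon> > 0"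
  then have "\<epsilon> / 2 > 0" by simp
  then have "\<forall>\<^sub>F n in sequentially. \<exists>A\<in>sets M. measure M A \<ge> 1 - \<epsilon> / 2 \<and> (\<forall>\<omega>\<in>A. P n \<omega>)"
    "\<forall>\<^sub>F n in sequentially. \<exists>A\<in>sets M. measure M A \<ge> 1 - \<epsilon> / 2 \<and> (\<forall>\<omega>\<in>A. Q n \<omega>)"
    using assms unfolding with_prob_tending_to_1_def by blast+
  then show "\<forall>\<^sub>F n in sequentially. \<exists>A\<in>sets M. measure M A \<ge> 1 - \<epsilon> \<and> (\<forall>\<omega>\<in>A. P n \<omega> \<and> Q n \<omega>)"
  proof eventually_elim
    case (elim n)
    then obtain A B where A: "A \<in> sets M" "prob A \<ge> 1 - \<epsilon> / 2" "\<forall>\<omega>\<in>A. P n \<omega>"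
      and B: "B \<in> sets M" "prob B \<ge> 1 - \<epsilon> / 2" "\<forall>\<omega>\<in>B. Q n \<omega>" by blast
    have "prob (A \<union> B) = prob A + prob B - prob (A \<inter> B)"
      using A(1) B(1) by (simp add: measure_Un3 fmeasurable_eq_sets)
    then have "prob (A \<inter> B) \<ge> 1 - \<epsilon>" using A(2) B(2) prob_le_1[of "A \<union> B"] by simp
    then show ?case using A B by (intro bexI[of _ "A \<inter> B"]) auto
  qed
qed

lemma with_prob_finite_all:
  assumes "finite I" "\<And>i. i \<in> I \<Longrightarrow> with_prob_tending_to_1 M (P i)"
  shows "with_prob_tending_to_1 M (\<lambda>n \<omega>. \<forall>i\<in>I. P i n \<omega>)"
  using assms
proof (induction I)
  case empty
  show ?case unfolding with_prob_tending_to_1_def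
    by (auto intro!: always_eventually bexI[of _ "space M"] simp: prob_space)
next
  case (insert i I)
  then have "with_prob_tending_to_1 M (\<lambda>n \<omega>. P i n \<omega> \<and> (\<forall>i\<in>I. P i n \<omega>))"
    by (intro with_prob_conj) auto
  then show ?case by simp
qed

lemma with_prob_AE:
  assumes "AE \<omega> in M. \<forall>n. P n \<omega>"
  shows "with_prob_tending_to_1 M P"
proof -
  obtain N where N: "N \<in> null_sets M" "{\<omega>\<in>space M. \<not> (\<forall>n. P n \<omega>)} \<subseteq> N"
    using assms by (auto elim!: AE_E simp: null_sets_def)
  then have "prob (space M - N) = 1" by (subst prob_compl) (auto simp: null_sets_def measure_def)
  then show ?thesis
    unfolding with_prob_tending_to_1_def using N
    by (auto intro!: always_eventually bexI[of _ "space M - N"])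
qed

lemma with_prob_of_prob:
  assumes meas: "\<And>n. {\<omega>\<in>space M. \<not> P n \<omega>} \<in> sets M"
    and lim: "\<And>\<epsilon>. 0 < \<epsilon> \<Longrightarrow> \<forall>\<^sub>F n in sequentially. prob {\<omega>\<in>space M. \<not> P n \<omega>} \<le> \<epsilon>"
  shows "with_prob_tending_to_1 M P"
  unfolding with_prob_tending_to_1_def
proof (intro allI impI)
  fix \<epsilon> :: real assume "\<epsilon> > 0"
  from lim[OF this] show "\<forall>\<^sub>F n in sequentially. \<exists>A\<in>sets M. measure M A \<ge> 1 - \<epsilon> \<and> (\<forall>\<omega>\<in>A. P n \<omega>)"
  proof eventually_elim
    case (elim n)
    have "prob (space M - {\<omega>\<in>space M. \<not> P n \<omega>}) = 1 - prob {\<omega>\<in>space M. \<not> P n \<omega>}"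
      using meas by (rule prob_compl)
    then show ?case using elim meas by (intro bexI[of _ "space M - {\<omega>\<in>space M. \<not> P n \<omega>}"]) auto
  qed
qed

context
  fixes X :: "nat \<Rightarrow> 'a \<Rightarrow> real" and N :: "real measure"
  assumes indep: "indep_vars (\<lambda>_. borel) X UNIV" and distr: "\<And>i. distr M borel (X i) = N"
begin

lemma X_meas: "X i \<in> borel_measurable M"
  using indep by (auto simp: indep_vars_def)

lemma sets_N: "sets N = sets borel"
  using distr[of 0] by (metis sets_distr)

lemma space_N: "space N = UNIV"
  using distr[of 0] by (metis space_distr space_borel)

lemma integral_X:
  assumes [measurable]: "f \<in> borel_measurable borel"
  shows "expectation (\<lambda>\<omega>. f (X i \<omega>) :: real) = integral\<^sup>L N f"
    and "integrable M (\<lambda>\<omega>. f (X i \<omega>)) \<longleftrightarrow> integrable N f"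
  unfolding distr[of i, symmetric] using X_meas by (simp_all add: integral_distr integrable_distr_eq)

text \<open>Chebyshev's inequality: independence makes the mixed second moments vanish.\<close>

lemma weak_law_bounded:
  fixes f :: "real \<Rightarrow> real"
  assumes f [measurable]: "f \<in> borel_measurable borel" and bound: "\<And>x. \<bar>f x\<bar> \<le> K" and r: "0 < r" and \<epsilon>: "0 < \<epsilon>"
  shows "\<forall>\<^sub>F n in sequentially. prob {\<omega>\<in>space M. r \<le> \<bar>1 / real n * (\<Sum>j<n. f (X j \<omega>)) - integral\<^sup>L N f\<bar>} \<le> \<epsilon>"
proof -
  note X_meas [measurable] and sets_N [measurable_cong, simp] and space_N [simp]
  define \<mu> where "\<mu> = integral\<^sup>L N f"
  define Z where "Z j \<omega> = f (X j \<omega>) - \<mu>" for j \<omega>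
  have K0: "0 \<le> K" using bound[of 0] by simp
  have int_f: "integrable M (\<lambda>\<omega>. f (X j \<omega>))" for j
    by (rule integrable_const_bound[of _ K]) (use bound in auto)
  have \<mu>: "\<bar>\<mu>\<bar> \<le> K"
  proof -
    have "\<mu> = expectation (\<lambda>\<omega>. f (X 0 \<omega>))" unfolding \<mu>_def integral_X(1)[OF f, of 0] ..
    also have "\<bar>\<dots>\<bar> \<le> expectation (\<lambda>\<omega>. \<bar>f (X 0 \<omega>)\<bar>)" by (rule integral_abs_bound)
    also have "\<dots> \<le> expectation (\<lambda>\<omega>. K)" by (rule integral_mono) (use int_f bound in auto)
    finally show ?thesis by (simp add: prob_space)
  qed
  have Zb: "\<bar>Z j \<omega>\<bar> \<le> 2 * K" for j \<omega> using bound[of "X j \<omega>"] \<mu> by (simp add: Z_def)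
  have [measurable]: "Z j \<in> borel_measurable M" for j unfolding Z_def[abs_def] by measurable
  have int_Z: "integrable M (Z j)" for j by (rule integrable_const_bound[of _ "2 * K"]) (use Zb in auto)
  have EZ: "expectation (Z j) = 0" for j
    unfolding Z_def using int_f[of j] integral_X(1)[OF f, of j] by (simp add: \<mu>_def prob_space)
  have int_ZZ: "integrable M (\<lambda>\<omega>. Z i \<omega> * Z j \<omega>)" for i j
    by (rule integrable_const_bound[of _ "(2 * K) * (2 * K)"]) (use abs_mult_le[OF Zb Zb] in auto)
  have indepZ: "indep_vars (\<lambda>_. borel) Z UNIV"
    unfolding Z_def[abs_def] by (rule indep_vars_compose2[OF indep]) measurable
  have EZZ: "expectation (\<lambda>\<omega>. Z i \<omega> * Z j \<omega>) = 0" if "i \<noteq> j" for i j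
  proof -
    have "expectation (\<lambda>\<omega>. \<Prod>l\<in>{i, j}. Z l \<omega>) = (\<Prod>l\<in>{i, j}. expectation (Z l))"
      by (rule indep_vars_lebesgue_integral) (use indep_vars_subset[OF indepZ] int_Z in auto)
    then show ?thesis using that EZ by simp
  qed
  have EZ2: "expectation (\<lambda>\<omega>. Z i \<omega> * Z i \<omega>) \<le> 4 * K\<^sup>2" for i
  proof -
    have "expectation (\<lambda>\<omega>. Z i \<omega> * Z i \<omega>) \<le> expectation (\<lambda>_. 4 * K\<^sup>2)"
    proof (rule integral_mono)
      show "Z i \<omega> * Z i \<omega> \<le> 4 * K\<^sup>2" for \<omega>
        using abs_mult_le[OF Zb[of i \<omega>] Zb[of i \<omega>]] by (simp add: power2_eq_square)
    qed (use int_ZZ in auto)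
    then show ?thesis by (simp add: prob_space)
  qed
  have second: "expectation (\<lambda>\<omega>. (\<Sum>j<n. Z j \<omega>)\<^sup>2) \<le> real n * (4 * K\<^sup>2)" "integrable M (\<lambda>\<omega>. (\<Sum>j<n. Z j \<omega>)\<^sup>2)" for n
  proof -
    have sq: "(\<Sum>j<n. Z j \<omega>)\<^sup>2 = (\<Sum>i<n. \<Sum>j<n. Z i \<omega> * Z j \<omega>)" for \<omega>
      by (simp add: power2_eq_square sum_product)
    show "integrable M (\<lambda>\<omega>. (\<Sum>j<n. Z j \<omega>)\<^sup>2)" unfolding sq using int_ZZ by auto
    have "expectation (\<lambda>\<omega>. (\<Sum>j<n. Z j \<omega>)\<^sup>2) = (\<Sum>i<n. \<Sum>j<n. expectation (\<lambda>\<omega>. Z i \<omega> * Z j \<omega>))"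
      unfolding sq using int_ZZ by (simp add: Bochner_Integration.integral_sum)
    also have "\<dots> = (\<Sum>i<n. \<Sum>j<n. if i = j then expectation (\<lambda>\<omega>. Z i \<omega> * Z i \<omega>) else 0)"
      by (intro sum.cong refl) (auto simp: EZZ)
    also have "\<dots> = (\<Sum>i<n. expectation (\<lambda>\<omega>. Z i \<omega> * Z i \<omega>))" by simp
    also have "\<dots> \<le> (\<Sum>i<n. 4 * K\<^sup>2)" by (intro sum_mono EZ2)
    finally show "expectation (\<lambda>\<omega>. (\<Sum>j<n. Z j \<omega>)\<^sup>2) \<le> real n * (4 * K\<^sup>2)" by simp
  qed
  have bnd: "prob {\<omega>\<in>space M. r \<le> \<bar>1 / real n * (\<Sum>j<n. f (X j \<omega>)) - \<mu>\<bar>} \<le> 4 * K\<^sup>2 / r\<^sup>2 * (1 / real n)" if n: "n > 0" for n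
  proof -
    have eq: "1 / real n * (\<Sum>j<n. f (X j \<omega>)) - \<mu> = (\<Sum>j<n. Z j \<omega>) / real n" for \<omega>
      using n by (simp add: Z_def sum_subtractf field_simps)
    have "{\<omega>\<in>space M. r \<le> \<bar>1 / real n * (\<Sum>j<n. f (X j \<omega>)) - \<mu>\<bar>} = {\<omega>\<in>space M. (real n * r)\<^sup>2 \<le> (\<Sum>j<n. Z j \<omega>)\<^sup>2}"
      unfolding eq abs_le_square_iff[symmetric] using n r by (auto simp: field_simps abs_mult)
    also have "prob \<dots> \<le> expectation (\<lambda>\<omega>. (\<Sum>j<n. Z j \<omega>)\<^sup>2) / (real n * r)\<^sup>2"
      by (rule integral_Markov_inequality_measure[where A = "{}"]) (use second(2) n r in auto)
    also have "\<dots> \<le> (real n * (4 * K\<^sup>2)) / (real n * r)\<^sup>2" by (intro divide_right_mono second) auto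
    also have "\<dots> = 4 * K\<^sup>2 / r\<^sup>2 * (1 / real n)" using n r by (simp add: power2_eq_square field_simps)
    finally show ?thesis .
  qed
  have "(\<lambda>n. 4 * K\<^sup>2 / r\<^sup>2 * (1 / real n)) \<longlonglongrightarrow> 0" by real_asymp
  then have "\<forall>\<^sub>F n in sequentially. 4 * K\<^sup>2 / r\<^sup>2 * (1 / real n) < \<epsilon>" using \<epsilon> by (rule order_tendstoD(2))
  then show ?thesis using eventually_gt_at_top[of 0]
  proof eventually_elim
    case (elim n)
    then show ?case using bnd[OF elim(2)] unfolding \<mu>_def by linarith
  qed
qed

text \<open>
  Khinchin's weak law, without a second moment, by truncation: the part of \<open>f\<close> that is cut off has small
  mean absolute value, which Markov's inequality turns into a small probability.
\<close>

lemma weak_law: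
  fixes f :: "real \<Rightarrow> real"
  assumes int: "integrable N f" and r: "0 < r"
  shows "with_prob_tending_to_1 M (\<lambda>n \<omega>. \<bar>1 / real n * (\<Sum>j<n. f (X j \<omega>)) - integral\<^sup>L N f\<bar> < r)"
proof (rule with_prob_of_prob)
  note X_meas [measurable] and sets_N [measurable_cong, simp] and space_N [simp]
  have f [measurable]: "f \<in> borel_measurable borel" using borel_measurable_integrable[OF int] by simp
  show "{\<omega>\<in>space M. \<not> \<bar>1 / real n * (\<Sum>j<n. f (X j \<omega>)) - integral\<^sup>L N f\<bar> < r} \<in> sets M" for n
    by measurable
  fix \<epsilon> :: real assume \<epsilon>: "0 < \<epsilon>"
  define fK where "fK k x = (if \<bar>f x\<bar> \<le> real k then f x else 0)" for k x
  have [measurable]: "fK k \<in> borel_measurable borel" for k unfolding fK_def[abs_def] by measurable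
  have lim: "(\<lambda>k. \<integral>x. \<bar>f x - fK k x\<bar> \<partial>N) \<longlonglongrightarrow> (\<integral>x. 0 \<partial>N)"
  proof (rule integral_dominated_convergence[where w = "\<lambda>x. \<bar>f x\<bar>"])
    show "AE x in N. (\<lambda>k. \<bar>f x - fK k x\<bar>) \<longlonglongrightarrow> 0"
    proof (rule AE_I2)
      fix x
      have "\<forall>\<^sub>F k in sequentially. \<bar>f x\<bar> \<le> real k"
        using eventually_ge_at_top[of "nat \<lceil>\<bar>f x\<bar>\<rceil>"] by eventually_elim linarith
      then have "\<forall>\<^sub>F k in sequentially. \<bar>f x - fK k x\<bar> = 0"
        by eventually_elim (simp add: fK_def)
      then show "(\<lambda>k. \<bar>f x - fK k x\<bar>) \<longlonglongrightarrow> 0" by (rule tendsto_eventually)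
    qed
    show "AE x in N. norm \<bar>f x - fK k x\<bar> \<le> \<bar>f x\<bar>" for k by (auto simp: fK_def)
  qed (use int in auto)
  \<comment> \<open>The truncation changes the mean by less than \<open>r / 4\<close>, and by Markov's inequality it changes the average by
    \<open>r / 4\<close> or more with probability at most \<open>\<epsilon> / 2\<close>.\<close>
  define \<delta> where "\<delta> = min (r / 4) (\<epsilon> * r / 8)"
  have "0 < \<delta>" using r \<epsilon> by (simp add: \<delta>_def)
  then have "\<forall>\<^sub>F k in sequentially. (\<integral>x. \<bar>f x - fK k x\<bar> \<partial>N) < \<delta>"
    using order_tendstoD(2)[OF lim] by simp
  then obtain k where k: "(\<integral>x. \<bar>f x - fK k x\<bar> \<partial>N) < \<delta>"
    by (auto simp: eventually_sequentially)
  define h where "h x = \<bar>f x - fK k x\<bar>" for x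
  have [measurable]: "h \<in> borel_measurable borel" unfolding h_def[abs_def] by measurable
  have int_h: "integrable N h"
    by (rule Bochner_Integration.integrable_bound[OF int]) (auto simp: h_def fK_def)
  have int_fK: "integrable N (fK k)"
    by (rule Bochner_Integration.integrable_bound[OF int]) (auto simp: fK_def)
  have Eh: "integral\<^sup>L N h < \<delta>" using k by (simp add: h_def[abs_def])
  have diff: "\<bar>integral\<^sup>L N f - integral\<^sup>L N (fK k)\<bar> \<le> integral\<^sup>L N h"
    using integral_abs_bound[of N "\<lambda>x. f x - fK k x"] int int_fK by (simp add: h_def[abs_def])
  have ev: "\<forall>\<^sub>F n in sequentially. prob {\<omega>\<in>space M. r / 4 \<le> \<bar>1 / real n * (\<Sum>j<n. fK k (X j \<omega>)) - integral\<^sup>L N (fK k)\<bar>} \<le> \<epsilon> / 2"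
    by (rule weak_law_bounded[where K = "real k"]) (use r \<epsilon> in \<open>auto simp: fK_def\<close>)
  show "\<forall>\<^sub>F n in sequentially. prob {\<omega>\<in>space M. \<not> \<bar>1 / real n * (\<Sum>j<n. f (X j \<omega>)) - integral\<^sup>L N f\<bar> < r} \<le> \<epsilon>"
    using ev eventually_gt_at_top[of 0]
  proof eventually_elim
    case (elim n)
    let ?A = "{\<omega>\<in>space M. r / 4 \<le> \<bar>1 / real n * (\<Sum>j<n. fK k (X j \<omega>)) - integral\<^sup>L N (fK k)\<bar>}"
    let ?B = "{\<omega>\<in>space M. r / 4 \<le> 1 / real n * (\<Sum>j<n. h (X j \<omega>))}"
    have intM: "integrable M (\<lambda>\<omega>. h (X j \<omega>))" for j using integral_X(2)[of h j] int_h by simp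
    have "prob ?B \<le> expectation (\<lambda>\<omega>. 1 / real n * (\<Sum>j<n. h (X j \<omega>))) / (r / 4)"
      by (rule integral_Markov_inequality_measure[where A = "{}"]) (use intM r in \<open>auto simp: h_def intro!: sum_nonneg divide_nonneg_nonneg\<close>)
    also have "expectation (\<lambda>\<omega>. 1 / real n * (\<Sum>j<n. h (X j \<omega>))) = integral\<^sup>L N h"
      using intM elim(2) integral_X(1)[of h] by (simp add: Bochner_Integration.integral_sum)
    also have "integral\<^sup>L N h / (r / 4) \<le> \<epsilon> / 2"
      using Eh r by (simp add: \<delta>_def field_simps)
    finally have B: "prob ?B \<le> \<epsilon> / 2" .
    have "{\<omega>\<in>space M. \<not> \<bar>1 / real n * (\<Sum>j<n. f (X j \<omega>)) - integral\<^sup>L N f\<bar> < r} \<subseteq> ?A \<union> ?B"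
    proof
      fix \<omega> assume *: "\<omega> \<in> {\<omega>\<in>space M. \<not> \<bar>1 / real n * (\<Sum>j<n. f (X j \<omega>)) - integral\<^sup>L N f\<bar> < r}"
      define F where "F = 1 / real n * (\<Sum>j<n. f (X j \<omega>))"
      define FK where "FK = 1 / real n * (\<Sum>j<n. fK k (X j \<omega>))"
      define HH where "HH = 1 / real n * (\<Sum>j<n. h (X j \<omega>))"
      have "\<bar>F - FK\<bar> = 1 / real n * \<bar>\<Sum>j<n. f (X j \<omega>) - fK k (X j \<omega>)\<bar>"
        by (simp add: F_def FK_def sum_subtractf diff_divide_distrib[symmetric])
      also have "\<dots> \<le> HH" unfolding HH_def h_def by (intro mult_left_mono sum_abs) auto
      finally have "\<bar>F - FK\<bar> \<le> HH" .
      moreover have "r \<le> \<bar>F - integral\<^sup>L N f\<bar>" using * by (simp add: F_def)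
      moreover have "integral\<^sup>L N h < r / 4" using Eh by (simp add: \<delta>_def)
      ultimately have "r / 4 \<le> \<bar>FK - integral\<^sup>L N (fK k)\<bar> \<or> r / 4 \<le> HH"
        using diff by linarith
      then show "\<omega> \<in> ?A \<union> ?B" using * by (auto simp: FK_def HH_def)
    qed
    then have "prob {\<omega>\<in>space M. \<not> \<bar>1 / real n * (\<Sum>j<n. f (X j \<omega>)) - integral\<^sup>L N f\<bar> < r} \<le> prob (?A \<union> ?B)"
      by (intro finite_measure_mono) measurable
    also have "\<dots> \<le> prob ?A + prob ?B" by (intro measure_Un_le) measurable
    finally show ?case using elim(1) B by simp
  qed
qed

lemma AE_X:
  assumes "AE x in N. P x" shows "AE \<omega> in M. P (X i \<omega>)"
  using assms unfolding distr[of i, symmetric] by (rule AE_distrD[rotated]) (rule X_meas)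

text \<open>The joint law is a product, for which the diagonal is null by Fubini's theorem.\<close>

lemma AE_X_distinct:
  assumes null: "\<And>x. emeasure N {x} = 0" and ij: "i \<noteq> j"
  shows "AE \<omega> in M. X i \<omega> \<noteq> X j \<omega>"
proof -
  note X_meas [measurable] and sets_N [measurable_cong, simp] and space_N [simp]
  have "indep_var (PiM {i} (\<lambda>_. borel)) (\<lambda>\<omega>. restrict (\<lambda>k. X k \<omega>) {i})
      (PiM {j} (\<lambda>_. borel)) (\<lambda>\<omega>. restrict (\<lambda>k. X k \<omega>) {j})"
    using indep_var_restrict[OF indep, of "{i}" "{j}"] ij by simp
  from indep_var_compose[OF this, of "\<lambda>x. x i" borel "\<lambda>x. x j" borel]
  have "indep_var borel (X i) borel (X j)" by (simp add: o_def)
  then have joint: "N \<Otimes>\<^sub>M N = distr M (borel \<Otimes>\<^sub>M borel) (\<lambda>\<omega>. (X i \<omega>, X j \<omega>))"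
    using indep_var_distribution_eq[of borel "X i" borel "X j"] by (simp add: distr)
  interpret N: prob_space N using prob_space_distr[OF X_meas, of 0] by (simp add: distr)
  let ?D = "{z :: real \<times> real. fst z = snd z}"
  have D: "?D \<in> sets (borel \<Otimes>\<^sub>M borel)"
    unfolding borel_prod by (intro borel_closed closed_Collect_eq continuous_intros)
  have NN: "sets (N \<Otimes>\<^sub>M N) = sets (borel \<Otimes>\<^sub>M borel)" by (intro sets_pair_measure_cong) simp_all
  have "emeasure (N \<Otimes>\<^sub>M N) ?D = (\<integral>\<^sup>+x. emeasure N (Pair x -` ?D) \<partial>N)"
    by (rule N.emeasure_pair_measure_alt) (use D NN in simp)
  also have "(\<lambda>x. Pair x -` ?D) = (\<lambda>x. {x})" by auto
  finally have "emeasure (N \<Otimes>\<^sub>M N) ?D = 0" by (simp add: null)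
  then have "emeasure M ((\<lambda>\<omega>. (X i \<omega>, X j \<omega>)) -` ?D \<inter> space M) = 0"
    unfolding joint using D by (subst (asm) emeasure_distr) auto
  moreover have "(\<lambda>\<omega>. (X i \<omega>, X j \<omega>)) -` ?D \<inter> space M = {\<omega>\<in>space M. X i \<omega> = X j \<omega>}" by auto
  moreover have "{\<omega>\<in>space M. X i \<omega> = X j \<omega>} \<in> sets M" by measurable
  ultimately show ?thesis by (auto intro!: AE_I'[of "{\<omega>\<in>space M. X i \<omega> = X j \<omega>}"] simp: null_sets_def)
qed

end

end


section \<open>Derivatives of truncated log-densities\<close>

lemma ddir_diff:
  assumes "f differentiable (at z)" "g differentiable (at z)"
  shows "ddir b (\<lambda>z. f z - g z) z = ddir b f z - ddir b g z"
  using has_derivative_diff[OF assms[THEN differentiable_has_ddir]] by (rule ddir_eqI)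

lemma ddir_uminus:
  assumes "f differentiable (at z)"
  shows "ddir b (\<lambda>z. - f z) z = - ddir b f z"
  using has_derivative_minus[OF assms[THEN differentiable_has_ddir]] by (rule ddir_eqI)

lemma iter_d_cong:
  assumes "open S" "\<And>z. z \<in> S \<Longrightarrow> F z = G z" "z \<in> S"
  shows "iter_d F is z = iter_d G is z"
  using assms(3)
proof (induction "is" arbitrary: z)
  case (Cons i "is")
  show ?case using ddir_cong[OF assms(1) Cons.prems, of "iter_d F is" "iter_d G is"] Cons.IH by simp
qed (use assms in auto)

lemma iter_d_diff:
  assumes S: "open S" and F: "smooth_on S F" and G: "smooth_on S G" and "z \<in> S"
  shows "iter_d (\<lambda>z. F z - G z) is z = iter_d F is z - iter_d G is z"
  using assms(4)
proof (induction "is" arbitrary: z)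
  case (Cons i "is")
  have "iter_d (\<lambda>z. F z - G z) (i # is) z = ddir (axis i 1, 0) (\<lambda>z. iter_d F is z - iter_d G is z) z"
    using ddir_cong[OF S Cons.prems, of "iter_d (\<lambda>z. F z - G z) is" "\<lambda>z. iter_d F is z - iter_d G is z"] Cons.IH
    by simp
  then show ?case
    using ddir_diff[OF smooth_on_differentiable[OF S smooth_on_iter_d[OF F] Cons.prems]
      smooth_on_differentiable[OF S smooth_on_iter_d[OF G] Cons.prems], of "(axis i 1, 0)" "is" "is"] by simp
qed simp

lemma iter_d_uminus:
  assumes S: "open S" and F: "smooth_on S F" and "z \<in> S"
  shows "iter_d (\<lambda>z. - F z) is z = - iter_d F is z"
  using assms(3)
proof (induction "is" arbitrary: z)
  case (Cons i "is")
  have "iter_d (\<lambda>z. - F z) (i # is) z = ddir (axis i 1, 0) (\<lambda>z. - iter_d F is z) z"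
    using ddir_cong[OF S Cons.prems, of "iter_d (\<lambda>z. - F z) is" "\<lambda>z. - iter_d F is z"] Cons.IH
    by simp
  then show ?case
    using ddir_uminus[OF smooth_on_differentiable[OF S smooth_on_iter_d[OF F] Cons.prems],
      of "(axis i 1, 0)" "is"] by simp
qed simp

lemma ddir_gamma_const:
  assumes S: "open S" and F: "smooth_on S F" and z: "z \<in> S" and const: "\<And>\<theta> \<gamma> \<gamma>'. F (\<theta>, \<gamma>) = F (\<theta>, \<gamma>')"
  shows "ddir (0, 1) F z = 0"
proof -
  obtain \<theta> \<gamma> where zz: "z = (\<theta>, \<gamma>)" by (cases z)
  have "deriv (\<lambda>_. F (\<theta>, 0)) 0 = ddir (0, 1) F (\<theta>, \<gamma>)"
    by (rule deriv_along_line[OF S F]) (use z zz const in auto)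
  then show ?thesis by (simp add: zz)
qed

lemma iter_g_const_diff:
  assumes S: "open S" and F: "smooth_on S F" and G: "smooth_on S G"
    and const: "\<And>\<theta> \<gamma> \<gamma>'. G (\<theta>, \<gamma>) = G (\<theta>, \<gamma>')" and "z \<in> S"
  shows "iter_g (Suc s) (\<lambda>z. G z - F z) z = - iter_g (Suc s) F z"
  using assms(5)
proof (induction s arbitrary: z)
  case 0
  then show ?case
    using ddir_diff[OF smooth_on_differentiable[OF S G] smooth_on_differentiable[OF S F], of z "(0, 1)"]
      ddir_gamma_const[OF S G _ const] by simp
next
  case (Suc s)
  have "iter_g (Suc (Suc s)) (\<lambda>z. G z - F z) z = ddir (0, 1) (\<lambda>z. - iter_g (Suc s) F z) z"
    using ddir_cong[OF S Suc.prems, of "iter_g (Suc s) (\<lambda>z. G z - F z)" "\<lambda>z. - iter_g (Suc s) F z"] Suc.IH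
    by simp
  then show ?case
    using ddir_uminus[OF smooth_on_differentiable[OF S smooth_on_iter_g[OF F, of "Suc s"] Suc.prems], of "(0, 1)"] by simp
qed

lemma D_theta_eq_iter_d:
  assumes S: "open S" and F: "smooth_on S F" and f: "\<And>\<eta>. (\<eta>, \<gamma>) \<in> S \<Longrightarrow> f \<eta> = F (\<eta>, \<gamma>)"
    and "(\<theta>, \<gamma>) \<in> S"
  shows "D_theta f \<theta> is = iter_d F is (\<theta>, \<gamma>)"
  using assms(4)
proof (induction "is" arbitrary: \<theta>)
  case (Cons i "is")
  have "deriv (\<lambda>h. D_theta f (\<theta> + h *\<^sub>R axis i 1) is) 0 = ddir (axis i 1, 0) (iter_d F is) (\<theta>, \<gamma>)"
    by (rule deriv_along_line[OF S smooth_on_iter_d[OF F] Cons.prems]) (simp add: Cons.IH)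
  then show ?case by (simp add: pderiv_at_def)
qed (simp add: f)

lemma bounded_derivatives:
  assumes S: "open S" and F: "smooth_on S F" and B: "compact B" "B \<subseteq> S"
  shows "\<exists>H>0. \<forall>z\<in>B. \<forall>s\<le>a. \<forall>is. length is \<le> b \<longrightarrow> \<bar>iter_d (iter_g s F) is z\<bar> \<le> H"
proof -
  let ?I = "{..a} \<times> {is :: 'a list. length is \<le> b}"
  have fin: "finite ?I" using finite_lists_length_le[of "UNIV :: 'a set" b] by simp
  have "\<exists>H. \<forall>z\<in>B. \<bar>iter_d (iter_g (fst p) F) (snd p) z\<bar> \<le> H" for p
  proof -
    have "continuous_on B (iter_d (iter_g (fst p) F) (snd p))"
      using smooth_on_continuous[OF smooth_on_iter_d[OF smooth_on_iter_g[OF F]]] B(2) continuous_on_subset by blast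
    then have "bounded (iter_d (iter_g (fst p) F) (snd p) ` B)"
      using B(1) compact_continuous_image compact_imp_bounded by blast
    then show ?thesis by (auto simp: bounded_iff)
  qed
  then obtain H where H: "\<And>p z. z \<in> B \<Longrightarrow> \<bar>iter_d (iter_g (fst p) F) (snd p) z\<bar> \<le> H p" by metis
  define H' where "H' = 1 + (\<Sum>p\<in>?I. \<bar>H p\<bar>)"
  have "H p \<le> H'" if "p \<in> ?I" for p
    using member_le_sum[OF that _ fin, of "\<lambda>p. \<bar>H p\<bar>"] by (simp add: H'_def)
  moreover have "H' > 0" by (simp add: H'_def add_pos_nonneg sum_nonneg)
  ultimately show ?thesis
  proof (intro exI[of _ H'] conjI ballI allI impI)
    fix z s and "is" :: "'a list" assume "z \<in> B" "s \<le> a" "length is \<le> b"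
    then show "\<bar>iter_d (iter_g s F) is z\<bar> \<le> H'"
      using H[of z "(s, is)"] \<open>\<And>p. p \<in> ?I \<Longrightarrow> H p \<le> H'\<close>[of "(s, is)"] by simp
  qed
qed

lemma gamma_ML_properties:
  assumes "0 < n" shows "\<exists>j<n. gamma_ML n x = x j" "\<And>j. j < n \<Longrightarrow> gamma_ML n x \<le> x j"
proof -
  have "Min (x ` {..<n}) \<in> x ` {..<n}" using assms by (intro Min_in) auto
  then show "\<exists>j<n. gamma_ML n x = x j" by (auto simp: gamma_ML_def)
qed (simp add: gamma_ML_def)

locale truncated_family =
  fixes \<Theta> :: "(real ^ 'd::finite) set" and I1 I2 :: ereal
    and q :: "real \<Rightarrow> real ^ 'd \<Rightarrow> real" and \<gamma>0 :: real
  assumes family: "oTF \<Theta> I1 I2 q" and \<gamma>0: "\<gamma>0 \<in> einterval I1 I2"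
begin

abbreviation J where "J \<equiv> einterval I1 I2"

definition S :: "((real ^ 'd) \<times> real) set" where "S = \<Theta> \<times> J"

definition U :: "real set" where "U = {x. \<gamma>0 < x \<and> ereal x < I2}"

text \<open>
  The log-density is \<open>lp x = lp0 x - h\<close>. Here \<open>lp0 x\<close> is free of \<open>\<gamma>\<close>, so that its \<open>\<theta>\<close>-derivatives are those
  with the integrable envelope, and \<open>h\<close> is free of the observation, so that its derivatives need no
  averaging.
\<close>

definition h :: "(real ^ 'd) \<times> real \<Rightarrow> real" where
  "h z = psi I2 q (fst z) (snd z) - psi I2 q (fst z) \<gamma>0"

definition lp :: "real \<Rightarrow> (real ^ 'd) \<times> real \<Rightarrow> real" where
  "lp x z = logp I2 q x (fst z) (snd z)"

definition lp0 :: "real \<Rightarrow> (real ^ 'd) \<times> real \<Rightarrow> real" where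
  "lp0 x z = logp I2 q x (fst z) \<gamma>0"

lemma lp_eq: "lp x = (\<lambda>z. lp0 x z - h z)"
  by (auto simp: lp_def lp0_def h_def logp_def)

lemma open_\<Theta>: "open \<Theta>" using family by (simp add: oTF_def)

lemma open_J: "open J" by simp

lemma open_S: "open S" unfolding S_def by (intro open_Times open_\<Theta> open_J)

lemma tsupport_J: "\<gamma> \<in> J \<Longrightarrow> tsupport I2 \<gamma> \<subseteq> J"
proof
  fix x assume "\<gamma> \<in> J" "x \<in> tsupport I2 \<gamma>"
  then have "I1 < ereal \<gamma>" "ereal \<gamma> \<le> ereal x" "ereal x < I2" by (auto simp: einterval_def tsupport_def)
  then show "x \<in> J" using less_le_trans[of I1 "ereal \<gamma>" "ereal x"] by (simp add: einterval_def)
qed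

lemma U_J: "U \<subseteq> J"
  using tsupport_J[OF \<gamma>0] by (auto simp: U_def tsupport_def)

lemma q_pos: "\<theta> \<in> \<Theta> \<Longrightarrow> x \<in> J \<Longrightarrow> 0 < q x \<theta>"
  using family by (simp add: oTF_def)

lemma q_integrable: "\<theta> \<in> \<Theta> \<Longrightarrow> \<gamma> \<in> J \<Longrightarrow> set_integrable lborel (tsupport I2 \<gamma>) (\<lambda>x. q x \<theta>)"
  using family by (simp add: oTF_def)

lemma right_point: "\<gamma> \<in> J \<Longrightarrow> \<exists>y. \<gamma> < y \<and> ereal y < I2"
  using ereal_dense2[of "ereal \<gamma>" I2] by (auto simp: einterval_def)

lemma tsupport_borel [measurable]: "tsupport I2 \<gamma> \<in> sets borel"
proof -
  have "tsupport I2 \<gamma> = {\<gamma>..} \<inter> einterval (-\<infinity>) I2" by (auto simp: tsupport_def einterval_def)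
  then show ?thesis by simp
qed

lemma U_borel [measurable]: "U \<in> sets borel"
proof -
  have "U = {\<gamma>0<..} \<inter> einterval (-\<infinity>) I2" by (auto simp: U_def einterval_def)
  then show ?thesis by simp
qed

lemma indicator_q_nonneg: "\<theta> \<in> \<Theta> \<Longrightarrow> \<gamma> \<in> J \<Longrightarrow> 0 \<le> indicator (tsupport I2 \<gamma>) x * q x \<theta>"
  using q_pos[of \<theta> x] tsupport_J[of \<gamma>] by (auto simp: indicator_def less_imp_le)

lemma not_AE_interval:
  fixes \<gamma> y :: real
  assumes "\<gamma> < y" shows "\<not> (AE x in lborel. x \<notin> {\<gamma><..<y})"
proof
  assume "AE x in lborel. x \<notin> {\<gamma><..<y}"
  then have "emeasure lborel {\<gamma><..<y} = 0" by (subst (asm) AE_iff_null_sets[symmetric]) auto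
  then show False using assms by simp
qed

lemma norm_const_pos:
  assumes \<theta>: "\<theta> \<in> \<Theta>" and \<gamma>: "\<gamma> \<in> J" shows "0 < (LINT x:tsupport I2 \<gamma>|lborel. q x \<theta>)"
proof -
  have int: "integrable lborel (\<lambda>x. indicator (tsupport I2 \<gamma>) x * q x \<theta>)"
    using q_integrable[OF assms] by (simp add: set_integrable_def)
  have nn: "AE x in lborel. 0 \<le> indicator (tsupport I2 \<gamma>) x * q x \<theta>"
    using indicator_q_nonneg[OF assms] by simp
  have "(\<integral>x. indicator (tsupport I2 \<gamma>) x * q x \<theta> \<partial>lborel) \<noteq> 0"
  proof
    assume "(\<integral>x. indicator (tsupport I2 \<gamma>) x * q x \<theta> \<partial>lborel) = 0"
    then have ae: "AE x in lborel. indicator (tsupport I2 \<gamma>) x * q x \<theta> = 0"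
      using integral_nonneg_eq_0_iff_AE[OF int nn] by simp
    obtain y where y: "\<gamma> < y" "ereal y < I2" using right_point[OF \<gamma>] by blast
    have "AE x in lborel. x \<notin> {\<gamma><..<y}"
      using ae
    proof eventually_elim
      case (elim x)
      have "x \<in> tsupport I2 \<gamma>" if "x \<in> {\<gamma><..<y}"
        using that y by (auto simp: tsupport_def intro: less_trans[of _ "ereal y"])
      then show ?case using elim q_pos[OF \<theta>, of x] tsupport_J[OF \<gamma>] by (auto simp: indicator_def)
    qed
    then show False using not_AE_interval[OF y(1)] by simp
  qed
  moreover have "0 \<le> (\<integral>x. indicator (tsupport I2 \<gamma>) x * q x \<theta> \<partial>lborel)"
    using nn by (rule integral_nonneg_AE)
  ultimately show ?thesis by (simp add: set_lebesgue_integral_def)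
qed

lemma psi_antimono:
  assumes \<theta>: "\<theta> \<in> \<Theta>" and "\<gamma> \<in> J" "\<gamma>' \<in> J" "\<gamma> \<le> \<gamma>'"
  shows "psi I2 q \<theta> \<gamma>' \<le> psi I2 q \<theta> \<gamma>"
proof -
  have "(LINT x:tsupport I2 \<gamma>'|lborel. q x \<theta>) \<le> (LINT x:tsupport I2 \<gamma>|lborel. q x \<theta>)"
    unfolding set_lebesgue_integral_def
  proof (rule integral_mono)
    show "integrable lborel (\<lambda>x. indicator (tsupport I2 \<gamma>') x *\<^sub>R q x \<theta>)"
      "integrable lborel (\<lambda>x. indicator (tsupport I2 \<gamma>) x *\<^sub>R q x \<theta>)"
      using q_integrable \<theta> assms(2,3) by (auto simp: set_integrable_def)
    fix x
    have "x \<in> tsupport I2 \<gamma>' \<Longrightarrow> x \<in> tsupport I2 \<gamma>" using assms(4) by (auto simp: tsupport_def)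
    then show "indicator (tsupport I2 \<gamma>') x *\<^sub>R q x \<theta> \<le> indicator (tsupport I2 \<gamma>) x *\<^sub>R q x \<theta>"
      using indicator_q_nonneg[OF \<theta> assms(2), of x] by (auto simp: indicator_def)
  qed
  then show ?thesis unfolding psi_def using norm_const_pos[OF \<theta> assms(3)] by (intro ln_mono) auto
qed

lemma pdens_eq_exp:
  assumes "x \<in> tsupport I2 \<gamma>" "\<theta> \<in> \<Theta>" "\<gamma> \<in> J"
  shows "pdens I2 q x \<theta> \<gamma> = exp (logp I2 q x \<theta> \<gamma>)"
proof -
  have "0 < q x \<theta>" using assms tsupport_J q_pos by blast
  then show ?thesis using assms(1) by (simp add: pdens_def logp_def exp_diff exp_minus field_simps)
qed

lemma smooth_logp_below:
  assumes x: "x \<in> J" shows "smooth_on (\<Theta> \<times> {\<gamma>\<in>J. \<gamma> < x}) (lp x)"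
proof -
  let ?T = "\<Theta> \<times> {\<gamma>\<in>J. \<gamma> < x}"
  have "{\<gamma>\<in>J. \<gamma> < x} = J \<inter> {..<x}" by auto
  then have T: "open ?T" using open_\<Theta> by (simp add: open_Times open_Int)
  have eq: "(case z of (\<theta>, \<gamma>) \<Rightarrow> pdens I2 q x \<theta> \<gamma>) = exp (lp x z)" if "z \<in> ?T" for z
    using that x pdens_eq_exp[of x "snd z" "fst z"] by (auto simp: lp_def tsupport_def einterval_def)
  have "smooth_on ?T (\<lambda>(\<theta>, \<gamma>). pdens I2 q x \<theta> \<gamma>)" using family x by (simp add: oTF_def)
  then have "smooth_on ?T (\<lambda>z. ln (case z of (\<theta>, \<gamma>) \<Rightarrow> pdens I2 q x \<theta> \<gamma>))"
    by (rule smooth_on_ln[OF T]) (simp only: eq exp_gt_zero)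
  then show ?thesis by (rule smooth_on_cong[OF T]) (simp only: eq ln_exp)
qed

lemma smooth_lp0:
  assumes x: "x \<in> U" shows "smooth_on S (lp0 x)"
proof -
  have xJ: "x \<in> J" using x U_J by blast
  let ?T = "\<Theta> \<times> {\<gamma>\<in>J. \<gamma> < x}"
  have "{\<gamma>\<in>J. \<gamma> < x} = J \<inter> {..<x}" by auto
  then have T: "open ?T" using open_\<Theta> by (simp add: open_Times open_Int)
  have L: "bounded_linear (\<lambda>z :: (real ^ 'd) \<times> real. (fst z, 0 :: real))"
    by (intro bounded_linear_Pair bounded_linear_fst bounded_linear_zero)
  from smooth_on_affine[OF T L smooth_logp_below[OF xJ], of "(0, \<gamma>0)"]
  have "smooth_on {z. fst z \<in> \<Theta> \<and> \<gamma>0 \<in> J \<and> \<gamma>0 < x} (\<lambda>z :: (real ^ 'd) \<times> real. lp x (fst z, \<gamma>0))"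
    by simp
  moreover have "{z :: (real ^ 'd) \<times> real. fst z \<in> \<Theta> \<and> \<gamma>0 \<in> J \<and> \<gamma>0 < x} = \<Theta> \<times> (UNIV :: real set)"
    using \<gamma>0 x by (auto simp: U_def)
  ultimately have "smooth_on (\<Theta> \<times> (UNIV :: real set)) (\<lambda>z. lp x (fst z, \<gamma>0))" by simp
  then have "smooth_on S (\<lambda>z. lp x (fst z, \<gamma>0))"
    by (rule smooth_on_subset[rotated 3]) (use open_\<Theta> open_S in \<open>auto simp: S_def open_Times\<close>)
  then show ?thesis by (simp add: lp_def lp0_def[abs_def])
qed

text \<open>
  Near a given \<open>\<gamma>\<close>, \<open>h\<close> is the difference of \<open>lp0 y\<close> and \<open>lp y\<close> for any point \<open>y\<close> of the support to the right of
  \<open>\<gamma>0\<close> and \<open>\<gamma>\<close>; both are smooth there although \<open>psi\<close> and \<open>ln (q y _)\<close> are not known to be.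
\<close>

lemma smooth_h: "smooth_on S h"
proof (rule smooth_on_local[OF open_S])
  fix z assume z: "z \<in> S"
  have "max \<gamma>0 (snd z) \<in> J" using z \<gamma>0 by (auto simp: S_def max_def)
  then obtain y where y: "max \<gamma>0 (snd z) < y" "ereal y < I2" using right_point by blast
  have yU: "y \<in> U" using y by (simp add: U_def)
  let ?T = "\<Theta> \<times> {\<gamma>\<in>J. \<gamma> < y}"
  have "{\<gamma>\<in>J. \<gamma> < y} = J \<inter> {..<y}" by auto
  then have T: "open ?T" using open_\<Theta> by (simp add: open_Times open_Int)
  have TS: "?T \<subseteq> S" by (auto simp: S_def)
  have "smooth_on ?T (lp0 y)" by (rule smooth_on_subset[OF open_S T TS smooth_lp0[OF yU]])
  moreover have "smooth_on ?T (lp y)" using yU U_J by (intro smooth_logp_below) auto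
  ultimately have "smooth_on ?T (\<lambda>z. lp0 y z - lp y z)" by (rule smooth_on_diff[OF T])
  moreover have "(\<lambda>z. lp0 y z - lp y z) = h" by (simp add: lp_eq)
  ultimately show "\<exists>T. open T \<and> z \<in> T \<and> T \<subseteq> S \<and> smooth_on T h"
    using T TS z y by (intro exI[of _ ?T]) (auto simp: S_def)
qed

lemma smooth_lp: "x \<in> U \<Longrightarrow> smooth_on S (lp x)"
  unfolding lp_eq by (intro smooth_on_diff open_S smooth_lp0 smooth_h)

lemma smooth_prior: "prior_density \<Theta> I1 I2 \<pi> \<Longrightarrow> smooth_on S (\<lambda>z. \<pi> (fst z) (snd z))"
  by (simp add: prior_density_def S_def case_prod_beta')

lemma iter_d_lp:
  "x \<in> U \<Longrightarrow> z \<in> S \<Longrightarrow> iter_d (lp x) is z = iter_d (lp0 x) is z - iter_d h is z"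
  unfolding lp_eq by (intro iter_d_diff[OF open_S] smooth_lp0 smooth_h)

lemma iter_d_lp0:
  "x \<in> U \<Longrightarrow> z \<in> S \<Longrightarrow> iter_d (lp0 x) is z = D_theta (\<lambda>\<eta>. logp I2 q x \<eta> \<gamma>0) (fst z) is"
  using D_theta_eq_iter_d[OF open_S smooth_lp0, of x "snd z" "\<lambda>\<eta>. logp I2 q x \<eta> \<gamma>0" "fst z"]
  by (simp add: lp0_def)

lemma iter_d_iter_g_lp:
  assumes "x \<in> U" "z \<in> S"
  shows "iter_d (iter_g (Suc s) (lp x)) is z = - iter_d (iter_g (Suc s) h) is z"
proof -
  have "iter_g (Suc s) (lp x) w = - iter_g (Suc s) h w" if "w \<in> S" for w
    unfolding lp_eq by (rule iter_g_const_diff[OF open_S smooth_h smooth_lp0[OF assms(1)] _ that]) (simp add: lp0_def)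
  then have "iter_d (iter_g (Suc s) (lp x)) is z = iter_d (\<lambda>w. - iter_g (Suc s) h w) is z"
    by (rule iter_d_cong[OF open_S _ assms(2)])
  then show ?thesis
    using iter_d_uminus[OF open_S smooth_on_iter_g[OF smooth_h, of "Suc s"] assms(2), of "is"]
    by (simp del: iter_g.simps)
qed

text \<open>
  All observations lie in the support of the density with truncation point \<open>gamma_ML n x\<close>, so there the
  likelihood is the exponential of a sum, and the MLE can be compared with other values of \<open>\<theta>\<close>.
\<close>

lemma log_likelihood_le_MLE:
  assumes n: "0 < n" and x: "\<And>j. j < n \<Longrightarrow> x j \<in> U"
    and mle: "is_MLE \<Theta> I1 I2 q n x (theta_ML \<Theta> I2 q n x) (gamma_ML n x)" and \<theta>: "\<theta> \<in> \<Theta>"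
  shows "(\<Sum>j<n. logp I2 q (x j) \<theta> (gamma_ML n x)) \<le> (\<Sum>j<n. logp I2 q (x j) (theta_ML \<Theta> I2 q n x) (gamma_ML n x))"
proof -
  have J: "gamma_ML n x \<in> J" using mle by (simp add: is_MLE_def)
  have eq: "likelihood I2 q n x \<eta> (gamma_ML n x) = exp (\<Sum>j<n. logp I2 q (x j) \<eta> (gamma_ML n x))" if "\<eta> \<in> \<Theta>" for \<eta>
  proof -
    have "x j \<in> tsupport I2 (gamma_ML n x)" if "j < n" for j
      using x[OF that] gamma_ML_properties(2)[OF n that] by (simp add: U_def tsupport_def)
    then show ?thesis
      unfolding likelihood_def exp_sum[OF finite_lessThan] using pdens_eq_exp[OF _ that J] by (intro prod.cong) auto
  qed
  have "likelihood I2 q n x \<theta> (gamma_ML n x) \<le> likelihood I2 q n x (theta_ML \<Theta> I2 q n x) (gamma_ML n x)"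
    using mle \<theta> J by (simp add: is_MLE_def)
  then show ?thesis using mle \<theta> by (simp add: eq is_MLE_def)
qed

lemma A_hat_eq:
  assumes x: "\<And>j. j < n \<Longrightarrow> x j \<in> U" and z: "(theta_ML \<Theta> I2 q n x, gamma_ML n x) \<in> S" and l: "length is = r"
  shows "A_hat \<Theta> I2 q n x r s is
    = 1 / real n * (\<Sum>j<n. iter_d (iter_g s (lp (x j))) is (theta_ML \<Theta> I2 q n x, gamma_ML n x))"
proof -
  have "D_theta (\<lambda>\<theta>. (deriv ^^ s) (\<lambda>\<gamma>. logp I2 q (x j) \<theta> \<gamma>) (gamma_ML n x)) (theta_ML \<Theta> I2 q n x) is
      = iter_d (iter_g s (lp (x j))) is (theta_ML \<Theta> I2 q n x, gamma_ML n x)" if j: "j < n" for j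
  proof (rule D_theta_eq_iter_d[OF open_S smooth_on_iter_g[OF smooth_lp[OF x[OF j]]] _ z])
    fix \<eta> assume "(\<eta>, gamma_ML n x) \<in> S"
    from iter_deriv_gamma[OF open_S smooth_lp[OF x[OF j]] this, of s]
    show "(deriv ^^ s) (\<lambda>\<gamma>. logp I2 q (x j) \<eta> \<gamma>) (gamma_ML n x) = iter_g s (lp (x j)) (\<eta>, gamma_ML n x)"
      by (simp add: lp_def)
  qed
  then show ?thesis by (simp add: A_hat_def l)
qed

text \<open>
  Derivatives that involve \<open>\<gamma>\<close> do not depend on the observation, so averaging has no effect.
\<close>

lemma A_hat_Suc_eq:
  assumes x: "\<And>j. j < n \<Longrightarrow> x j \<in> U" and z: "(theta_ML \<Theta> I2 q n x, gamma_ML n x) \<in> S" and l: "length is = r" and n: "0 < n"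
  shows "A_hat \<Theta> I2 q n x r (Suc s) is = - iter_d (iter_g (Suc s) h) is (theta_ML \<Theta> I2 q n x, gamma_ML n x)"
proof -
  let ?z = "(theta_ML \<Theta> I2 q n x, gamma_ML n x)"
  have "(\<Sum>j<n. iter_d (iter_g (Suc s) (lp (x j))) is ?z) = (\<Sum>j<n. - iter_d (iter_g (Suc s) h) is ?z)"
    by (intro sum.cong refl iter_d_iter_g_lp x z) simp
  then show ?thesis using A_hat_eq[OF x z l, of "Suc s"] n by (simp del: iter_g.simps)
qed

text \<open>
  Derivatives are limits of difference quotients along a fixed sequence. The indicator removes the
  points at which no differentiability in \<open>\<theta>\<close> is known.
\<close>

lemma D_theta_measurable:
  assumes "\<theta> \<in> \<Theta>"
  shows "(\<lambda>x. indicator U x * D_theta (\<lambda>\<eta>. logp I2 q x \<eta> \<gamma>0) \<theta> is) \<in> borel_measurable borel"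
  using assms
proof (induction "is" arbitrary: \<theta>)
  case Nil
  have "(\<lambda>x. indicator (tsupport I2 \<gamma>0) x * q x \<theta>) \<in> borel_measurable borel"
    using q_integrable[OF Nil \<gamma>0] by (auto simp: set_integrable_def)
  then have "(\<lambda>x. indicator U x * (ln (indicator (tsupport I2 \<gamma>0) x * q x \<theta>) - psi I2 q \<theta> \<gamma>0)) \<in> borel_measurable borel"
    by measurable
  moreover have "indicator U x * (ln (indicator (tsupport I2 \<gamma>0) x * q x \<theta>) - psi I2 q \<theta> \<gamma>0)
      = indicator U x * logp I2 q x \<theta> \<gamma>0" for x
    by (auto simp: indicator_def U_def tsupport_def logp_def)
  ultimately show ?case by simp
next
  case (Cons i "is")
  let ?f = "\<lambda>x \<eta>. D_theta (\<lambda>\<eta>. logp I2 q x \<eta> \<gamma>0) \<eta> is"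
  let ?e = "axis i 1 :: real ^ 'd"
  obtain r where r: "r > 0" "ball \<theta> r \<subseteq> \<Theta>" using open_\<Theta> Cons.prems open_contains_ball by blast
  define a where "a k = r / 2 / real (Suc k)" for k
  have a: "0 < a k" "a k < r" for k
  proof -
    show "0 < a k" using r by (simp add: a_def)
    have "a k \<le> r / 2" using r by (simp add: a_def field_simps)
    then show "a k < r" using r by simp
  qed
  have a0: "a \<longlonglongrightarrow> 0" unfolding a_def[abs_def] by real_asymp
  have in\<Theta>: "\<theta> + a k *\<^sub>R ?e \<in> \<Theta>" for k
    using a[of k] r by (intro subsetD[OF r(2)]) (simp add: dist_norm)
  show ?case
  proof (rule borel_measurable_LIMSEQ_real)
    show "(\<lambda>x. (indicator U x * ?f x (\<theta> + a k *\<^sub>R ?e) - indicator U x * ?f x \<theta>) / a k) \<in> borel_measurable borel" for k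
      using Cons.IH[OF in\<Theta>] Cons.IH[OF Cons.prems] by measurable
    fix x
    show "(\<lambda>k. (indicator U x * ?f x (\<theta> + a k *\<^sub>R ?e) - indicator U x * ?f x \<theta>) / a k)
        \<longlonglongrightarrow> indicator U x * D_theta (\<lambda>\<eta>. logp I2 q x \<eta> \<gamma>0) \<theta> (i # is)"
    proof (cases "x \<in> U")
      case True
      have z: "(\<theta>, \<gamma>0) \<in> S" using Cons.prems \<gamma>0 by (simp add: S_def)
      define F where "F = iter_d (lp0 x) is"
      have F: "smooth_on S F" unfolding F_def by (rule smooth_on_iter_d[OF smooth_lp0[OF True]])
      have "((\<lambda>h. F ((\<theta>, \<gamma>0) + h *\<^sub>R (?e, 0))) has_real_derivative ddir (?e, 0) F ((\<theta>, \<gamma>0) + 0 *\<^sub>R (?e, 0))) (at 0)"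
        using z by (intro has_real_derivative_along_line smooth_on_differentiable[OF open_S F]) simp
      then have "((\<lambda>h. (F ((\<theta>, \<gamma>0) + h *\<^sub>R (?e, 0)) - F (\<theta>, \<gamma>0)) / h) \<longlongrightarrow> ddir (?e, 0) F (\<theta>, \<gamma>0)) (at 0)"
        by (simp add: has_field_derivative_iff)
      moreover have "filterlim a (at 0) sequentially"
        unfolding filterlim_at using a a0 by (auto simp: less_imp_neq[symmetric])
      ultimately have "(\<lambda>k. (F ((\<theta>, \<gamma>0) + a k *\<^sub>R (?e, 0)) - F (\<theta>, \<gamma>0)) / a k) \<longlonglongrightarrow> ddir (?e, 0) F (\<theta>, \<gamma>0)"
        by (rule filterlim_compose)
      moreover have "F ((\<theta>, \<gamma>0) + a k *\<^sub>R (?e, 0)) = ?f x (\<theta> + a k *\<^sub>R ?e)" for k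
        unfolding F_def using iter_d_lp0[OF True, of "(\<theta> + a k *\<^sub>R ?e, \<gamma>0)" "is"] in\<Theta> \<gamma>0 by (simp add: S_def)
      moreover have "F (\<theta>, \<gamma>0) = ?f x \<theta>"
        unfolding F_def using iter_d_lp0[OF True z] by simp
      moreover have "ddir (?e, 0) F (\<theta>, \<gamma>0) = D_theta (\<lambda>\<eta>. logp I2 q x \<eta> \<gamma>0) \<theta> (i # is)"
        unfolding F_def using iter_d_lp0[OF True z, of "i # is"] by simp
      ultimately show ?thesis using True by simp
    qed simp
  qed
qed

lemma pdens_measurable:
  assumes "\<theta> \<in> \<Theta>" "\<gamma> \<in> J"
  shows "(\<lambda>x. pdens I2 q x \<theta> \<gamma>) \<in> borel_measurable borel"
proof -
  have "(\<lambda>x. indicator (tsupport I2 \<gamma>) x * q x \<theta>) \<in> borel_measurable borel"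
    using q_integrable[OF assms] by (auto simp: set_integrable_def)
  then have "(\<lambda>x. (indicator (tsupport I2 \<gamma>) x * q x \<theta>) * exp (- psi I2 q \<theta> \<gamma>)) \<in> borel_measurable borel"
    by measurable
  then show ?thesis by (simp add: pdens_def[abs_def] mult_ac)
qed

context
  fixes \<theta>0 :: "real ^ 'd" assumes \<theta>0: "\<theta>0 \<in> \<Theta>"
begin

abbreviation N where "N \<equiv> Pdist I2 q \<theta>0 \<gamma>0"

lemma N_sets [measurable_cong, simp]: "sets N = sets borel"
  by (simp add: Pdist_def)

lemma AE_N_iff:
  "(AE x in N. P x) \<longleftrightarrow> (AE x in lborel. 0 < pdens I2 q x \<theta>0 \<gamma>0 \<longrightarrow> P x)"
  using pdens_measurable[OF \<theta>0 \<gamma>0] unfolding Pdist_def by (subst AE_density) auto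

lemma N_singleton: "emeasure N {x} = 0"
proof -
  have "AE y in lborel. y \<noteq> x" by (rule AE_lborel_singleton)
  then have "AE y in N. y \<notin> {x}" unfolding AE_N_iff by eventually_elim simp
  then have "{x} \<in> null_sets N" by (subst AE_iff_null_sets) auto
  then show ?thesis by auto
qed

lemma AE_N_U: "AE x in N. x \<in> U"
proof -
  have "AE y in lborel. y \<noteq> \<gamma>0" by (rule AE_lborel_singleton)
  then show ?thesis unfolding AE_N_iff
    by eventually_elim (auto simp: pdens_def indicator_def tsupport_def U_def split: if_splits)
qed

lemma N_left_pos:
  assumes "0 < \<delta>" shows "emeasure N {..<\<gamma>0 + \<delta>} \<noteq> 0"
proof
  assume "emeasure N {..<\<gamma>0 + \<delta>} = 0"
  then have "AE x in N. x \<notin> {..<\<gamma>0 + \<delta>}"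
    by (subst AE_iff_null_sets[symmetric]) auto
  then have ae: "AE x in lborel. 0 < pdens I2 q x \<theta>0 \<gamma>0 \<longrightarrow> x \<notin> {..<\<gamma>0 + \<delta>}" unfolding AE_N_iff .
  obtain y where y: "\<gamma>0 < y" "ereal y < I2" using right_point[OF \<gamma>0] by blast
  have "AE x in lborel. x \<notin> {\<gamma>0<..<min y (\<gamma>0 + \<delta>)}"
    using ae
  proof eventually_elim
    case (elim x)
    have "x \<in> tsupport I2 \<gamma>0" if "x \<in> {\<gamma>0<..<min y (\<gamma>0 + \<delta>)}"
      using that y by (auto simp: tsupport_def intro: less_trans[of _ "ereal y"])
    then show ?case using elim pdens_eq_exp[of x \<gamma>0 \<theta>0] \<theta>0 \<gamma>0 by auto
  qed
  then show False using not_AE_interval[of \<gamma>0 "min y (\<gamma>0 + \<delta>)"] y assms by simp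
qed

text \<open>
  The defining integral includes the point \<open>\<gamma>0\<close>, where nothing is known about the integrand; it is a null set.
\<close>

lemma fisher_info_eq:
  assumes "integrable N (\<lambda>x. indicator U x * D_theta (\<lambda>\<eta>. logp I2 q x \<eta> \<gamma>0) \<theta>0 [i, j])"
  shows "fisher_info I2 q \<theta>0 \<gamma>0 $ i $ j = - (\<integral>x. indicator U x * D_theta (\<lambda>\<eta>. logp I2 q x \<eta> \<gamma>0) \<theta>0 [i, j] \<partial>N)"
proof -
  let ?D = "\<lambda>x. D_theta (\<lambda>\<eta>. logp I2 q x \<eta> \<gamma>0) \<theta>0 [i, j]"
  have [measurable]: "(\<lambda>x. indicator U x * ?D x) \<in> borel_measurable borel"
    by (rule D_theta_measurable[OF \<theta>0])
  have eq: "indicator (tsupport I2 \<gamma>0) x * ?D x = indicator U x * ?D x + indicator {\<gamma>0} x * ?D \<gamma>0" for x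
    using \<gamma>0 by (auto simp: indicator_def U_def tsupport_def einterval_def)
  have "(\<integral>x. indicator (tsupport I2 \<gamma>0) x * ?D x \<partial>N) = (\<integral>x. indicator U x * ?D x \<partial>N)"
  proof (rule integral_cong_AE)
    show "(\<lambda>x. indicator (tsupport I2 \<gamma>0) x * ?D x) \<in> borel_measurable N"
      unfolding eq by measurable
    show "AE x in N. indicator (tsupport I2 \<gamma>0) x * ?D x = indicator U x * ?D x"
      using AE_N_U by eventually_elim (auto simp: U_def tsupport_def indicator_def)
  qed measurable
  then show ?thesis by (simp add: fisher_info_def set_lebesgue_integral_def)
qed

end

end


section \<open>Samples that admit the expansion\<close>

lemma kron_pow_2: "length is = 2 * r \<Longrightarrow> kron_pow r x 2 is = kron r x x is"
  by (simp add: numeral_2_eq_2 kron_def)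

lemma tinner_cong:
  "(\<And>is. length is = r \<Longrightarrow> S is = S' is) \<Longrightarrow> (\<And>is. length is = r \<Longrightarrow> T is = T' is) \<Longrightarrow> tinner r S T = tinner r S' T'"
  by (simp add: tinner_def midx_def)

text \<open>
  What is needed of one sample \<open>x\<close>, in terms of numbers that do not depend on it: \<open>b0\<close> is the size of a
  neighbourhood of the true parameter in which \<open>H\<close> and \<open>Hp\<close> bound the derivatives of \<open>h\<close> and of the prior,
  \<open>c0\<close> bounds the slope in \<open>\<gamma>\<close> and \<open>p00\<close> the prior from below, and \<open>G\<close> is the envelope of the \<open>\<theta>\<close>-derivatives
  of the log-density. The sample enters through the average of \<open>G\<close>, the position of the MLE, the gap \<open>kap0\<close>
  away from the true \<open>\<theta>\<close>, and the lower bound \<open>lam\<close> of the observed information. The conditions on \<open>K\<close> and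
  \<open>eta\<close> are those of \<open>laplace\<close>.
\<close>

locale good_sample = truncated_family \<Theta> I1 I2 q \<gamma>0
  for \<Theta> :: "(real ^ 'd::finite) set" and I1 I2 :: ereal
    and q :: "real \<Rightarrow> real ^ 'd \<Rightarrow> real" and \<gamma>0 :: real +
  fixes \<theta>0 :: "real ^ 'd" and \<pi> :: "real ^ 'd \<Rightarrow> real \<Rightarrow> real" and n :: nat and x :: "nat \<Rightarrow> real"
    and b0 H Hp c0 p00 kap0 lam eta K Gm :: real and G :: "real \<Rightarrow> real"
  assumes \<theta>0: "\<theta>0 \<in> \<Theta>" and n: "0 < n" and prior: "prior_density \<Theta> I1 I2 \<pi>"
    and box: "cball \<theta>0 b0 \<times> cball \<gamma>0 b0 \<subseteq> S"
    and H: "\<And>z s is. z \<in> cball \<theta>0 b0 \<times> cball \<gamma>0 b0 \<Longrightarrow> s \<le> 3 \<Longrightarrow> length is \<le> 5 \<Longrightarrow>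
      \<bar>iter_d (iter_g s h) is z\<bar> \<le> H"
    and Hp: "\<And>z s is. z \<in> cball \<theta>0 b0 \<times> cball \<gamma>0 b0 \<Longrightarrow> s \<le> 3 \<Longrightarrow> length is \<le> 5 \<Longrightarrow>
      \<bar>iter_d (iter_g s (\<lambda>z. \<pi> (fst z) (snd z))) is z\<bar> \<le> Hp"
    and c0: "0 < c0" "\<And>z. z \<in> cball \<theta>0 b0 \<times> cball \<gamma>0 b0 \<Longrightarrow> iter_g 1 h z \<le> - c0"
    and p00: "0 < p00" "\<And>z. z \<in> cball \<theta>0 b0 \<times> cball \<gamma>0 b0 \<Longrightarrow> p00 \<le> \<pi> (fst z) (snd z)"
    and x_U: "\<And>j. j < n \<Longrightarrow> x j \<in> U"
    and G: "\<And>y \<eta> is. y \<in> U \<Longrightarrow> \<eta> \<in> cball \<theta>0 b0 \<Longrightarrow> 2 \<le> length is \<Longrightarrow> length is \<le> 5 \<Longrightarrow>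
      \<bar>D_theta (\<lambda>\<eta>. logp I2 q y \<eta> \<gamma>0) \<eta> is\<bar> \<le> G y"
    and Gm: "1 / real n * (\<Sum>j<n. G (x j)) \<le> Gm"
    and th_close: "dist (theta_ML \<Theta> I2 q n x) \<theta>0 < eta / 2"
    and gh_close: "gamma_ML n x < \<gamma>0 + eta / 2"
    and leq: "likelihood_eq I2 q n x (theta_ML \<Theta> I2 q n x)"
    and mle: "is_MLE \<Theta> I1 I2 q n x (theta_ML \<Theta> I2 q n x) (gamma_ML n x)"
    and kap0: "0 < kap0"
    and sep: "\<And>\<eta>. \<eta> \<in> \<Theta> \<Longrightarrow> dist \<eta> \<theta>0 \<ge> eta / 2 \<Longrightarrow>
      (\<Sum>j<n. logp I2 q (x j) \<eta> (gamma_ML n x)) \<le> (\<Sum>j<n. logp I2 q (x j) \<theta>0 (gamma_ML n x)) - kap0 * real n"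
    and lam: "0 < lam" and coercive: "\<And>v. lam * (norm v)\<^sup>2 \<le> v \<bullet> (g_hat \<Theta> I2 q n x *v v)"
    and K: "1 \<le> K" "real CARD('d) ^ 5 * (Gm + H) \<le> K" "real CARD('d) ^ 5 * Hp \<le> K"
      "1 \<le> K * c0" "1 \<le> K * p00"
    and eta: "0 < eta" "eta \<le> 1" "eta \<le> b0 / 2" "12 * K * eta \<le> lam" "12 * K * eta \<le> c0"
begin

abbreviation th where "th \<equiv> theta_ML \<Theta> I2 q n x"
abbreviation gh where "gh \<equiv> gamma_ML n x"
abbreviation A where "A \<equiv> A_hat \<Theta> I2 q n x"
abbreviation ch where "ch \<equiv> c_hat \<Theta> I2 q n x"
abbreviation ghat where "ghat \<equiv> g_hat \<Theta> I2 q n x"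
abbreviation Box where "Box \<equiv> cball \<theta>0 b0 \<times> cball \<gamma>0 b0"

definition pi2 :: "(real ^ 'd) \<times> real \<Rightarrow> real" where "pi2 z = \<pi> (fst z) (snd z)"

definition Lbar :: "real ^ 'd \<Rightarrow> real \<Rightarrow> real" where
  "Lbar \<theta> \<gamma> = 1 / real n * (\<Sum>j<n. lp (x j) (\<theta>, \<gamma>))"

abbreviation P where "P \<equiv> D_theta (\<lambda>\<theta>. \<pi> \<theta> gh) th"
abbreviation dp where "dp \<equiv> deriv (\<lambda>\<gamma>. \<pi> th \<gamma>) gh"

lemma gh_le: "j < n \<Longrightarrow> gh \<le> x j"
  by (rule gamma_ML_properties(2)[OF n])

lemma gh_in: "\<exists>j<n. gh = x j"
  by (rule gamma_ML_properties(1)[OF n])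

lemma gh_U: "gh \<in> U" using gh_in x_U by auto

lemma gh_J: "gh \<in> J" using gh_U U_J by blast

lemma gh_gt: "\<gamma>0 < gh" using gh_U by (simp add: U_def)

lemma in_Box: "norm v < eta \<Longrightarrow> - eta \<le> s \<Longrightarrow> s \<le> 0 \<Longrightarrow> (th + v, gh + s) \<in> Box"
proof -
  assume v: "norm v < eta" and s: "- eta \<le> s" "s \<le> 0"
  have "dist (th + v) \<theta>0 \<le> norm v + dist th \<theta>0"
    using norm_triangle_ineq[of v "th - \<theta>0"] by (simp add: dist_norm algebra_simps)
  then have "dist \<theta>0 (th + v) \<le> b0" using v th_close eta by (simp add: dist_commute)
  moreover have "dist \<gamma>0 (gh + s) \<le> b0"
    unfolding dist_real_def using s gh_gt gh_close eta by linarith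
  ultimately show ?thesis by simp
qed

lemma in_S: "norm v < eta \<Longrightarrow> - eta \<le> s \<Longrightarrow> s \<le> 0 \<Longrightarrow> (th + v, gh + s) \<in> S"
  using in_Box box by blast

lemma zhat_Box: "(th, gh) \<in> Box" using in_Box[of 0 0] eta by simp

lemma zhat_S: "(th, gh) \<in> S" using zhat_Box box by blast

lemma th_\<Theta>: "th \<in> \<Theta>" using zhat_S by (simp add: S_def)

lemma segment_Box:
  assumes "norm v < eta" "0 \<le> r" "r \<le> 1" "- eta \<le> s" "s \<le> 0"
  shows "(th + r *\<^sub>R v, gh + s) \<in> Box"
proof (rule in_Box)
  have "norm (r *\<^sub>R v) \<le> norm v" using assms(2,3) by (simp add: mult_left_le_one_le)
  then show "norm (r *\<^sub>R v) < eta" using assms(1) by simp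
qed (use assms in auto)

lemma H_nonneg: "0 \<le> H"
  using order_trans[OF abs_ge_zero H[OF zhat_Box, of 0 "[]"]] by simp

lemma Hp_nonneg: "0 \<le> Hp"
  using order_trans[OF abs_ge_zero Hp[OF zhat_Box, of 0 "[]"]] by simp

lemma G_nonneg: "y \<in> U \<Longrightarrow> 0 \<le> G y"
proof -
  assume y: "y \<in> U"
  obtain i :: 'd where True by simp
  have "\<theta>0 \<in> cball \<theta>0 b0" using eta by simp
  from G[OF y this, of "[i, i]"] show ?thesis by (simp add: abs_ge_zero order_trans[OF abs_ge_zero])
qed

lemma Gm_nonneg: "0 \<le> Gm"
proof -
  have "0 \<le> 1 / real n * (\<Sum>j<n. G (x j))"
    using G_nonneg x_U by (intro mult_nonneg_nonneg sum_nonneg) auto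
  then show ?thesis using Gm by linarith
qed

lemma d_power: "r \<le> 5 \<Longrightarrow> real CARD('d) ^ r \<le> real CARD('d) ^ 5"
  by (intro power_increasing) (auto simp: Suc_le_eq)

lemma form_le_K:
  fixes T :: "'d tensor" and v :: "real ^ 'd"
  assumes "r \<le> 5" "\<And>is. length is = r \<Longrightarrow> \<bar>T is\<bar> \<le> B" "0 \<le> B" "real CARD('d) ^ 5 * B \<le> K"
  shows "\<bar>form r T v\<bar> \<le> K * norm v ^ r"
proof -
  have "\<bar>form r T v\<bar> \<le> real CARD('d) ^ r * B * norm v ^ r"
    using abs_form_le[of r T B v] assms(2) by simp
  also have "\<dots> \<le> real CARD('d) ^ 5 * B * norm v ^ r"
    using d_power[OF assms(1)] assms(3) by (intro mult_right_mono) auto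
  also have "\<dots> \<le> K * norm v ^ r" using assms(4) by (intro mult_right_mono) auto
  finally show ?thesis .
qed

lemma H_le_K: "real CARD('d) ^ 5 * H \<le> K" "H \<le> K" "real CARD('d) ^ 5 * (Gm + H) \<le> K"
proof -
  have d1: "1 \<le> real CARD('d) ^ 5" by (intro one_le_power) (simp add: Suc_le_eq)
  have "real CARD('d) ^ 5 * H \<le> real CARD('d) ^ 5 * (Gm + H)" using Gm_nonneg by (intro mult_left_mono) auto
  then show 1: "real CARD('d) ^ 5 * H \<le> K" using K(2) by linarith
  show "H \<le> K" using mult_right_mono[OF d1 H_nonneg] 1 by simp
qed (rule K(2))

lemma Hp_le_K: "Hp \<le> K"
proof -
  have d1: "1 \<le> real CARD('d) ^ 5" by (intro one_le_power) (simp add: Suc_le_eq)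
  show ?thesis using mult_right_mono[OF d1 Hp_nonneg] K(3) by simp
qed

lemma iter_d_lp_bound:
  assumes "y \<in> U" "z \<in> Box" "2 \<le> length is" "length is \<le> 5"
  shows "\<bar>iter_d (lp y) is z\<bar> \<le> G y + H"
proof -
  have zS: "z \<in> S" using assms(2) box by blast
  have "fst z \<in> cball \<theta>0 b0" using assms(2) by auto
  from G[OF assms(1) this assms(3,4)] H[OF assms(2), of 0 "is"] assms(4)
  show ?thesis unfolding iter_d_lp[OF assms(1) zS] iter_d_lp0[OF assms(1) zS] by simp
qed

lemma A_0_eq: "length is = r \<Longrightarrow> A r 0 is = 1 / real n * (\<Sum>j<n. iter_d (lp (x j)) is (th, gh))"
  using A_hat_eq[OF x_U zhat_S, of "is" r 0] by simp

lemma A_Suc_eq: "length is = r \<Longrightarrow> A r (Suc s) is = - iter_d (iter_g (Suc s) h) is (th, gh)"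
  using A_hat_Suc_eq[OF x_U zhat_S _ n] by blast

lemma A_1_eq: "length is = r \<Longrightarrow> A r 1 is = - iter_d (iter_g 1 h) is (th, gh)"
  using A_Suc_eq[of "is" r 0] by (simp only: One_nat_def)

lemma A_2_eq: "length is = r \<Longrightarrow> A r 2 is = - iter_d (iter_g 2 h) is (th, gh)"
  using A_Suc_eq[of "is" r 1] by (simp only: Suc_1)

lemma average_G: "1 / real n * (\<Sum>j<n. G (x j) + H) \<le> Gm + H"
  using Gm n by (simp add: sum.distrib add_divide_distrib)

lemma A_0_bound:
  assumes "length is = r" "2 \<le> r" "r \<le> 5" shows "\<bar>A r 0 is\<bar> \<le> Gm + H"
proof -
  have "\<bar>A r 0 is\<bar> \<le> 1 / real n * (\<Sum>j<n. \<bar>iter_d (lp (x j)) is (th, gh)\<bar>)"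
    unfolding A_0_eq[OF assms(1)] abs_mult by (intro mult_mono sum_abs) auto
  also have "\<dots> \<le> 1 / real n * (\<Sum>j<n. G (x j) + H)"
    using assms by (intro mult_left_mono sum_mono iter_d_lp_bound x_U zhat_Box) auto
  also have "\<dots> \<le> Gm + H" by (rule average_G)
  finally show ?thesis .
qed

lemma A_Suc_bound:
  assumes "length is = r" "r \<le> 5" "s \<le> 2" shows "\<bar>A r (Suc s) is\<bar> \<le> H"
  using H[OF zhat_Box, of "Suc s" "is"] assms by (simp add: A_Suc_eq del: iter_g.simps)

lemma form_A_2: "form 2 (A 2 0) v = - (v \<bullet> (ghat *v v))"
proof -
  have "form 2 (A 2 0) v = (\<Sum>i\<in>UNIV. \<Sum>j\<in>UNIV. A 2 0 [i, j] * (v $ i * v $ j))"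
    by (simp add: form_eq_sum sum_midx_2)
  then show ?thesis
    by (simp add: inner_vec_def matrix_vector_mult_def g_hat_def sum_distrib_left sum_negf mult_ac)
qed

text \<open>This is the likelihood equation.\<close>

lemma A_1_0: "length is = 1 \<Longrightarrow> A 1 0 is = 0"
proof -
  assume l: "length is = 1"
  then obtain i where i: "is = [i]" by (cases "is") auto
  have "iter_d (lp (x j)) [i] (th, gh) = pderiv_at i (\<lambda>\<eta>. logp I2 q (x j) \<eta> gh) th" if "j < n" for j
    using D_theta_eq_iter_d[OF open_S smooth_lp[OF x_U[OF that]], of gh "\<lambda>\<eta>. logp I2 q (x j) \<eta> gh" th "[i]"] zhat_S
    by (simp add: lp_def)
  then have "(\<Sum>j<n. iter_d (lp (x j)) [i] (th, gh)) = 0"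
    using leq by (simp add: likelihood_eq_def del: iter_d.simps)
  then show ?thesis using A_0_eq[OF l] by (simp add: i del: iter_d.simps)
qed

text \<open>
  Taylor expansion for each observation separately. The intermediate points differ, but the remainders
  are bounded by the envelope, whose average is under control.
\<close>

lemma Lbar_theta_expand:
  assumes v: "norm v < eta"
  shows "\<bar>Lbar (th + v) gh - Lbar th gh - (- (v \<bullet> (ghat *v v)) / 2 + form 3 (A 3 0) v / 6 + form 4 (A 4 0) v / 24)\<bar>
    \<le> K * norm v ^ 5"
proof -
  define Q where "Q j s \<longleftrightarrow> 0 < s \<and> s < 1 \<and> lp (x j) (th + v, gh) =
    (\<Sum>i<5. form i (\<lambda>is. iter_d (lp (x j)) is (th, gh)) v / fact i)
    + form 5 (\<lambda>is. iter_d (lp (x j)) is (th + s *\<^sub>R v, gh)) v / fact 5" for j s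
  have "\<exists>s. Q j s" if j: "j < n" for j
    unfolding Q_def
  proof (rule theta_taylor[OF open_S smooth_lp[OF x_U[OF j]]])
    fix s :: real assume "0 \<le> s" "s \<le> 1"
    then show "(th + s *\<^sub>R v, gh) \<in> S" using segment_Box[OF v, of s 0] eta box by auto
  qed simp
  then obtain s where s: "\<And>j. j < n \<Longrightarrow> Q j (s j)" by metis
  define R where "R j = form 5 (\<lambda>is. iter_d (lp (x j)) is (th + s j *\<^sub>R v, gh)) v / fact 5" for j
  have formA: "1 / real n * (\<Sum>j<n. form i (\<lambda>is. iter_d (lp (x j)) is (th, gh)) v) = form i (A i 0) v" for i
    unfolding form_sum[symmetric] form_cmult[symmetric] by (rule form_cong) (simp add: A_0_eq)
  have "Lbar (th + v) gh = 1 / real n * (\<Sum>j<n. (\<Sum>i<5. form i (\<lambda>is. iter_d (lp (x j)) is (th, gh)) v / fact i) + R j)"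
    unfolding Lbar_def using s by (intro arg_cong2[of _ _ _ _ "(*)"] sum.cong refl) (auto simp: Q_def R_def)
  also have "\<dots> = (\<Sum>i<5. (1 / real n * (\<Sum>j<n. form i (\<lambda>is. iter_d (lp (x j)) is (th, gh)) v)) / fact i) + 1 / real n * (\<Sum>j<n. R j)"
    unfolding sum.distrib distrib_left
    by (subst sum.swap) (simp add: sum_distrib_left sum_divide_distrib mult_ac)
  also have "\<dots> = (\<Sum>i<5. form i (A i 0) v / fact i) + 1 / real n * (\<Sum>j<n. R j)"
    unfolding formA ..
  also have "(\<Sum>i<5. form i (A i 0) v / fact i)
      = form 0 (A 0 0) v + form 1 (A 1 0) v + form 2 (A 2 0) v / 2 + form 3 (A 3 0) v / 6 + form 4 (A 4 0) v / 24"
  proof -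
    have "{..<5} = {0, 1, 2, 3, 4 :: nat}" by auto
    then show ?thesis by (simp add: fact_numeral)
  qed
  also have "form 0 (A 0 0) v = Lbar th gh" by (simp add: A_0_eq Lbar_def)
  also have "form 1 (A 1 0) v = 0"
    using form_cong[of 1 "A 1 0" "\<lambda>_. 0" v] A_1_0 by (simp add: form_eq_sum)
  finally have eq: "Lbar (th + v) gh - Lbar th gh - (- (v \<bullet> (ghat *v v)) / 2 + form 3 (A 3 0) v / 6 + form 4 (A 4 0) v / 24)
      = 1 / real n * (\<Sum>j<n. R j)"
    by (simp add: form_A_2)
  have R: "\<bar>R j\<bar> \<le> real CARD('d) ^ 5 * (G (x j) + H) * norm v ^ 5" if j: "j < n" for j
  proof -
    have "\<bar>form 5 (\<lambda>is. iter_d (lp (x j)) is (th + s j *\<^sub>R v, gh)) v\<bar> \<le> real CARD('d) ^ 5 * (G (x j) + H) * norm v ^ 5"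
      using abs_form_le[of 5 "\<lambda>is. iter_d (lp (x j)) is (th + s j *\<^sub>R v, gh)" "G (x j) + H" v]
        iter_d_lp_bound[OF x_U[OF j] segment_Box[OF v, of "s j" 0]] s[OF j] eta by (simp add: Q_def)
    moreover have "\<bar>R j\<bar> \<le> \<bar>form 5 (\<lambda>is. iter_d (lp (x j)) is (th + s j *\<^sub>R v, gh)) v\<bar>"
      by (simp add: R_def fact_numeral)
    ultimately show ?thesis by linarith
  qed
  have "\<bar>1 / real n * (\<Sum>j<n. R j)\<bar> \<le> 1 / real n * (\<Sum>j<n. real CARD('d) ^ 5 * (G (x j) + H) * norm v ^ 5)"
    unfolding abs_mult by (intro mult_mono order_trans[OF sum_abs] sum_mono R) auto
  also have "\<dots> = real CARD('d) ^ 5 * (1 / real n * (\<Sum>j<n. G (x j) + H)) * norm v ^ 5"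
    by (simp add: sum_distrib_left sum_distrib_right mult_ac)
  also have "\<dots> \<le> real CARD('d) ^ 5 * (Gm + H) * norm v ^ 5"
    by (intro mult_right_mono mult_left_mono average_G) auto
  also have "\<dots> \<le> K * norm v ^ 5" by (intro mult_right_mono H_le_K) auto
  finally show ?thesis unfolding eq .
qed

lemma smooth_theta_expand:
  assumes F: "smooth_on S F" and v: "norm v < eta" and k: "0 < k" "k \<le> 5"
    and B: "\<And>z is. z \<in> Box \<Longrightarrow> length is \<le> 5 \<Longrightarrow> \<bar>iter_d F is z\<bar> \<le> B" "0 \<le> B" "real CARD('d) ^ 5 * B \<le> K"
  shows "\<bar>F (th + v, gh) - (\<Sum>j<k. form j (\<lambda>is. iter_d F is (th, gh)) v / fact j)\<bar> \<le> K * norm v ^ k"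
proof -
  obtain s where s: "0 < s" "s < 1" and eq: "F (th + v, gh) =
    (\<Sum>j<k. form j (\<lambda>is. iter_d F is (th, gh)) v / fact j)
    + form k (\<lambda>is. iter_d F is (th + s *\<^sub>R v, gh)) v / fact k"
    using theta_taylor[OF open_S F k(1), of th v gh] segment_Box[OF v, of _ 0] eta box by force
  have "\<bar>form k (\<lambda>is. iter_d F is (th + s *\<^sub>R v, gh)) v\<bar> \<le> K * norm v ^ k"
    by (rule form_le_K[OF k(2) _ B(2,3)]) (use B(1) segment_Box[OF v, of s 0] s eta k in auto)
  moreover have "\<bar>form k (\<lambda>is. iter_d F is (th + s *\<^sub>R v, gh)) v / fact k\<bar> \<le> \<bar>form k (\<lambda>is. iter_d F is (th + s *\<^sub>R v, gh)) v\<bar>"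
    by (simp add: abs_divide divide_le_eq mult_le_cancel_left1 fact_ge_1)
  ultimately show ?thesis unfolding eq by simp
qed

lemma gamma_expand:
  assumes F: "smooth_on S F" and v: "norm v < eta" and s: "- eta < s" "s \<le> 0" and k: "0 < k" "k \<le> 3"
    and B: "\<And>z. z \<in> Box \<Longrightarrow> \<bar>iter_g k F z\<bar> \<le> B" "B \<le> K"
  shows "\<bar>F (th + v, gh + s) - (\<Sum>j<k. s ^ j * iter_g j F (th + v, gh) / fact j)\<bar> \<le> K * \<bar>s\<bar> ^ k"
proof -
  have line: "(th + v, gh + r * s) \<in> Box" if "0 \<le> r" "r \<le> 1" for r
  proof (rule in_Box[OF v])
    have "1 * s \<le> r * s" using that s by (intro mult_right_mono_neg) auto
    then show "- eta \<le> r * s" using s by simp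
    show "r * s \<le> 0" using that s by (simp add: mult_nonneg_nonpos)
  qed
  obtain r where r: "0 < r" "r < 1" and eq: "F (th + v, gh + s) =
    (\<Sum>j<k. s ^ j * iter_g j F (th + v, gh) / fact j) + s ^ k * iter_g k F (th + v, gh + r * s) / fact k"
    using gamma_taylor[OF open_S F k(1), of "th + v" gh s] line box by force
  have "\<bar>s ^ k * iter_g k F (th + v, gh + r * s)\<bar> \<le> \<bar>s\<bar> ^ k * K"
    using B(1)[OF line[of r]] B(2) r by (intro abs_mult_le) (auto simp: power_abs)
  moreover have "\<bar>s ^ k * iter_g k F (th + v, gh + r * s) / fact k\<bar> \<le> \<bar>s ^ k * iter_g k F (th + v, gh + r * s)\<bar>"
    by (simp add: abs_divide divide_le_eq mult_le_cancel_left1 fact_ge_1)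
  ultimately show ?thesis unfolding eq by (simp add: mult.commute)
qed

lemma ch_eq: "ch = - iter_g 1 h (th, gh)"
  using A_Suc_eq[of "[]" 0 0] by (simp add: c_hat_def)

text \<open>
  Expansion in \<open>\<gamma>\<close> at fixed \<open>\<theta>\<close>, and then of its coefficients in \<open>\<theta>\<close>; only \<open>h\<close> depends on \<open>\<gamma>\<close>.
\<close>

lemma Lbar_expand:
  assumes v: "norm v < eta" and s: "- eta < s" "s \<le> 0"
  shows "\<bar>Lbar (th + v) (gh + s) - Lbar th gh - (- (v \<bullet> (ghat *v v)) / 2 + form 3 (A 3 0) v / 6 + form 4 (A 4 0) v / 24
         + s * (ch + form 1 (A 1 1) v + form 2 (A 2 1) v / 2) + A 0 2 [] * s\<^sup>2 / 2)\<bar>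
      \<le> K * (norm v ^ 5 + \<bar>s\<bar> * norm v ^ 3 + s\<^sup>2 * norm v + \<bar>s\<bar> ^ 3)"
proof -
  define h1 where "h1 = iter_g 1 h (th + v, gh)"
  define h2 where "h2 = iter_g 2 h (th + v, gh)"
  have HB: "\<bar>iter_d (iter_g i h) is z\<bar> \<le> H" if "z \<in> Box" "length is \<le> 5" "i \<le> 3" for z "is" i
    using H that by blast
  have e0: "\<bar>h (th + v, gh + s) - (h (th + v, gh) + s * h1 + s\<^sup>2 * h2 / 2)\<bar> \<le> K * \<bar>s\<bar> ^ 3"
    using gamma_expand[OF smooth_h v s, of 3 H] HB[of _ "[]" 3] H_le_K(2)
    by (simp add: h1_def h2_def eval_nat_numeral)
  have e1: "\<bar>h1 - (- ch - form 1 (A 1 1) v - form 2 (A 2 1) v / 2)\<bar> \<le> K * norm v ^ 3"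
  proof -
    have "form 1 (A 1 1) v = - form 1 (\<lambda>is. iter_d (iter_g 1 h) is (th, gh)) v"
      "form 2 (A 2 1) v = - form 2 (\<lambda>is. iter_d (iter_g 1 h) is (th, gh)) v"
      unfolding form_uminus[symmetric] by (rule form_cong, erule A_1_eq)+
    then show ?thesis
      using smooth_theta_expand[OF smooth_on_iter_g[OF smooth_h, of 1] v, of 3 H] HB[of _ _ 1] H_nonneg H_le_K(1)
      unfolding h1_def ch_eq by (simp add: eval_nat_numeral del: iter_g.simps form_Suc)
  qed
  have e2: "\<bar>h2 - (- A 0 2 [])\<bar> \<le> K * norm v"
    using smooth_theta_expand[OF smooth_on_iter_g[OF smooth_h, of 2] v, of 1 H] HB[of _ _ 2] H_nonneg H_le_K(1)
      A_2_eq[of "[]" 0]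
    unfolding h2_def by simp
  have e3: "Lbar (th + v) (gh + s) = Lbar (th + v) gh - (h (th + v, gh + s) - h (th + v, gh))"
    using n by (simp add: Lbar_def lp_eq lp0_def sum_subtractf field_simps)
  define X where "X = - (v \<bullet> (ghat *v v)) / 2 + form 3 (A 3 0) v / 6 + form 4 (A 4 0) v / 24"
  define Y where "Y = ch + form 1 (A 1 1) v + form 2 (A 2 1) v / 2"
  have e4: "\<bar>Lbar (th + v) gh - Lbar th gh - X\<bar> \<le> K * norm v ^ 5"
    unfolding X_def by (rule Lbar_theta_expand[OF v])
  have "\<bar>h1 + Y\<bar> \<le> K * norm v ^ 3" using e1 by (simp add: Y_def)
  from abs_mult_le[of s "\<bar>s\<bar>", OF _ this]
  have e5: "\<bar>s * (h1 + Y)\<bar> \<le> K * (\<bar>s\<bar> * norm v ^ 3)" by (simp add: mult_ac)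
  have "\<bar>h2 + A 0 2 []\<bar> \<le> K * norm v" using e2 by simp
  from abs_mult_le[of "s\<^sup>2" "s\<^sup>2", OF _ this]
  have e6: "\<bar>s\<^sup>2 * (h2 + A 0 2 [])\<bar> \<le> K * (s\<^sup>2 * norm v)" by (simp add: mult_ac)
  define E0 where "E0 = h (th + v, gh + s) - (h (th + v, gh) + s * h1 + s\<^sup>2 * h2 / 2)"
  have "Lbar (th + v) (gh + s) - Lbar th gh - (X + s * Y + A 0 2 [] * s\<^sup>2 / 2)
      = (Lbar (th + v) gh - Lbar th gh - X) - E0 - s * (h1 + Y) - s\<^sup>2 * (h2 + A 0 2 []) / 2"
    unfolding e3 E0_def by (simp add: algebra_simps)
  also have "\<bar>\<dots>\<bar> \<le> K * norm v ^ 5 + K * \<bar>s\<bar> ^ 3 + K * (\<bar>s\<bar> * norm v ^ 3) + K * (s\<^sup>2 * norm v)"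
    using e4 e0[folded E0_def] e5 e6 by linarith
  finally show ?thesis unfolding X_def Y_def by (simp add: algebra_simps)
qed

lemma smooth_pi2: "smooth_on S pi2"
  using smooth_prior[OF prior] by (simp add: pi2_def[abs_def])

lemma pi2_bound: "z \<in> Box \<Longrightarrow> s \<le> 3 \<Longrightarrow> length is \<le> 5 \<Longrightarrow> \<bar>iter_d (iter_g s pi2) is z\<bar> \<le> Hp"
  using Hp by (simp add: pi2_def[abs_def])

lemma P_eq: "P is = iter_d pi2 is (th, gh)"
  by (rule D_theta_eq_iter_d[OF open_S smooth_pi2 _ zhat_S]) (simp add: pi2_def)

lemma dp_eq: "dp = iter_g 1 pi2 (th, gh)"
  using iter_deriv_gamma[OF open_S smooth_pi2 zhat_S, of 1] by (simp add: pi2_def)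

lemma prior_expand:
  assumes v: "norm v < eta" and s: "- eta < s" "s \<le> 0"
  shows "\<bar>\<pi> (th + v) (gh + s) - (\<pi> th gh + form 1 P v + form 2 P v / 2 + dp * s)\<bar>
      \<le> K * (norm v ^ 3 + norm v * \<bar>s\<bar> + s\<^sup>2)"
proof -
  define h1 where "h1 = iter_g 1 pi2 (th + v, gh)"
  have e0: "\<bar>pi2 (th + v, gh + s) - (pi2 (th + v, gh) + s * h1)\<bar> \<le> K * \<bar>s\<bar> ^ 2"
    using gamma_expand[OF smooth_pi2 v s, of 2 Hp] pi2_bound[of _ 2 "[]"] Hp_le_K
    by (simp add: h1_def eval_nat_numeral)
  have Peq: "form i P v = form i (\<lambda>is. iter_d pi2 is (th, gh)) v" for i
    by (rule form_cong) (rule P_eq)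
  have e1: "\<bar>pi2 (th + v, gh) - (\<pi> th gh + form 1 P v + form 2 P v / 2)\<bar> \<le> K * norm v ^ 3"
    using smooth_theta_expand[OF smooth_pi2 v, of 3 Hp] pi2_bound[of _ 0] Hp_nonneg K(3)
    unfolding Peq by (simp add: eval_nat_numeral pi2_def)
  have e2: "\<bar>h1 - dp\<bar> \<le> K * norm v"
    using smooth_theta_expand[OF smooth_on_iter_g[OF smooth_pi2, of 1] v, of 1 Hp] pi2_bound[of _ 1] Hp_nonneg K(3)
    unfolding h1_def dp_eq by simp
  from abs_mult_le[of s "\<bar>s\<bar>", OF _ this]
  have e3: "\<bar>s * (h1 - dp)\<bar> \<le> K * (norm v * \<bar>s\<bar>)" by (simp add: mult_ac)
  define W where "W = form 1 P v + form 2 P v / 2"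
  have "\<pi> (th + v) (gh + s) = pi2 (th + v, gh + s)" by (simp add: pi2_def)
  then have "\<bar>\<pi> (th + v) (gh + s) - (\<pi> th gh + W + dp * s)\<bar> \<le> K * norm v ^ 3 + K * (norm v * \<bar>s\<bar>) + K * \<bar>s\<bar> ^ 2"
  proof -
    have "s * (h1 - dp) = s * h1 - dp * s" by (simp add: algebra_simps)
    moreover have "\<bar>pi2 (th + v, gh) - (\<pi> th gh + W)\<bar> \<le> K * norm v ^ 3"
      using e1 by (simp add: W_def add.assoc)
    ultimately show ?thesis using e0 e3 \<open>\<pi> (th + v) (gh + s) = pi2 (th + v, gh + s)\<close> by linarith
  qed
  then show ?thesis by (simp add: W_def algebra_simps)
qed

end


section \<open>The posterior of a good sample\<close>

context good_sample
begin

lemma Lbar_sum: "real n * Lbar \<theta> \<gamma> = (\<Sum>j<n. logp I2 q (x j) \<theta> \<gamma>)"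
  using n by (simp add: Lbar_def lp_def)

lemma Lbar_mono:
  assumes "\<theta> \<in> \<Theta>" "\<gamma> \<in> J" "\<gamma>' \<in> J" "\<gamma> \<le> \<gamma>'"
  shows "Lbar \<theta> \<gamma> \<le> Lbar \<theta> \<gamma>'"
  unfolding Lbar_def lp_def logp_def using psi_antimono[OF assms]
  by (intro mult_left_mono sum_mono) auto

lemma likelihood_eq_exp:
  assumes "(\<theta>, \<gamma>) \<in> S"
  shows "likelihood I2 q n x \<theta> \<gamma> = indicator {..gh} \<gamma> * exp (real n * Lbar \<theta> \<gamma>)"
proof (cases "\<gamma> \<le> gh")
  case True
  have "pdens I2 q (x j) \<theta> \<gamma> = exp (logp I2 q (x j) \<theta> \<gamma>)" if j: "j < n" for j
  proof (rule pdens_eq_exp)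
    show "x j \<in> tsupport I2 \<gamma>"
      using x_U[OF j] gh_le[OF j] True by (simp add: U_def tsupport_def)
  qed (use assms in \<open>auto simp: S_def\<close>)
  then have "likelihood I2 q n x \<theta> \<gamma> = (\<Prod>j<n. exp (logp I2 q (x j) \<theta> \<gamma>))"
    unfolding likelihood_def by (intro prod.cong) auto
  then show ?thesis using True by (simp add: Lbar_sum exp_sum)
next
  case False
  obtain j where "j < n" "gh = x j" using gh_in by blast
  then have "\<exists>j\<in>{..<n}. pdens I2 q (x j) \<theta> \<gamma> = 0"
    using False by (auto simp: pdens_def tsupport_def intro!: bexI[of _ j])
  then show ?thesis using False unfolding likelihood_def by (subst prod_zero) auto
qed

lemma Lbar_MLE:
  assumes "\<theta> \<in> \<Theta>" shows "Lbar \<theta> gh \<le> Lbar th gh"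
proof -
  have "real n * Lbar \<theta> gh \<le> real n * Lbar th gh"
    unfolding Lbar_sum by (rule log_likelihood_le_MLE[OF n x_U mle assms])
  then show ?thesis using n by simp
qed

text \<open>
  If \<open>\<theta>\<close> is far from the MLE, it is far from the true value as well, and the gap \<open>kap0\<close> applies. If \<open>\<theta>\<close> is
  close but \<open>\<gamma>\<close> is below \<open>gh - eta\<close>, a passage from \<open>gh\<close> to \<open>gh - eta\<close> already costs \<open>eta * c0\<close>. In both cases
  the log-likelihood is nondecreasing in \<open>\<gamma>\<close> up to \<open>gh\<close>, because the normalizing constant shrinks with the
  support.
\<close>

lemma Lbar_far:
  assumes z: "(\<theta>, \<gamma>) \<in> S" and le: "\<gamma> \<le> gh" and far: "\<not> (norm (\<theta> - th) < eta \<and> gh - eta < \<gamma>)"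
  shows "Lbar \<theta> \<gamma> \<le> Lbar th gh - min kap0 (eta * c0)"
proof -
  have \<theta>: "\<theta> \<in> \<Theta>" and \<gamma>: "\<gamma> \<in> J" using z by (auto simp: S_def)
  show ?thesis
  proof (cases "norm (\<theta> - th) < eta")
    case False
    have "norm (\<theta> - th) \<le> dist \<theta> \<theta>0 + dist th \<theta>0"
      using dist_triangle2[of \<theta> th \<theta>0] by (simp add: dist_norm)
    then have "dist \<theta> \<theta>0 \<ge> eta / 2" using False th_close by simp
    from sep[OF \<theta> this] have "real n * Lbar \<theta> gh \<le> real n * (Lbar \<theta>0 gh - kap0)"
      by (simp add: Lbar_sum right_diff_distrib mult.commute)
    then have "Lbar \<theta> gh \<le> Lbar \<theta>0 gh - kap0" using n by simp
    then show ?thesis using Lbar_mono[OF \<theta> \<gamma> gh_J le] Lbar_MLE[OF \<theta>0] by simp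
  next
    case True
    then have \<gamma>le: "\<gamma> \<le> gh - eta" using far by simp
    define v where "v = \<theta> - th"
    have v: "norm v < eta" "th + v = \<theta>" using True by (auto simp: v_def)
    have line: "(\<theta>, gh + s) \<in> Box" if "- eta \<le> s" "s \<le> 0" for s
      using in_Box[OF v(1) that] v(2) by simp
    have J': "gh - eta \<in> J" using subsetD[OF box line[of "- eta"]] eta by (simp add: S_def)
    obtain s where s: "0 < s" "s < 1" "h (\<theta>, gh + - eta) = h (\<theta>, gh) + - eta * iter_g 1 h (\<theta>, gh + s * - eta)"
    proof -
      have "(\<theta>, gh + s * - eta) \<in> S" if "0 \<le> s" "s \<le> 1" for s
      proof -
        have "s * eta \<le> 1 * eta" using that eta by (intro mult_right_mono) auto
        then have "(\<theta>, gh + s * - eta) \<in> Box" using that eta by (intro line) auto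
        then show ?thesis using box by blast
      qed
      from gamma_taylor[OF open_S smooth_h zero_less_one this] that show thesis by force
    qed
    have "(\<theta>, gh + s * - eta) \<in> Box"
    proof (rule line)
      have "s * eta \<le> 1 * eta" using s eta by (intro mult_right_mono) auto
      then show "- eta \<le> s * - eta" by simp
    qed (use s eta in auto)
    from c0(2)[OF this] have "eta * c0 \<le> - eta * iter_g 1 h (\<theta>, gh + s * - eta)"
      using mult_left_mono[of c0 "- iter_g 1 h (\<theta>, gh + s * - eta)" eta] eta by simp
    then have hh: "eta * c0 \<le> h (\<theta>, gh - eta) - h (\<theta>, gh)" using s(3) by simp
    have "Lbar \<theta> (gh - eta) = Lbar \<theta> gh - (h (\<theta>, gh - eta) - h (\<theta>, gh))"
      using n by (simp add: Lbar_def lp_eq lp0_def sum_subtractf field_simps)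
    then have "Lbar \<theta> (gh - eta) \<le> Lbar \<theta> gh - eta * c0" using hh by simp
    then show ?thesis using Lbar_mono[OF \<theta> \<gamma> J' \<gamma>le] Lbar_MLE[OF \<theta>] by simp
  qed
qed

lemma ch_ge: "c0 \<le> ch"
  using c0(2)[OF zhat_Box] by (simp only: ch_eq)

lemma p_hat_ge: "p00 \<le> \<pi> th gh"
  using p00(2)[OF zhat_Box] by simp

lemma A20_sym: "A 2 0 [i, j] = A 2 0 [j, i]"
proof -
  have "iter_d (lp (x k)) [i, j] (th, gh) = iter_d (lp (x k)) [j, i] (th, gh)" if "k < n" for k
    by (rule iter_d_swap[OF open_S smooth_lp[OF x_U[OF that]] zhat_S])
  then show ?thesis by (simp add: A_0_eq del: iter_d.simps)
qed

lemma A30_sym: "A 3 0 [a, b, c] = A 3 0 [b, a, c]" "A 3 0 [a, b, c] = A 3 0 [a, c, b]"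
proof -
  have 1: "iter_d (lp (x k)) [a, b, c] (th, gh) = iter_d (lp (x k)) [b, a, c] (th, gh)" if "k < n" for k
    by (rule iter_d_swap[OF open_S smooth_lp[OF x_U[OF that]] zhat_S])
  have 2: "iter_d (lp (x k)) [a, b, c] (th, gh) = iter_d (lp (x k)) [a, c, b] (th, gh)" if "k < n" for k
    by (rule iter_d_cong_Cons[OF open_S zhat_S], rule iter_d_swap[OF open_S smooth_lp[OF x_U[OF that]]])
  show "A 3 0 [a, b, c] = A 3 0 [b, a, c]" "A 3 0 [a, b, c] = A 3 0 [a, c, b]"
    using 1 2 by (simp_all add: A_0_eq del: iter_d.simps)
qed

lemma A40_sym: "A 4 0 [a, b, c, d] = A 4 0 [a, c, b, d]" "A 4 0 [a, b, c, d] = A 4 0 [a, b, d, c]"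
proof -
  have 1: "iter_d (lp (x k)) [a, b, c, d] (th, gh) = iter_d (lp (x k)) [a, c, b, d] (th, gh)" if "k < n" for k
    by (rule iter_d_cong_Cons[OF open_S zhat_S], rule iter_d_swap[OF open_S smooth_lp[OF x_U[OF that]]])
  have 2: "iter_d (lp (x k)) [a, b, c, d] (th, gh) = iter_d (lp (x k)) [a, b, d, c] (th, gh)" if "k < n" for k
    by (rule iter_d_cong_Cons[OF open_S zhat_S], rule iter_d_cong_Cons[OF open_S], assumption,
        rule iter_d_swap[OF open_S smooth_lp[OF x_U[OF that]]])
  show "A 4 0 [a, b, c, d] = A 4 0 [a, c, b, d]" "A 4 0 [a, b, c, d] = A 4 0 [a, b, d, c]"
    using 1 2 by (simp_all add: A_0_eq del: iter_d.simps)
qed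

lemma ghat_sym: "transpose ghat = ghat"
  by (simp add: transpose_def g_hat_def vec_eq_iff A20_sym)

lemma prior_integrable:
  "integrable lborel (\<lambda>z. indicator S z * \<pi> (fst z) (snd z))"
  "(\<integral>z. indicator S z * \<pi> (fst z) (snd z) \<partial>lborel) = 1"
proof -
  have eq: "(\<lambda>z. indicator S z *\<^sub>R (case z of (\<theta>, \<gamma>) \<Rightarrow> \<pi> \<theta> \<gamma>)) = (\<lambda>z. indicator S z * \<pi> (fst z) (snd z))"
    by (auto simp: case_prod_beta')
  show "integrable lborel (\<lambda>z. indicator S z * \<pi> (fst z) (snd z))"
    using prior unfolding prior_density_def set_integrable_def S_def[symmetric] eq by blast
  show "(\<integral>z. indicator S z * \<pi> (fst z) (snd z) \<partial>lborel) = 1"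
    using prior unfolding prior_density_def set_lebesgue_integral_def S_def[symmetric] eq by blast
qed

lemma Lbar_measurable: "(\<lambda>z. indicator S z * Lbar (fst z) (snd z)) \<in> borel_measurable borel"
proof -
  have cont: "continuous_on S (\<lambda>z. Lbar (fst z) (snd z))"
    unfolding Lbar_def
    by (intro continuous_intros) (use smooth_on_continuous[OF smooth_lp[OF x_U]] in simp)
  have "S \<in> sets borel" using open_S by simp
  from borel_measurable_continuous_on_indicator[OF this cont] show ?thesis by simp
qed

lemma P_bound: "length is \<le> 5 \<Longrightarrow> \<bar>P is\<bar> \<le> Hp"
  using pi2_bound[OF zhat_Box, of 0 "is"] by (simp add: P_eq)

text \<open>
  \<open>P\<close> serves for both \<open>P1\<close> and \<open>P2\<close>, as \<open>D_theta\<close> contains the derivatives of all orders.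
\<close>

sublocale L: laplace ghat lam S n Lbar \<pi> th gh ch "A 1 1" "A 2 1" "A 3 0" "A 4 0" P P "A 0 2 []" dp K eta "min kap0 (eta * c0)"
proof
  show "transpose ghat = ghat" by (rule ghat_sym)
  show "0 < lam" by (rule lam)
  show "lam * (norm v)\<^sup>2 \<le> v \<bullet> (ghat *v v)" for v by (rule coercive)
  show "0 < n" "1 \<le> K" "0 < eta" "eta \<le> 1" "12 * K * eta \<le> lam" using n K eta by auto
  show "12 * K * eta \<le> ch" using eta ch_ge by simp
  show "0 < ch" using c0 ch_ge by simp
  show "1 \<le> K * ch" using order_trans[OF K(4) mult_left_mono[OF ch_ge, of K]] K(1) by simp
  show "ch \<le> K" using H[OF zhat_Box, of 1 "[]"] H_le_K(2) by (simp add: ch_eq)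
  show "1 \<le> K * \<pi> th gh" using order_trans[OF K(5) mult_left_mono[OF p_hat_ge, of K]] K(1) by simp
  show "0 < min kap0 (eta * c0)" using kap0 eta c0 by simp
  have Hs: "\<bar>A r (Suc s) is\<bar> \<le> H" if "length is = r" "r \<le> 5" "s \<le> 2" for r s "is"
    using A_Suc_bound that by blast
  show "v \<bullet> (ghat *v v) \<le> K * (norm v)\<^sup>2" for v
    using form_le_K[of 2 "A 2 0" "Gm + H" v] A_0_bound[of _ 2] Gm_nonneg H_nonneg H_le_K(3) form_A_2[of v] by simp
  show "\<bar>form 1 (A 1 1) v\<bar> \<le> K * norm v" for v
    using form_le_K[of 1 "A 1 1" H v] Hs[of _ 1 0] H_nonneg H_le_K(1) by simp
  show "\<bar>form 2 (A 2 1) v\<bar> \<le> K * (norm v)\<^sup>2" for v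
    using form_le_K[of 2 "A 2 1" H v] Hs[of _ 2 0] H_nonneg H_le_K(1) by simp
  show "\<bar>form 3 (A 3 0) v\<bar> \<le> K * norm v ^ 3" for v
    using form_le_K[of 3 "A 3 0" "Gm + H" v] A_0_bound[of _ 3] Gm_nonneg H_nonneg H_le_K(3) by simp
  show "\<bar>form 4 (A 4 0) v\<bar> \<le> K * norm v ^ 4" for v
    using form_le_K[of 4 "A 4 0" "Gm + H" v] A_0_bound[of _ 4] Gm_nonneg H_nonneg H_le_K(3) by simp
  show "\<bar>form 1 P v\<bar> \<le> K * norm v" for v
    using form_le_K[of 1 P Hp v] P_bound Hp_nonneg K(3) by simp
  show "\<bar>form 2 P v\<bar> \<le> K * (norm v)\<^sup>2" for v
    using form_le_K[of 2 P Hp v] P_bound Hp_nonneg K(3) by simp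
  show "\<bar>A 0 2 []\<bar> \<le> K" using Hs[of "[]" 0 1] H_le_K(2) by (simp add: numeral_2_eq_2)
  show "\<bar>dp\<bar> \<le> K" using pi2_bound[OF zhat_Box, of 1 "[]"] Hp_le_K by (simp add: dp_eq)
  show "(th + v, gh + s) \<in> S" if "norm v < eta" "- eta < s" "s \<le> 0" for v s
    using in_S that by simp
  show "\<bar>Lbar (th + v) (gh + s) - Lbar th gh - (- (v \<bullet> (ghat *v v)) / 2 + form 3 (A 3 0) v / 6 + form 4 (A 4 0) v / 24
         + s * (ch + form 1 (A 1 1) v + form 2 (A 2 1) v / 2) + A 0 2 [] * s\<^sup>2 / 2)\<bar>
      \<le> K * (norm v ^ 5 + \<bar>s\<bar> * norm v ^ 3 + s\<^sup>2 * norm v + \<bar>s\<bar> ^ 3)"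
    if "norm v < eta" "- eta < s" "s \<le> 0" for v s
    by (rule Lbar_expand[OF that])
  show "\<bar>\<pi> (th + v) (gh + s) - (\<pi> th gh + form 1 P v + form 2 P v / 2 + dp * s)\<bar>
      \<le> K * (norm v ^ 3 + norm v * \<bar>s\<bar> + s\<^sup>2)"
    if "norm v < eta" "- eta < s" "s \<le> 0" for v s
    by (rule prior_expand[OF that])
  show "Lbar \<theta> \<gamma> \<le> Lbar th gh - min kap0 (eta * c0)"
    if "(\<theta>, \<gamma>) \<in> S" "\<gamma> \<le> gh" "\<not> (norm (\<theta> - th) < eta \<and> gh - eta < \<gamma>)" for \<theta> \<gamma>
    by (rule Lbar_far[OF that])
  show "0 \<le> \<pi> \<theta> \<gamma>" if "(\<theta>, \<gamma>) \<in> S" for \<theta> \<gamma>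
    using prior that by (simp add: prior_density_def S_def)
  show "S \<in> sets borel" using open_S by simp
qed (fact prior_integrable Lbar_measurable)+

lemma B1_eq: "B1 \<Theta> I2 q \<pi> n x u t = L.a1 u t"
  unfolding B1_def Let_def form_def[symmetric] L.a1_def L.b1_def L.w3_def
  by (simp add: fact_numeral)

lemma cov_pow_eq: "kron_pow 2 (vec_mat (matrix_inv ghat)) = L.cov_pow"
  by (simp add: L.cov_def)

lemma tinner_sub: "tinner r T (\<lambda>is. kron_pow 1 (tensor_of_vec u) r is - a * V is) = form r T u - a * tinner r T V"
  by (simp add: tinner_def form_def right_diff_distrib sum_subtractf sum_distrib_left mult_ac)

lemma tinner_add: "tinner r T (\<lambda>is. kron_pow 1 (tensor_of_vec u) r is * t + a * V is) = form r T u * t + a * tinner r T V"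
  by (simp add: tinner_def form_def distrib_left sum.distrib sum_distrib_left sum_distrib_right mult_ac)

text \<open>
  Each bracket in the definition of \<open>B2\<close> is a monomial of \<open>a2\<close> minus its expectation. The form of degree 6
  is evaluated at \<open>u\<close>, whose powers are symmetric tensors, so the symmetrizer acts on the expectation only.
\<close>

lemma B2_eq: "B2 \<Theta> I2 q \<pi> n x u t = L.a2 u t - L.z2"
proof -
  let ?U = "kron_pow 1 (tensor_of_vec u)"
  have t2: "tinner 2 T (\<lambda>is. ?U 2 is - L.cov_pow 1 is) = form 2 T u - L.expect 2 T" for T
    using tinner_sub[of 2 T u 1 "L.cov_pow 1"] by (simp add: L.expect_2)
  have t2t: "tinner 2 T (\<lambda>is. ?U 2 is * t + L.cov_pow 1 is) = form 2 T u * t + L.expect 2 T" for T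
    using tinner_add[of 2 T u t 1 "L.cov_pow 1"] by (simp add: L.expect_2)
  have t2tt: "tinner 2 T (\<lambda>is. ?U 2 is * t\<^sup>2 - 2 * L.cov_pow 1 is) = form 2 T u * t\<^sup>2 - 2 * L.expect 2 T" for T
    using tinner_add[of 2 T u "t\<^sup>2" "-2" "L.cov_pow 1"] by (simp add: L.expect_2)
  have e41: "L.expect 4 (kron 1 T (A 3 0)) = 3 * tinner 4 (kron 1 T (A 3 0)) (L.cov_pow 2)" for T
  proof (rule L.expect_4)
    fix a b c d
    have k: "kron 1 T (A 3 0) [a, b, c, d] = T [a] * A 3 0 [b, c, d]" for a b c d
      by (simp add: kron_def)
    show "kron 1 T (A 3 0) [a, b, c, d] = kron 1 T (A 3 0) [a, c, b, d]" unfolding k by (metis A30_sym(1))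
    show "kron 1 T (A 3 0) [a, b, c, d] = kron 1 T (A 3 0) [a, b, d, c]" unfolding k by (metis A30_sym(2))
  qed
  have e42: "L.expect 4 (A 4 0) = 3 * tinner 4 (A 4 0) (L.cov_pow 2)"
    by (rule L.expect_4) (rule A40_sym)+
  have t41: "tinner 4 (kron 1 T (A 3 0)) (\<lambda>is. ?U 4 is - 3 * L.cov_pow 2 is) = form 4 (kron 1 T (A 3 0)) u - L.expect 4 (kron 1 T (A 3 0))" for T
    unfolding e41 by (rule tinner_sub)
  have t41t: "tinner 4 (kron 1 T (A 3 0)) (\<lambda>is. ?U 4 is * t + 3 * L.cov_pow 2 is) = form 4 (kron 1 T (A 3 0)) u * t + L.expect 4 (kron 1 T (A 3 0))" for T
    unfolding e41 by (rule tinner_add)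
  have t42: "tinner 4 (A 4 0) (\<lambda>is. ?U 4 is - 3 * L.cov_pow 2 is) = form 4 (A 4 0) u - L.expect 4 (A 4 0)"
    unfolding e42 by (rule tinner_sub)
  have k2: "tinner 2 (kron_pow 1 T 2) V = tinner 2 (kron 1 T T) V" for T :: "'d tensor" and V
    by (rule tinner_cong) (simp_all only: kron_pow_2 mult_1_right)
  have k6: "tinner 6 (kron_pow 3 T 2) V = tinner 6 (kron 3 T T) V" for T :: "'d tensor" and V
    by (rule tinner_cong) (simp_all add: kron_pow_2)
  have t6: "tinner 6 T (symmetrizer 6 (\<lambda>is. ?U 6 is - 15 * L.cov_pow 3 is)) = form 6 T u - L.expect 6 T" for T
  proof -
    have "symmetrizer 6 (\<lambda>is. ?U 6 is - 15 * L.cov_pow 3 is) js = ?U 6 js - 15 * symmetrizer 6 (L.cov_pow 3) js"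
      if l: "length js = 6" for js
    proof -
      have "symmetrizer 6 (\<lambda>is. ?U 6 is - 15 * L.cov_pow 3 is) js
          = symmetrizer 6 (?U 6) js - 15 * symmetrizer 6 (L.cov_pow 3) js"
        by (simp add: symmetrizer_eq[OF l] sum_subtractf sum_distrib_left right_diff_distrib mult_ac)
      then show ?thesis by (simp only: symmetrizer_monom[OF l] kron_pow_tensor_of_vec[OF l])
    qed
    then have "tinner 6 T (symmetrizer 6 (\<lambda>is. ?U 6 is - 15 * L.cov_pow 3 is))
        = tinner 6 T (\<lambda>is. ?U 6 is - 15 * symmetrizer 6 (L.cov_pow 3) is)"
      by (intro tinner_cong) auto
    then show ?thesis by (simp only: tinner_sub L.expect_6)
  qed
  have f: "(fact 3 :: real) = 6" "(fact 4 :: real) = 24" by (simp_all add: fact_numeral)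
  have c: "ch \<noteq> 0" and p: "\<pi> th gh \<noteq> 0" using c0 ch_ge p00 p_hat_ge by auto
  show ?thesis
    unfolding B2_def Let_def cov_pow_eq t2 t2t t2tt t41 t41t t42 k2 k6 t6 f L.a2_eq L.z2_def
    using c p by (simp add: power2_eq_square field_simps)
qed

lemma posterior_eq: "posterior \<Theta> I1 I2 q \<pi> n x \<theta> \<gamma> = L.kernel \<theta> \<gamma> / (\<integral>z. L.kernel_pair z \<partial>lborel)"
proof -
  define C where "C = \<pi> th gh * exp (real n * Lbar th gh)"
  have C: "0 < C" using p00 p_hat_ge by (simp add: C_def)
  have ker: "indicator S (\<theta>, \<gamma>) * (\<pi> \<theta> \<gamma> * likelihood I2 q n x \<theta> \<gamma>) = C * L.kernel \<theta> \<gamma>" for \<theta> \<gamma>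
  proof (cases "(\<theta>, \<gamma>) \<in> S")
    case True
    have "exp (real n * Lbar \<theta> \<gamma>) = exp (real n * Lbar th gh) * exp (real n * (Lbar \<theta> \<gamma> - Lbar th gh))"
      by (simp add: exp_add[symmetric] algebra_simps)
    then show ?thesis
      using True L.p0_pos by (simp add: likelihood_eq_exp C_def L.kernel_def)
  qed (simp add: L.kernel_def)
  have "(LINT (\<eta>, g):(\<Theta> \<times> J)|lborel. \<pi> \<eta> g * likelihood I2 q n x \<eta> g) = (\<integral>z. C * L.kernel_pair z \<partial>lborel)"
    unfolding set_lebesgue_integral_def S_def[symmetric]
  proof (rule Bochner_Integration.integral_cong[OF refl])
    fix z show "indicat_real S z *\<^sub>R (case z of (\<eta>, g) \<Rightarrow> \<pi> \<eta> g * likelihood I2 q n x \<eta> g) = C * L.kernel_pair z"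
      using ker[of "fst z" "snd z"] by (simp add: L.kernel_pair_def case_prod_beta')
  qed
  then show ?thesis
    unfolding posterior_def S_def[symmetric] ker using C by simp
qed

lemma posterior_ut_eq:
  "posterior_ut \<Theta> I1 I2 q \<pi> n x u t
    = L.kernel (th + L.e *\<^sub>R u) (gh + t / (real n * ch)) / (\<integral>w. L.kernel_pair (L.unscale w) \<partial>lborel)"
  unfolding posterior_ut_def posterior_eq L.change_variables(2)[OF L.kernel_measurable] L.e_def[symmetric]
    L.jac_def[symmetric] by (simp add: mult.commute)

text \<open>The limiting density, which is the leading factor of the expansion.\<close>

definition lead :: "real ^ 'd \<Rightarrow> real \<Rightarrow> real" where
  "lead u t = sqrt (det ghat) / (2 * pi) powr (real CARD('d) / 2) * exp (t - u \<bullet> (ghat *v u) / 2)"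

lemma lead_eq: "lead u t = L.gauss u * exp t / L.mass"
proof -
  have "exp (t - u \<bullet> (ghat *v u) / 2) = exp (- (u \<bullet> (ghat *v u)) / 2) * exp t"
    by (simp add: exp_add[symmetric])
  then show ?thesis
    using L.nn_integral_gauss(1) by (simp add: lead_def L.gauss_def L.mass_def)
qed

lemma lead_pos: "0 < lead u t"
  using L.gauss_pos L.mass_pos by (simp add: lead_eq)

lemma e_cubed: "L.e ^ 3 = real n powr (- 3 / 2)"
proof -
  have "L.e = real n powr (- 1 / 2)"
    using n by (simp add: L.e_def powr_minus_divide powr_half_sqrt)
  then have "L.e ^ 3 = (real n powr (- 1 / 2)) powr 3" using n by (simp add: powr_numeral)
  then show ?thesis by (simp add: powr_powr)
qed

theorem posterior_ut_expansion:
  assumes t: "t \<le> 0" and u: "1 / sqrt (real n) * norm u < eta" and t': "1 / real n * (K * \<bar>t\<bar>) < eta"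
    and small: "1 / real n * (L.z2_bound + L.C2 / L.mass_lb) \<le> 1 / 2"
  shows "\<bar>posterior_ut \<Theta> I1 I2 q \<pi> n x u t / lead u t
      - (1 + 1 / sqrt (real n) * B1 \<Theta> I2 q \<pi> n x u t + 1 / real n * B2 \<Theta> I2 q \<pi> n x u t)\<bar>
    \<le> L.remainder_const u t * real n powr (- 3 / 2)"
proof -
  have box': "L.in_box (th + L.e *\<^sub>R u) (gh + t / (real n * ch))"
  proof -
    have "\<bar>L.e\<^sup>2 * (t / ch)\<bar> \<le> L.e\<^sup>2 * (K * \<bar>t\<bar>)" by (rule abs_mult_le[OF _ L.abs_t_c]) simp
    also have "\<dots> < eta" using t' by (simp add: L.inverse_n)
    finally have "- eta < L.e\<^sup>2 * (t / ch)" by (simp only: abs_less_iff) linarith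
    moreover have "L.e\<^sup>2 * (t / ch) \<le> 0" using t L.c by (simp add: divide_nonpos_pos mult_nonneg_nonpos)
    moreover have "norm (L.e *\<^sub>R u) < eta" using u L.e_pos by (simp add: L.e_def)
    ultimately show ?thesis unfolding L.in_box_def L.scaled_gamma by simp
  qed
  have "L.e\<^sup>2 * (L.z2_bound + L.C2 / L.mass_lb) \<le> 1 / 2" using small by (simp add: L.inverse_n)
  from L.posterior_expansion[OF t box' this]
  show ?thesis
    unfolding posterior_ut_eq lead_eq B1_eq B2_eq e_cubed[symmetric] L.inverse_n L.e_def[symmetric]
    using L.mass_pos by simp
qed

end


section \<open>Consistency of the observed information\<close>

text \<open>The minimum over the unit sphere, which is compact, is positive.\<close>

lemma positive_definite_coercive:
  fixes A :: "real ^ 'd::finite ^ 'd"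
  assumes "\<And>v. v \<noteq> 0 \<Longrightarrow> 0 < v \<bullet> (A *v v)"
  obtains l where "0 < l" "\<And>v. l * (norm v)\<^sup>2 \<le> v \<bullet> (A *v v)"
proof -
  let ?f = "\<lambda>v. v \<bullet> (A *v v)"
  have cont: "continuous_on (sphere 0 1) ?f"
    by (intro continuous_intros linear_continuous_on matrix_vector_mul_bounded_linear)
  obtain i :: 'd where True by simp
  have ne: "sphere (0 :: real ^ 'd) 1 \<noteq> {}"
    using norm_axis_1[of i] by (metis empty_iff mem_sphere_0)
  obtain v0 where v0: "v0 \<in> sphere 0 1" "\<And>v. v \<in> sphere 0 1 \<Longrightarrow> ?f v0 \<le> ?f v"
    using continuous_attains_inf[OF compact_sphere ne cont] by blast
  show thesis
  proof
    show "0 < ?f v0" using v0(1) by (intro assms) auto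
    fix v :: "real ^ 'd"
    show "?f v0 * (norm v)\<^sup>2 \<le> ?f v"
    proof (cases "v = 0")
      case False
      define w where "w = (1 / norm v) *\<^sub>R v"
      have w: "w \<in> sphere 0 1" "v = norm v *\<^sub>R w" using False by (simp_all add: w_def)
      have "?f v = (norm v)\<^sup>2 * ?f w"
        by (subst w(2), subst (2) w(2)) (simp add: matrix_vector_mult_scaleR power2_eq_square)
      then show ?thesis using mult_left_mono[OF v0(2)[OF w(1)], of "(norm v)\<^sup>2"] by (simp add: mult.commute)
    qed simp
  qed
qed

lemma coercive_perturbation:
  fixes A B :: "real ^ 'd::finite ^ 'd"
  assumes A: "l * (norm v)\<^sup>2 \<le> v \<bullet> (A *v v)" and close: "\<And>i j. \<bar>B $ i $ j - A $ i $ j\<bar> \<le> r"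
  shows "(l - (real CARD('d))\<^sup>2 * r) * (norm v)\<^sup>2 \<le> v \<bullet> (B *v v)"
proof -
  have eq: "v \<bullet> (C *v v) = (\<Sum>i\<in>UNIV. \<Sum>j\<in>UNIV. v $ i * (C $ i $ j * v $ j))" for C :: "real ^ 'd ^ 'd"
    by (simp add: inner_vec_def matrix_vector_mult_def sum_distrib_left)
  have entry: "- (r * (norm v)\<^sup>2) \<le> v $ i * ((B - A) $ i $ j * v $ j)" for i j
  proof -
    have r: "0 \<le> r" using order_trans[OF abs_ge_zero close] .
    have "\<bar>v $ i * ((B - A) $ i $ j * v $ j)\<bar> = \<bar>v $ i\<bar> * (\<bar>B $ i $ j - A $ i $ j\<bar> * \<bar>v $ j\<bar>)"
      by (simp add: abs_mult)
    also have "\<dots> \<le> norm v * (r * norm v)"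
      by (intro mult_mono close component_le_norm_cart mult_nonneg_nonneg r) auto
    finally have "\<bar>v $ i * ((B - A) $ i $ j * v $ j)\<bar> \<le> r * (norm v)\<^sup>2"
      by (simp add: power2_eq_square mult_ac)
    then show ?thesis by (simp only: abs_le_iff) linarith
  qed
  have "(\<Sum>i\<in>(UNIV :: 'd set). \<Sum>j\<in>(UNIV :: 'd set). - (r * (norm v)\<^sup>2)) \<le> v \<bullet> ((B - A) *v v)"
    unfolding eq by (intro sum_mono entry)
  then have "- ((real CARD('d))\<^sup>2 * (r * (norm v)\<^sup>2)) \<le> v \<bullet> (B *v v) - v \<bullet> (A *v v)"
    by (simp add: matrix_vector_mult_diff_rdistrib inner_diff_right power2_eq_square mult.assoc)
  then show ?thesis using A by (simp add: left_diff_distrib mult.assoc)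
qed

context truncated_family
begin

lemma h_at_\<gamma>0: "\<theta> \<in> \<Theta> \<Longrightarrow> iter_d h is (\<theta>, \<gamma>0) = 0"
proof -
  assume \<theta>: "\<theta> \<in> \<Theta>"
  have "D_theta (\<lambda>\<eta>. 0) \<eta> is = 0" for \<eta> :: "real ^ 'd"
    by (induction "is" arbitrary: \<eta>) (simp_all add: pderiv_at_def)
  moreover have "D_theta (\<lambda>\<eta>. 0) \<theta> is = iter_d h is (\<theta>, \<gamma>0)"
    by (rule D_theta_eq_iter_d[OF open_S smooth_h]) (use \<theta> \<gamma>0 in \<open>simp_all add: h_def S_def\<close>)
  ultimately show ?thesis by simp
qed

text \<open>
  The normalizing integral extends over a smaller set when \<open>\<gamma>\<close> grows, so the slope cannot be positive.
\<close>

lemma h_slope: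
  assumes \<theta>: "\<theta> \<in> \<Theta>" shows "iter_g 1 h (\<theta>, \<gamma>0) = deriv (psi I2 q \<theta>) \<gamma>0" "iter_g 1 h (\<theta>, \<gamma>0) \<le> 0"
proof -
  have z: "(\<theta>, \<gamma>0) \<in> S" using \<theta> \<gamma>0 by (simp add: S_def)
  have h_diff: "h differentiable (at (\<theta>, \<gamma>0))" by (rule smooth_on_differentiable[OF open_S smooth_h z])
  have "((\<lambda>g. h ((\<theta>, 0) + g *\<^sub>R (0, 1))) has_real_derivative ddir (0, 1) h ((\<theta>, 0) + \<gamma>0 *\<^sub>R (0, 1))) (at \<gamma>0)"
    by (rule has_real_derivative_along_line) (use h_diff in simp)
  then have "((\<lambda>g. h (\<theta>, g)) has_real_derivative ddir (0, 1) h (\<theta>, \<gamma>0)) (at \<gamma>0)" by simp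
  from DERIV_add[OF this DERIV_const[of "psi I2 q \<theta> \<gamma>0"]]
  have D: "(psi I2 q \<theta> has_real_derivative ddir (0, 1) h (\<theta>, \<gamma>0)) (at \<gamma>0)"
    by (simp add: h_def)
  then show "iter_g 1 h (\<theta>, \<gamma>0) = deriv (psi I2 q \<theta>) \<gamma>0" by (simp add: DERIV_imp_deriv)
  show "iter_g 1 h (\<theta>, \<gamma>0) \<le> 0"
  proof (rule ccontr)
    assume "\<not> iter_g 1 h (\<theta>, \<gamma>0) \<le> 0"
    then have "0 < ddir (0, 1) h (\<theta>, \<gamma>0)" by simp
    from DERIV_pos_inc_right[OF D this] obtain d
      where d: "0 < d" "\<And>s. 0 < s \<Longrightarrow> s < d \<Longrightarrow> psi I2 q \<theta> \<gamma>0 < psi I2 q \<theta> (\<gamma>0 + s)" by blast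
    obtain e where e: "0 < e" "ball \<gamma>0 e \<subseteq> J" using open_J \<gamma>0 by (meson openE)
    define s where "s = min d e / 2"
    have s: "0 < s" "s < d" "s < e" using d e by (auto simp: s_def min_def)
    have "\<gamma>0 + s \<in> J" using e(2) s by (intro subsetD[OF e(2)]) (simp add: dist_real_def)
    with psi_antimono[OF \<theta> \<gamma>0 this] s d(2)[OF s(1,2)] show False by simp
  qed
qed

text \<open>
  By continuity at the true parameter. The second \<open>\<theta>\<close>-derivatives of \<open>h\<close> are small near \<open>\<gamma> = \<gamma>0\<close> because \<open>h\<close>
  vanishes identically there.
\<close>

lemma regular_box:
  assumes \<theta>: "\<theta> \<in> \<Theta>" and slope: "deriv (psi I2 q \<theta>) \<gamma>0 \<noteq> 0"
    and prior: "prior_density \<Theta> I1 I2 \<pi>" "0 < \<pi> \<theta> \<gamma>0" and r: "0 < r" and d: "0 < d"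
  obtains b c p where "0 < b" "b < d" "0 < c" "0 < p" "cball \<theta> b \<times> cball \<gamma>0 b \<subseteq> S"
    "\<And>z. z \<in> cball \<theta> b \<times> cball \<gamma>0 b \<Longrightarrow> iter_g 1 h z \<le> - c"
    "\<And>z. z \<in> cball \<theta> b \<times> cball \<gamma>0 b \<Longrightarrow> p \<le> \<pi> (fst z) (snd z)"
    "\<And>z i j. z \<in> cball \<theta> b \<times> cball \<gamma>0 b \<Longrightarrow> \<bar>iter_d h [i, j] z\<bar> \<le> r"
proof -
  let ?z = "(\<theta>, \<gamma>0)"
  define c where "c = - iter_g 1 h ?z / 2"
  define p where "p = \<pi> \<theta> \<gamma>0 / 2"
  have c: "0 < c" using h_slope[OF \<theta>] slope by (simp add: c_def del: iter_g.simps)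
  have p: "0 < p" using prior(2) by (simp add: p_def)
  have z: "?z \<in> S" using \<theta> \<gamma>0 by (simp add: S_def)
  have tend: "(F \<longlongrightarrow> F ?z) (nhds ?z)" if "smooth_on S F" for F :: "(real ^ 'd) \<times> real \<Rightarrow> real"
    using smooth_on_continuous[OF that] z open_S
    by (simp add: continuous_on_eq_continuous_at isCont_def tendsto_at_iff_tendsto_nhds)
  have "\<forall>\<^sub>F z in nhds ?z. z \<in> S" using open_S z by (rule eventually_nhds_in_open)
  moreover have "\<forall>\<^sub>F z in nhds ?z. iter_g 1 h z < - c"
    by (rule order_tendstoD(2)[OF tend[OF smooth_on_iter_g[OF smooth_h]]]) (use c in \<open>simp add: c_def del: iter_g.simps\<close>)
  moreover have "\<forall>\<^sub>F z in nhds ?z. p < \<pi> (fst z) (snd z)"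
    by (rule order_tendstoD(1)[OF tend[OF smooth_prior[OF prior(1)]]]) (use p in \<open>simp add: p_def\<close>)
  moreover have "\<forall>\<^sub>F z in nhds ?z. \<forall>ij. \<bar>iter_d h [fst ij, snd ij] z\<bar> < r"
  proof (rule eventually_all_finite)
    fix ij :: "'d \<times> 'd"
    have "((\<lambda>z. \<bar>iter_d h [fst ij, snd ij] z\<bar>) \<longlongrightarrow> \<bar>iter_d h [fst ij, snd ij] ?z\<bar>) (nhds ?z)"
      by (rule tendsto_rabs[OF tend[OF smooth_on_iter_d[OF smooth_h]]])
    then show "\<forall>\<^sub>F z in nhds ?z. \<bar>iter_d h [fst ij, snd ij] z\<bar> < r"
      by (rule order_tendstoD(2)) (use r in \<open>simp only: h_at_\<gamma>0[OF \<theta>] abs_zero\<close>)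
  qed
  ultimately have "\<forall>\<^sub>F z in nhds ?z. z \<in> S \<and> iter_g 1 h z < - c \<and> p < \<pi> (fst z) (snd z)
      \<and> (\<forall>ij. \<bar>iter_d h [fst ij, snd ij] z\<bar> < r)"
    by eventually_elim blast
  then obtain e where e: "0 < e" and near: "\<And>z. dist z ?z < e \<Longrightarrow> z \<in> S \<and> iter_g 1 h z < - c \<and> p < \<pi> (fst z) (snd z)
      \<and> (\<forall>ij. \<bar>iter_d h [fst ij, snd ij] z\<bar> < r)"
    unfolding eventually_nhds_metric by blast
  define b where "b = min (e / 3) (d / 2)"
  have b: "0 < b" "b < d" "b \<le> e / 3" using e d by (auto simp: b_def)
  have close: "dist z ?z < e" if "z \<in> cball \<theta> b \<times> cball \<gamma>0 b" for z
  proof -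
    have "dist z ?z \<le> dist (fst z) \<theta> + dist (snd z) \<gamma>0"
      using sqrt_sum_squares_le_sum[of "dist (fst z) \<theta>" "dist (snd z) \<gamma>0"] by (simp add: dist_prod_def)
    then show ?thesis using that b(3) e by (auto simp: dist_commute)
  qed
  show thesis
  proof (rule that[OF b(1,2) c p])
    show "\<bar>iter_d h [i, j] z\<bar> \<le> r" if "z \<in> cball \<theta> b \<times> cball \<gamma>0 b" for z i j
      using near[OF close[OF that]] by (metis fst_conv snd_conv less_imp_le)
  qed (use near[OF close] in \<open>auto simp del: iter_g.simps intro: less_imp_le\<close>)
qed

text \<open>
  The observed information at the MLE differs from the average of the second derivatives at the true
  parameter by a change of \<open>\<theta>\<close>, which the envelope of the third derivatives controls, and by a derivative
  of \<open>h\<close>.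
\<close>

lemma g_hat_close:
  assumes n: "0 < n" and x: "\<And>j. j < n \<Longrightarrow> x j \<in> U"
    and box: "cball \<theta>0 b \<times> cball \<gamma>0 b \<subseteq> S"
    and G: "\<And>y \<eta> is. y \<in> U \<Longrightarrow> \<eta> \<in> cball \<theta>0 b \<Longrightarrow> 2 \<le> length is \<Longrightarrow> length is \<le> 5 \<Longrightarrow>
      \<bar>D_theta (\<lambda>\<eta>. logp I2 q y \<eta> \<gamma>0) \<eta> is\<bar> \<le> G y"
    and Gm: "1 / real n * (\<Sum>j<n. G (x j)) \<le> Gm"
    and z: "(theta_ML \<Theta> I2 q n x, gamma_ML n x) \<in> cball \<theta>0 b \<times> cball \<gamma>0 b"
  shows "\<bar>g_hat \<Theta> I2 q n x $ i $ j + 1 / real n * (\<Sum>k<n. D_theta (\<lambda>\<eta>. logp I2 q (x k) \<eta> \<gamma>0) \<theta>0 [i, j])\<bar>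
    \<le> real CARD('d) * Gm * dist (theta_ML \<Theta> I2 q n x) \<theta>0 + \<bar>iter_d h [i, j] (theta_ML \<Theta> I2 q n x, gamma_ML n x)\<bar>"
proof -
  let ?t = "theta_ML \<Theta> I2 q n x" and ?g = "gamma_ML n x"
  define v where "v = ?t - \<theta>0"
  have t: "?t = \<theta>0 + v" by (simp add: v_def)
  have zS: "(?t, ?g) \<in> S" using z box by blast
  have v: "norm v \<le> b" using z by (simp add: v_def dist_norm norm_minus_commute)
  have line: "\<theta>0 + s *\<^sub>R v \<in> cball \<theta>0 b" if "0 \<le> s" "s \<le> 1" for s
  proof -
    have "norm (s *\<^sub>R v) \<le> norm v" using that by (simp add: mult_left_le_one_le)
    then show ?thesis using v by (simp add: dist_norm)
  qed
  have lineS: "(\<theta>0 + s *\<^sub>R v, ?g) \<in> S" if "0 \<le> s" "s \<le> 1" for s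
    using line[OF that] z box by blast
  define D where "D k \<theta> = D_theta (\<lambda>\<eta>. logp I2 q (x k) \<eta> \<gamma>0) \<theta> [i, j]" for k \<theta>
  have D: "\<bar>D k ?t - D k \<theta>0\<bar> \<le> real CARD('d) * norm v * G (x k)" if k: "k < n" for k
  proof -
    let ?F = "iter_d (lp0 (x k)) [i, j]"
    note xk = x[OF k]
    have "\<exists>s. 0 < s \<and> s < 1 \<and> ?F (\<theta>0 + v, ?g) = (\<Sum>m<1. form m (\<lambda>is. iter_d ?F is (\<theta>0, ?g)) v / fact m)
        + form 1 (\<lambda>is. iter_d ?F is (\<theta>0 + s *\<^sub>R v, ?g)) v / fact 1"
      by (rule theta_taylor[OF open_S smooth_on_iter_d[OF smooth_lp0[OF xk]] zero_less_one lineS])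
    then obtain s where s: "0 < s" "s < 1"
      and eq: "?F (\<theta>0 + v, ?g) = (\<Sum>m<1. form m (\<lambda>is. iter_d ?F is (\<theta>0, ?g)) v / fact m)
        + form 1 (\<lambda>is. iter_d ?F is (\<theta>0 + s *\<^sub>R v, ?g)) v / fact 1" by blast
    have third: "\<bar>iter_d ?F is (\<theta>0 + s *\<^sub>R v, ?g)\<bar> \<le> G (x k)" if "length is = 1" for "is"
    proof -
      obtain a where a: "is = [a]" using \<open>length is = 1\<close> by (cases "is") auto
      have "iter_d ?F is (\<theta>0 + s *\<^sub>R v, ?g) = iter_d (lp0 (x k)) [a, i, j] (\<theta>0 + s *\<^sub>R v, ?g)"
        by (simp add: a)
      also have "\<dots> = D_theta (\<lambda>\<eta>. logp I2 q (x k) \<eta> \<gamma>0) (\<theta>0 + s *\<^sub>R v) [a, i, j]"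
        using iter_d_lp0[OF xk lineS[of s], of "[a, i, j]"] s by (simp del: D_theta.simps iter_d.simps)
      finally show ?thesis using G[OF xk line[of s], of "[a, i, j]"] s by (simp del: D_theta.simps iter_d.simps)
    qed
    have "\<bar>form 1 (\<lambda>is. iter_d ?F is (\<theta>0 + s *\<^sub>R v, ?g)) v\<bar> \<le> real CARD('d) ^ 1 * G (x k) * norm v ^ 1"
      using abs_form_le[of 1 "\<lambda>is. iter_d ?F is (\<theta>0 + s *\<^sub>R v, ?g)" "G (x k)" v] third by simp
    then have "\<bar>?F (\<theta>0 + v, ?g) - ?F (\<theta>0, ?g)\<bar> \<le> real CARD('d) * G (x k) * norm v"
      using eq by (simp del: iter_d.simps(2))
    moreover have "?F (\<theta>0 + v, ?g) = D k ?t" "?F (\<theta>0, ?g) = D k \<theta>0"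
      using iter_d_lp0[OF xk, of "(\<theta>0 + v, ?g)" "[i, j]"] iter_d_lp0[OF xk, of "(\<theta>0, ?g)" "[i, j]"] zS lineS[of 0]
      by (simp_all add: t D_def del: D_theta.simps iter_d.simps)
    ultimately show ?thesis by (simp only: mult_ac)
  qed
  have "g_hat \<Theta> I2 q n x $ i $ j = - (1 / real n * (\<Sum>k<n. iter_d (lp (x k)) [i, j] (?t, ?g)))"
    using A_hat_eq[OF x zS, of "[i, j]" 2 0] by (simp add: g_hat_def del: iter_d.simps)
  also have "(\<Sum>k<n. iter_d (lp (x k)) [i, j] (?t, ?g)) = (\<Sum>k<n. D k ?t - iter_d h [i, j] (?t, ?g))"
  proof (intro sum.cong refl)
    fix k assume "k \<in> {..<n}"
    then have xk: "x k \<in> U" using x by simp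
    show "iter_d (lp (x k)) [i, j] (?t, ?g) = D k ?t - iter_d h [i, j] (?t, ?g)"
      unfolding iter_d_lp[OF xk zS] iter_d_lp0[OF xk zS] D_def fst_conv ..
  qed
  finally have eq: "g_hat \<Theta> I2 q n x $ i $ j + 1 / real n * (\<Sum>k<n. D k \<theta>0)
      = iter_d h [i, j] (?t, ?g) - 1 / real n * (\<Sum>k<n. D k ?t - D k \<theta>0)"
    using n by (simp add: sum_subtractf field_simps del: iter_d.simps)
  have "\<bar>1 / real n * (\<Sum>k<n. D k ?t - D k \<theta>0)\<bar> \<le> 1 / real n * (\<Sum>k<n. real CARD('d) * norm v * G (x k))"
    unfolding abs_mult by (intro mult_mono order_trans[OF sum_abs] sum_mono D) auto
  also have "\<dots> = real CARD('d) * norm v * (1 / real n * (\<Sum>k<n. G (x k)))"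
    by (simp add: sum_distrib_left[symmetric])
  also have "\<dots> \<le> real CARD('d) * norm v * Gm" by (intro mult_left_mono Gm) simp
  finally have "\<bar>1 / real n * (\<Sum>k<n. D k ?t - D k \<theta>0)\<bar> \<le> real CARD('d) * Gm * dist ?t \<theta>0"
    by (simp add: v_def dist_norm mult_ac)
  then show ?thesis unfolding D_def[symmetric] eq by (intro order_trans[OF abs_triangle_ineq4]) simp
qed

end


section \<open>Good samples have probability tending to one\<close>

locale regular_sampling = truncated_family \<Theta> I1 I2 q \<gamma>0 + prob_space M
  for \<Theta> :: "(real ^ 'd::finite) set" and I1 I2 :: ereal
    and q :: "real \<Rightarrow> real ^ 'd \<Rightarrow> real" and \<gamma>0 :: real and M :: "'w measure" +
  fixes \<theta>0 :: "real ^ 'd" and \<pi> :: "real ^ 'd \<Rightarrow> real \<Rightarrow> real" and X :: "nat \<Rightarrow> 'w \<Rightarrow> real"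
  assumes \<theta>0: "\<theta>0 \<in> \<Theta>" and mle: "MLE_condition \<Theta> I1 I2 q \<gamma>0"
    and prior: "prior_density \<Theta> I1 I2 \<pi>" and prior_pos: "0 < \<pi> \<theta>0 \<gamma>0"
    and indep: "indep_vars (\<lambda>_. borel) X UNIV"
    and dist_X: "\<And>i. distributed M lborel (X i) (\<lambda>x. ennreal (pdens I2 q x \<theta>0 \<gamma>0))"
    and regular: "regular_at \<Theta> I2 q M X \<theta>0 \<gamma>0"
begin

abbreviation N0 where "N0 \<equiv> Pdist I2 q \<theta>0 \<gamma>0"

lemma distr_X: "distr M borel (X i) = N0"
proof -
  have "distr M borel (X i) = distr M lborel (X i)" by (rule distr_cong) simp_all
  then show ?thesis using dist_X[of i] by (simp add: distributed_def Pdist_def)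
qed

sublocale N0: prob_space N0
  using prob_space_distr[OF X_meas[OF indep distr_X], of 0] by (simp add: distr_X)

lemma sample_in_U: "with_prob_tending_to_1 M (\<lambda>n \<omega>. (\<forall>j. X j \<omega> \<in> U) \<and> inj (\<lambda>j. X j \<omega>))"
proof (rule with_prob_AE)
  have "AE \<omega> in M. \<forall>j. X j \<omega> \<in> U"
    unfolding AE_all_countable by (intro allI AE_X[OF indep distr_X] AE_N_U[OF \<theta>0])
  moreover have "AE \<omega> in M. \<forall>i j. i \<noteq> j \<longrightarrow> X i \<omega> \<noteq> X j \<omega>"
    unfolding AE_all_countable
  proof (intro allI)
    fix i j show "AE \<omega> in M. i \<noteq> j \<longrightarrow> X i \<omega> \<noteq> X j \<omega>"
    proof (cases "i = j")
      case False
      from AE_X_distinct[OF indep distr_X N_singleton[OF \<theta>0] False] show ?thesis by eventually_elim simp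
    qed simp
  qed
  ultimately show "AE \<omega> in M. \<forall>n::nat. (\<forall>j. X j \<omega> \<in> U) \<and> inj (\<lambda>j. X j \<omega>)"
    by eventually_elim (auto simp: inj_def)
qed

text \<open>
  The interval \<open>{..<\<gamma>0 + \<delta>}\<close> has positive probability, so by the weak law a positive fraction of the
  observations lies in it.
\<close>

lemma gamma_ML_consistent:
  assumes "0 < \<delta>" shows "with_prob_tending_to_1 M (\<lambda>n \<omega>. gamma_ML n (\<lambda>j. X j \<omega>) < \<gamma>0 + \<delta>)"
proof -
  let ?f = "indicator {..<\<gamma>0 + \<delta>} :: real \<Rightarrow> real"
  have int: "integrable N0 ?f"
  proof (rule N0.integrable_const_bound[of _ 1])
    show "?f \<in> borel_measurable N0" by (simp add: measurable_cong_sets[OF N_sets[OF \<theta>0] refl])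
  qed (simp add: indicator_def)
  have "space N0 = UNIV" by (simp add: Pdist_def)
  then have E: "integral\<^sup>L N0 ?f = measure N0 {..<\<gamma>0 + \<delta>}" by simp
  have pos: "0 < integral\<^sup>L N0 ?f"
    using N_left_pos[OF \<theta>0 assms] unfolding E
    by (metis N0.emeasure_eq_measure ennreal_0 measure_nonneg order_le_less)
  show ?thesis
  proof (rule with_prob_mono[OF weak_law[OF indep distr_X int pos]])
    show "\<forall>\<^sub>F n in sequentially. \<forall>\<omega>\<in>space M. \<bar>1 / real n * (\<Sum>j<n. ?f (X j \<omega>)) - integral\<^sup>L N0 ?f\<bar> < integral\<^sup>L N0 ?f
        \<longrightarrow> gamma_ML n (\<lambda>j. X j \<omega>) < \<gamma>0 + \<delta>"
      using eventually_gt_at_top[of 0]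
    proof (eventually_elim, intro ballI impI)
      fix n \<omega> assume n: "0 < n"
        and "\<bar>1 / real n * (\<Sum>j<n. ?f (X j \<omega>)) - integral\<^sup>L N0 ?f\<bar> < integral\<^sup>L N0 ?f"
      then have "1 / real n * (\<Sum>j<n. ?f (X j \<omega>)) \<noteq> 0" by auto
      then have "(\<Sum>j<n. ?f (X j \<omega>)) \<noteq> 0" by auto
      then obtain j where "j < n" "X j \<omega> < \<gamma>0 + \<delta>"
        by (metis (no_types, lifting) indicator_simps(2) lessThan_iff sum.neutral)
      then show "gamma_ML n (\<lambda>j. X j \<omega>) < \<gamma>0 + \<delta>"
        using gamma_ML_properties(2)[OF n, of j "\<lambda>j. X j \<omega>"] by simp
    qed
  qed
qed

definition separated :: "real \<Rightarrow> real \<Rightarrow> nat \<Rightarrow> (nat \<Rightarrow> real) \<Rightarrow> bool" where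
  "separated \<delta> \<kappa> n x \<longleftrightarrow> (\<forall>\<eta>\<in>\<Theta>. \<delta> \<le> dist \<eta> \<theta>0 \<longrightarrow>
    (\<Sum>j<n. logp I2 q (x j) \<eta> (gamma_ML n x)) \<le> (\<Sum>j<n. logp I2 q (x j) \<theta>0 (gamma_ML n x)) - \<kappa> * real n)"

lemma separated:
  assumes "0 < \<delta>" obtains \<kappa> where "0 < \<kappa>" "with_prob_tending_to_1 M (\<lambda>n \<omega>. separated \<delta> \<kappa> n (\<lambda>j. X j \<omega>))"
  proof -
  have "\<forall>\<delta>>0. \<exists>\<kappa>>0. with_prob_tending_to_1 M (\<lambda>n \<omega>. separated \<delta> \<kappa> n (\<lambda>j. X j \<omega>))"
    using regular unfolding regular_at_def separated_def Let_def by (elim conjE)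
  then show thesis using assms that by blast
qed

text \<open>
  Beyond distance \<open>\<delta>\<close> the likelihood is smaller than at \<open>\<theta>0\<close>, so no maximizer lies there.
\<close>

lemma theta_ML_close:
  assumes n: "0 < n" and x: "\<And>j. j < n \<Longrightarrow> x j \<in> U"
    and mle: "is_MLE \<Theta> I1 I2 q n x (theta_ML \<Theta> I2 q n x) (gamma_ML n x)"
    and sep: "separated \<delta> \<kappa> n x" and \<kappa>: "0 < \<kappa>"
  shows "dist (theta_ML \<Theta> I2 q n x) \<theta>0 < \<delta>"
proof (rule ccontr)
  assume far: "\<not> dist (theta_ML \<Theta> I2 q n x) \<theta>0 < \<delta>"
  have "theta_ML \<Theta> I2 q n x \<in> \<Theta>" using mle by (simp add: is_MLE_def)
  with sep far have "(\<Sum>j<n. logp I2 q (x j) (theta_ML \<Theta> I2 q n x) (gamma_ML n x))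
      \<le> (\<Sum>j<n. logp I2 q (x j) \<theta>0 (gamma_ML n x)) - \<kappa> * real n"
    by (simp add: separated_def)
  moreover have "0 < \<kappa> * real n" using \<kappa> n by simp
  ultimately show False using log_likelihood_le_MLE[OF n x mle \<theta>0] by simp
qed

text \<open>
  Almost surely the observations are distinct and interior to the support, so \<open>MLE_condition\<close> applies.
\<close>

lemma MLE_exists:
  "with_prob_tending_to_1 M (\<lambda>n \<omega>. let x = (\<lambda>j. X j \<omega>) in 0 < n \<and> (\<forall>j. x j \<in> U)
    \<and> likelihood_eq I2 q n x (theta_ML \<Theta> I2 q n x) \<and> is_MLE \<Theta> I1 I2 q n x (theta_ML \<Theta> I2 q n x) (gamma_ML n x))"
proof (rule with_prob_mono[OF sample_in_U])
  show "\<forall>\<^sub>F n in sequentially. \<forall>\<omega>\<in>space M. (\<forall>j. X j \<omega> \<in> U) \<and> inj (\<lambda>j. X j \<omega>) \<longrightarrow> (let x = (\<lambda>j. X j \<omega>) in 0 < n \<and> (\<forall>j. x j \<in> U)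
    \<and> likelihood_eq I2 q n x (theta_ML \<Theta> I2 q n x) \<and> is_MLE \<Theta> I1 I2 q n x (theta_ML \<Theta> I2 q n x) (gamma_ML n x))"
    using mle[unfolded MLE_condition_def] eventually_gt_at_top[of 0]
  proof (eventually_elim, intro ballI impI, elim conjE)
    fix n \<omega>
    assume n: "0 < n" and U: "\<forall>j. X j \<omega> \<in> U" and inj: "inj (\<lambda>j. X j \<omega>)"
      and ex: "\<forall>x. (\<forall>j<n. \<gamma>0 < x j \<and> ereal (x j) < I2) \<and> inj_on x {..<n} \<longrightarrow>
       (\<exists>!\<theta>. \<theta> \<in> \<Theta> \<and> likelihood_eq I2 q n x \<theta>) \<and> is_MLE \<Theta> I1 I2 q n x (theta_ML \<Theta> I2 q n x) (gamma_ML n x)"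
    let ?x = "\<lambda>j. X j \<omega>"
    have "(\<forall>j<n. \<gamma>0 < ?x j \<and> ereal (?x j) < I2) \<and> inj_on ?x {..<n}"
      using U inj by (auto simp: U_def inj_on_def)
    from mp[OF spec[OF ex] this] have *: "(\<exists>!\<theta>. \<theta> \<in> \<Theta> \<and> likelihood_eq I2 q n ?x \<theta>)"
      "is_MLE \<Theta> I1 I2 q n ?x (theta_ML \<Theta> I2 q n ?x) (gamma_ML n ?x)" by blast+
    from theI'[OF *(1)] have "likelihood_eq I2 q n ?x (theta_ML \<Theta> I2 q n ?x)" by (simp add: theta_ML_def)
    with n U *(2) show "let x = ?x in 0 < n \<and> (\<forall>j. x j \<in> U)
      \<and> likelihood_eq I2 q n x (theta_ML \<Theta> I2 q n x) \<and> is_MLE \<Theta> I1 I2 q n x (theta_ML \<Theta> I2 q n x) (gamma_ML n x)"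
      by simp
  qed
qed

abbreviation D2 where "D2 y i j \<equiv> D_theta (\<lambda>\<eta>. logp I2 q y \<eta> \<gamma>0) \<theta>0 [i, j]"

lemma hessian_consistent:
  assumes int: "integrable N0 G" and G: "\<And>y is. y \<in> U \<Longrightarrow> 2 \<le> length is \<Longrightarrow> length is \<le> 5 \<Longrightarrow>
      \<bar>D_theta (\<lambda>\<eta>. logp I2 q y \<eta> \<gamma>0) \<theta>0 is\<bar> \<le> G y" and r: "0 < r"
  shows "with_prob_tending_to_1 M (\<lambda>n \<omega>. \<forall>p\<in>UNIV.
    \<bar>1 / real n * (\<Sum>k<n. indicator U (X k \<omega>) * D2 (X k \<omega>) (fst p) (snd p)) + fisher_info I2 q \<theta>0 \<gamma>0 $ fst p $ snd p\<bar> < r)"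
proof (rule with_prob_finite_all)
  fix p :: "'d \<times> 'd"
  let ?f = "\<lambda>y. indicator U y * D2 y (fst p) (snd p)"
  have int_f: "integrable N0 ?f"
  proof (rule Bochner_Integration.integrable_bound[OF int])
    show "?f \<in> borel_measurable N0"
      using D_theta_measurable[OF \<theta>0, of "[fst p, snd p]"] by (simp add: measurable_cong_sets[OF N_sets[OF \<theta>0] refl])
    show "AE y in N0. norm (?f y) \<le> norm (G y)"
      using AE_N_U[OF \<theta>0]
    proof eventually_elim
      fix y assume y: "y \<in> U"
      from G[OF y, of "[fst p, snd p]"] show "norm (?f y) \<le> norm (G y)"
        using y by (simp del: D_theta.simps)
    qed
  qed
  have "integral\<^sup>L N0 ?f = - fisher_info I2 q \<theta>0 \<gamma>0 $ fst p $ snd p"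
    using fisher_info_eq[OF \<theta>0 int_f] by simp
  with weak_law[OF indep distr_X int_f r]
  show "with_prob_tending_to_1 M (\<lambda>n \<omega>. \<bar>1 / real n * (\<Sum>k<n. ?f (X k \<omega>)) + fisher_info I2 q \<theta>0 \<gamma>0 $ fst p $ snd p\<bar> < r)"
    by (simp only: diff_minus_eq_add)
qed simp

text \<open>
  The constants are chosen one after the other, so that each depends on earlier ones only: the
  tolerance \<open>r\<close> for the information matrix, the box, the bounds of derivatives in the box, \<open>K\<close>, \<open>eta\<close>, the
  distance \<open>\<rho>\<close> within which the MLE must lie, and at last the separation gaps for \<open>\<rho>\<close> and for \<open>eta / 2\<close>.
\<close>

theorem good_sample_with_prob_tending_to_1:
  obtains b0 H Hp c0 p00 kap0 lam eta K Gm G where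
    "0 < eta" "with_prob_tending_to_1 M (\<lambda>n \<omega>.
      good_sample \<Theta> I1 I2 q \<gamma>0 \<theta>0 \<pi> n (\<lambda>j. X j \<omega>) b0 H Hp c0 p00 kap0 lam eta K Gm G)"
proof -
  obtain d G where d: "0 < d" and int: "integrable N0 G"
    and "ball \<theta>0 d \<subseteq> \<Theta>"
    and env: "\<forall>y. \<gamma>0 < y \<and> ereal y < I2 \<longrightarrow> (\<forall>\<eta>\<in>ball \<theta>0 d. \<forall>is. 2 \<le> length is \<and> length is \<le> 5 \<longrightarrow>
      \<bar>D_theta (\<lambda>\<eta>. logp I2 q y \<eta> \<gamma>0) \<eta> is\<bar> \<le> G y)"
    and slope: "deriv (psi I2 q \<theta>0) \<gamma>0 \<noteq> 0"
    and pd: "\<forall>v. v \<noteq> 0 \<longrightarrow> 0 < v \<bullet> (fisher_info I2 q \<theta>0 \<gamma>0 *v v)"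
    using regular unfolding regular_at_def by (elim conjE exE) (rule that)
  let ?I = "fisher_info I2 q \<theta>0 \<gamma>0" and ?d = "real CARD('d)"
  obtain l where l: "0 < l" "\<And>v. l * (norm v)\<^sup>2 \<le> v \<bullet> (?I *v v)"
    using positive_definite_coercive[OF pd[rule_format]] by blast
  have d1: "1 \<le> ?d" using one_le_card_finite[where 'a = 'd] by simp
  \<comment> \<open>Entrywise errors up to \<open>r\<close> cost at most half of the coercivity constant \<open>l\<close>. The law of large numbers, the
    distance of the MLE and the derivatives of \<open>h\<close> may contribute \<open>r / 3\<close> each.\<close>
  define r where "r = l / (2 * ?d\<^sup>2)"
  have r: "0 < r" using l d1 by (simp add: r_def)
  have r3: "0 < r / 3" using r by simp
  obtain b0 c0 p00 where b0: "0 < b0" "b0 < d" and c0: "0 < c0" and p00: "0 < p00"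
    and box: "cball \<theta>0 b0 \<times> cball \<gamma>0 b0 \<subseteq> S"
    and hc: "\<And>z. z \<in> cball \<theta>0 b0 \<times> cball \<gamma>0 b0 \<Longrightarrow> iter_g 1 h z \<le> - c0"
    and hp: "\<And>z. z \<in> cball \<theta>0 b0 \<times> cball \<gamma>0 b0 \<Longrightarrow> p00 \<le> \<pi> (fst z) (snd z)"
    and hr: "\<And>z i j. z \<in> cball \<theta>0 b0 \<times> cball \<gamma>0 b0 \<Longrightarrow> \<bar>iter_d h [i, j] z\<bar> \<le> r / 3"
    using regular_box[OF \<theta>0 slope prior prior_pos r3 d] by blast
  have comp: "compact (cball \<theta>0 b0 \<times> cball \<gamma>0 b0)" by (intro compact_Times compact_cball)
  obtain H where H: "0 < H" "\<And>z s is. z \<in> cball \<theta>0 b0 \<times> cball \<gamma>0 b0 \<Longrightarrow> s \<le> 3 \<Longrightarrow> length is \<le> 5 \<Longrightarrow>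
      \<bar>iter_d (iter_g s h) is z\<bar> \<le> H"
    using bounded_derivatives[OF open_S smooth_h comp box, of 3 5] by blast
  obtain Hp where Hp: "0 < Hp" "\<And>z s is. z \<in> cball \<theta>0 b0 \<times> cball \<gamma>0 b0 \<Longrightarrow> s \<le> 3 \<Longrightarrow> length is \<le> 5 \<Longrightarrow>
      \<bar>iter_d (iter_g s (\<lambda>z. \<pi> (fst z) (snd z))) is z\<bar> \<le> Hp"
    using bounded_derivatives[OF open_S smooth_prior[OF prior] comp box, of 3 5] by blast
  have GU: "\<bar>D_theta (\<lambda>\<eta>. logp I2 q y \<eta> \<gamma>0) \<eta> is\<bar> \<le> G y"
    if "y \<in> U" "\<eta> \<in> cball \<theta>0 b0" "2 \<le> length is" "length is \<le> 5" for y \<eta> "is"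
    using that b0 by (intro env[rule_format]) (auto simp: U_def)
  have GU0: "\<bar>D_theta (\<lambda>\<eta>. logp I2 q y \<eta> \<gamma>0) \<theta>0 is\<bar> \<le> G y"
    if "y \<in> U" "2 \<le> length is" "length is \<le> 5" for y "is"
    using that b0 by (intro GU) auto
  define Gm where "Gm = \<bar>integral\<^sup>L N0 G\<bar> + 1"
  define lam where "lam = l / 2"
  define K where "K = 1 + ?d ^ 5 * (Gm + H) + ?d ^ 5 * Hp + 1 / c0 + 1 / p00"
  have Gm: "0 < Gm" by (simp add: Gm_def)
  have lam: "0 < lam" using l by (simp add: lam_def)
  have parts: "0 \<le> ?d ^ 5 * (Gm + H)" "0 \<le> ?d ^ 5 * Hp" "0 \<le> 1 / c0" "0 \<le> 1 / p00"
    using Gm H Hp c0 p00 by auto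
  have K: "1 \<le> K" "?d ^ 5 * (Gm + H) \<le> K" "?d ^ 5 * Hp \<le> K" "1 / c0 \<le> K" "1 / p00 \<le> K"
    unfolding K_def using parts by linarith+
  have Kc: "1 \<le> K * c0" "1 \<le> K * p00"
    using K(4,5) c0 p00 by (simp_all add: field_simps)
  define eta where "eta = Min {1, b0 / 2, lam / (12 * K), c0 / (12 * K)}"
  have eta: "0 < eta" "eta \<le> 1" "eta \<le> b0 / 2" "eta \<le> lam / (12 * K)" "eta \<le> c0 / (12 * K)"
    using b0 lam c0 K(1) by (auto simp: eta_def)
  have eta': "12 * K * eta \<le> lam" "12 * K * eta \<le> c0"
    using eta(4,5) K(1) by (simp_all add: field_simps)
  \<comment> \<open>The first bound is the closeness required of a good sample, the second one serves for the information matrix.\<close>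
  define \<rho> where "\<rho> = min (eta / 2) (r / (3 * ?d * Gm))"
  have \<rho>: "0 < \<rho>" "\<rho> \<le> eta / 2" "?d * Gm * \<rho> \<le> r / 3"
  proof -
    have pos: "0 < ?d * Gm" using d1 Gm by simp
    show "0 < \<rho>" using eta r pos by (simp add: \<rho>_def mult.assoc)
    show "\<rho> \<le> eta / 2" by (simp add: \<rho>_def)
    have "?d * Gm * \<rho> \<le> ?d * Gm * (r / (3 * ?d * Gm))"
      using pos by (intro mult_left_mono) (auto simp: \<rho>_def)
    also have "\<dots> = r / 3" using Gm d1 by (simp add: field_simps)
    finally show "?d * Gm * \<rho> \<le> r / 3" .
  qed
  have eta2: "0 < eta / 2" using eta by simp
  obtain \<kappa>1 where \<kappa>1: "0 < \<kappa>1" and sep1: "with_prob_tending_to_1 M (\<lambda>n \<omega>. separated \<rho> \<kappa>1 n (\<lambda>j. X j \<omega>))"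
    by (rule separated[OF \<rho>(1)])
  obtain \<kappa>0 where \<kappa>0: "0 < \<kappa>0" and sep0: "with_prob_tending_to_1 M (\<lambda>n \<omega>. separated (eta / 2) \<kappa>0 n (\<lambda>j. X j \<omega>))"
    by (rule separated[OF eta2])
  have events: "with_prob_tending_to_1 M (\<lambda>n \<omega>.
      (let x = (\<lambda>j. X j \<omega>) in 0 < n \<and> (\<forall>j. x j \<in> U) \<and> likelihood_eq I2 q n x (theta_ML \<Theta> I2 q n x)
        \<and> is_MLE \<Theta> I1 I2 q n x (theta_ML \<Theta> I2 q n x) (gamma_ML n x))
      \<and> separated \<rho> \<kappa>1 n (\<lambda>j. X j \<omega>) \<and> separated (eta / 2) \<kappa>0 n (\<lambda>j. X j \<omega>)
      \<and> gamma_ML n (\<lambda>j. X j \<omega>) < \<gamma>0 + eta / 2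
      \<and> \<bar>1 / real n * (\<Sum>j<n. G (X j \<omega>)) - integral\<^sup>L N0 G\<bar> < 1
      \<and> (\<forall>p\<in>UNIV. \<bar>1 / real n * (\<Sum>k<n. indicator U (X k \<omega>) * D2 (X k \<omega>) (fst p) (snd p)) + ?I $ fst p $ snd p\<bar> < r / 3))"
    by (intro with_prob_conj MLE_exists sep1 sep0 gamma_ML_consistent[OF eta2]
        weak_law[OF indep distr_X int zero_less_one] hessian_consistent[OF int GU0 r3])
  have "with_prob_tending_to_1 M (\<lambda>n \<omega>.
      good_sample \<Theta> I1 I2 q \<gamma>0 \<theta>0 \<pi> n (\<lambda>j. X j \<omega>) b0 H Hp c0 p00 \<kappa>0 lam eta K Gm G)"
  proof (rule with_prob_mono[OF events], intro always_eventually allI ballI impI, elim conjE)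
    fix n \<omega>
    define x where "x = (\<lambda>j. X j \<omega>)"
    let ?t = "theta_ML \<Theta> I2 q n x" and ?g = "gamma_ML n x"
    assume "let x = (\<lambda>j. X j \<omega>) in 0 < n \<and> (\<forall>j. x j \<in> U)
        \<and> likelihood_eq I2 q n x (theta_ML \<Theta> I2 q n x) \<and> is_MLE \<Theta> I1 I2 q n x (theta_ML \<Theta> I2 q n x) (gamma_ML n x)"
    then have n: "0 < n" and U: "\<And>j. x j \<in> U" and leq: "likelihood_eq I2 q n x ?t"
      and mle: "is_MLE \<Theta> I1 I2 q n x ?t ?g" by (simp_all add: Let_def x_def)
    assume "separated \<rho> \<kappa>1 n (\<lambda>j. X j \<omega>)" "separated (eta / 2) \<kappa>0 n (\<lambda>j. X j \<omega>)"
      and "gamma_ML n (\<lambda>j. X j \<omega>) < \<gamma>0 + eta / 2"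
      and "\<bar>1 / real n * (\<Sum>j<n. G (X j \<omega>)) - integral\<^sup>L N0 G\<bar> < 1"
    then have s1: "separated \<rho> \<kappa>1 n x" and s0: "separated (eta / 2) \<kappa>0 n x"
      and g: "?g < \<gamma>0 + eta / 2" and avg: "\<bar>1 / real n * (\<Sum>j<n. G (x j)) - integral\<^sup>L N0 G\<bar> < 1"
      unfolding x_def .
    assume all: "\<forall>p\<in>UNIV. \<bar>1 / real n * (\<Sum>k<n. indicator U (X k \<omega>) * D2 (X k \<omega>) (fst p) (snd p))
        + ?I $ fst p $ snd p\<bar> < r / 3"
    have hess: "\<bar>1 / real n * (\<Sum>k<n. D2 (x k) i j) + ?I $ i $ j\<bar> < r / 3" for i j
    proof -
      from bspec[OF all UNIV_I, of "(i, j)"] show ?thesis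
        using U unfolding x_def by (simp del: D_theta.simps)
    qed
    have avg': "1 / real n * (\<Sum>j<n. G (x j)) \<le> Gm" using avg by (simp only: Gm_def abs_less_iff) linarith
    have t: "dist ?t \<theta>0 < \<rho>" by (rule theta_ML_close[OF n U mle s1 \<kappa>1])
    have zbox: "(?t, ?g) \<in> cball \<theta>0 b0 \<times> cball \<gamma>0 b0"
    proof -
      obtain j where "j < n" "?g = x j" using gamma_ML_properties(1)[OF n] by blast
      then have "\<gamma>0 < ?g" using U[of j] by (simp add: U_def)
      then have "dist \<gamma>0 ?g \<le> b0" using g eta b0 by (simp add: dist_real_def)
      moreover have "dist \<theta>0 ?t \<le> b0" using t \<rho>(2) eta b0 by (simp add: dist_commute)
      ultimately show ?thesis by simp
    qed
    have close: "\<bar>g_hat \<Theta> I2 q n x $ i $ j - ?I $ i $ j\<bar> \<le> r" for i j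
    proof -
      have "\<bar>g_hat \<Theta> I2 q n x $ i $ j + 1 / real n * (\<Sum>k<n. D2 (x k) i j)\<bar>
          \<le> ?d * Gm * dist ?t \<theta>0 + \<bar>iter_d h [i, j] (?t, ?g)\<bar>"
        by (rule g_hat_close[OF n U box GU avg' zbox])
      also have "\<dots> \<le> ?d * Gm * \<rho> + r / 3"
        using t Gm by (intro add_mono mult_left_mono hr[OF zbox]) auto
      also have "\<dots> \<le> r / 3 + r / 3" using \<rho>(3) by simp
      finally show ?thesis using hess[of i j] by (simp only: abs_le_iff abs_less_iff) linarith
    qed
    show "good_sample \<Theta> I1 I2 q \<gamma>0 \<theta>0 \<pi> n (\<lambda>j. X j \<omega>) b0 H Hp c0 p00 \<kappa>0 lam eta K Gm G"
      unfolding x_def[symmetric]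
    proof (unfold_locales)
      fix v :: "real ^ 'd"
      have "lam = l - ?d\<^sup>2 * r" using d1 by (simp add: lam_def r_def)
      then show "lam * (norm v)\<^sup>2 \<le> v \<bullet> (g_hat \<Theta> I2 q n x *v v)"
        using coercive_perturbation[OF l(2) close] by simp
    next
      show "x j \<in> U" for j by (rule U)
      show "\<bar>D_theta (\<lambda>\<eta>. logp I2 q y \<eta> \<gamma>0) \<eta> is\<bar> \<le> G y"
        if "y \<in> U" "\<eta> \<in> cball \<theta>0 b0" "2 \<le> length is" "length is \<le> 5" for y \<eta> "is"
        using that by (rule GU)
      show "dist ?t \<theta>0 < eta / 2" using t \<rho>(2) by simp
    next
      fix \<eta> assume "\<eta> \<in> \<Theta>" "eta / 2 \<le> dist \<eta> \<theta>0"
      then show "(\<Sum>j<n. logp I2 q (x j) \<eta> ?g) \<le> (\<Sum>j<n. logp I2 q (x j) \<theta>0 ?g) - \<kappa>0 * real n"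
        using s0 by (simp add: separated_def)
    qed (fact \<theta>0 n prior box H(2) Hp(2) c0 hc p00 hp avg' g leq mle \<kappa>0 lam K(1-3) Kc eta(1-3) eta')+
  qed
  with eta(1) show thesis by (rule that)
qed

end


section \<open>Asymptotic expansion of the posterior\<close>

text \<open>
  The remainder is defined by the equation itself, which is solvable for it because the leading factor
  is positive on good samples. The bound on it holds with a constant that does not depend on the
  probability that is neglected.
\<close>

theorem lemma1:
  fixes \<Theta> :: "(real ^ 'd::finite) set" and I1 I2 :: ereal
    and q :: "real \<Rightarrow> real ^ 'd \<Rightarrow> real"
    and \<pi> :: "real ^ 'd \<Rightarrow> real \<Rightarrow> real"
    and \<theta> :: "real ^ 'd" and \<gamma> :: real
    and M :: "'w measure" and X :: "nat \<Rightarrow> 'w \<Rightarrow> real"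
    and u :: "real ^ 'd" and t :: real
  assumes family: "oTF \<Theta> I1 I2 q"
    and param: "\<theta> \<in> \<Theta>" "\<gamma> \<in> einterval I1 I2"
    and mle: "MLE_condition \<Theta> I1 I2 q \<gamma>"
    and prior: "prior_density \<Theta> I1 I2 \<pi>" "\<pi> \<theta> \<gamma> > 0"
    and sample: "prob_space M" "prob_space.indep_vars M (\<lambda>_. borel) X UNIV"
      "\<And>i. distributed M lborel (X i) (\<lambda>x. ennreal (pdens I2 q x \<theta> \<gamma>))"
    and regular: "regular_at \<Theta> I2 q M X \<theta> \<gamma>"
    and t: "t \<le> 0"
  shows "\<exists>R. bigO_p M R (\<lambda>n. real n powr (- 3 / 2)) \<and>
    with_prob_tending_to_1 M (\<lambda>n \<omega>.
      let x = (\<lambda>j. X j \<omega>); g = g_hat \<Theta> I2 q n x in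
      posterior_ut \<Theta> I1 I2 q \<pi> n x u t =
        sqrt (det g) / (2 * pi) powr (real CARD('d) / 2) * exp (t - u \<bullet> (g *v u) / 2) *
        (1 + 1 / sqrt (real n) * B1 \<Theta> I2 q \<pi> n x u t
           + 1 / real n * B2 \<Theta> I2 q \<pi> n x u t + R n \<omega>))"
proof -
  interpret truncated_family \<Theta> I1 I2 q \<gamma> by unfold_locales (fact family param)+
  interpret prob_space M by fact
  interpret regular_sampling \<Theta> I1 I2 q \<gamma> M \<theta> \<pi> X by unfold_locales (fact param mle prior sample regular)+
  obtain b0 H Hp c0 p00 kap0 lam eta K Gm G where eta: "0 < eta"
    and good: "with_prob_tending_to_1 M (\<lambda>n \<omega>.
      good_sample \<Theta> I1 I2 q \<gamma> \<theta> \<pi> n (\<lambda>j. X j \<omega>) b0 H Hp c0 p00 kap0 lam eta K Gm G)"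
    by (rule good_sample_with_prob_tending_to_1)
  define lead0 where "lead0 n \<omega> = (let g = g_hat \<Theta> I2 q n (\<lambda>j. X j \<omega>) in
    sqrt (det g) / (2 * pi) powr (real CARD('d) / 2) * exp (t - u \<bullet> (g *v u) / 2))" for n \<omega>
  define F where "F n \<omega> = 1 + 1 / sqrt (real n) * B1 \<Theta> I2 q \<pi> n (\<lambda>j. X j \<omega>) u t
    + 1 / real n * B2 \<Theta> I2 q \<pi> n (\<lambda>j. X j \<omega>) u t" for n \<omega>
  define R where "R n \<omega> = posterior_ut \<Theta> I1 I2 q \<pi> n (\<lambda>j. X j \<omega>) u t / lead0 n \<omega> - F n \<omega>" for n \<omega>
  define C where "C = laplace.remainder_const lam K eta (min kap0 (eta * c0)) u t"
  define Z where "Z = laplace.z2_bound TYPE('d) lam K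
    + laplace.C2 TYPE('d) lam K eta (min kap0 (eta * c0)) / laplace.mass_lb TYPE('d) K"
  have "\<forall>\<^sub>F n in sequentially. 1 / sqrt (real n) * norm u < eta"
  proof -
    have "(\<lambda>n. 1 / sqrt (real n) * norm u) \<longlonglongrightarrow> 0" by real_asymp
    then show ?thesis using eta by (rule order_tendstoD(2))
  qed
  moreover have "\<forall>\<^sub>F n in sequentially. 1 / real n * (K * \<bar>t\<bar>) < eta"
  proof -
    have "(\<lambda>n. 1 / real n * (K * \<bar>t\<bar>)) \<longlonglongrightarrow> 0" by real_asymp
    then show ?thesis using eta by (rule order_tendstoD(2))
  qed
  moreover have "\<forall>\<^sub>F n in sequentially. 1 / real n * Z < 1 / 2"
  proof -
    have "(\<lambda>n. 1 / real n * Z) \<longlonglongrightarrow> 0" by real_asymp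
    then show ?thesis by (rule order_tendstoD(2)) simp
  qed
  ultimately have "\<forall>\<^sub>F n in sequentially. \<forall>\<omega>\<in>space M. good_sample \<Theta> I1 I2 q \<gamma> \<theta> \<pi> n (\<lambda>j. X j \<omega>) b0 H Hp c0 p00 kap0 lam eta K Gm G
      \<longrightarrow> lead0 n \<omega> \<noteq> 0 \<and> \<bar>R n \<omega>\<bar> \<le> C * real n powr (- 3 / 2)"
  proof (eventually_elim, intro ballI impI)
    fix n \<omega>
    assume u: "1 / sqrt (real n) * norm u < eta" and t': "1 / real n * (K * \<bar>t\<bar>) < eta" and Z: "1 / real n * Z < 1 / 2"
      and "good_sample \<Theta> I1 I2 q \<gamma> \<theta> \<pi> n (\<lambda>j. X j \<omega>) b0 H Hp c0 p00 kap0 lam eta K Gm G"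
    interpret good_sample \<Theta> I1 I2 q \<gamma> \<theta> \<pi> n "\<lambda>j. X j \<omega>" b0 H Hp c0 p00 kap0 lam eta K Gm G by fact
    have lead: "lead0 n \<omega> = lead u t"
      by (simp add: lead0_def lead_def Let_def)
    show "lead0 n \<omega> \<noteq> 0 \<and> \<bar>R n \<omega>\<bar> \<le> C * real n powr (- 3 / 2)"
      using posterior_ut_expansion[OF t u t' less_imp_le[OF Z[unfolded Z_def]]] lead_pos[of u t]
      unfolding R_def F_def C_def lead by simp
  qed
  from with_prob_mono[OF good this]
  have ev: "with_prob_tending_to_1 M (\<lambda>n \<omega>. lead0 n \<omega> \<noteq> 0 \<and> \<bar>R n \<omega>\<bar> \<le> C * real n powr (- 3 / 2))" .
  show ?thesis
  proof (intro exI[of _ R] conjI)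
    show "bigO_p M R (\<lambda>n. real n powr (- 3 / 2))"
      unfolding bigO_p_def
    proof (intro allI impI exI[of _ C])
      fix \<epsilon> :: real assume "0 < \<epsilon>"
      then have "\<forall>\<^sub>F n in sequentially. \<exists>A\<in>sets M. 1 - \<epsilon> \<le> prob A
          \<and> (\<forall>\<omega>\<in>A. lead0 n \<omega> \<noteq> 0 \<and> \<bar>R n \<omega>\<bar> \<le> C * real n powr (- 3 / 2))"
        by (rule ev[unfolded with_prob_tending_to_1_def, rule_format])
      then show "\<forall>\<^sub>F n in sequentially. \<exists>A\<in>sets M. 1 - \<epsilon> \<le> prob A
          \<and> (\<forall>\<omega>\<in>A. \<bar>R n \<omega>\<bar> \<le> C * real n powr (- 3 / 2))"
        by eventually_elim blast
    qed
    show "with_prob_tending_to_1 M (\<lambda>n \<omega>.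
      let x = (\<lambda>j. X j \<omega>); g = g_hat \<Theta> I2 q n x in
      posterior_ut \<Theta> I1 I2 q \<pi> n x u t =
        sqrt (det g) / (2 * pi) powr (real CARD('d) / 2) * exp (t - u \<bullet> (g *v u) / 2) *
        (1 + 1 / sqrt (real n) * B1 \<Theta> I2 q \<pi> n x u t
           + 1 / real n * B2 \<Theta> I2 q \<pi> n x u t + R n \<omega>))"
    proof (rule with_prob_mono[OF ev], intro always_eventually allI ballI impI, elim conjE)
      fix n \<omega> assume "lead0 n \<omega> \<noteq> 0"
      then have "posterior_ut \<Theta> I1 I2 q \<pi> n (\<lambda>j. X j \<omega>) u t = lead0 n \<omega> * (F n \<omega> + R n \<omega>)"
        by (simp add: R_def)
      then show "let x = (\<lambda>j. X j \<omega>); g = g_hat \<Theta> I2 q n x in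
        posterior_ut \<Theta> I1 I2 q \<pi> n x u t =
          sqrt (det g) / (2 * pi) powr (real CARD('d) / 2) * exp (t - u \<bullet> (g *v u) / 2) *
          (1 + 1 / sqrt (real n) * B1 \<Theta> I2 q \<pi> n x u t
             + 1 / real n * B2 \<Theta> I2 q \<pi> n x u t + R n \<omega>)"
        by (simp only: lead0_def F_def Let_def)
    qed
  qed
qed

end
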